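(* Let $T>0$, let $f:\mathbb{R}\to\mathbb{R}$ be a continuous function, let $\alpha\in(1/2,1]$, and put $F(\xi):=\int_0^\xi f(s)\,ds$ for $\xi\in\mathbb{R}$, $$\kappa_\alpha:=\frac{T^{2\alpha}}{\Gamma(\alpha)^2\,|\cos(\pi\alpha)|\,(2\alpha-1)},\qquad \mu^\star:=\frac1{\kappa_\alpha}\sup_{\gamma>0}\frac{\gamma^2}{\max_{|\xi|\le\gamma}F(\xi)}\in(0,+\infty].$$ Assume that either $f(0)\neq0$, or $f(0)=0$ and $$\lim_{t\to0^+}\frac{F(t)}{t^2}=+\infty .$$ Then, for every $\mu\in(0,\mu^\star)$, the problem $$\frac{d}{dt}\Big({}_0D_t^{\alpha-1}({}_0^cD_t^{\alpha}u(t))-{}_tD_T^{\alpha-1}({}_t^cD_T^{\alpha}u(t))\Big)+\mu f(u(t))=0\ \text{ for a.e. }t\in[0,T],\qquad u(0)=u(T)=0,$$ admits at least one non-trivial solution $u_\mu\in E_0^\alpha$.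
   Context: Here $\Gamma$ is the Euler gamma function. The quotient $\gamma^2/\max_{|\xi|\le\gamma}F(\xi)$ is taken to be $+\infty$ when its denominator (which is always $\ge0$) vanishes. Fractional integrals: for $\beta>0$, the left and right Riemann–Liouville fractional integrals of order $\beta$ on $[0,T]$ are ${}_0D_t^{-\beta}u(t)=\frac1{\Gamma(\beta)}\int_0^t(t-s)^{\beta-1}u(s)\,ds$ and ${}_tD_T^{-\beta}u(t)=\frac1{\Gamma(\beta)}\int_t^T(s-t)^{\beta-1}u(s)\,ds$. Thus ${}_0D_t^{\alpha-1}$ and ${}_tD_T^{\alpha-1}$ are the fractional integrals of order $1-\alpha$ (the identity if $\alpha=1$). Caputo derivatives: for $\alpha\in(0,1)$ and $u$ absolutely continuous on $[0,T]$, ${}_0^cD_t^\alpha u(t)=\frac1{\Gamma(1-\alpha)}\int_0^t(t-s)^{-\alpha}u'(s)\,ds$ and ${}_t^cD_T^\alpha u(t)=-\frac1{\Gamma(1-\alpha)}\int_t^T(s-t)^{-\alpha}u'(s)\,ds$; for $\alpha=1$, ${}_0^cD_t^1u=u'$ and ${}_t^cD_T^1u=-u'$. The space $E_0^\alpha$ is the closure (completion) of $\{g\in C^\infty([0,T],\mathbb{R}):g(0)=g(T)=0\}$ with respect to the norm $\|u\|=\big(\int_0^T|{}_0^cD_t^\alpha u(t)|^2dt+\int_0^T|u(t)|^2dt\big)^{1/2}$; the Caputo derivatives ${}_0^cD_t^\alpha u,\ {}_t^cD_T^\alpha u\in L^2(0,T)$ of $u\in E_0^\alpha$ are understood by continuous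 extension. $E_0^\alpha$ is a Hilbert space with the equivalent norm $\|u\|_\alpha=\big(\int_0^T|{}_0^cD_t^\alpha u(t)|^2dt\big)^{1/2}$, and for $\alpha>1/2$ its elements are continuous functions on $[0,T]$. Solution: an absolutely continuous function $u:[0,T]\to\mathbb{R}$ such that $t\mapsto{}_0D_t^{\alpha-1}({}_0^cD_t^\alpha u(t))-{}_tD_T^{\alpha-1}({}_t^cD_T^\alpha u(t))$ is differentiable (in the classical sense) for almost every $t\in[0,T]$, the equation holds for a.e. $t\in[0,T]$, and $u(0)=u(T)=0$. Non-trivial means not identically zero. *)

theory Defs
  imports "HOL-Analysis.Analysis"
begin

text \<open>Functions on \<open>[0,T]\<close> are represented by functions \<open>real \<Rightarrow> real\<close>; only their values on
  \<open>{0..T}\<close> matter. Integrals over \<open>[0,T]\<close> are Lebesgue integrals with respect to the completed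
  measure \<open>lebesgue\<close>, so that the arbitrary values of \<open>deriv u\<close> on a null set are harmless.\<close>

definition frac_int_left :: "real \<Rightarrow> (real \<Rightarrow> real) \<Rightarrow> real \<Rightarrow> real" where
  "frac_int_left \<beta> u t =
     (if \<beta> = 0 then u t
      else 1 / Gamma \<beta> * (LINT s:{0..t}|lebesgue. (t - s) powr (\<beta> - 1) * u s))"

definition frac_int_right :: "real \<Rightarrow> real \<Rightarrow> (real \<Rightarrow> real) \<Rightarrow> real \<Rightarrow> real" where
  "frac_int_right T \<beta> u t =
     (if \<beta> = 0 then u t
      else 1 / Gamma \<beta> * (LINT s:{t..T}|lebesgue. (s - t) powr (\<beta> - 1) * u s))"

definition caputo_left :: "real \<Rightarrow> (real \<Rightarrow> real) \<Rightarrow> real \<Rightarrow> real" where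
  "caputo_left \<alpha> u t =
     (if \<alpha> = 1 then deriv u t
      else 1 / Gamma (1 - \<alpha>) * (LINT s:{0..t}|lebesgue. (t - s) powr (- \<alpha>) * deriv u s))"

definition caputo_right :: "real \<Rightarrow> real \<Rightarrow> (real \<Rightarrow> real) \<Rightarrow> real \<Rightarrow> real" where
  "caputo_right T \<alpha> u t =
     (if \<alpha> = 1 then - deriv u t
      else - (1 / Gamma (1 - \<alpha>)) * (LINT s:{t..T}|lebesgue. (s - t) powr (- \<alpha>) * deriv u s))"

definition absolutely_continuous_fun_on :: "real \<Rightarrow> real \<Rightarrow> (real \<Rightarrow> real) \<Rightarrow> bool" where
  "absolutely_continuous_fun_on a b u \<longleftrightarrow>
     (\<forall>\<epsilon>>0. \<exists>\<delta>>0. \<forall>(n::nat) (l::nat \<Rightarrow> real) (r::nat \<Rightarrow> real).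
        (\<forall>i<n. a \<le> l i \<and> l i \<le> r i \<and> r i \<le> b) \<and>
        (\<forall>i<n. \<forall>j<n. i \<noteq> j \<longrightarrow> {l i<..<r i} \<inter> {l j<..<r j} = {}) \<and>
        (\<Sum>i<n. r i - l i) < \<delta>
        \<longrightarrow> (\<Sum>i<n. \<bar>u (r i) - u (l i)\<bar>) < \<epsilon>)"

text \<open>\<open>C\<^sup>\<infinity>([0,T])\<close> with derivatives at the endpoints taken one-sidedly; \<open>d n\<close> is the \<open>n\<close>-th derivative.\<close>

definition smooth_vanishing :: "real \<Rightarrow> (real \<Rightarrow> real) set" where
  "smooth_vanishing T = {g. g 0 = 0 \<and> g T = 0 \<and>
     (\<exists>d :: nat \<Rightarrow> real \<Rightarrow> real. (\<forall>t\<in>{0..T}. d 0 t = g t) \<and>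
        (\<forall>n. \<forall>t\<in>{0..T}. (d n has_real_derivative d (Suc n) t) (at t within {0..T})))}"

definition E0_norm :: "real \<Rightarrow> real \<Rightarrow> (real \<Rightarrow> real) \<Rightarrow> real" where
  "E0_norm \<alpha> T u =
     sqrt ((LINT t:{0..T}|lebesgue. \<bar>caputo_left \<alpha> u t\<bar>\<^sup>2) + (LINT t:{0..T}|lebesgue. \<bar>u t\<bar>\<^sup>2))"

text \<open>The completion is realised inside \<open>L\<^sup>2(0,T)\<close>: its elements are the \<open>L\<^sup>2\<close>-limits of sequences of
  smooth functions that are Cauchy for \<open>E0_norm\<close> (the map from the abstract completion to \<open>L\<^sup>2\<close> is
  injective, the left Caputo derivative being closable). Membership is invariant under changes on
  null sets; for \<open>\<alpha> > 1/2\<close> the element is identified with its continuous representative.\<close>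

definition E0 :: "real \<Rightarrow> real \<Rightarrow> (real \<Rightarrow> real) set" where
  "E0 \<alpha> T = {u. set_borel_measurable lebesgue {0..T} u \<and>
     set_integrable lebesgue {0..T} (\<lambda>t. \<bar>u t\<bar>\<^sup>2) \<and>
     (\<exists>g :: nat \<Rightarrow> real \<Rightarrow> real. (\<forall>n. g n \<in> smooth_vanishing T) \<and>
        (\<forall>\<epsilon>>0. \<exists>N. \<forall>m\<ge>N. \<forall>n\<ge>N. E0_norm \<alpha> T (\<lambda>t. g m t - g n t) < \<epsilon>) \<and>
        (\<lambda>n. LINT t:{0..T}|lebesgue. \<bar>g n t - u t\<bar>\<^sup>2) \<longlonglongrightarrow> 0)}"

definition flux :: "real \<Rightarrow> real \<Rightarrow> (real \<Rightarrow> real) \<Rightarrow> real \<Rightarrow> real" where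
  "flux \<alpha> T u t =
     frac_int_left (1 - \<alpha>) (caputo_left \<alpha> u) t - frac_int_right T (1 - \<alpha>) (caputo_right T \<alpha> u) t"

definition is_solution ::
    "real \<Rightarrow> real \<Rightarrow> real \<Rightarrow> (real \<Rightarrow> real) \<Rightarrow> (real \<Rightarrow> real) \<Rightarrow> bool" where
  "is_solution \<alpha> T \<mu> f u \<longleftrightarrow>
     absolutely_continuous_fun_on 0 T u \<and>
     (AE t\<in>{0..T} in lebesgue. flux \<alpha> T u differentiable (at t)) \<and>
     (AE t\<in>{0..T} in lebesgue. deriv (flux \<alpha> T u) t + \<mu> * f (u t) = 0) \<and>
     u 0 = 0 \<and> u T = 0"

definition antideriv :: "(real \<Rightarrow> real) \<Rightarrow> real \<Rightarrow> real" where
  "antideriv f \<xi> = (LBINT s=0..\<xi>. f s)"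

definition kappa :: "real \<Rightarrow> real \<Rightarrow> real" where
  "kappa \<alpha> T =
     T powr (2 * \<alpha>) / ((Gamma \<alpha>)\<^sup>2 * \<bar>cos (pi * \<alpha>)\<bar> * (2 * \<alpha> - 1))"

text \<open>For continuous \<open>f\<close> the supremum over \<open>[-\<gamma>,\<gamma>]\<close> is attained, i.e. it is the maximum
  (\<open>Max\<close> is meaningful for finite sets only).\<close>

definition quotient :: "(real \<Rightarrow> real) \<Rightarrow> real \<Rightarrow> ereal" where
  "quotient f \<gamma> =
     (let M = (SUP \<xi>\<in>{-\<gamma>..\<gamma>}. antideriv f \<xi>)
      in if M = 0 then \<infinity> else ereal (\<gamma>\<^sup>2 / M))"

definition mu_star :: "real \<Rightarrow> real \<Rightarrow> (real \<Rightarrow> real) \<Rightarrow> ereal" where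
  "mu_star \<alpha> T f = ereal (1 / kappa \<alpha> T) * (SUP \<gamma>\<in>{0<..}. quotient f \<gamma>)"

end

theory Submission
  imports Defs "HOL-Complex_Analysis.Great_Picard"
begin

text \<open>The flux of \<open>u\<close> is the derivative of a Riesz potential, so the equation is the Dirichlet problem for the
  fractional Laplacian: \<open>2 |cos (\<pi>\<alpha>)| (-\<Delta>)\<^sup>\<alpha> u = \<mu> f(u)\<close> on \<open>(0,T)\<close>, with \<open>u = 0\<close> outside. Its Green operator factors
  as \<open>c A A\<^sup>*\<close> with an explicit Volterra operator \<open>A\<close>. Writing \<open>u = c A A\<^sup>* h\<close>, the action functional becomes
  \<open>J h = c/2 |A\<^sup>* h|\<^sup>2 - \<mu> \<integral> F(u)\<close>, and Cauchy--Schwarz for the kernel of \<open>A\<close> gives \<open>u\<^sup>2 \<le> (\<kappa>/T) c/2 |A\<^sup>* h|\<^sup>2\<close>, which is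
  exactly the constant in \<open>\<mu>\<^sup>\<star>\<close>. For \<open>\<mu> < \<mu>\<^sup>\<star>\<close> some \<open>\<gamma>\<close> makes \<open>J\<close> positive on the boundary of the energy ball of radius
  \<open>r = \<gamma>\<^sup>2 T/\<kappa>\<close>, so near-minimisers in that ball are nearly critical, and by compactness of \<open>A A\<^sup>*\<close> they converge to a
  fixed point \<open>u = c A A\<^sup>* (\<mu> f(u))\<close>; \<open>u = 0\<close> is excluded because it is no fixed point if \<open>f(0) \<noteq> 0\<close>, and because
  \<open>inf J < 0\<close> if \<open>F(t)/t\<^sup>2 \<rightarrow> \<infinity>\<close>. The explicit derivative of the Green function makes \<open>u\<close> absolutely continuous, Abel
  inversion gives the equation pointwise, and \<open>u\<close> is a limit of polynomials in the energy norm because its Caputo derivative is in \<open>L\<^sup>2\<close>.\<close>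

section \<open>Beta integrals and Abel operators\<close>

text \<open>The equation has to hold classically almost everywhere, whereas a critical point in the
  energy space only satisfies an identity against test functions. Parametrising \<open>u\<close> by
  its right-hand side \<open>h\<close> replaces weak formulations by calculus with explicit kernels;
  \<open>h\<close> is just a bounded Borel function until the pointwise equation is reached, and
  \<open>f\<close> needs no growth condition because the energy ball embeds into |u| \<le> \<gamma>.
  The hard inversion is that of the Riesz kernel with exponent 1-2\<alpha> on a bounded interval.
  That kernel is a superposition over z of products of two one-sided kernels (z-s) and (z-t) with
  exponent -\<alpha>; after a suitable weight each one-sided step is a composition of Abel
  operators, governed by Beta integrals. The cosine in \<kappa> is what the reflection formula, used
  twice, leaves of the Gamma factors, and 2\<alpha>-1 comes from the square integral of the kernel
  of A. At \<alpha> = 1 the one-sided kernels are no longer integrable, so there the classical Green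
  function is differentiated directly.\<close>

lemma set_integral_has_integral:
  fixes f :: "real \<Rightarrow> real"
  assumes "set_integrable lborel S f"
  shows "(f has_integral (LINT x:S|lborel. f x)) S"
  using set_borel_integral_eq_integral[OF assms] by (simp add: has_integral_integral)

lemma set_integrable_lborel_of_lebesgue:
  fixes f :: "real \<Rightarrow> real"
  assumes "f absolutely_integrable_on S" "f \<in> borel_measurable borel" "S \<in> sets borel"
  shows "set_integrable lborel S f"
proof -
  have "(\<lambda>x. indicator S x *\<^sub>R f x) \<in> borel_measurable lborel"
    using assms(2,3) by (intro borel_measurable_scaleR) auto
  with assms(1) show ?thesis
    unfolding set_integrable_def using integrable_completion by blast
qed

text \<open>Explicit values come from the fundamental theorem of calculus, hence from the gauge
  integral. The sign of the integrand makes such an integral absolutely convergent, so integrability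
  and value are obtained together, endpoint singularities included.\<close>

lemma set_integral_of_has_integral_nonneg:
  fixes f :: "real \<Rightarrow> real"
  assumes "(f has_integral I) S" "f \<in> borel_measurable borel" "S \<in> sets borel" "\<And>x. x \<in> S \<Longrightarrow> 0 \<le> f x"
  shows "set_integrable lborel S f" "(LINT x:S|lborel. f x) = I"
proof -
  have "f absolutely_integrable_on S"
    using assms by (intro nonnegative_absolutely_integrable_1) auto
  then show *: "set_integrable lborel S f"
    using assms by (intro set_integrable_lborel_of_lebesgue)
  from set_integral_has_integral[OF this] assms(1) show "(LINT x:S|lborel. f x) = I"
    by (rule has_integral_unique)
qed

lemma set_integral_affine:
  fixes f :: "real \<Rightarrow> real"
  assumes "c > 0"
  shows "set_integrable lborel {a<..<b} f \<longleftrightarrow> set_integrable lborel {(a-t)/c<..<(b-t)/c} (\<lambda>x. f (t + c * x))"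
    "(LINT x:{a<..<b}|lborel. f x) = c * (LINT x:{(a-t)/c<..<(b-t)/c}|lborel. f (t + c * x))"
proof -
  have ind: "indicator {a<..<b} (t + c * x) = (indicator {(a-t)/c<..<(b-t)/c} x :: real)" for x
    using assms by (auto simp: indicator_def field_simps)
  show "set_integrable lborel {a<..<b} f \<longleftrightarrow> set_integrable lborel {(a-t)/c<..<(b-t)/c} (\<lambda>x. f (t + c * x))"
    unfolding set_integrable_def
    using lborel_integrable_real_affine_iff[of c "\<lambda>x. indicator {a<..<b} x *\<^sub>R f x" t] assms
    by (simp add: ind)
  show "(LINT x:{a<..<b}|lborel. f x) = c * (LINT x:{(a-t)/c<..<(b-t)/c}|lborel. f (t + c * x))"
    unfolding set_lebesgue_integral_def
    using lborel_integral_real_affine[of c "\<lambda>x. indicator {a<..<b} x *\<^sub>R f x" t] assms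
    by (simp add: ind)
qed

lemma set_integral_reflect:
  fixes f :: "real \<Rightarrow> real"
  shows "set_integrable lborel {a<..<b} f \<longleftrightarrow> set_integrable lborel {t-b<..<t-a} (\<lambda>x. f (t - x))"
    "(LINT x:{a<..<b}|lborel. f x) = (LINT x:{t-b<..<t-a}|lborel. f (t - x))"
proof -
  have ind: "indicator {a<..<b} (t - x) = (indicator {t-b<..<t-a} x :: real)" for x
    by (auto simp: indicator_def field_simps)
  show "set_integrable lborel {a<..<b} f \<longleftrightarrow> set_integrable lborel {t-b<..<t-a} (\<lambda>x. f (t - x))"
    unfolding set_integrable_def
    using lborel_integrable_real_affine_iff[of "-1" "\<lambda>x. indicator {a<..<b} x *\<^sub>R f x" t]
    by (simp add: ind)
  show "(LINT x:{a<..<b}|lborel. f x) = (LINT x:{t-b<..<t-a}|lborel. f (t - x))"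
    unfolding set_lebesgue_integral_def
    using lborel_integral_real_affine[of "-1" "\<lambda>x. indicator {a<..<b} x *\<^sub>R f x" t]
    by (simp add: ind)
qed

section \<open>Beta integrals on bounded intervals\<close>

lemma beta_integral_unit:
  assumes "p > 0" "q > (0::real)"
  shows "set_integrable lborel {0<..<1} (\<lambda>z. (1 - z) powr (p-1) * z powr (q-1))"
    "(LINT z:{0<..<1}|lborel. (1 - z) powr (p-1) * z powr (q-1)) = Beta p q"
proof -
  have "((\<lambda>t. t powr (q - 1) * (1 - t) powr (p - 1)) has_integral Beta q p) {0..1}"
    by (rule has_integral_Beta_real) (use assms in auto)
  then have "((\<lambda>z. (1 - z) powr (p-1) * z powr (q-1)) has_integral Beta p q) {0<..<1}"
    by (simp add: has_integral_Icc_iff_Ioo mult.commute Beta_commute)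
  from set_integral_of_has_integral_nonneg[OF this]
  show "set_integrable lborel {0<..<1} (\<lambda>z. (1 - z) powr (p-1) * z powr (q-1))"
    "(LINT z:{0<..<1}|lborel. (1 - z) powr (p-1) * z powr (q-1)) = Beta p q" by auto
qed

lemma beta_integral:
  assumes "p > 0" "q > (0::real)" "a < b"
  shows "set_integrable lborel {a<..<b} (\<lambda>z. (b - z) powr (p-1) * (z - a) powr (q-1))"
    "(LINT z:{a<..<b}|lborel. (b - z) powr (p-1) * (z - a) powr (q-1)) = (b - a) powr (p+q-1) * Beta p q"
proof -
  let ?f = "\<lambda>z. (b - z) powr (p-1) * (z - a) powr (q-1)"
  let ?g = "\<lambda>z. (b-a) powr (p+q-2) * ((1 - z) powr (p-1) * z powr (q-1))"
  have eq: "?f (a + (b-a) * z) = ?g z" if "z \<in> {0<..<1}" for z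
  proof -
    have 1: "b - (a + (b-a) * z) = (b-a)*(1-z)" "a + (b-a) * z - a = (b-a)*z" by (simp_all add: algebra_simps)
    have 2: "(b-a) powr (p+q-2) = (b-a) powr (p-1) * (b-a) powr (q-1)" 
      by (simp only: powr_add[symmetric]) (simp add: algebra_simps)
    show ?thesis unfolding 1 2 using that assms by (simp add: powr_mult)
  qed
  have I: "{(a - a) / (b - a)<..<(b - a) / (b - a)} = {0<..<1::real}" using assms by auto
  have i1: "set_integrable lborel {0<..<1} ?g"
    using beta_integral_unit(1)[OF assms(1,2)] by (rule set_integrable_mult_right)
  have "set_integrable lborel {0<..<1} (\<lambda>z. ?f (a + (b-a) * z)) \<longleftrightarrow> set_integrable lborel {0<..<1} ?g"
    by (rule set_integrable_cong[OF refl refl eq])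
  with i1 show "set_integrable lborel {a<..<b} ?f"
    using set_integral_affine(1)[of "b-a" a b ?f a] assms(3) unfolding I by simp
  have "(LINT z:{0<..<1}|lborel. ?f (a + (b-a) * z)) = (LINT z:{0<..<1}|lborel. ?g z)"
    by (rule set_lebesgue_integral_cong) (use eq in auto)
  also have "\<dots> = (b-a) powr (p+q-2) * Beta p q"
    by (simp add: beta_integral_unit(2)[OF assms(1,2)])
  finally have "(LINT z:{a<..<b}|lborel. ?f z) = (b-a) * ((b-a) powr (p+q-2) * Beta p q)"
    using set_integral_affine(2)[of "b-a" a b ?f a] assms(3) unfolding I by simp
  also have "\<dots> = (b - a) powr (p+q-1) * Beta p q"
  proof -
    have "(b-a) * (b-a) powr (p+q-2) = (b-a) powr 1 * (b-a) powr (p+q-2)" using assms by simp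
    also have "\<dots> = (b-a) powr (p+q-1)" by (simp only: powr_add[symmetric]) (simp add: algebra_simps)
    finally show ?thesis by simp
  qed
  finally show "(LINT z:{a<..<b}|lborel. ?f z) = (b - a) powr (p+q-1) * Beta p q" .
qed

lemma Beta_1_right:
  assumes "p > 0" shows "Beta p 1 = 1 / (p::real)"
proof -
  have "p \<notin> \<int>\<^sub>\<le>\<^sub>0" using assms by (auto elim!: nonpos_Ints_cases)
  then show ?thesis using Gamma_plus1[of p] less_imp_neq[OF Gamma_real_pos[OF assms]] assms
    by (simp add: Beta_def field_simps)
qed

lemma Beta_pos: "p > 0 \<Longrightarrow> q > 0 \<Longrightarrow> Beta p q > (0::real)"
  by (simp add: Beta_def Gamma_real_pos)

text \<open>Integrability of the sections is asked only almost everywhere: in the factorised Riesz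
  kernel the section s = t carries the exponent -2\<alpha> and diverges.\<close>

lemma fubini_lborel:
  fixes f :: "real \<Rightarrow> real \<Rightarrow> real"
  assumes meas: "(\<lambda>(x,y). f x y) \<in> borel_measurable (borel \<Otimes>\<^sub>M borel)"
    and inner: "AE x in lborel. integrable lborel (f x)"
    and outer: "integrable lborel (\<lambda>x. \<integral>y. \<bar>f x y\<bar> \<partial>lborel)"
  shows "(\<integral>y. (\<integral>x. f x y \<partial>lborel) \<partial>lborel) = (\<integral>x. (\<integral>y. f x y \<partial>lborel) \<partial>lborel)"
    "integrable lborel (\<lambda>y. \<integral>x. f x y \<partial>lborel)"
    "integrable lborel (\<lambda>x. \<integral>y. f x y \<partial>lborel)"
    "integrable (lborel \<Otimes>\<^sub>M lborel) (\<lambda>(x,y). f x y)"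
proof -
  have "sets (lborel \<Otimes>\<^sub>M lborel) = sets (borel \<Otimes>\<^sub>M (borel :: real measure) :: (real \<times> real) measure)"
    by (rule sets_pair_measure_cong) auto
  then have m: "(\<lambda>(x,y). f x y) \<in> borel_measurable (lborel \<Otimes>\<^sub>M lborel)"
    using meas measurable_cong_sets by blast
  show *: "integrable (lborel \<Otimes>\<^sub>M lborel) (\<lambda>(x,y). f x y)"
    by (rule lborel_pair.Fubini_integrable[OF m]) (use inner outer in auto)
  show "(\<integral>y. (\<integral>x. f x y \<partial>lborel) \<partial>lborel) = (\<integral>x. (\<integral>y. f x y \<partial>lborel) \<partial>lborel)"
    by (rule lborel_pair.Fubini_integral[OF *])
  show "integrable lborel (\<lambda>y. \<integral>x. f x y \<partial>lborel)"
    by (rule lborel_pair.integrable_snd[OF *])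
  show "integrable lborel (\<lambda>x. \<integral>y. f x y \<partial>lborel)"
    by (rule lborel_pair.integrable_fst[OF *])
qed

text \<open>Continuity in the parameter is required for almost every \<open>y\<close> only, since a
  translated kernel with a singular diagonal loses it at one point.\<close>

lemma continuous_on_integral_dominated:
  fixes f :: "real \<Rightarrow> real \<Rightarrow> real"
  assumes meas: "\<And>x. x \<in> S \<Longrightarrow> f x \<in> borel_measurable lborel"
    and bound: "\<And>x. x \<in> S \<Longrightarrow> AE y in lborel. \<bar>f x y\<bar> \<le> w y"
    and w: "integrable lborel w"
    and cont: "AE y in lborel. continuous_on S (\<lambda>x. f x y)"
  shows "continuous_on S (\<lambda>x. \<integral>y. f x y \<partial>lborel)"
  unfolding continuous_on_sequentially
proof (intro allI ballI impI)
  fix X a assume X: "a \<in> S" "(\<forall>n. X n \<in> S) \<and> X \<longlonglongrightarrow> a"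
  have "(\<lambda>n. \<integral>y. f (X n) y \<partial>lborel) \<longlonglongrightarrow> (\<integral>y. f a y \<partial>lborel)"
  proof (rule integral_dominated_convergence[where w=w])
    show "AE y in lborel. (\<lambda>n. f (X n) y) \<longlonglongrightarrow> f a y"
      using cont
    proof eventually_elim
      case (elim y)
      then show ?case using X unfolding continuous_on_sequentially by (auto simp: o_def)
    qed
    show "AE y in lborel. norm (f (X n) y) \<le> w y" for n using bound X by auto
  qed (use meas X w in auto)
  then show "((\<lambda>x. \<integral>y. f x y \<partial>lborel) \<circ> X) \<longlonglongrightarrow> (\<integral>y. f a y \<partial>lborel)"
    by (simp add: o_def)
qed

text \<open>The integrand may be singular at 0, where nothing but integrability is known. The
  integral is therefore cut at an interior point, and only the part over a compact interval of
  continuity is differentiated.\<close>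

lemma DERIV_indefinite_integral:
  fixes \<phi> :: "real \<Rightarrow> real"
  assumes cont: "continuous_on {0<..<T} \<phi>"
    and int: "\<And>z. 0 < z \<Longrightarrow> z < T \<Longrightarrow> set_integrable lborel {0<..<z} \<phi>"
    and z: "0 < z" "z < T"
  shows "((\<lambda>z. LINT s:{0<..<z}|lborel. \<phi> s) has_real_derivative \<phi> z) (at z)"
proof -
  define l u where "l = z/2" and "u = (z+T)/2"
  have lu: "0 < l" "l < z" "z < u" "u < T" using z by (auto simp: l_def u_def)
  have split: "(LINT s:{0<..<x}|lborel. \<phi> s) = (LINT s:{0<..<l}|lborel. \<phi> s) + integral {l..x} \<phi>"
    if "x \<in> {l<..<u}" for x
  proof -
    have hx: "(\<phi> has_integral (LINT s:{0<..<x}|lborel. \<phi> s)) {0..x}"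
      unfolding has_integral_Icc_iff_Ioo by (rule set_integral_has_integral, rule int) (use that lu in auto)
    have hl: "(\<phi> has_integral (LINT s:{0<..<l}|lborel. \<phi> s)) {0..l}"
      unfolding has_integral_Icc_iff_Ioo by (rule set_integral_has_integral, rule int) (use that lu in auto)
    have "integral {0..l} \<phi> + integral {l..x} \<phi> = integral {0..x} \<phi>"
      by (rule Henstock_Kurzweil_Integration.integral_combine) (use that lu hx in auto)
    then show ?thesis using hx hl by (simp add: integral_unique)
  qed
  have "((\<lambda>x. integral {l..x} \<phi>) has_real_derivative \<phi> z) (at z within {l..u})"
    by (rule integral_has_real_derivative[OF continuous_on_subset[OF cont]]) (use lu in auto)
  then have "((\<lambda>x. integral {l..x} \<phi>) has_real_derivative \<phi> z) (at z)"
    using lu by (simp add: at_within_Icc_at)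
  then have "((\<lambda>x. (LINT s:{0<..<l}|lborel. \<phi> s) + integral {l..x} \<phi>) has_real_derivative \<phi> z) (at z)"
    by (auto intro!: derivative_eq_intros)
  then show ?thesis
    by (rule has_field_derivative_transform_within_open[of _ _ _ "{l<..<u}"]) (use lu split in auto)
qed

text \<open>The Riemann--Liouville integral of order \<open>p\<close> is \<open>abel p \<phi> / \<Gamma>(p)\<close>.\<close>

definition abel :: "real \<Rightarrow> (real \<Rightarrow> real) \<Rightarrow> real \<Rightarrow> real" where
  "abel p \<phi> z = (LINT s:{0<..<z}|lborel. (z - s) powr (p - 1) * \<phi> s)"

lemma abel_cong: "(\<And>s. 0 < s \<Longrightarrow> s < z \<Longrightarrow> \<phi> s = \<psi> s) \<Longrightarrow> abel p \<phi> z = abel p \<psi> z"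
  unfolding abel_def by (rule set_lebesgue_integral_cong) auto

lemma abel_one: "abel 1 \<phi> z = (LINT s:{0<..<z}|lborel. \<phi> s)"
  unfolding abel_def by (rule set_lebesgue_integral_cong) auto

lemma abel_cmult: "abel p (\<lambda>s. c * \<phi> s) z = c * abel p \<phi> z"
  unfolding abel_def by (subst set_integral_mult_right[symmetric]) (simp add: mult_ac)

lemma borel_measurable_abel [measurable]:
  assumes [measurable]: "\<phi> \<in> borel_measurable borel"
  shows "abel p \<phi> \<in> borel_measurable borel"
proof -
  have "(\<lambda>z. \<integral>s. (if 0 < s \<and> s < z then (z - s) powr (p - 1) * \<phi> s else 0) \<partial>lborel) \<in> borel_measurable borel"
    by measurable
  moreover have "abel p \<phi> = (\<lambda>z. \<integral>s. (if 0 < s \<and> s < z then (z - s) powr (p - 1) * \<phi> s else 0) \<partial>lborel)"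
    unfolding abel_def set_lebesgue_integral_def by (intro ext Bochner_Integration.integral_cong) auto
  ultimately show ?thesis by simp
qed

text \<open>For fixed s < z the product of the two kernels integrates over the intermediate variable
  to a Beta integral, so Fubini yields the semigroup law; \<open>Beta p q\<close> appears because
  \<open>abel\<close> omits the Gamma factors. The integrability hypothesis is exactly the absolute
  convergence of the double integral.\<close>

lemma abel_abel:
  assumes p: "p > 0" "q > 0" and [measurable]: "\<phi> \<in> borel_measurable borel"
    and int: "set_integrable lborel {0<..<z} (\<lambda>s. (z - s) powr (p + q - 1) * \<phi> s)"
  shows "set_integrable lborel {0<..<z} (\<lambda>s. (z - s) powr (p - 1) * abel q \<phi> s)"
    "abel p (abel q \<phi>) z = Beta p q * abel (p + q) \<phi> z"
proof -
  define f where "f s r = (if 0 < s \<and> s < r \<and> r < z then (z - r) powr (p-1) * (r - s) powr (q-1) * \<phi> s else 0)" for s r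
  have f: "f s = (\<lambda>r. indicator {s<..<z} r *\<^sub>R ((z - r) powr (p-1) * (r - s) powr (q-1)) * \<phi> s)"
    if "s \<in> {0<..<z}" for s using that by (auto simp: f_def)
  have f0: "f s = (\<lambda>r. 0)" if "s \<notin> {0<..<z}" for s using that by (auto simp: f_def)
  have int1: "integrable lborel (f s)" for s
  proof (cases "s \<in> {0<..<z}")
    case True
    then show ?thesis unfolding f[OF True]
      using beta_integral(1)[OF p, of s z] by (intro integrable_mult_left) (auto simp: set_integrable_def)
  qed (simp add: f0)
  have eq1: "(\<integral>r. f s r \<partial>lborel) = indicator {0<..<z} s *\<^sub>R ((z - s) powr (p+q-1) * \<phi> s) * Beta p q" for s
  proof (cases "s \<in> {0<..<z}")
    case True
    then show ?thesis unfolding f[OF True]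
      using beta_integral(2)[OF p, of s z] by (simp add: set_lebesgue_integral_def)
  qed (simp add: f0)
  have eq2: "(\<integral>r. \<bar>f s r\<bar> \<partial>lborel) = \<bar>indicator {0<..<z} s *\<^sub>R ((z - s) powr (p+q-1) * \<phi> s)\<bar> * Beta p q" for s
  proof (cases "s \<in> {0<..<z}")
    case True
    have "(\<lambda>r. \<bar>f s r\<bar>) = (\<lambda>r. indicator {s<..<z} r *\<^sub>R ((z - r) powr (p-1) * (r - s) powr (q-1)) * \<bar>\<phi> s\<bar>)"
      unfolding f[OF True] by (auto simp: abs_mult)
    then show ?thesis 
      using True beta_integral(2)[OF p, of s z] by (simp add: set_lebesgue_integral_def abs_mult)
  qed (simp add: f0)
  have meas: "(\<lambda>(s,r). f s r) \<in> borel_measurable (borel \<Otimes>\<^sub>M borel)"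
    unfolding f_def by measurable
  have out: "integrable lborel (\<lambda>s. \<integral>r. \<bar>f s r\<bar> \<partial>lborel)"
    unfolding eq2 using int unfolding set_integrable_def by (intro integrable_mult_left integrable_abs)
  note F = fubini_lborel[OF meas _ out]
  have in2: "(\<integral>s. f s r \<partial>lborel) = indicator {0<..<z} r *\<^sub>R ((z - r) powr (p-1) * abel q \<phi> r)" for r
  proof (cases "r \<in> {0<..<z}")
    case True
    have "(\<integral>s. f s r \<partial>lborel) = (\<integral>s. (z - r) powr (p-1) * (indicator {0<..<r} s *\<^sub>R ((r - s) powr (q-1) * \<phi> s)) \<partial>lborel)"
      by (rule Bochner_Integration.integral_cong) (use True in \<open>auto simp: f_def indicator_def\<close>)
    then show ?thesis using True by (simp add: abel_def set_lebesgue_integral_def)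
  next
    case False
    then have "f s r = 0" for s by (auto simp: f_def)
    then show ?thesis using False by simp
  qed
  show "set_integrable lborel {0<..<z} (\<lambda>s. (z - s) powr (p - 1) * abel q \<phi> s)"
    using F(2) int1 unfolding in2 set_integrable_def by simp
  show "abel p (abel q \<phi>) z = Beta p q * abel (p + q) \<phi> z"
    using F(1) int1 unfolding in2 eq1 unfolding abel_def[of p] abel_def[of "p+q"] set_lebesgue_integral_def by simp
qed

lemma abel_power_bound:
  assumes p: "p > 0" "q > 0" and [measurable]: "\<phi> \<in> borel_measurable borel" and z: "z > 0"
    and bound: "\<And>s. 0 < s \<Longrightarrow> s < z \<Longrightarrow> \<bar>\<phi> s\<bar> \<le> C * s powr (q - 1)"
  shows "set_integrable lborel {0<..<z} (\<lambda>s. (z - s) powr (p - 1) * \<phi> s)"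
    "\<bar>abel p \<phi> z\<bar> \<le> C * Beta p q * z powr (p + q - 1)"
proof -
  have w: "set_integrable lborel {0<..<z} (\<lambda>s. C * ((z - s) powr (p-1) * s powr (q-1)))"
    using beta_integral(1)[OF p z] by (intro set_integrable_mult_right) simp
  have b: "\<bar>(z - s) powr (p-1) * \<phi> s\<bar> \<le> C * ((z - s) powr (p-1) * s powr (q-1))" if "s \<in> {0<..<z}" for s
    using bound[of s] that mult_left_mono[OF bound[of s], of "(z - s) powr (p-1)"] by (simp add: abs_mult mult_ac)
  show i: "set_integrable lborel {0<..<z} (\<lambda>s. (z - s) powr (p - 1) * \<phi> s)"
    by (rule set_integrable_bound[OF w]) (use b in \<open>auto simp: set_borel_measurable_def intro!: AE_I2 order.trans[OF b]\<close>)
  have "\<bar>abel p \<phi> z\<bar> \<le> (LINT s:{0<..<z}|lborel. \<bar>(z - s) powr (p - 1) * \<phi> s\<bar>)"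
    unfolding abel_def using set_integral_norm_bound[OF i] by simp
  also have "\<dots> \<le> (LINT s:{0<..<z}|lborel. C * ((z - s) powr (p-1) * s powr (q-1)))"
    by (rule set_integral_mono[OF set_integrable_abs[OF i] w b])
  also have "\<dots> = C * Beta p q * z powr (p + q - 1)"
    using beta_integral(2)[OF p z] by simp
  finally show "\<bar>abel p \<phi> z\<bar> \<le> C * Beta p q * z powr (p + q - 1)" .
qed

lemma abel_scale:
  assumes "z > 0"
  shows "abel p \<phi> z = z powr p * (LINT \<sigma>:{0<..<1}|lborel. (1 - \<sigma>) powr (p - 1) * \<phi> (z * \<sigma>))"
proof -
  have "abel p \<phi> z = z * (LINT \<sigma>:{0<..<1}|lborel. (z - z * \<sigma>) powr (p - 1) * \<phi> (z * \<sigma>))"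
    unfolding abel_def using set_integral_affine(2)[OF assms, of 0 z "\<lambda>s. (z - s) powr (p - 1) * \<phi> s" 0] assms
    by simp
  also have "(LINT \<sigma>:{0<..<1}|lborel. (z - z * \<sigma>) powr (p - 1) * \<phi> (z * \<sigma>)) 
     = (LINT \<sigma>:{0<..<1}|lborel. z powr (p - 1) * ((1 - \<sigma>) powr (p - 1) * \<phi> (z * \<sigma>)))"
  proof (rule set_lebesgue_integral_cong, simp, clarify)
    fix \<sigma> :: real assume "\<sigma> \<in> {0<..<1}"
    moreover have "z - z * \<sigma> = z * (1 - \<sigma>)" by (simp add: algebra_simps)
    ultimately show "(z - z * \<sigma>) powr (p - 1) * \<phi> (z * \<sigma>) = z powr (p - 1) * ((1 - \<sigma>) powr (p - 1) * \<phi> (z * \<sigma>))"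
      using assms by (simp add: powr_mult)
  qed
  also have "z * \<dots> = (z powr 1 * z powr (p-1)) * (LINT \<sigma>:{0<..<1}|lborel. (1 - \<sigma>) powr (p - 1) * \<phi> (z * \<sigma>))"
    using assms by simp
  also have "z powr 1 * z powr (p-1) = z powr p" by (simp only: powr_add[symmetric]) simp
  finally show ?thesis .
qed

lemma continuous_on_Ioo_if_Icc:
  fixes \<phi> :: "real \<Rightarrow> real"
  assumes "\<And>l b. a < l \<Longrightarrow> l < b \<Longrightarrow> b < c \<Longrightarrow> continuous_on {l..b} \<phi>"
  shows "continuous_on {a<..<c} \<phi>"
proof (rule continuous_at_imp_continuous_on, rule ballI)
  fix x assume x: "x \<in> {a<..<c}"
  have "continuous_on {(a+x)/2..(x+c)/2} \<phi>" using x by (intro assms) (auto simp: field_simps)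
  then show "isCont \<phi> x" using x by (intro continuous_on_interior) (auto simp: field_simps)
qed

text \<open>Scaling to the unit interval fixes the kernel singularity at
  \<open>\<sigma> = 1\<close>, independently of \<open>z\<close>. On a compact range of
  \<open>z\<close> a single Beta density then dominates, the power bound on \<open>\<phi>\<close>
  controlling the end \<open>\<sigma> = 0\<close>.\<close>

lemma abel_continuous:
  assumes p: "p > 0" "q > 0" and [measurable]: "\<phi> \<in> borel_measurable borel"
    and cont: "continuous_on {0<..<T} \<phi>"
    and bound: "\<And>b. b < T \<Longrightarrow> \<exists>C. \<forall>s. 0 < s \<and> s \<le> b \<longrightarrow> \<bar>\<phi> s\<bar> \<le> C * s powr (q - 1)"
  shows "continuous_on {0<..<T} (abel p \<phi>)"
proof (rule continuous_on_Ioo_if_Icc)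
  fix l b assume lb: "0 < l" "l < b" "b < T"
  obtain C where C: "\<And>s. 0 < s \<Longrightarrow> s \<le> b \<Longrightarrow> \<bar>\<phi> s\<bar> \<le> C * s powr (q - 1)" using bound[OF lb(3)] by blast
  have C0: "C \<ge> 0"
  proof -
    have "0 \<le> C * b powr (q-1)" using C[of b] lb by linarith
    moreover have "b powr (q-1) > 0" using lb by simp
    ultimately show ?thesis by (simp add: zero_le_mult_iff)
  qed
  \<comment> \<open>The sign of \<open>q - 1\<close> is open, so the power is bounded by the larger
    of its endpoint values.\<close>
  define K where "K = max (l powr (q-1)) (b powr (q-1))"
  have K: "z powr (q-1) \<le> K" if "z \<in> {l..b}" for z
  proof (cases "q \<ge> 1")
    case True then show ?thesis using that lb powr_mono2[of "q-1" z b] by (auto simp: K_def)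
  next
    case False then show ?thesis using that lb powr_mono2'[of "q-1" l z] by (auto simp: K_def)
  qed
  let ?f = "\<lambda>z \<sigma>. indicator {0<..<1} \<sigma> *\<^sub>R ((1 - \<sigma>) powr (p - 1) * \<phi> (z * \<sigma>))"
  have "continuous_on {l..b} (\<lambda>z. \<integral>\<sigma>. ?f z \<sigma> \<partial>lborel)"
  proof (rule continuous_on_integral_dominated[where w="\<lambda>\<sigma>. indicator {0<..<1} \<sigma> *\<^sub>R ((C * K) * ((1 - \<sigma>) powr (p-1) * \<sigma> powr (q-1)))"])
    show "integrable lborel (\<lambda>\<sigma>. indicator {0<..<1} \<sigma> *\<^sub>R ((C * K) * ((1 - \<sigma>) powr (p-1) * \<sigma> powr (q-1))))"
      using set_integrable_mult_right[OF beta_integral_unit(1)[OF p], of "C*K"] unfolding set_integrable_def by simp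
    fix z assume z: "z \<in> {l..b}"
    show "?f z \<in> borel_measurable lborel" by measurable
    have "\<bar>?f z \<sigma>\<bar> \<le> indicator {0<..<1} \<sigma> *\<^sub>R ((C * K) * ((1 - \<sigma>) powr (p-1) * \<sigma> powr (q-1)))" for \<sigma>
    proof (cases "\<sigma> \<in> {0<..<1}")
      case True
      have "z * \<sigma> \<le> b * 1" using True z lb by (intro mult_mono) auto
      then have "\<bar>\<phi> (z * \<sigma>)\<bar> \<le> C * (z * \<sigma>) powr (q - 1)" using C[of "z*\<sigma>"] True z lb by auto
      also have "\<dots> = C * (z powr (q-1) * \<sigma> powr (q-1))" using True z lb by (simp add: powr_mult)
      also have "\<dots> \<le> C * (K * \<sigma> powr (q-1))" using K[OF z] C0 by (intro mult_left_mono mult_right_mono) auto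
      finally have "(1 - \<sigma>) powr (p-1) * \<bar>\<phi> (z * \<sigma>)\<bar> \<le> (1 - \<sigma>) powr (p-1) * (C * (K * \<sigma> powr (q-1)))"
        by (rule mult_left_mono) simp
      then show ?thesis using True by (simp add: abs_mult mult_ac)
    qed simp
    then show "AE \<sigma> in lborel. \<bar>?f z \<sigma>\<bar> \<le> indicator {0<..<1} \<sigma> *\<^sub>R ((C * K) * ((1 - \<sigma>) powr (p-1) * \<sigma> powr (q-1)))" by simp
  next
    have "continuous_on {l..b} (\<lambda>z. ?f z \<sigma>)" for \<sigma>
    proof (cases "\<sigma> \<in> {0<..<1}")
      case True
      have "continuous_on {l..b} (\<lambda>z. \<phi> (z * \<sigma>))"
      proof (rule continuous_on_compose2[OF cont], intro continuous_intros, clarify)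
        fix z assume "z \<in> {l..b}"
        moreover have "z * \<sigma> \<le> b * 1" using True calculation lb by (intro mult_mono) auto
        ultimately show "z * \<sigma> \<in> {0<..<T}" using True lb by auto
      qed
      then show ?thesis using True by (auto intro!: continuous_intros)
    qed simp
    then show "AE \<sigma> in lborel. continuous_on {l..b} (\<lambda>z. ?f z \<sigma>)" by simp
  qed
  then have "continuous_on {l..b} (\<lambda>z. z powr p * (LINT \<sigma>:{0<..<1}|lborel. (1 - \<sigma>) powr (p - 1) * \<phi> (z * \<sigma>)))"
    unfolding set_lebesgue_integral_def using lb by (intro continuous_intros) auto
  then show "continuous_on {l..b} (abel p \<phi>)"
    by (rule continuous_on_eq) (use lb in \<open>simp add: abel_scale\<close>)
qed

text \<open>Abel's inversion: applying the operator of complementary order \<open>1 - p\<close>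
  turns both sides into multiples of plain primitives, and differentiating these recovers the
  functions pointwise thanks to continuity.\<close>

lemma abel_inject:
  assumes p: "0 < p" "p < 1" and m[measurable]: "\<phi> \<in> borel_measurable borel" "\<psi> \<in> borel_measurable borel"
    and cont: "continuous_on {0<..<T} \<phi>" "continuous_on {0<..<T} \<psi>"
    and int: "\<And>z. 0 < z \<Longrightarrow> z < T \<Longrightarrow> set_integrable lborel {0<..<z} \<phi>"
       "\<And>z. 0 < z \<Longrightarrow> z < T \<Longrightarrow> set_integrable lborel {0<..<z} \<psi>"
    and eq: "\<And>z. 0 < z \<Longrightarrow> z < T \<Longrightarrow> abel p \<phi> z = abel p \<psi> z"
    and z: "0 < z" "z < T"
  shows "\<phi> z = \<psi> z"
proof -
  have *: "abel (1-p) (abel p \<theta>) x = Beta (1-p) p * (LINT s:{0<..<x}|lborel. \<theta> s)"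
    if "\<theta> \<in> borel_measurable borel" "set_integrable lborel {0<..<x} \<theta>" for \<theta> x
  proof -
    have "set_integrable lborel {0<..<x} (\<lambda>s. (x - s) powr ((1 - p) + p - 1) * \<theta> s) \<longleftrightarrow> set_integrable lborel {0<..<x} \<theta>"
      by (rule set_integrable_cong) auto
    then show ?thesis using abel_abel(2)[of "1-p" p \<theta> x] p that by (simp add: abel_one)
  qed
  have **: "(LINT s:{0<..<x}|lborel. \<phi> s) = (LINT s:{0<..<x}|lborel. \<psi> s)" if "0 < x" "x < T" for x
  proof -
    have "abel (1-p) (abel p \<phi>) x = abel (1-p) (abel p \<psi>) x"
      by (rule abel_cong) (use eq that in auto)
    then show ?thesis using *[OF m(1) int(1)[OF that]] *[OF m(2) int(2)[OF that]] Beta_pos[of "1-p" p] p by simp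
  qed
  have "((\<lambda>z. LINT s:{0<..<z}|lborel. \<phi> s) has_real_derivative \<phi> z) (at z)"
    by (rule DERIV_indefinite_integral[OF cont(1) int(1) z])
  then have "((\<lambda>z. LINT s:{0<..<z}|lborel. \<psi> s) has_real_derivative \<phi> z) (at z)"
    by (rule has_field_derivative_transform_within_open[of _ _ _ "{0<..<T}"]) (use z ** in auto)
  moreover have "((\<lambda>z. LINT s:{0<..<z}|lborel. \<psi> s) has_real_derivative \<psi> z) (at z)"
    by (rule DERIV_indefinite_integral[OF cont(2) int(2) z])
  ultimately show ?thesis by (rule DERIV_unique)
qed

section \<open>The Green operator\<close>

lemma power_integral:
  assumes "p > (0::real)" "a < b"
  shows "set_integrable lborel {a<..<b} (\<lambda>z. (b - z) powr (p-1))"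
    "(LINT z:{a<..<b}|lborel. (b - z) powr (p-1)) = (b - a) powr p / p"
    "set_integrable lborel {a<..<b} (\<lambda>z. (z - a) powr (p-1))"
    "(LINT z:{a<..<b}|lborel. (z - a) powr (p-1)) = (b - a) powr p / p"
proof -
  note 1 = beta_integral[OF assms(1) zero_less_one assms(2)]
  have "set_integrable lborel {a<..<b} (\<lambda>z. (b - z) powr (p-1) * (z - a) powr (1-1)) \<longleftrightarrow> set_integrable lborel {a<..<b} (\<lambda>z. (b - z) powr (p-1))"
    by (rule set_integrable_cong) auto
  then show "set_integrable lborel {a<..<b} (\<lambda>z. (b - z) powr (p-1))" using 1 by simp
  have "(LINT z:{a<..<b}|lborel. (b - z) powr (p-1) * (z - a) powr (1-1)) = (LINT z:{a<..<b}|lborel. (b - z) powr (p-1))"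
    by (rule set_lebesgue_integral_cong) auto
  then show "(LINT z:{a<..<b}|lborel. (b - z) powr (p-1)) = (b - a) powr p / p"
    using 1 Beta_1_right[OF assms(1)] by simp
  note 2 = beta_integral[OF zero_less_one assms(1) assms(2)]
  have "set_integrable lborel {a<..<b} (\<lambda>z. (b - z) powr (1-1) * (z - a) powr (p-1)) \<longleftrightarrow> set_integrable lborel {a<..<b} (\<lambda>z. (z - a) powr (p-1))"
    by (rule set_integrable_cong) auto
  then show "set_integrable lborel {a<..<b} (\<lambda>z. (z - a) powr (p-1))" using 2 by simp
  have "(LINT z:{a<..<b}|lborel. (b - z) powr (1-1) * (z - a) powr (p-1)) = (LINT z:{a<..<b}|lborel. (z - a) powr (p-1))"
    by (rule set_lebesgue_integral_cong) auto
  then show "(LINT z:{a<..<b}|lborel. (z - a) powr (p-1)) = (b - a) powr p / p"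
    using 2 Beta_1_right[OF assms(1)] by (simp add: Beta_commute)
qed

text \<open>Boundedness everywhere, not up to null sets, gives a class of honest functions closed
  under sums, products and \<open>adj\<close>, and containing every right-hand side \<mu> f(u) with
  \<open>u\<close> in [-\<gamma>,\<gamma>].\<close>

definition bdd_borel :: "(real \<Rightarrow> real) \<Rightarrow> bool" where
  "bdd_borel h \<longleftrightarrow> h \<in> borel_measurable borel \<and> (\<exists>H. \<forall>x. \<bar>h x\<bar> \<le> H)"

lemma bdd_borelD: "bdd_borel h \<Longrightarrow> h \<in> borel_measurable borel"
  by (simp add: bdd_borel_def)

lemma bdd_borelE:
  assumes "bdd_borel h"
  obtains H where "H \<ge> 0" "\<And>x. \<bar>h x\<bar> \<le> H"
proof -
  obtain H where "\<forall>x. \<bar>h x\<bar> \<le> H" using assms by (auto simp: bdd_borel_def)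
  moreover from this have "H \<ge> 0" using abs_ge_zero[of "h 0"] order_trans by blast
  ultimately show ?thesis using that by blast
qed

lemma bdd_borelI: "h \<in> borel_measurable borel \<Longrightarrow> (\<And>x. \<bar>h x\<bar> \<le> H) \<Longrightarrow> bdd_borel h"
  unfolding bdd_borel_def by blast

lemma bdd_borel_const: "bdd_borel (\<lambda>_. c)"
  by (rule bdd_borelI[of _ "\<bar>c\<bar>"]) auto

lemma bdd_borel_add:
  assumes "bdd_borel h" "bdd_borel k" shows "bdd_borel (\<lambda>x. h x + k x)"
proof -
  obtain H where H: "H \<ge> 0" "\<And>x. \<bar>h x\<bar> \<le> H" using bdd_borelE[OF assms(1)] by blast
  obtain H' where H': "H' \<ge> 0" "\<And>x. \<bar>k x\<bar> \<le> H'" using bdd_borelE[OF assms(2)] by blast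
  show ?thesis using bdd_borelD[OF assms(1)] bdd_borelD[OF assms(2)] H H'
    by (intro bdd_borelI[of _ "H + H'"]) (auto intro!: order.trans[OF abs_triangle_ineq] add_mono)
qed

lemma bdd_borel_cmult:
  assumes "bdd_borel h" shows "bdd_borel (\<lambda>x. c * h x)"
proof -
  obtain H where "H \<ge> 0" "\<And>x. \<bar>h x\<bar> \<le> H" using bdd_borelE[OF assms] by blast
  then show ?thesis using bdd_borelD[OF assms]
    by (intro bdd_borelI[of _ "\<bar>c\<bar> * H"]) (auto simp: abs_mult intro!: mult_left_mono)
qed

lemma bdd_borel_mult:
  assumes "bdd_borel h" "bdd_borel k" shows "bdd_borel (\<lambda>x. h x * k x)"
proof -
  obtain H where H: "H \<ge> 0" "\<And>x. \<bar>h x\<bar> \<le> H" using bdd_borelE[OF assms(1)] by blast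
  obtain H' where H': "H' \<ge> 0" "\<And>x. \<bar>k x\<bar> \<le> H'" using bdd_borelE[OF assms(2)] by blast
  show ?thesis using bdd_borelD[OF assms(1)] bdd_borelD[OF assms(2)] H H'
    by (intro bdd_borelI[of _ "H * H'"]) (auto simp: abs_mult intro!: mult_mono)
qed

lemma integrable_bounded_support:
  fixes g :: "real \<Rightarrow> real"
  assumes "g \<in> borel_measurable borel" "\<And>x. \<bar>g x\<bar> \<le> C" "\<And>x. x \<notin> {a<..<b} \<Longrightarrow> g x = 0"
  shows "integrable lborel g" "a \<le> b \<Longrightarrow> \<bar>\<integral>x. g x \<partial>lborel\<bar> \<le> C * (b - a)"
proof -
  have i: "integrable lborel (\<lambda>x. indicator {a<..<b} x *\<^sub>R C :: real)"
    by (rule integrable_scaleR_left) (auto intro!: integrable_real_indicator emeasure_bounded_finite)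
  have b: "\<bar>g x\<bar> \<le> indicator {a<..<b} x *\<^sub>R C" for x
    using assms(2)[of x] assms(3)[of x] by (auto simp: indicator_def)
  show g: "integrable lborel g"
    by (rule Bochner_Integration.integrable_bound[OF i]) (use assms(1) b in \<open>auto intro!: AE_I2 order.trans[OF b]\<close>)
  assume ab: "a \<le> b"
  have "\<bar>\<integral>x. g x \<partial>lborel\<bar> \<le> (\<integral>x. \<bar>g x\<bar> \<partial>lborel)" by (rule integral_abs_bound)
  also have "\<dots> \<le> (\<integral>x. indicator {a<..<b} x *\<^sub>R C \<partial>lborel)"
    by (intro integral_mono integrable_abs g i b)
  also have "\<dots> = C * (b - a)" using ab by simp
  finally show "\<bar>\<integral>x. g x \<partial>lborel\<bar> \<le> C * (b - a)" .
qed

lemma lebesgue_integral_pos: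
  fixes g :: "real \<Rightarrow> real"
  assumes "integrable lborel g" "\<And>z. 0 \<le> g z" "a < b" "\<And>z. a < z \<Longrightarrow> z < b \<Longrightarrow> 0 < g z"
  shows "0 < (\<integral>z. g z \<partial>lborel)"
proof -
  have "(\<integral>z. g z \<partial>lborel) \<noteq> 0"
  proof
    assume "(\<integral>z. g z \<partial>lborel) = 0"
    then have "AE z in lborel. g z = 0" using assms integral_nonneg_eq_0_iff_AE by blast
    then have "AE z in lborel. z \<notin> {a<..<b}"
      by eventually_elim (use assms(4) in \<open>metis greaterThanLessThan_iff less_irrefl\<close>)
    then have "{a<..<b} \<in> null_sets lborel" by (subst AE_iff_null_sets) auto
    then have "emeasure lborel {a<..<b} = 0" by (rule null_setsD1)
    then show False using assms(3) by simp
  qed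
  moreover have "(\<integral>z. g z \<partial>lborel) \<ge> 0" using assms(2) by simp
  ultimately show ?thesis by simp
qed

lemma integrable_Ioo_bounded:
  assumes "g \<in> borel_measurable borel" "\<And>s. a < s \<Longrightarrow> s < b \<Longrightarrow> \<bar>g s\<bar> \<le> C"
  shows "set_integrable lborel {a<..<b} (g :: real \<Rightarrow> real)"
proof (cases "a < b")
  case True
  then have "C \<ge> 0" using assms(2)[of "(a+b)/2"] abs_ge_zero[of "g ((a+b)/2)"] by (simp add: field_simps)
  then show ?thesis unfolding set_integrable_def
    by (intro integrable_bounded_support(1)[where a=a and b=b and C=C]) (use assms in \<open>auto simp: indicator_def\<close>)
qed (simp add: set_integrable_def)

lemma set_integrable_bounded_mult:
  fixes f g :: "real \<Rightarrow> real"
  assumes "set_integrable lborel S f" "g \<in> borel_measurable borel" "f \<in> borel_measurable borel" "S \<in> sets borel" "\<And>x. x \<in> S \<Longrightarrow> \<bar>g x\<bar> \<le> C"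
  shows "set_integrable lborel S (\<lambda>x. g x * f x)"
proof -
  have "set_integrable lborel S (\<lambda>x. \<bar>C\<bar> * f x)" by (rule set_integrable_mult_right[OF assms(1)])
  then show ?thesis
  proof (rule set_integrable_bound)
    have [measurable]: "f \<in> borel_measurable borel" "g \<in> borel_measurable borel" "S \<in> sets borel" by fact+
    show "set_borel_measurable lborel S (\<lambda>x. g x * f x)" unfolding set_borel_measurable_def by measurable
    show "AE x in lborel. x \<in> S \<longrightarrow> norm (g x * f x) \<le> norm (\<bar>C\<bar> * f x)"
      by (rule AE_I2) (auto simp: abs_mult intro!: mult_right_mono order.trans[OF assms(5)])
  qed
qed

lemma set_integrable_abs_powr:
  assumes p: "p > (0::real)" and y: "y \<in> {0<..<T}"
  shows "set_integrable lborel {0<..<T} (\<lambda>s. \<bar>s - y\<bar> powr (p-1))"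
proof -
  let ?f = "\<lambda>s. indicator {0<..<y} s *\<^sub>R (y - s) powr (p-1)" and ?g = "\<lambda>s. indicator {y<..<T} s *\<^sub>R (s - y) powr (p-1)"
  have f: "integrable lborel ?f" 
    using power_integral(1)[OF p, of 0 y] y unfolding set_integrable_def by auto
  have g: "integrable lborel ?g"
    using power_integral(3)[OF p, of y T] y unfolding set_integrable_def by auto
  have eq: "(\<lambda>s. indicator {0<..<T} s *\<^sub>R \<bar>s - y\<bar> powr (p-1)) = (\<lambda>s. ?f s + ?g s)"
    using y by (auto simp: indicator_def fun_eq_iff)
  show ?thesis unfolding set_integrable_def eq using f g by (intro Bochner_Integration.integrable_add)
qed

lemma cauchy_schwarz_integral:
  fixes f g :: "real \<Rightarrow> real"
  assumes [measurable]: "f \<in> borel_measurable borel" "g \<in> borel_measurable borel"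
    and f: "integrable lborel (\<lambda>x. (f x)\<^sup>2)" and g: "integrable lborel (\<lambda>x. (g x)\<^sup>2)"
  shows "integrable lborel (\<lambda>x. f x * g x)"
    "(\<integral>x. f x * g x \<partial>lborel)\<^sup>2 \<le> (\<integral>x. (f x)\<^sup>2 \<partial>lborel) * (\<integral>x. (g x)\<^sup>2 \<partial>lborel)"
proof -
  show fg: "integrable lborel (\<lambda>x. f x * g x)"
  proof (rule Bochner_Integration.integrable_bound[OF Bochner_Integration.integrable_add[OF f g]])
    show "AE x in lborel. norm (f x * g x) \<le> norm ((f x)\<^sup>2 + (g x)\<^sup>2)"
    proof (rule AE_I2)
      fix x
      have "0 \<le> (\<bar>f x\<bar> - \<bar>g x\<bar>)\<^sup>2" by simp
      then have "2 * (\<bar>f x\<bar> * \<bar>g x\<bar>) \<le> (f x)\<^sup>2 + (g x)\<^sup>2" by (simp add: power2_diff)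
      moreover have "0 \<le> \<bar>f x\<bar> * \<bar>g x\<bar>" by simp
      ultimately show "norm (f x * g x) \<le> norm ((f x)\<^sup>2 + (g x)\<^sup>2)" unfolding real_norm_def abs_mult by linarith
    qed
  qed measurable
  let ?P = "\<integral>x. (f x)\<^sup>2 \<partial>lborel" and ?Q = "\<integral>x. (g x)\<^sup>2 \<partial>lborel" and ?R = "\<integral>x. f x * g x \<partial>lborel"
  have quad: "0 \<le> t\<^sup>2 * ?P - 2 * t * ?R + ?Q" for t
  proof -
    have "0 \<le> (\<integral>x. (t * f x - g x)\<^sup>2 \<partial>lborel)" by simp
    also have "(\<lambda>x. (t * f x - g x)\<^sup>2) = (\<lambda>x. (t\<^sup>2 * (f x)\<^sup>2 - (2 * t) * (f x * g x)) + (g x)\<^sup>2)"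
      by (rule ext) (simp add: power2_eq_square algebra_simps)
    also have "(\<integral>x. (t\<^sup>2 * (f x)\<^sup>2 - (2 * t) * (f x * g x)) + (g x)\<^sup>2 \<partial>lborel)
        = (\<integral>x. t\<^sup>2 * (f x)\<^sup>2 - (2 * t) * (f x * g x) \<partial>lborel) + ?Q"
      by (intro Bochner_Integration.integral_add Bochner_Integration.integrable_diff integrable_mult_right f g fg)
    also have "(\<integral>x. t\<^sup>2 * (f x)\<^sup>2 - (2 * t) * (f x * g x) \<partial>lborel)
        = (\<integral>x. t\<^sup>2 * (f x)\<^sup>2 \<partial>lborel) - (\<integral>x. (2 * t) * (f x * g x) \<partial>lborel)"
      by (intro Bochner_Integration.integral_diff integrable_mult_right f fg)
    finally show ?thesis by simp
  qed
  have P0: "?P \<ge> 0" by simp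
  show "?R\<^sup>2 \<le> ?P * ?Q"
  proof (cases "?P = 0")
    case True
    have "?R = 0"
    proof (rule ccontr)
      assume n: "?R \<noteq> 0"
      \<comment> \<open>With \<open>?P = 0\<close> the quadratic form is affine in the parameter,
        and this choice gives it the value -1.\<close>
      have "0 \<le> ((?Q + 1) / (2 * ?R))\<^sup>2 * ?P - 2 * ((?Q + 1) / (2 * ?R)) * ?R + ?Q" by (rule quad)
      then show False using n True by simp
    qed
    then show ?thesis using True by simp
  next
    case False
    \<comment> \<open>The vertex of the parabola, where the nonnegativity is sharpest.\<close>
    have "0 \<le> (?R / ?P)\<^sup>2 * ?P - 2 * (?R / ?P) * ?R + ?Q" by (rule quad)
    also have "\<dots> = ?Q - ?R\<^sup>2 / ?P" using False by (simp add: field_simps power2_eq_square)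
    finally have "?R\<^sup>2 / ?P \<le> ?Q" by simp
    then show ?thesis using False P0 by (simp add: divide_le_eq mult.commute)
  qed
qed

section \<open>The Volterra operator, its adjoint and their product\<close>

locale fractional_dirichlet =
  fixes T \<alpha> :: real
  assumes T: "T > 0" and alpha: "1/2 < \<alpha>" "\<alpha> \<le> 1"
begin

text \<open>Up to the factor \<open>2 |cos (\<pi>\<alpha>)| \<Gamma>(\<alpha>)\<^sup>2\<close>, the inverse of the boundary value operator is \<open>A A\<^sup>*\<close>, where
  \<open>A\<close> is the Volterra operator with kernel \<open>ker\<close>. This comes from the Green function of the fractional
  Laplacian on the half line, whose factors are Riemann--Liouville integrals, by a Moebius
  transformation onto \<open>(0,T)\<close>.\<close>

definition ker :: "real \<Rightarrow> real \<Rightarrow> real" where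
  "ker x z = (if 0 < z \<and> z < x \<and> x < T then (T - x) powr \<alpha> * (x - z) powr (\<alpha> - 1) * (T - z) powr (- \<alpha>) else 0)"

definition adj :: "(real \<Rightarrow> real) \<Rightarrow> real \<Rightarrow> real" where
  "adj h z = (\<integral>y. ker y z * h y \<partial>lborel)"

definition K :: "(real \<Rightarrow> real) \<Rightarrow> real \<Rightarrow> real" where
  "K h x = (\<integral>z. ker x z * adj h z \<partial>lborel)"

text \<open>The kernel of A A*: up to a constant factor, the Green function of the Dirichlet
  problem.\<close>

definition G :: "real \<Rightarrow> real \<Rightarrow> real" where
  "G x y = (\<integral>z. ker x z * ker y z \<partial>lborel)"

lemma ker_nonneg: "0 \<le> ker x z" by (simp add: ker_def)

lemma ker_measurable [measurable]: "(\<lambda>(x,z). ker x z) \<in> borel_measurable (borel \<Otimes>\<^sub>M borel)"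
  unfolding ker_def by measurable

lemma ker_measurable1 [measurable]: "(\<lambda>x. ker x z) \<in> borel_measurable borel"
  "ker x \<in> borel_measurable borel"
proof -
  show "(\<lambda>x. ker x z) \<in> borel_measurable borel"
    using measurable_compose[OF measurable_Pair1'[of z borel borel] ker_measurable]
      measurable_compose[OF measurable_Pair2'[of z borel borel] ker_measurable] by simp
  show "ker x \<in> borel_measurable borel"
    using measurable_compose[OF measurable_Pair1'[of x borel borel] ker_measurable] by simp
qed

text \<open>Since z < x, the quotient (T-x)/(T-z) is at most 1 and the weights drop out: the kernel
  lies below the Riemann-Liouville kernel of order \<alpha>. All size estimates of
  \<open>adj\<close> and \<open>K\<close> rest on this comparison.\<close>

lemma ker_le: "ker x z \<le> (if 0 < z \<and> z < x \<and> x < T then (x - z) powr (\<alpha> - 1) else 0)"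
proof (cases "0 < z \<and> z < x \<and> x < T")
  case True
  have "(T - x) powr \<alpha> * (T - z) powr (-\<alpha>) = ((T - x) / (T - z)) powr \<alpha>"
    using True by (simp add: powr_divide powr_minus_divide)
  also have "\<dots> \<le> 1 powr \<alpha>" using True alpha by (intro powr_mono2) auto
  finally have "(T - x) powr \<alpha> * (T - z) powr (-\<alpha>) * (x - z) powr (\<alpha> - 1) \<le> 1 * (x - z) powr (\<alpha> - 1)"
    by (intro mult_right_mono) auto
  then show ?thesis using True by (simp add: ker_def mult_ac)
qed (auto simp: ker_def)

lemma ker_integral_fst: "integrable lborel (\<lambda>x. ker x z)" "(\<integral>x. ker x z \<partial>lborel) \<le> T powr \<alpha> / \<alpha>"
proof -
  consider "z \<in> {0<..<T}" | "z \<notin> {0<..<T}" by blast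
  then have "integrable lborel (\<lambda>x. ker x z) \<and> (\<integral>x. ker x z \<partial>lborel) \<le> T powr \<alpha> / \<alpha>"
  proof cases
    case 1
    have i: "integrable lborel (\<lambda>x. indicator {z<..<T} x *\<^sub>R (x - z) powr (\<alpha> - 1))"
      using power_integral(3)[of \<alpha> z T] 1 alpha by (auto simp: set_integrable_def)
    have b: "ker x z \<le> indicator {z<..<T} x *\<^sub>R (x - z) powr (\<alpha> - 1)" for x
      using ker_le[of x z] 1 by (auto simp: indicator_def split: if_splits)
    have int: "integrable lborel (\<lambda>x. ker x z)"
      by (rule Bochner_Integration.integrable_bound[OF i]) (use b in \<open>auto simp: ker_nonneg intro!: AE_I2 order.trans[OF b]\<close>)
    have "(\<integral>x. ker x z \<partial>lborel) \<le> (\<integral>x. indicator {z<..<T} x *\<^sub>R (x - z) powr (\<alpha> - 1) \<partial>lborel)"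
      by (rule integral_mono[OF int i b])
    also have "\<dots> = (T - z) powr \<alpha> / \<alpha>"
      using power_integral(4)[of \<alpha> z T] 1 alpha by (auto simp: set_lebesgue_integral_def)
    also have "\<dots> \<le> T powr \<alpha> / \<alpha>" using 1 alpha by (intro divide_right_mono powr_mono2) auto
    finally show ?thesis using int by simp
  next
    case 2
    then have "(\<lambda>x. ker x z) = (\<lambda>x. 0)" by (auto simp: ker_def)
    then show ?thesis using alpha by simp
  qed
  then show "integrable lborel (\<lambda>x. ker x z)" "(\<integral>x. ker x z \<partial>lborel) \<le> T powr \<alpha> / \<alpha>" by auto
qed

lemma ker_integral_snd: "integrable lborel (ker x)" "(\<integral>z. ker x z \<partial>lborel) \<le> T powr \<alpha> / \<alpha>"
proof -
  consider "x \<in> {0<..<T}" | "x \<notin> {0<..<T}" by blast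
  then have "integrable lborel (ker x) \<and> (\<integral>z. ker x z \<partial>lborel) \<le> T powr \<alpha> / \<alpha>"
  proof cases
    case 1
    have i: "integrable lborel (\<lambda>z. indicator {0<..<x} z *\<^sub>R (x - z) powr (\<alpha> - 1))"
      using power_integral(1)[of \<alpha> 0 x] 1 alpha by (auto simp: set_integrable_def)
    have b: "ker x z \<le> indicator {0<..<x} z *\<^sub>R (x - z) powr (\<alpha> - 1)" for z
      using ker_le[of x z] 1 by (auto simp: indicator_def split: if_splits)
    have int: "integrable lborel (ker x)"
      by (rule Bochner_Integration.integrable_bound[OF i]) (use b in \<open>auto simp: ker_nonneg intro!: AE_I2 order.trans[OF b]\<close>)
    have "(\<integral>z. ker x z \<partial>lborel) \<le> (\<integral>z. indicator {0<..<x} z *\<^sub>R (x - z) powr (\<alpha> - 1) \<partial>lborel)"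
      by (rule integral_mono[OF int i b])
    also have "\<dots> = x powr \<alpha> / \<alpha>"
      using power_integral(2)[of \<alpha> 0 x] 1 alpha by (auto simp: set_lebesgue_integral_def)
    also have "\<dots> \<le> T powr \<alpha> / \<alpha>" using 1 alpha by (intro divide_right_mono powr_mono2) auto
    finally show ?thesis using int by simp
  next
    case 2
    then have "ker x = (\<lambda>z. 0)" by (auto simp: ker_def)
    then show ?thesis using alpha by simp
  qed
  then show "integrable lborel (ker x)" "(\<integral>z. ker x z \<partial>lborel) \<le> T powr \<alpha> / \<alpha>" by auto
qed

text \<open>Square integrability of the comparison kernel is what \<alpha> > 1/2 provides.
  Multiplied by \<open>2 * c0 * T\<close>, this bound is \<open>kappa \<alpha> T\<close>; no loss
  occurs elsewhere in the embedding constant.\<close>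

lemma ker_sq_integral:
  "integrable lborel (\<lambda>z. (ker x z)\<^sup>2)" "(\<integral>z. (ker x z)\<^sup>2 \<partial>lborel) \<le> T powr (2*\<alpha>-1) / (2*\<alpha>-1)"
proof -
  consider "x \<in> {0<..<T}" | "x \<notin> {0<..<T}" by blast
  then have "integrable lborel (\<lambda>z. (ker x z)\<^sup>2) \<and> (\<integral>z. (ker x z)\<^sup>2 \<partial>lborel) \<le> T powr (2*\<alpha>-1) / (2*\<alpha>-1)"
  proof cases
    case 1
    have i: "integrable lborel (\<lambda>z. indicator {0<..<x} z *\<^sub>R (x - z) powr ((2*\<alpha>-1) - 1))"
      using power_integral(1)[of "2*\<alpha>-1" 0 x] 1 alpha by (auto simp: set_integrable_def)
    have b: "(ker x z)\<^sup>2 \<le> indicator {0<..<x} z *\<^sub>R (x - z) powr ((2*\<alpha>-1) - 1)" for z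
    proof (cases "z \<in> {0<..<x}")
      case True
      then have "(ker x z)\<^sup>2 \<le> ((x - z) powr (\<alpha> - 1))\<^sup>2"
        using ker_le[of x z] 1 by (intro power_mono) (auto simp: ker_nonneg)
      also have "\<dots> = (x - z) powr ((2*\<alpha>-1) - 1)"
        using True by (simp add: powr_power algebra_simps)
      finally show ?thesis using True by simp
    qed (auto simp: ker_def)
    have int: "integrable lborel (\<lambda>z. (ker x z)\<^sup>2)"
      by (rule Bochner_Integration.integrable_bound[OF i]) (use b in \<open>auto simp: ker_nonneg intro!: AE_I2 order.trans[OF b]\<close>)
    have "(\<integral>z. (ker x z)\<^sup>2 \<partial>lborel) \<le> (\<integral>z. indicator {0<..<x} z *\<^sub>R (x - z) powr ((2*\<alpha>-1) - 1) \<partial>lborel)"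
      by (rule integral_mono[OF int i b])
    also have "\<dots> = x powr (2*\<alpha>-1) / (2*\<alpha>-1)"
      using power_integral(2)[of "2*\<alpha>-1" 0 x] 1 alpha by (auto simp: set_lebesgue_integral_def)
    also have "\<dots> \<le> T powr (2*\<alpha>-1) / (2*\<alpha>-1)" using 1 alpha by (intro divide_right_mono powr_mono2) auto
    finally show ?thesis using int by simp
  next
    case 2
    then have "(\<lambda>z. (ker x z)\<^sup>2) = (\<lambda>z. 0)" by (auto simp: ker_def)
    then show ?thesis using alpha by simp
  qed
  then show "integrable lborel (\<lambda>z. (ker x z)\<^sup>2)" "(\<integral>z. (ker x z)\<^sup>2 \<partial>lborel) \<le> T powr (2*\<alpha>-1) / (2*\<alpha>-1)" by auto
qed

lemma integrable_ker_mult: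
  assumes "bdd_borel h"
  shows "integrable lborel (\<lambda>x. ker x z * h x)" "integrable lborel (\<lambda>z. ker x z * h z)"
    "\<And>H. H \<ge> 0 \<Longrightarrow> (\<And>x. \<bar>h x\<bar> \<le> H) \<Longrightarrow> \<bar>\<integral>x. ker x z * h x \<partial>lborel\<bar> \<le> H * (T powr \<alpha> / \<alpha>)"
    "\<And>H. H \<ge> 0 \<Longrightarrow> (\<And>x. \<bar>h x\<bar> \<le> H) \<Longrightarrow> \<bar>\<integral>z. ker x z * h z \<partial>lborel\<bar> \<le> H * (T powr \<alpha> / \<alpha>)"
proof -
  note [measurable] = bdd_borelD[OF assms]
  have b1: "\<bar>ker x z * h x\<bar> \<le> H * ker x z" and b2: "\<bar>ker x z * h z\<bar> \<le> H * ker x z"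
    if "H \<ge> 0" "\<And>x. \<bar>h x\<bar> \<le> H" for H x z
    using that(2)[of x] that(2)[of z] ker_nonneg[of x z] mult_left_mono[OF that(2) ker_nonneg] by (simp_all add: abs_mult mult_ac)
  obtain H0 where H0: "H0 \<ge> 0" "\<And>x. \<bar>h x\<bar> \<le> H0" using bdd_borelE[OF assms] by blast
  show i1: "integrable lborel (\<lambda>x. ker x z * h x)"
  proof (rule Bochner_Integration.integrable_bound[OF integrable_mult_right[OF ker_integral_fst(1)[of z], of H0]])
    show "AE x in lborel. norm (ker x z * h x) \<le> norm (H0 * ker x z)"
      using b1[OF H0] H0(1) ker_nonneg by (intro AE_I2) (simp add: abs_mult)
  qed simp
  show i2: "integrable lborel (\<lambda>z. ker x z * h z)"
  proof (rule Bochner_Integration.integrable_bound[OF integrable_mult_right[OF ker_integral_snd(1)[of x], of H0]])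
    show "AE z in lborel. norm (ker x z * h z) \<le> norm (H0 * ker x z)"
      using b2[OF H0] H0(1) ker_nonneg by (intro AE_I2) (simp add: abs_mult)
  qed simp
  fix H :: real assume H: "H \<ge> 0" "\<And>x. \<bar>h x\<bar> \<le> H"
  have "\<bar>\<integral>x. ker x z * h x \<partial>lborel\<bar> \<le> (\<integral>x. \<bar>ker x z * h x\<bar> \<partial>lborel)" by (rule integral_abs_bound)
  also have "\<dots> \<le> (\<integral>x. H * ker x z \<partial>lborel)"
    by (intro integral_mono integrable_abs i1 integrable_mult_right ker_integral_fst b1 H)
  also have "\<dots> \<le> H * (T powr \<alpha> / \<alpha>)" using mult_left_mono[OF ker_integral_fst(2)[of z] H(1)] by simp
  finally show "\<bar>\<integral>x. ker x z * h x \<partial>lborel\<bar> \<le> H * (T powr \<alpha> / \<alpha>)" .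
  have "\<bar>\<integral>z. ker x z * h z \<partial>lborel\<bar> \<le> (\<integral>z. \<bar>ker x z * h z\<bar> \<partial>lborel)" by (rule integral_abs_bound)
  also have "\<dots> \<le> (\<integral>z. H * ker x z \<partial>lborel)"
    by (intro integral_mono integrable_abs i2 integrable_mult_right ker_integral_snd b2 H)
  also have "\<dots> \<le> H * (T powr \<alpha> / \<alpha>)" using mult_left_mono[OF ker_integral_snd(2)[of x] H(1)] by simp
  finally show "\<bar>\<integral>z. ker x z * h z \<partial>lborel\<bar> \<le> H * (T powr \<alpha> / \<alpha>)" .
qed

lemma adj_outside: "z \<notin> {0<..<T} \<Longrightarrow> adj h z = 0"
proof -
  assume "z \<notin> {0<..<T}"
  then have "(\<lambda>y. ker y z * h y) = (\<lambda>y. 0)" by (auto simp: ker_def)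
  then show ?thesis unfolding adj_def by simp
qed

lemma K_outside: "x \<notin> {0<..<T} \<Longrightarrow> K h x = 0"
proof -
  assume "x \<notin> {0<..<T}"
  then have "(\<lambda>z. ker x z * adj h z) = (\<lambda>y. 0)" by (auto simp: ker_def)
  then show ?thesis unfolding K_def by simp
qed

lemma adj_measurable [measurable]:
  assumes [measurable]: "h \<in> borel_measurable borel" shows "adj h \<in> borel_measurable borel"
  unfolding adj_def by measurable

lemma K_measurable [measurable]:
  assumes [measurable]: "h \<in> borel_measurable borel" shows "K h \<in> borel_measurable borel"
  unfolding K_def by measurable

lemma adj_bound:
  assumes "bdd_borel h" "H \<ge> 0" "\<And>x. \<bar>h x\<bar> \<le> H"
  shows "\<bar>adj h z\<bar> \<le> H * (T powr \<alpha> / \<alpha>)"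
  unfolding adj_def using integrable_ker_mult(3)[OF assms] .

lemma bdd_borel_adj:
  assumes "bdd_borel h" shows "bdd_borel (adj h)"
proof -
  note [measurable] = bdd_borelD[OF assms]
  obtain H where H: "H \<ge> 0" "\<And>x. \<bar>h x\<bar> \<le> H" using bdd_borelE[OF assms] by blast
  show ?thesis by (rule bdd_borelI[OF _ adj_bound[OF assms H]]) measurable
qed

lemma K_bound:
  assumes "bdd_borel h" "H \<ge> 0" "\<And>x. \<bar>h x\<bar> \<le> H"
  shows "\<bar>K h x\<bar> \<le> H * (T powr \<alpha> / \<alpha>)\<^sup>2"
proof -
  have "\<bar>K h x\<bar> \<le> H * (T powr \<alpha> / \<alpha>) * (T powr \<alpha> / \<alpha>)"
    unfolding K_def using assms alpha
    by (intro integrable_ker_mult(4) bdd_borel_adj adj_bound) auto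
  then show ?thesis by (simp add: power2_eq_square mult_ac)
qed

lemma adj_linear:
  assumes "bdd_borel h" "bdd_borel k"
  shows "adj (\<lambda>x. h x + c * k x) z = adj h z + c * adj k z"
proof -
  have "adj (\<lambda>x. h x + c * k x) z = (\<integral>y. ker y z * h y + c * (ker y z * k y) \<partial>lborel)"
    unfolding adj_def by (simp add: algebra_simps)
  also have "\<dots> = adj h z + c * adj k z"
    unfolding adj_def by (subst Bochner_Integration.integral_add) (auto intro!: integrable_ker_mult assms)
  finally show ?thesis .
qed

lemma K_linear:
  assumes "bdd_borel h" "bdd_borel k"
  shows "K (\<lambda>x. h x + c * k x) x = K h x + c * K k x"
proof -
  have "K (\<lambda>x. h x + c * k x) x = (\<integral>z. ker x z * adj h z + c * (ker x z * adj k z) \<partial>lborel)"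
    unfolding K_def by (simp add: algebra_simps adj_linear[OF assms])
  also have "\<dots> = K h x + c * K k x"
    unfolding K_def by (subst Bochner_Integration.integral_add) (auto intro!: integrable_ker_mult assms bdd_borel_adj)
  finally show ?thesis .
qed

text \<open>Fubini for \<open>ker x z * adj h z * k x\<close>. Symmetry and positivity of
  \<open>K\<close> are contained in this formula; it also lets the first variation of the action, an
  integral of \<open>K h\<close> against a bounded function, be read as an energy pairing.\<close>

lemma K_form:
  assumes h: "bdd_borel h" and k: "bdd_borel k"
  shows "(\<integral>x. K h x * k x \<partial>lborel) = (\<integral>z. adj h z * adj k z \<partial>lborel)"
proof -
  note [measurable] = bdd_borelD[OF h] bdd_borelD[OF k]
  obtain A where A: "A \<ge> 0" "\<And>x. \<bar>adj h x\<bar> \<le> A" using bdd_borelE[OF bdd_borel_adj[OF h]] by blast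
  obtain B where B: "B \<ge> 0" "\<And>x. \<bar>k x\<bar> \<le> B" using bdd_borelE[OF k] by blast
  define f where "f x z = ker x z * adj h z * k x" for x z
  have meas: "(\<lambda>(x,z). f x z) \<in> borel_measurable (borel \<Otimes>\<^sub>M borel)"
    unfolding f_def by measurable
  have inner: "integrable lborel (f x)" for x
    unfolding f_def by (intro integrable_mult_left integrable_ker_mult bdd_borel_adj h)
  have aeq: "(\<integral>z. \<bar>f x z\<bar> \<partial>lborel) = (\<integral>z. ker x z * \<bar>adj h z\<bar> \<partial>lborel) * \<bar>k x\<bar>" for x
    unfolding f_def by (simp add: abs_mult ker_nonneg)
  have ba: "bdd_borel (\<lambda>z. \<bar>adj h z\<bar>)" by (rule bdd_borelI[of _ A]) (use A in auto)
  have aout: "\<bar>\<integral>z. \<bar>f x z\<bar> \<partial>lborel\<bar> \<le> A * (T powr \<alpha> / \<alpha>) * B" for x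
    unfolding aeq abs_mult
    by (intro mult_mono) (use A B integrable_ker_mult(4)[OF ba A(1)] alpha in auto)
  have outer: "integrable lborel (\<lambda>x. \<integral>z. \<bar>f x z\<bar> \<partial>lborel)"
  proof (rule integrable_bounded_support(1)[where a=0 and b=T and C="A * (T powr \<alpha> / \<alpha>) * B"])
    show "\<bar>\<integral>z. \<bar>f x z\<bar> \<partial>lborel\<bar> \<le> A * (T powr \<alpha> / \<alpha>) * B" for x by (rule aout)
    show "(\<lambda>x. \<integral>z. \<bar>f x z\<bar> \<partial>lborel) \<in> borel_measurable borel"
      unfolding f_def by measurable
    show "(\<integral>z. \<bar>f x z\<bar> \<partial>lborel) = 0" if "x \<notin> {0<..<T}" for x
    proof -
      have "(\<lambda>z. \<bar>f x z\<bar>) = (\<lambda>z. 0)" using that by (auto simp: f_def ker_def)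
      then show ?thesis by simp
    qed
  qed
  have "(\<integral>z. (\<integral>x. f x z \<partial>lborel) \<partial>lborel) = (\<integral>x. (\<integral>z. f x z \<partial>lborel) \<partial>lborel)"
    by (rule fubini_lborel(1)[OF meas _ outer]) (use inner in auto)
  moreover have "(\<integral>z. f x z \<partial>lborel) = K h x * k x" for x
    unfolding f_def K_def by simp
  moreover have "(\<integral>x. f x z \<partial>lborel) = adj h z * adj k z" for z
  proof -
    have "(\<lambda>x. f x z) = (\<lambda>x. adj h z * (ker x z * k x))" by (auto simp: f_def)
    then show ?thesis by (simp add: adj_def)
  qed
  ultimately show ?thesis by simp
qed

lemma integrable_adj_mult:
  assumes "bdd_borel h" "bdd_borel k"
  shows "integrable lborel (\<lambda>z. adj h z * adj k z)"
proof -
  have b: "bdd_borel (\<lambda>z. adj h z * adj k z)" by (intro bdd_borel_mult bdd_borel_adj assms)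
  show ?thesis
    by (rule bdd_borelE[OF b], rule integrable_bounded_support(1)[OF bdd_borelD[OF b], of _ 0 T])
      (auto simp: adj_outside)
qed

text \<open>\<open>K h x\<close> is the scalar product of \<open>ker x\<close> with
  \<open>adj h\<close>. The last integral is the energy up to a factor, so this is the embedding of
  the energy space into bounded functions.\<close>

lemma K_cauchy_schwarz:
  assumes h: "bdd_borel h"
  shows "(K h x)\<^sup>2 \<le> T powr (2*\<alpha>-1) / (2*\<alpha>-1) * (\<integral>z. (adj h z)\<^sup>2 \<partial>lborel)"
proof -
  have "integrable lborel (\<lambda>z. (adj h z)\<^sup>2)" using integrable_adj_mult[OF h h] by (simp add: power2_eq_square)
  then have "(K h x)\<^sup>2 \<le> (\<integral>z. (ker x z)\<^sup>2 \<partial>lborel) * (\<integral>z. (adj h z)\<^sup>2 \<partial>lborel)"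
    unfolding K_def by (intro cauchy_schwarz_integral(2) ker_measurable1 bdd_borelD[OF bdd_borel_adj[OF h]] ker_sq_integral(1))
  also have "\<dots> \<le> T powr (2*\<alpha>-1) / (2*\<alpha>-1) * (\<integral>z. (adj h z)\<^sup>2 \<partial>lborel)"
    by (rule mult_right_mono[OF ker_sq_integral(2)]) simp
  finally show ?thesis .
qed

lemma K_eq_G:
  assumes h: "bdd_borel h"
  shows "K h x = (\<integral>y. G x y * h y \<partial>lborel)"
proof -
  note [measurable] = bdd_borelD[OF h]
  obtain H where H: "H \<ge> 0" "\<And>x. \<bar>h x\<bar> \<le> H" using bdd_borelE[OF h] by blast
  define f where "f z y = ker x z * ker y z * h y" for z y
  have meas: "(\<lambda>(z,y). f z y) \<in> borel_measurable (borel \<Otimes>\<^sub>M borel)"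
    unfolding f_def by measurable
  have inner: "integrable lborel (f z)" for z
    using integrable_mult_right[OF integrable_ker_mult(1)[OF h, of z], of "ker x z"] by (simp add: f_def[abs_def] mult.assoc)
  have ba: "bdd_borel (\<lambda>z. \<bar>h z\<bar>)" by (rule bdd_borelI[of _ H]) (use H in auto)
  have aeq: "(\<integral>y. \<bar>f z y\<bar> \<partial>lborel) = ker x z * adj (\<lambda>y. \<bar>h y\<bar>) z" for z
  proof -
    have "(\<lambda>y. \<bar>f z y\<bar>) = (\<lambda>y. ker x z * (ker y z * \<bar>h y\<bar>))" by (auto simp: f_def abs_mult ker_nonneg mult.assoc)
    then show ?thesis by (simp add: adj_def)
  qed
  have outer: "integrable lborel (\<lambda>z. \<integral>y. \<bar>f z y\<bar> \<partial>lborel)"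
    unfolding aeq by (intro integrable_ker_mult bdd_borel_adj ba)
  have "(\<integral>y. (\<integral>z. f z y \<partial>lborel) \<partial>lborel) = (\<integral>z. (\<integral>y. f z y \<partial>lborel) \<partial>lborel)"
    by (rule fubini_lborel(1)[OF meas _ outer]) (use inner in auto)
  moreover have "(\<integral>z. f z y \<partial>lborel) = G x y * h y" for y
    unfolding f_def G_def by simp
  moreover have "(\<integral>y. f z y \<partial>lborel) = ker x z * adj h z" for z
  proof -
    have "f z = (\<lambda>y. ker x z * (ker y z * h y))" by (auto simp: f_def)
    then show ?thesis by (simp add: adj_def)
  qed
  ultimately show ?thesis by (simp add: K_def)
qed

text \<open>Both kernels are positive on the relevant triangle. \<open>K\<close> of a constant
  serves as the strictly positive test function when the zero solution is excluded.\<close>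

lemma K_one_pos:
  assumes x: "x \<in> {0<..<T}"
  shows "K (\<lambda>_. 1) x > 0"
proof -
  have kp: "ker y z > 0" if "0 < z" "z < y" "y < T" for y z using that by (simp add: ker_def)
  have a0: "adj (\<lambda>_. 1) z \<ge> 0" for z unfolding adj_def by (simp add: ker_nonneg)
  have ap: "adj (\<lambda>_. 1) z > 0" if "0 < z" "z < T" for z
    unfolding adj_def by (rule lebesgue_integral_pos[of _ z T]) (use that kp in \<open>auto simp: ker_nonneg ker_integral_fst\<close>)
  show ?thesis unfolding K_def
    by (rule lebesgue_integral_pos[of _ 0 x]) (use x kp ap a0 in \<open>auto simp: ker_nonneg intro!: integrable_ker_mult bdd_borel_adj bdd_borel_const\<close>)
qed

end

section \<open>The Green function\<close>

text \<open>Writing each positive quantity as an exponential reduces a product of powers to a linear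
  identity between exponents. The three instances are the substitution in the Green integral, the
  regular part of its derivative, and the algebraic part of its value.\<close>

lemma powr_product_identities:
  assumes pos: "A > 0" "B > 0" "C > 0" "D > 0" "E > 0" "F > (0::real)"
  shows "D powr (2*a-1) * (A*B/(C*D)) powr (a-1) * (E*F/(C*D)) powr (a-1) * (B*F/(C\<^sup>2*D))
      = F powr a * A powr (a-1) * C powr (-a) * (B powr a * E powr (a-1) * C powr (-a))" (is ?A)
    and "D powr (2*a-2) * (A*B/(C*D)) powr (a-1) * (E*F/(C*D)) powr (a-1) * (B/C)
      = C powr (1-2*a) * B powr a * E powr (a-1) * (A*F) powr (a-1)" (is ?B)
    and "D powr (2*a-1) * (A*B/(C*D)) powr a * (E*F/(C*D)) powr (a-1)
      = C powr (1-2*a) * (A*B) powr a * (E*F) powr (a-1)" (is ?C)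
proof -
  have "\<exists>x. y = exp x" if "y > 0" for y :: real using that exp_ln by metis
  then obtain x1 x2 x3 x4 x5 x6 where [simp]: "A = exp x1" "B = exp x2" "C = exp x3" "D = exp x4" "E = exp x5" "F = exp x6"
    using pos by metis
  show ?A by (simp add: powr_def exp_add[symmetric] exp_diff[symmetric] power2_eq_square) (simp add: algebra_simps)
  show ?B by (simp add: powr_def exp_add[symmetric] exp_diff[symmetric] power2_eq_square) (simp add: algebra_simps)
  show ?C by (simp add: powr_def exp_add[symmetric] exp_diff[symmetric] power2_eq_square) (simp add: algebra_simps)
qed

context fractional_dirichlet
begin

definition Theta :: "real \<Rightarrow> real" where
  "Theta r = (LINT w:{0<..<r}|lborel. w powr (\<alpha>-1) * (1+w) powr (\<alpha>-2))"

lemma Theta_integrable: "set_integrable lborel {0<..<r} (\<lambda>w. w powr (\<alpha>-1) * (1+w) powr (\<alpha>-2))"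
proof (cases "r > 0")
  case True
  have i: "set_integrable lborel {0<..<r} (\<lambda>w. w powr (\<alpha>-1))"
    using power_integral(3)[of \<alpha> 0 r] True alpha by simp
  have "\<bar>w powr (\<alpha>-1) * (1+w) powr (\<alpha>-2)\<bar> \<le> w powr (\<alpha>-1)" if "w > 0" for w :: real
  proof -
    have "(1+w) powr (\<alpha>-2) \<le> 1" using that alpha powr_mono[of "\<alpha>-2" 0 "1+w"] by simp
    then show ?thesis using mult_left_mono[of "(1+w) powr (\<alpha>-2)" 1 "w powr (\<alpha>-1)"] by (simp add: abs_mult)
  qed
  then show ?thesis
    by (intro set_integrable_bound[OF i]) (auto simp: set_borel_measurable_def)
qed (simp add: set_integrable_def)

lemma Theta_nonpos: "r \<le> 0 \<Longrightarrow> Theta r = 0"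
  by (simp add: Theta_def set_lebesgue_integral_def)

lemma Theta_nonneg: "Theta r \<ge> 0"
  unfolding Theta_def set_lebesgue_integral_def by (intro Bochner_Integration.integral_nonneg) (auto simp: indicator_def)

lemma Theta_measurable [measurable]: "Theta \<in> borel_measurable borel"
proof -
  have "(\<lambda>r. \<integral>w. (if 0 < w \<and> w < r then w powr (\<alpha>-1) * (1+w) powr (\<alpha>-2) else 0) \<partial>lborel) \<in> borel_measurable borel"
    by measurable
  moreover have "Theta = (\<lambda>r. \<integral>w. (if 0 < w \<and> w < r then w powr (\<alpha>-1) * (1+w) powr (\<alpha>-2) else 0) \<partial>lborel)"
    unfolding Theta_def set_lebesgue_integral_def by (intro ext Bochner_Integration.integral_cong) auto
  ultimately show ?thesis by simp
qed

lemma DERIV_Theta: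
  assumes "r > 0" shows "(Theta has_real_derivative r powr (\<alpha>-1) * (1+r) powr (\<alpha>-2)) (at r)"
  unfolding Theta_def[abs_def]
  by (rule DERIV_indefinite_integral[where T="r+1"])
    (use assms in \<open>auto intro!: Theta_integrable continuous_intros\<close>)

lemma Theta_le: "r \<ge> 0 \<Longrightarrow> Theta r \<le> r powr \<alpha> / \<alpha>"
proof (cases "r > 0")
  case True
  have "Theta r \<le> (LINT w:{0<..<r}|lborel. w powr (\<alpha>-1))" unfolding Theta_def
  proof (rule set_integral_mono[OF Theta_integrable])
    show "set_integrable lborel {0<..<r} (\<lambda>w. w powr (\<alpha>-1))"
      using power_integral(3)[of \<alpha> 0 r] True alpha by simp
    fix w :: real assume "w \<in> {0<..<r}"
    then have "(1+w) powr (\<alpha>-2) \<le> 1" using alpha powr_mono[of "\<alpha>-2" 0 "1+w"] by simp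
    then show "w powr (\<alpha>-1) * (1+w) powr (\<alpha>-2) \<le> w powr (\<alpha>-1)"
      using mult_left_mono[of "(1+w) powr (\<alpha>-2)" 1 "w powr (\<alpha>-1)"] by simp
  qed
  then show ?thesis using power_integral(4)[of \<alpha> 0 r] True alpha by simp
qed (use alpha in \<open>simp add: Theta_nonpos\<close>)

lemma continuous_on_Theta: "continuous_on {0..} Theta"
  unfolding continuous_on_eq_continuous_within
proof
  fix x :: real assume x: "x \<in> {0..}"
  show "continuous (at x within {0..}) Theta"
  proof (cases "x = 0")
    case False
    then show ?thesis using x DERIV_isCont[OF DERIV_Theta[of x]] continuous_at_imp_continuous_at_within by auto
  next
    case True
    have "continuous_on {0..} (\<lambda>r::real. r powr \<alpha> / \<alpha>)"
      using alpha by (intro continuous_intros continuous_on_powr') auto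
    then have "((\<lambda>r. r powr \<alpha> / \<alpha>) \<longlongrightarrow> 0 powr \<alpha> / \<alpha>) (at 0 within {0..})"
      unfolding continuous_on_def by (rule bspec) simp
    then have l: "((\<lambda>r. r powr \<alpha> / \<alpha>) \<longlongrightarrow> 0) (at 0 within {0..})" by simp
    have "(Theta \<longlongrightarrow> 0) (at 0 within {0..})"
      by (rule tendsto_sandwich[OF _ _ tendsto_const l]) (auto simp: eventually_at_filter Theta_nonneg Theta_le)
    then show ?thesis using True by (simp add: continuous_within Theta_nonpos)
  qed
qed

text \<open>The integrand decays like the power 2\<alpha>-3, so the integral over (1,\<infinity>)
  has order 1/(2-2\<alpha>). Keeping the factor 1-\<alpha> makes the bound uniform and covers
  \<alpha> = 1, where \<open>Theta r\<close> is ln (1+r).\<close>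

lemma Theta_bound: "(1 - \<alpha>) * Theta r \<le> 2"
proof -
  have one: "(1 - \<alpha>) * Theta r \<le> 1" if "0 \<le> r" "r \<le> 1" for r
  proof -
    have "Theta r \<le> r powr \<alpha> / \<alpha>" by (rule Theta_le[OF that(1)])
    also have "\<dots> \<le> 1 / \<alpha>" using alpha that powr_le1[of \<alpha> r] by (intro divide_right_mono) auto
    finally have "(1 - \<alpha>) * Theta r \<le> (1 - \<alpha>) * (1 / \<alpha>)" using alpha by (intro mult_left_mono) auto
    also have "\<dots> \<le> 1" using alpha by (simp add: field_simps)
    finally show ?thesis .
  qed
  consider "r \<le> 0" | "0 \<le> r" "r \<le> 1" | "\<alpha> = 1" | "r > 1" "\<alpha> < 1" using alpha by linarith
  then show ?thesis
  proof cases
    case 4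
    \<comment> \<open>The added term has derivative \<open>- x powr (2*\<alpha>-3)\<close>, which
      outweighs the derivative of \<open>Theta\<close>; hence \<open>f\<close> decreases on
      [1,r].\<close>
    define f where "f x = Theta x + x powr (2*\<alpha>-2) / (2-2*\<alpha>)" for x
    have "f r \<le> f 1"
    proof (rule DERIV_nonpos_imp_nonincreasing[of 1 r f])
      fix x :: real assume x: "1 \<le> x" "x \<le> r"
      have "(f has_real_derivative x powr (\<alpha>-1) * (1+x) powr (\<alpha>-2) + ((2*\<alpha>-2) * x powr (2*\<alpha>-2-1)) / (2-2*\<alpha>)) (at x)"
        unfolding f_def[abs_def] using x by (intro DERIV_add DERIV_Theta DERIV_cdivide has_real_derivative_powr) auto
      moreover have "((2*\<alpha>-2) * x powr (2*\<alpha>-2-1)) / (2-2*\<alpha>) = - (x powr (2*\<alpha>-2-1))"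
        using 4 by (simp add: field_simps)
      moreover have "x powr (\<alpha>-1) * (1+x) powr (\<alpha>-2) \<le> x powr (2*\<alpha>-2-1)"
      proof -
        have "(1+x) powr (\<alpha>-2) \<le> x powr (\<alpha>-2)" using x alpha by (intro powr_mono2') auto
        then have "x powr (\<alpha>-1) * (1+x) powr (\<alpha>-2) \<le> x powr (\<alpha>-1) * x powr (\<alpha>-2)" by (rule mult_left_mono) simp
        also have "\<dots> = x powr (2*\<alpha>-2-1)" by (simp add: powr_add[symmetric] algebra_simps)
        finally show ?thesis .
      qed
      ultimately show "\<exists>y. (f has_real_derivative y) (at x) \<and> y \<le> 0" by (intro exI conjI) auto
    qed (use 4 in simp)
    then have "Theta r + r powr (2*\<alpha>-2) / (2-2*\<alpha>) \<le> Theta 1 + 1 / (2-2*\<alpha>)" by (simp add: f_def)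
    moreover have "0 \<le> r powr (2*\<alpha>-2) / (2-2*\<alpha>)" using 4 by simp
    ultimately have "Theta r \<le> Theta 1 + 1 / (2-2*\<alpha>)" by linarith
    then have "(1 - \<alpha>) * Theta r \<le> (1 - \<alpha>) * (Theta 1 + 1 / (2-2*\<alpha>))" using 4 by (intro mult_left_mono) auto
    also have "\<dots> = (1 - \<alpha>) * Theta 1 + 1/2" using 4 by (simp add: field_simps)
    finally show ?thesis using one[of 1] by simp
  qed (use one[of r] in \<open>auto simp: Theta_nonpos\<close>)
qed

text \<open>The primitive of (r(1+r)) to the power \<alpha>-1 that vanishes at 0, after an
  integration by parts. The closed term carries the full growth of order 2\<alpha>-1 at infinity,
  and the remaining multiple of \<open>Theta\<close> is bounded; this separates the regular part of
  the Green function from its behaviour on the diagonal.\<close>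

definition Psi :: "real \<Rightarrow> real" where
  "Psi r = (r powr \<alpha> * (1+r) powr (\<alpha>-1) - (1-\<alpha>) * Theta r) / (2*\<alpha>-1)"

lemma DERIV_Psi:
  assumes r: "r > 0" shows "(Psi has_real_derivative r powr (\<alpha>-1) * (1+r) powr (\<alpha>-1)) (at r)"
proof -
  have 1: "((\<lambda>r. (r powr \<alpha> * (1+r) powr (\<alpha>-1) - (1-\<alpha>) * Theta r) / (2*\<alpha>-1)) has_real_derivative
     (((\<alpha> * r powr (\<alpha>-1)) * (1+r) powr (\<alpha>-1) + ((\<alpha>-1) * (1+r) powr (\<alpha>-1-1) * (0+1)) * r powr \<alpha>)
       - (1-\<alpha>) * (r powr (\<alpha>-1) * (1+r) powr (\<alpha>-2))) / (2*\<alpha>-1)) (at r)"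
    using r by (intro DERIV_cdivide DERIV_diff DERIV_cmult DERIV_Theta DERIV_mult has_real_derivative_powr
        DERIV_chain'[where f="\<lambda>r. 1+r" and g="\<lambda>r. r powr (\<alpha>-1)"] DERIV_add DERIV_const DERIV_ident) auto
  have e1: "r powr \<alpha> = r * r powr (\<alpha>-1)" using powr_mult_base[of r "\<alpha>-1"] r by simp
  have e2: "(1+r) powr (\<alpha>-1) = (1+r) * (1+r) powr (\<alpha>-2)" using powr_mult_base[of "1+r" "\<alpha>-2"] r by simp
  have e3: "(1+r) powr (\<alpha>-1-1) = (1+r) powr (\<alpha>-2)" by simp
  define P Q where "P = r powr (\<alpha>-1)" and "Q = (1+r) powr (\<alpha>-2)"
  have "((\<alpha> * P) * ((1+r) * Q) + ((\<alpha>-1) * Q * (0+1)) * (r * P)) - (1-\<alpha>) * (P * Q) = (2*\<alpha>-1) * (P * ((1+r) * Q))"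
    by (simp add: algebra_simps)
  then have "(((\<alpha> * r powr (\<alpha>-1)) * (1+r) powr (\<alpha>-1) + ((\<alpha>-1) * (1+r) powr (\<alpha>-1-1) * (0+1)) * r powr \<alpha>)
       - (1-\<alpha>) * (r powr (\<alpha>-1) * (1+r) powr (\<alpha>-2))) / (2*\<alpha>-1) = r powr (\<alpha>-1) * (1+r) powr (\<alpha>-1)"
    unfolding e3 e1 e2 P_def[symmetric] Q_def[symmetric] using alpha by (simp add: field_simps)
  with 1 show ?thesis unfolding Psi_def[abs_def] by simp
qed

lemma continuous_on_Psi: "continuous_on {0..} Psi"
  unfolding Psi_def[abs_def] using alpha
  by (intro continuous_intros continuous_on_Theta continuous_on_powr') auto

lemma Psi_0: "Psi 0 = 0" by (simp add: Psi_def Theta_nonpos)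

text \<open>The cross ratio of 0, x, y, T. The quantity 4 \<rho> (1 + \<rho>) is the upper limit in
  Boggio's formula for the ball of radius T/2, and \<open>Psi\<close> is Boggio's integral in the
  variable w obtained from 4w(1+w), up to a constant.\<close>

definition rho :: "real \<Rightarrow> real \<Rightarrow> real" where "rho x y = x * (T - y) / (T * (y - x))"

lemma one_plus_rho: "x < y \<Longrightarrow> 1 + rho x y = y * (T - x) / (T * (y - x))"
  using T by (simp add: rho_def field_simps)

text \<open>The Moebius substitution \<open>?w\<close> maps (0,x) decreasingly onto (0,
  \<open>rho x y\<close>), and under it the product of the two kernels becomes (w(1+w)) to the power
  \<alpha>-1 times a power of y-x. The decrease accounts for the minus sign in the primitive
  \<open>?P\<close>.\<close>

lemma G_eq_Psi:
  assumes xy: "0 < x" "x < y" "y < T"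
  shows "G x y = (y - x) powr (2*\<alpha>-1) * Psi (rho x y)"
proof -
  let ?w = "\<lambda>z. (x - z) * (T - y) / ((T - z) * (y - x))"
  let ?i = "\<lambda>z. (T - x) powr \<alpha> * (x - z) powr (\<alpha>-1) * (T - z) powr (-\<alpha>) * ((T - y) powr \<alpha> * (y - z) powr (\<alpha>-1) * (T - z) powr (-\<alpha>))"
  let ?P = "\<lambda>z. - ((y - x) powr (2*\<alpha>-1) * Psi (?w z))"
  have "(?i has_integral (?P x - ?P 0)) {0..x}"
  proof (rule fundamental_theorem_of_calculus_interior)
    show "continuous_on {0..x} ?P"
    proof (intro continuous_intros continuous_on_compose2[OF continuous_on_Psi])
      show "(\<lambda>z. ?w z) ` {0..x} \<subseteq> {0..}" using xy by auto
    qed (use xy in auto)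
    fix z assume z: "z \<in> {0<..<x}"
    have w1: "1 + ?w z = (y - z) * (T - x) / ((T - z) * (y - x))" 
    proof -
      have "(T - z) * (y - x) + (x - z) * (T - y) = (y - z) * (T - x)" by (simp add: algebra_simps)
      moreover have "(T - z) * (y - x) \<noteq> 0" using z xy by simp
      ultimately show ?thesis by (metis add_divide_distrib divide_self)
    qed
    have wpos: "?w z > 0" using z xy by simp
    have "((\<lambda>z. ?w z) has_real_derivative ((0 - 1) * (T - y) * ((T - z) * (y - x)) - (x - z) * (T - y) * ((0 - 1) * (y - x))) / ((T - z) * (y - x) * ((T - z) * (y - x)))) (at z)"
      using z xy by (intro DERIV_divide DERIV_cmult_right DERIV_diff DERIV_const DERIV_ident) auto
    moreover have "((0 - 1) * (T - y) * ((T - z) * (y - x)) - (x - z) * (T - y) * ((0 - 1) * (y - x))) / ((T - z) * (y - x) * ((T - z) * (y - x)))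
       = - ((T - y) * (T - x) / ((T - z)\<^sup>2 * (y - x)))" using z xy by (simp add: divide_simps power2_eq_square) (simp add: algebra_simps)
    ultimately have dw: "((\<lambda>z. ?w z) has_real_derivative - ((T - y) * (T - x) / ((T - z)\<^sup>2 * (y - x)))) (at z)" by simp
    have "(?P has_real_derivative - ((y - x) powr (2*\<alpha>-1) * ((?w z powr (\<alpha>-1) * (1 + ?w z) powr (\<alpha>-1)) * (- ((T - y) * (T - x) / ((T - z)\<^sup>2 * (y - x))))))) (at z)"
      by (intro DERIV_minus DERIV_cmult DERIV_chain2[OF DERIV_Psi[OF wpos] dw])
    moreover have "- ((y - x) powr (2*\<alpha>-1) * ((?w z powr (\<alpha>-1) * (1 + ?w z) powr (\<alpha>-1)) * (- ((T - y) * (T - x) / ((T - z)\<^sup>2 * (y - x)))))) = ?i z"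
      unfolding w1 using powr_product_identities(1)[of "x-z" "T-y" "T-z" "y-x" "y-z" "T-x" \<alpha>] z xy by (simp add: mult_ac)
    ultimately show "(?P has_vector_derivative ?i z) (at z)"
      by (simp add: has_real_derivative_iff_has_vector_derivative)
  qed (use xy in simp)
  also have "?P x - ?P 0 = (y - x) powr (2*\<alpha>-1) * Psi (rho x y)"
    by (simp add: Psi_0 rho_def mult_ac)
  finally have "(?i has_integral (y - x) powr (2*\<alpha>-1) * Psi (rho x y)) {0<..<x}"
    by (simp add: has_integral_Icc_iff_Ioo)
  from set_integral_of_has_integral_nonneg(2)[OF this]
  have "(LINT z:{0<..<x}|lborel. ?i z) = (y - x) powr (2*\<alpha>-1) * Psi (rho x y)" by simp
  moreover have "(LINT z:{0<..<x}|lborel. ?i z) = G x y"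
    unfolding G_def set_lebesgue_integral_def
    by (rule Bochner_Integration.integral_cong) (use xy in \<open>auto simp: ker_def indicator_def\<close>)
  ultimately show ?thesis by simp
qed

text \<open>A closed formula for \<open>G\<close> off the diagonal, symmetric by \<open>min\<close>
  and \<open>max\<close>. On the diagonal the division by 0 inside \<open>Theta\<close> is harmless:
  the factor \<open>0 powr (2*\<alpha>-1)\<close> is 0, which is the limit of the second
  term.\<close>

definition Gc :: "real \<Rightarrow> real \<Rightarrow> real" where
  "Gc x y = T powr (1-2*\<alpha>) / (2*\<alpha>-1) * ((min x y * (T - max x y)) powr \<alpha> * (max x y * (T - min x y)) powr (\<alpha>-1))
     - \<bar>x - y\<bar> powr (2*\<alpha>-1) * ((1-\<alpha>) * Theta (min x y * (T - max x y) / (T * \<bar>x - y\<bar>))) / (2*\<alpha>-1)"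

lemma Gc_eq_Psi:
  assumes xy: "0 < x" "x < y" "y < T"
  shows "Gc x y = (y - x) powr (2*\<alpha>-1) * Psi (rho x y)"
proof -
  have "(y - x) powr (2*\<alpha>-1) * rho x y powr \<alpha> * (1 + rho x y) powr (\<alpha>-1) = T powr (1-2*\<alpha>) * (x * (T - y)) powr \<alpha> * (y * (T - x)) powr (\<alpha>-1)"
    unfolding one_plus_rho[OF xy(2)] using powr_product_identities(3)[of x "T-y" T "y-x" y "T-x" \<alpha>] xy T by (simp add: rho_def)
  then have "(y - x) powr (2*\<alpha>-1) * Psi (rho x y) = (T powr (1-2*\<alpha>) * (x * (T - y)) powr \<alpha> * (y * (T - x)) powr (\<alpha>-1)
     - (y - x) powr (2*\<alpha>-1) * ((1-\<alpha>) * Theta (rho x y))) / (2*\<alpha>-1)"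
    unfolding Psi_def by (simp add: algebra_simps)
  then show ?thesis using xy by (simp add: Gc_def rho_def diff_divide_distrib mult_ac)
qed

lemma Gc_reflect: "Gc (T - x) (T - y) = Gc x y"
proof -
  have "min (T - x) (T - y) = T - max x y" "max (T - x) (T - y) = T - min x y" by auto
  then show ?thesis by (simp add: Gc_def mult_ac abs_minus_commute)
qed

lemma Gc_commute: "Gc x y = Gc y x"
  by (simp add: Gc_def min.commute max.commute abs_minus_commute)

lemma G_commute: "G x y = G y x" by (simp add: G_def mult.commute)

lemma G_eq_Gc: 
  assumes "x \<in> {0<..<T}" "y \<in> {0<..<T}" "x \<noteq> y" shows "G x y = Gc x y"
proof (cases "x < y")
  case True then show ?thesis using assms by (simp add: G_eq_Psi Gc_eq_Psi)
next
  case False then show ?thesis using assms by (simp add: G_eq_Psi Gc_eq_Psi G_commute[of x] Gc_commute[of x])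
qed

lemma Gc_boundary: 
  assumes "y \<in> {0<..<T}" shows "Gc 0 y = 0" "Gc T y = 0"
  using assms alpha by (simp_all add: Gc_def Theta_nonpos)

lemma continuous_on_Gc:
  assumes y: "y \<in> {0<..<T}" shows "continuous_on {0..T} (\<lambda>x. Gc x y)"
proof -
  let ?e = "\<lambda>x. \<bar>x - y\<bar> powr (2*\<alpha>-1) * ((1-\<alpha>) * Theta (min x y * (T - max x y) / (T * \<bar>x - y\<bar>)))"
  have c1: "continuous_on {0..T} (\<lambda>x. T powr (1-2*\<alpha>) / (2*\<alpha>-1) * ((min x y * (T - max x y)) powr \<alpha> * (max x y * (T - min x y)) powr (\<alpha>-1)))"
    using y alpha by (intro continuous_intros continuous_on_powr') (auto simp: min_def max_def)
  have pw: "continuous_on UNIV (\<lambda>x. \<bar>x - y\<bar> powr (2*\<alpha>-1))"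
    using alpha by (intro continuous_intros continuous_on_powr') auto
  have c2: "continuous_on {0..T} ?e"
    unfolding continuous_on_eq_continuous_within
  proof
    fix x assume x: "x \<in> {0..T}"
    show "continuous (at x within {0..T}) ?e"
    proof (cases "x = y")
      case True
      have "((\<lambda>x. \<bar>x - y\<bar> powr (2*\<alpha>-1)) \<longlongrightarrow> \<bar>y - y\<bar> powr (2*\<alpha>-1)) (at y within {0..T})"
        by (rule tendsto_within_subset[OF bspec[OF pw[unfolded continuous_on_def]]]) auto
      then have l: "((\<lambda>x. \<bar>x - y\<bar> powr (2*\<alpha>-1) * 2) \<longlongrightarrow> 0 * 2) (at y within {0..T})"
        using alpha by (intro tendsto_intros) auto
      \<comment> \<open>The argument of \<open>Theta\<close> tends to infinity here; its bound
        leaves twice a positive power of |x-y|.\<close>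
      have "(?e \<longlongrightarrow> 0) (at y within {0..T})"
        by (rule tendsto_sandwich[OF _ _ tendsto_const, of _ _ _ "\<lambda>x. \<bar>x - y\<bar> powr (2*\<alpha>-1) * 2"])
          (use l Theta_bound Theta_nonneg alpha in \<open>auto intro!: always_eventually mult_left_mono mult_nonneg_nonneg\<close>)
      then show ?thesis using True alpha by (simp add: continuous_within)
    next
      case False
      have "continuous_on ({0..T} - {y}) ?e"
        using y T alpha by (intro continuous_intros continuous_on_powr' continuous_on_compose2[OF continuous_on_Theta])
          (auto simp: min_def max_def)
      then have "continuous (at x within {0..T} - {y}) ?e" using x False by (auto simp: continuous_on_eq_continuous_within)
      moreover have "at x within {0..T} - {y} = at x within {0..T}"
        using False by (intro at_within_nhd[of _ "- {y}"]) auto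
      ultimately show ?thesis by simp
    qed
  qed
  show ?thesis unfolding Gc_def[abs_def]
    by (rule continuous_on_diff[OF c1 continuous_on_divide[OF c2 continuous_on_const]]) (use alpha in auto)
qed

text \<open>The x-derivative of \<open>Gc\<close>, with value 0 on the diagonal. The
  \<open>Theta\<close> term is the diagonal singularity of exponent 2\<alpha>-2, the other term the
  boundary singularity of exponent \<alpha>-1 at both ends. The case y < x is the reflection of the
  case x < y.\<close>

definition dG :: "real \<Rightarrow> real \<Rightarrow> real" where
  "dG x y = (if 0 < x \<and> x < y \<and> y < T then (1-\<alpha>) * (y - x) powr (2*\<alpha>-2) * Theta (rho x y)
        + T powr (1-2*\<alpha>) * (T - y) powr \<alpha> * y powr (\<alpha>-1) * (x * (T - x)) powr (\<alpha>-1)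
      else if 0 < y \<and> y < x \<and> x < T then - ((1-\<alpha>) * (x - y) powr (2*\<alpha>-2) * Theta (rho y x)
        + T powr (1-2*\<alpha>) * y powr \<alpha> * (T - y) powr (\<alpha>-1) * (x * (T - x)) powr (\<alpha>-1))
      else 0)"

lemma dG_reflect: "dG (T - x) (T - y) = - dG x y"
proof -
  have "rho (T - x) (T - y) = rho y x" for x y by (simp add: rho_def mult_ac)
  then show ?thesis by (auto simp: dG_def mult_ac)
qed

text \<open>In the product rule the algebraic part of \<open>Psi\<close> and the derivative of
  \<open>Psi (rho x y)\<close> both carry \<open>d * R * S\<close>. Their difference has the
  coefficient \<open>(T - y) / T\<close>, in which y-x has cancelled, so only the
  \<open>Theta\<close> term remains singular on the diagonal.\<close>

lemma DERIV_Gc_less: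
  assumes xy: "0 < x" "x < y" "y < T"
  shows "((\<lambda>x. Gc x y) has_real_derivative dG x y) (at x)"
proof -
  have rpos: "rho x y > 0" using xy T by (simp add: rho_def)
  have "((\<lambda>x. rho x y) has_real_derivative ((1 * (T - y)) * (T * (y - x)) - x * (T - y) * (T * (0 - 1))) / (T * (y - x) * (T * (y - x)))) (at x)"
    unfolding rho_def using xy T by (intro DERIV_divide DERIV_cmult DERIV_cmult_right DERIV_diff DERIV_const DERIV_ident) auto
  moreover have "((1 * (T - y)) * (T * (y - x)) - x * (T - y) * (T * (0 - 1))) / (T * (y - x) * (T * (y - x))) = (T - y) * y / (T * (y - x)\<^sup>2)"
    using xy T by (simp add: divide_simps power2_eq_square) (simp add: algebra_simps)
  ultimately have drho: "((\<lambda>x. rho x y) has_real_derivative (T - y) * y / (T * (y - x)\<^sup>2)) (at x)" by simp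
  have dp: "((\<lambda>x. (y - x) powr (2*\<alpha>-1)) has_real_derivative ((2*\<alpha>-1) * (y - x) powr (2*\<alpha>-1-1)) * (0 - 1)) (at x)"
    using xy by (intro DERIV_chain2[OF has_real_derivative_powr] DERIV_diff DERIV_const DERIV_ident) auto
  let ?D = "(((2*\<alpha>-1) * (y - x) powr (2*\<alpha>-1-1)) * (0 - 1)) * Psi (rho x y)
      + ((rho x y powr (\<alpha>-1) * (1 + rho x y) powr (\<alpha>-1)) * ((T - y) * y / (T * (y - x)\<^sup>2))) * (y - x) powr (2*\<alpha>-1)"
  have "((\<lambda>x. (y - x) powr (2*\<alpha>-1) * Psi (rho x y)) has_real_derivative ?D) (at x)"
    by (intro DERIV_mult dp DERIV_chain2[OF DERIV_Psi[OF rpos] drho])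
  moreover have "?D = dG x y"
  proof -
    define d R S where "d = (y - x) powr (2*\<alpha>-2)" and "R = rho x y powr (\<alpha>-1)" and "S = (1 + rho x y) powr (\<alpha>-1)"
    have e1: "(y - x) powr (2*\<alpha>-1) = (y - x) * d" using powr_mult_base[of "y-x" "2*\<alpha>-2"] xy by (simp add: d_def)
    have e2: "rho x y powr \<alpha> = rho x y * R" using powr_mult_base[of "rho x y" "\<alpha>-1"] rpos by (simp add: R_def)
    have "?D = - d * ((2*\<alpha>-1) * Psi (rho x y)) + d * R * S * ((y - x) * ((T - y) * y / (T * (y - x)\<^sup>2)))"
      unfolding e1 by (simp add: d_def R_def S_def mult_ac)
    also have "(y - x) * ((T - y) * y / (T * (y - x)\<^sup>2)) = (T - y) * y / (T * (y - x))"
      using xy T by (simp add: power2_eq_square)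
    also have "(2*\<alpha>-1) * Psi (rho x y) = rho x y * R * S - (1-\<alpha>) * Theta (rho x y)"
      using alpha by (simp add: Psi_def e2 S_def)
    also have "- d * (rho x y * R * S - (1-\<alpha>) * Theta (rho x y)) + d * R * S * ((T - y) * y / (T * (y - x)))
       = d * ((1-\<alpha>) * Theta (rho x y)) + d * R * S * ((T - y) * y / (T * (y - x)) - rho x y)" by (simp add: algebra_simps)
    also have "(T - y) * y / (T * (y - x)) - rho x y = (T - y) / T"
      using xy T by (simp add: rho_def divide_simps) (simp add: algebra_simps)
    also have "d * R * S * ((T - y) / T) = T powr (1-2*\<alpha>) * (T - y) powr \<alpha> * y powr (\<alpha>-1) * (x * (T - x)) powr (\<alpha>-1)"
      unfolding d_def R_def S_def one_plus_rho[OF xy(2)]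
      using powr_product_identities(2)[of x "T-y" T "y-x" y "T-x" \<alpha>] xy T by (simp add: rho_def)
    also have "d * ((1-\<alpha>) * Theta (rho x y)) + \<dots> = dG x y" using xy by (simp add: dG_def d_def mult_ac)
    finally show ?thesis .
  qed
  ultimately have "((\<lambda>x. (y - x) powr (2*\<alpha>-1) * Psi (rho x y)) has_real_derivative dG x y) (at x)" by simp
  then show ?thesis
    by (rule has_field_derivative_transform_within_open[of _ _ _ "{0<..<y}"]) (use xy Gc_eq_Psi in auto)
qed

lemma DERIV_Gc:
  assumes xy: "x \<in> {0<..<T}" "y \<in> {0<..<T}" "x \<noteq> y"
  shows "((\<lambda>x. Gc x y) has_real_derivative dG x y) (at x)"
proof (cases "x < y")
  case True then show ?thesis using xy DERIV_Gc_less by simp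
next
  case False
  have "((\<lambda>x. Gc x (T - y)) has_real_derivative dG (T - x) (T - y)) (at (T - x))"
    by (rule DERIV_Gc_less) (use False xy in auto)
  moreover have "((\<lambda>x. T - x) has_real_derivative (0 - 1)) (at x)" by (intro DERIV_diff DERIV_const DERIV_ident)
  ultimately have "((\<lambda>x. Gc (T - x) (T - y)) has_real_derivative dG (T - x) (T - y) * (0 - 1)) (at x)"
    by (rule DERIV_chain2)
  then show ?thesis by (simp add: Gc_reflect dG_reflect)
qed

end

section \<open>The derivative of the Green operator\<close>

context fractional_dirichlet
begin

text \<open>The boundary behaviour of u': integrable majorant, up to a constant, of the derivative
  of every \<open>K h\<close>.\<close>

definition wt :: "real \<Rightarrow> real" where "wt s = (s * (T - s)) powr (\<alpha> - 1)"

lemma wt_integral: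
  "set_integrable lborel {0<..<T} wt" "(LINT s:{0<..<T}|lborel. wt s) = T powr (2*\<alpha>-1) * Beta \<alpha> \<alpha>"
proof -
  have e: "wt s = (T - s) powr (\<alpha>-1) * (s - 0) powr (\<alpha>-1)" if "s \<in> {0<..<T}" for s
    using that by (simp add: wt_def powr_mult)
  note b = beta_integral[of \<alpha> \<alpha> 0 T]
  have "set_integrable lborel {0<..<T} wt \<longleftrightarrow> set_integrable lborel {0<..<T} (\<lambda>s. (T - s) powr (\<alpha>-1) * (s - 0) powr (\<alpha>-1))"
    by (rule set_integrable_cong[OF refl refl]) (use e in simp)
  then show "set_integrable lborel {0<..<T} wt" using b(1) T alpha by simp
  have "(LINT s:{0<..<T}|lborel. wt s) = (LINT s:{0<..<T}|lborel. (T - s) powr (\<alpha>-1) * (s - 0) powr (\<alpha>-1))"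
    by (rule set_lebesgue_integral_cong) (use e in auto)
  also have "\<dots> = (T - 0) powr (\<alpha> + \<alpha> - 1) * Beta \<alpha> \<alpha>" using b(2) T alpha by linarith
  also have "\<alpha> + \<alpha> - 1 = 2 * \<alpha> - 1" by simp
  finally show "(LINT s:{0<..<T}|lborel. wt s) = T powr (2*\<alpha>-1) * Beta \<alpha> \<alpha>"
    by simp
qed

text \<open>Lets constants be absorbed into multiples of \<open>wt\<close>, so that estimates can be
  stated with the weight alone.\<close>

lemma wt_ge: "s \<in> {0<..<T} \<Longrightarrow> 1 \<le> (T\<^sup>2) powr (1-\<alpha>) * wt s"
proof -
  assume s: "s \<in> {0<..<T}"
  have "s * (T - s) \<le> T * T" using s by (intro mult_mono) auto
  then have "(T\<^sup>2) powr (\<alpha>-1) \<le> wt s" unfolding wt_def using s alpha T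
    by (intro powr_mono2') (auto simp: power2_eq_square)
  then have "(T\<^sup>2) powr (1-\<alpha>) * (T\<^sup>2) powr (\<alpha>-1) \<le> (T\<^sup>2) powr (1-\<alpha>) * wt s" by (rule mult_left_mono) simp
  then show ?thesis using T by (simp add: powr_add[symmetric])
qed

lemma wt_nonneg: "wt s \<ge> 0" by (simp add: wt_def)

lemma wt_measurable [measurable]: "wt \<in> borel_measurable borel" unfolding wt_def by measurable

lemma abs_power_integral:
  assumes y: "y \<in> {0<..<T}"
  shows "set_integrable lborel {0<..<T} (\<lambda>s. \<bar>s - y\<bar> powr (2*\<alpha>-2))"
    "(LINT s:{0<..<T}|lborel. \<bar>s - y\<bar> powr (2*\<alpha>-2)) \<le> 2 * T powr (2*\<alpha>-1) / (2*\<alpha>-1)"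
proof -
  let ?f = "\<lambda>s. indicator {0<..<y} s *\<^sub>R (y - s) powr (2*\<alpha>-2)" and ?g = "\<lambda>s. indicator {y<..<T} s *\<^sub>R (s - y) powr (2*\<alpha>-2)"
  have f: "integrable lborel ?f" "integral\<^sup>L lborel ?f = y powr (2*\<alpha>-1) / (2*\<alpha>-1)"
    using power_integral(1,2)[of "2*\<alpha>-1" 0 y] y alpha unfolding set_integrable_def set_lebesgue_integral_def by auto
  have g: "integrable lborel ?g" "integral\<^sup>L lborel ?g = (T - y) powr (2*\<alpha>-1) / (2*\<alpha>-1)"
    using power_integral(3,4)[of "2*\<alpha>-1" y T] y alpha unfolding set_integrable_def set_lebesgue_integral_def by auto
  have eq: "(\<lambda>s. indicator {0<..<T} s *\<^sub>R \<bar>s - y\<bar> powr (2*\<alpha>-2)) = (\<lambda>s. ?f s + ?g s)"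
    using y by (auto simp: indicator_def fun_eq_iff)
  show "set_integrable lborel {0<..<T} (\<lambda>s. \<bar>s - y\<bar> powr (2*\<alpha>-2))"
    unfolding set_integrable_def eq using f g by (intro Bochner_Integration.integrable_add)
  have "(LINT s:{0<..<T}|lborel. \<bar>s - y\<bar> powr (2*\<alpha>-2)) = y powr (2*\<alpha>-1) / (2*\<alpha>-1) + (T - y) powr (2*\<alpha>-1) / (2*\<alpha>-1)"
    unfolding set_lebesgue_integral_def eq using f g by (subst Bochner_Integration.integral_add) auto
  also have "\<dots> \<le> T powr (2*\<alpha>-1) / (2*\<alpha>-1) + T powr (2*\<alpha>-1) / (2*\<alpha>-1)"
    using y alpha by (intro add_mono divide_right_mono powr_mono2) auto
  finally show "(LINT s:{0<..<T}|lborel. \<bar>s - y\<bar> powr (2*\<alpha>-2)) \<le> 2 * T powr (2*\<alpha>-1) / (2*\<alpha>-1)" by simp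
qed

lemma dG_outside: "x \<notin> {0<..<T} \<or> y \<notin> {0<..<T} \<Longrightarrow> dG x y = 0"
  by (auto simp: dG_def)

lemma dG_cases:
  obtains "0 < x \<and> x < y \<and> y < T" | "0 < y \<and> y < x \<and> x < T" | "dG x y = 0"
proof -
  have "dG x y = 0" if "\<not> (0 < x \<and> x < y \<and> y < T)" "\<not> (0 < y \<and> y < x \<and> x < T)"
    using that by (simp only: dG_def if_False)
  then show thesis using that by blast
qed

lemma dG_measurable [measurable]: "(\<lambda>(x,y). dG x y) \<in> borel_measurable (borel \<Otimes>\<^sub>M borel)"
  unfolding dG_def rho_def by measurable

lemma dG_measurable1 [measurable]: "(\<lambda>x. dG x y) \<in> borel_measurable borel" "dG x \<in> borel_measurable borel"
proof -
  show "dG x \<in> borel_measurable borel"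
    using measurable_compose[OF measurable_Pair1'[of x borel borel] dG_measurable] by simp
  show "(\<lambda>x. dG x y) \<in> borel_measurable borel"
    using measurable_compose[OF measurable_Pair2'[of y borel borel] dG_measurable] by simp
qed

text \<open>The first majorant is symmetric and integrable in either variable. The second uses x < y
  to trade \<open>y powr (\<alpha>-1)\<close> for \<open>x powr (\<alpha>-1)\<close>: apart from the
  diagonal it has no singularity in y, so it is uniform for x in a compact subinterval.\<close>

lemma dG_bound_less:
  assumes xy: "0 < x" "x < y" "y < T"
  shows "\<bar>dG x y\<bar> \<le> 2 * \<bar>x - y\<bar> powr (2*\<alpha>-2) + T powr (2-2*\<alpha>) * wt y * wt x"
    "\<bar>dG x y\<bar> \<le> 2 * \<bar>x - y\<bar> powr (2*\<alpha>-2) + T powr (1-\<alpha>) * x powr (\<alpha>-1) * wt x"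
proof -
  have a: "(1-\<alpha>) * (y - x) powr (2*\<alpha>-2) * Theta (rho x y) \<le> 2 * \<bar>x - y\<bar> powr (2*\<alpha>-2)"
    using mult_right_mono[OF Theta_bound[of "rho x y"], of "(y - x) powr (2*\<alpha>-2)"] xy by (simp add: mult_ac)
  have a0: "0 \<le> (1-\<alpha>) * (y - x) powr (2*\<alpha>-2) * Theta (rho x y)" using alpha Theta_nonneg by simp
  have "(T - y) powr \<alpha> * y powr (\<alpha>-1) = (T - y) * wt y"
    using powr_mult_base[of "T-y" "\<alpha>-1"] xy by (simp add: wt_def powr_mult)
  also have "\<dots> \<le> T * wt y" using xy by (intro mult_right_mono wt_nonneg) auto
  finally have "T powr (1-2*\<alpha>) * ((T - y) powr \<alpha> * y powr (\<alpha>-1)) * wt x \<le> T powr (1-2*\<alpha>) * (T * wt y) * wt x"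
    by (intro mult_right_mono mult_left_mono wt_nonneg) auto
  also have "T powr (1-2*\<alpha>) * (T * wt y) * wt x = T powr (2-2*\<alpha>) * wt y * wt x"
    using powr_mult_base[of T "1-2*\<alpha>"] T by (simp add: mult_ac)
  finally have b: "T powr (1-2*\<alpha>) * (T - y) powr \<alpha> * y powr (\<alpha>-1) * (x * (T - x)) powr (\<alpha>-1) \<le> T powr (2-2*\<alpha>) * wt y * wt x"
    by (simp add: wt_def mult_ac)
  have "(T - y) powr \<alpha> * y powr (\<alpha>-1) \<le> T powr \<alpha> * x powr (\<alpha>-1)"
    using xy alpha by (intro mult_mono powr_mono2 powr_mono2') auto
  then have "T powr (1-2*\<alpha>) * ((T - y) powr \<alpha> * y powr (\<alpha>-1)) * wt x \<le> T powr (1-2*\<alpha>) * (T powr \<alpha> * x powr (\<alpha>-1)) * wt x"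
    by (intro mult_right_mono mult_left_mono wt_nonneg) auto
  also have "T powr (1-2*\<alpha>) * (T powr \<alpha> * x powr (\<alpha>-1)) * wt x = (T powr (1-2*\<alpha>) * T powr \<alpha>) * x powr (\<alpha>-1) * wt x" by simp
  also have "T powr (1-2*\<alpha>) * T powr \<alpha> = T powr (1-\<alpha>)" by (simp add: powr_add[symmetric])
  finally have c: "T powr (1-2*\<alpha>) * (T - y) powr \<alpha> * y powr (\<alpha>-1) * (x * (T - x)) powr (\<alpha>-1) \<le> T powr (1-\<alpha>) * x powr (\<alpha>-1) * wt x"
    by (simp add: wt_def mult_ac)
  have d: "0 \<le> T powr (1-2*\<alpha>) * (T - y) powr \<alpha> * y powr (\<alpha>-1) * (x * (T - x)) powr (\<alpha>-1)" by simp
  have e: "dG x y = (1-\<alpha>) * (y - x) powr (2*\<alpha>-2) * Theta (rho x y) + T powr (1-2*\<alpha>) * (T - y) powr \<alpha> * y powr (\<alpha>-1) * (x * (T - x)) powr (\<alpha>-1)"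
    using xy by (simp add: dG_def)
  show "\<bar>dG x y\<bar> \<le> 2 * \<bar>x - y\<bar> powr (2*\<alpha>-2) + T powr (2-2*\<alpha>) * wt y * wt x"
    unfolding e using a a0 b d by linarith
  show "\<bar>dG x y\<bar> \<le> 2 * \<bar>x - y\<bar> powr (2*\<alpha>-2) + T powr (1-\<alpha>) * x powr (\<alpha>-1) * wt x"
    unfolding e using a a0 c d by linarith
qed

lemma wt_reflect: "wt (T - x) = wt x" by (simp add: wt_def mult_ac)

lemma dG_bound:
  "\<bar>dG x y\<bar> \<le> 2 * \<bar>x - y\<bar> powr (2*\<alpha>-2) + T powr (2-2*\<alpha>) * wt y * wt x"
proof -
  consider "0 < x \<and> x < y \<and> y < T" | "0 < y \<and> y < x \<and> x < T" | "dG x y = 0" by (rule dG_cases)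
  then show ?thesis
  proof cases
    case 2
    then have "\<bar>dG (T-x) (T-y)\<bar> \<le> 2 * \<bar>(T-x) - (T-y)\<bar> powr (2*\<alpha>-2) + T powr (2-2*\<alpha>) * wt (T-y) * wt (T-x)"
      by (intro dG_bound_less) auto
    then show ?thesis by (simp add: dG_reflect wt_reflect abs_minus_commute)
  next
    case 1 then show ?thesis using dG_bound_less(1) by blast
  qed (simp add: wt_nonneg)
qed

text \<open>The integral over y of the symmetric majorant of \<open>dG\<close>: the diagonal part,
  made a multiple of \<open>wt\<close> at the cost of \<open>(T\<^sup>2) powr (1-\<alpha>)\<close>,
  plus the boundary part, which is a Beta integral.\<close>

definition cU :: real where
  "cU = 2 * (2 * T powr (2*\<alpha>-1) / (2*\<alpha>-1)) * (T\<^sup>2) powr (1-\<alpha>) + T powr (2-2*\<alpha>) * (T powr (2*\<alpha>-1) * Beta \<alpha> \<alpha>)"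

lemma cU_nonneg: "cU \<ge> 0" using alpha Beta_pos[of \<alpha> \<alpha>] by (simp add: cU_def)

lemma dG_integral_snd:
  assumes x: "x \<in> {0<..<T}"
  shows "integrable lborel (dG x)" "(\<integral>y. \<bar>dG x y\<bar> \<partial>lborel) \<le> cU * wt x"
proof -
  let ?b = "\<lambda>y. 2 * (indicator {0<..<T} y *\<^sub>R \<bar>y - x\<bar> powr (2*\<alpha>-2)) + T powr (2-2*\<alpha>) * wt x * (indicator {0<..<T} y *\<^sub>R wt y)"
  note p = abs_power_integral[OF x]
  have i: "integrable lborel ?b"
    using p(1) wt_integral(1) unfolding set_integrable_def by (intro Bochner_Integration.integrable_add integrable_mult_right)
  have b: "\<bar>dG x y\<bar> \<le> ?b y" for y
    using dG_bound[of x y] dG_outside[of x y] by (cases "y \<in> {0<..<T}") (auto simp: abs_minus_commute mult_ac)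
  show d: "integrable lborel (dG x)"
    by (rule Bochner_Integration.integrable_bound[OF i]) (auto intro!: AE_I2 order.trans[OF b])
  have "(\<integral>y. \<bar>dG x y\<bar> \<partial>lborel) \<le> integral\<^sup>L lborel ?b" by (intro integral_mono integrable_abs d i b)
  also have "\<dots> = 2 * (LINT y:{0<..<T}|lborel. \<bar>y - x\<bar> powr (2*\<alpha>-2)) + T powr (2-2*\<alpha>) * wt x * (LINT s:{0<..<T}|lborel. wt s)"
    using p(1) wt_integral(1) unfolding set_integrable_def set_lebesgue_integral_def
    by (subst Bochner_Integration.integral_add) auto
  also have "\<dots> \<le> 2 * (2 * T powr (2*\<alpha>-1) / (2*\<alpha>-1)) + T powr (2-2*\<alpha>) * wt x * (T powr (2*\<alpha>-1) * Beta \<alpha> \<alpha>)"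
    using p(2) wt_integral(2) by simp
  also have "\<dots> \<le> 2 * (2 * T powr (2*\<alpha>-1) / (2*\<alpha>-1)) * ((T\<^sup>2) powr (1-\<alpha>) * wt x) + T powr (2-2*\<alpha>) * wt x * (T powr (2*\<alpha>-1) * Beta \<alpha> \<alpha>)"
    using mult_left_mono[OF wt_ge[OF x], of "2 * (2 * T powr (2*\<alpha>-1) / (2*\<alpha>-1))"] alpha by simp
  also have "\<dots> = cU * wt x" by (simp add: cU_def algebra_simps)
  finally show "(\<integral>y. \<bar>dG x y\<bar> \<partial>lborel) \<le> cU * wt x" .
qed

text \<open>The fundamental theorem tolerates the exceptional point s = y because \<open>Gc\<close>
  is continuous across the diagonal, and the lower boundary term vanishes.\<close>

lemma dG_integral_fst:
  assumes y: "y \<in> {0<..<T}" and x: "x \<in> {0..T}"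
  shows "(LINT s:{0<..<x}|lborel. dG s y) = Gc x y"
proof -
  let ?b = "\<lambda>s. 2 * (indicator {0<..<T} s *\<^sub>R \<bar>s - y\<bar> powr (2*\<alpha>-2)) + T powr (2-2*\<alpha>) * wt y * (indicator {0<..<T} s *\<^sub>R wt s)"
  have i: "integrable lborel ?b"
    using abs_power_integral(1)[OF y] wt_integral(1) unfolding set_integrable_def by (intro Bochner_Integration.integrable_add integrable_mult_right)
  have b: "\<bar>dG s y\<bar> \<le> ?b s" for s
    using dG_bound[of s y] dG_outside[of s y] by (cases "s \<in> {0<..<T}") (auto simp: mult_ac)
  have "integrable lborel (\<lambda>s. dG s y)"
    by (rule Bochner_Integration.integrable_bound[OF i]) (auto intro!: AE_I2 order.trans[OF b])
  then have int: "set_integrable lborel {0<..<x} (\<lambda>s. dG s y)"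
    unfolding set_integrable_def by (rule integrable_mult_indicator[rotated]) simp
  have "((\<lambda>s. dG s y) has_integral (Gc x y - Gc 0 y)) {0..x}"
  proof (rule fundamental_theorem_of_calculus_interior_strong[where S="{y}"])
    show "continuous_on {0..x} (\<lambda>x. Gc x y)"
      by (rule continuous_on_subset[OF continuous_on_Gc[OF y]]) (use x in auto)
    show "((\<lambda>x. Gc x y) has_vector_derivative dG s y) (at s)" if "s \<in> {0<..<x} - {y}" for s
      using DERIV_Gc[of s y] that x y by (simp add: has_real_derivative_iff_has_vector_derivative)
  qed (use x in auto)
  then have "((\<lambda>s. dG s y) has_integral Gc x y) {0<..<x}"
    using Gc_boundary[OF y] by (simp add: has_integral_Icc_iff_Ioo)
  then show ?thesis using set_integral_has_integral[OF int] has_integral_unique by blast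
qed

text \<open>For bounded \<open>h\<close> a density whose primitive is \<open>K h\<close>; for
  continuous \<open>h\<close> the classical derivative of \<open>K h\<close> on (0,T).\<close>

definition U :: "(real \<Rightarrow> real) \<Rightarrow> real \<Rightarrow> real" where
  "U h s = (\<integral>y. dG s y * h y \<partial>lborel)"

lemma U_measurable [measurable]:
  assumes [measurable]: "h \<in> borel_measurable borel" shows "U h \<in> borel_measurable borel"
  unfolding U_def by measurable

lemma U_outside: "s \<notin> {0<..<T} \<Longrightarrow> U h s = 0"
  by (simp add: U_def dG_outside)

lemma integrable_dG_mult:
  assumes h: "bdd_borel h" shows "integrable lborel (\<lambda>y. dG s y * h y)"
proof (cases "s \<in> {0<..<T}")
  case True
  note [measurable] = bdd_borelD[OF h]
  obtain H where H: "H \<ge> 0" "\<And>x. \<bar>h x\<bar> \<le> H" using bdd_borelE[OF h] by blast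
  show ?thesis
  proof (rule Bochner_Integration.integrable_bound[OF integrable_mult_right[OF dG_integral_snd(1)[OF True], of H]])
    show "AE y in lborel. norm (dG s y * h y) \<le> norm (H * dG s y)"
      using H by (intro AE_I2) (simp add: abs_mult mult.commute mult_right_mono)
  qed simp
qed (simp add: dG_outside)

lemma U_bound:
  assumes h: "bdd_borel h" and H: "H \<ge> 0" "\<And>x. \<bar>h x\<bar> \<le> H" and s: "s \<in> {0<..<T}"
  shows "(\<integral>y. \<bar>dG s y * h y\<bar> \<partial>lborel) \<le> H * cU * wt s" "\<bar>U h s\<bar> \<le> H * cU * wt s"
proof -
  have "(\<integral>y. \<bar>dG s y * h y\<bar> \<partial>lborel) \<le> (\<integral>y. H * \<bar>dG s y\<bar> \<partial>lborel)"
    using H by (intro integral_mono integrable_abs integrable_dG_mult h integrable_mult_right dG_integral_snd s)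
      (simp add: abs_mult mult.commute mult_right_mono)
  also have "\<dots> \<le> H * (cU * wt s)" using mult_left_mono[OF dG_integral_snd(2)[OF s] H(1)] by simp
  finally show 1: "(\<integral>y. \<bar>dG s y * h y\<bar> \<partial>lborel) \<le> H * cU * wt s" by simp
  show "\<bar>U h s\<bar> \<le> H * cU * wt s"
    unfolding U_def using integral_abs_bound[of lborel "\<lambda>y. dG s y * h y"] 1 by linarith
qed

lemma integrable_U:
  assumes h: "bdd_borel h" shows "set_integrable lborel {0<..<T} (U h)" "integrable lborel (U h)"
proof -
  note [measurable] = bdd_borelD[OF h]
  obtain H where H: "H \<ge> 0" "\<And>x. \<bar>h x\<bar> \<le> H" using bdd_borelE[OF h] by blast
  show 1: "set_integrable lborel {0<..<T} (U h)"
  proof (rule set_integrable_bound[OF set_integrable_mult_right[OF wt_integral(1), of "H * cU"]])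
    show "AE s in lborel. s \<in> {0<..<T} \<longrightarrow> norm (U h s) \<le> norm (H * cU * wt s)"
      using U_bound(2)[OF h H] by (auto intro!: AE_I2 order.trans[OF _ abs_ge_self])
  qed (simp add: set_borel_measurable_def)
  have "indicator {0<..<T} s *\<^sub>R U h s = U h s" for s using U_outside[of s h] by (cases "s \<in> {0<..<T}") auto
  then show "integrable lborel (U h)" using 1 by (simp only: set_integrable_def)
qed

text \<open>Integrating \<open>dG\<close> in its first variable before the second avoids any
  differentiation under the integral, so bounded Borel \<open>h\<close> suffice. \<open>G\<close>
  and \<open>Gc\<close> are compared only for y different from x, which is enough almost
  everywhere.\<close>

lemma K_eq_integral_U:
  assumes h: "bdd_borel h" and x: "x \<in> {0..T}"
  shows "K h x = (LINT s:{0<..<x}|lborel. U h s)"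
proof -
  note [measurable] = bdd_borelD[OF h]
  obtain H where H: "H \<ge> 0" "\<And>x. \<bar>h x\<bar> \<le> H" using bdd_borelE[OF h] by blast
  define f where "f s y = indicator {0<..<x} s * (dG s y * h y)" for s y
  have meas: "(\<lambda>(s,y). f s y) \<in> borel_measurable (borel \<Otimes>\<^sub>M borel)"
    unfolding f_def by measurable
  have inner: "integrable lborel (f s)" for s
    unfolding f_def by (intro integrable_mult_right integrable_dG_mult h)
  have outer: "integrable lborel (\<lambda>s. \<integral>y. \<bar>f s y\<bar> \<partial>lborel)"
  proof (rule Bochner_Integration.integrable_bound)
    show "integrable lborel (\<lambda>s. indicator {0<..<T} s *\<^sub>R (H * cU * wt s))"
      using set_integrable_mult_right[OF wt_integral(1), of "H * cU"] by (simp add: set_integrable_def)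
    show "(\<lambda>s. \<integral>y. \<bar>f s y\<bar> \<partial>lborel) \<in> borel_measurable lborel" unfolding f_def by measurable
    have "norm (\<integral>y. \<bar>f s y\<bar> \<partial>lborel) \<le> norm (indicator {0<..<T} s *\<^sub>R (H * cU * wt s))" for s
    proof (cases "s \<in> {0<..<x}")
      case True
      then have sT: "s \<in> {0<..<T}" using x by auto
      have "(\<integral>y. \<bar>f s y\<bar> \<partial>lborel) = (\<integral>y. \<bar>dG s y * h y\<bar> \<partial>lborel)" using True by (simp add: f_def)
      moreover have "0 \<le> (\<integral>y. \<bar>dG s y * h y\<bar> \<partial>lborel)" by simp
      ultimately show ?thesis using U_bound(1)[OF h H sT] sT by simp
    qed (simp add: f_def)
    then show "AE s in lborel. norm (\<integral>y. \<bar>f s y\<bar> \<partial>lborel) \<le> norm (indicator {0<..<T} s *\<^sub>R (H * cU * wt s))" by simp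
  qed
  have "(\<integral>y. (\<integral>s. f s y \<partial>lborel) \<partial>lborel) = (\<integral>s. (\<integral>y. f s y \<partial>lborel) \<partial>lborel)"
    by (rule fubini_lborel(1)[OF meas _ outer]) (use inner in auto)
  also have "(\<integral>s. (\<integral>y. f s y \<partial>lborel) \<partial>lborel) = (LINT s:{0<..<x}|lborel. U h s)"
    by (simp add: f_def U_def set_lebesgue_integral_def)
  also have "(\<integral>y. (\<integral>s. f s y \<partial>lborel) \<partial>lborel) = (\<integral>y. G x y * h y \<partial>lborel)"
  proof (rule integral_cong_AE)
    show "(\<lambda>y. \<integral>s. f s y \<partial>lborel) \<in> borel_measurable lborel" unfolding f_def by measurable
    show "(\<lambda>y. G x y * h y) \<in> borel_measurable lborel" unfolding G_def by measurable
    have "AE y in lborel. y \<noteq> x" by (rule AE_lborel_singleton)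
    then show "AE y in lborel. (\<integral>s. f s y \<partial>lborel) = G x y * h y"
    proof eventually_elim
      fix y assume yx: "y \<noteq> x"
      show "(\<integral>s. f s y \<partial>lborel) = G x y * h y"
      proof (cases "y \<in> {0<..<T}")
        case True
        have "(\<lambda>s. f s y) = (\<lambda>s. (indicator {0<..<x} s *\<^sub>R dG s y) * h y)" by (auto simp: f_def)
        then have "(\<integral>s. f s y \<partial>lborel) = Gc x y * h y"
          using dG_integral_fst[OF True x] by (simp add: set_lebesgue_integral_def)
        moreover have "Gc x y = G x y"
        proof (cases "x \<in> {0<..<T}")
          case False
          then have "x = 0 \<or> x = T" using x by auto
          moreover have "(\<lambda>z. ker x z * ker y z) = (\<lambda>z. 0)" using calculation by (auto simp: ker_def)
          then have "G x y = 0" by (simp add: G_def)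
          ultimately show ?thesis using Gc_boundary[OF True] by auto
        qed (use G_eq_Gc True yx in auto)
        ultimately show ?thesis by simp
      next
        case False
        then have "(\<lambda>z. ker x z * ker y z) = (\<lambda>z. 0)" "(\<lambda>s. f s y) = (\<lambda>s. 0)" by (auto simp: ker_def f_def dG_outside)
        then show ?thesis by (simp add: G_def)
      qed
    qed
  qed
  finally show ?thesis using K_eq_G[OF h] by simp
qed

text \<open>The modulus depends on \<open>h\<close> only through a bound of its values. It serves
  both the equicontinuity needed for compactness and the absolute continuity of the
  solution.\<close>

lemma K_modulus:
  assumes h: "bdd_borel h" and H: "H \<ge> 0" "\<And>x. \<bar>h x\<bar> \<le> H" and xy: "0 \<le> x" "x \<le> y" "y \<le> T"
  shows "\<bar>K h y - K h x\<bar> \<le> H * cU * ((LINT s:{0<..<y}|lborel. wt s) - (LINT s:{0<..<x}|lborel. wt s))"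
proof -
  have sub: "set_integrable lborel A f" if "set_integrable lborel {0<..<T} f" "A \<subseteq> {0<..<T}" "A \<in> sets borel" for A and f :: "real \<Rightarrow> real"
    by (rule set_integrable_subset[OF that(1)]) (use that in auto)
  have split: "(LINT s:{0<..<y}|lborel. f s) - (LINT s:{0<..<x}|lborel. f s) = (LINT s:{x..<y} \<inter> {0<..<T}|lborel. f s)"
    if "set_integrable lborel {0<..<T} f" for f :: "real \<Rightarrow> real"
  proof -
    have "{0<..<y} = {0<..<x} \<union> ({x..<y} \<inter> {0<..<T})" using xy by auto
    moreover have "(LINT s:{0<..<x} \<union> ({x..<y} \<inter> {0<..<T})|lborel. f s) = (LINT s:{0<..<x}|lborel. f s) + (LINT s:{x..<y} \<inter> {0<..<T}|lborel. f s)"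
      by (rule set_integral_Un) (use xy in \<open>auto intro!: sub[OF that]\<close>)
    ultimately show ?thesis by simp
  qed
  let ?A = "{x..<y} \<inter> {0<..<T}"
  have iU: "set_integrable lborel ?A (U h)" by (rule sub[OF integrable_U(1)[OF h]]) auto
  have iw: "set_integrable lborel ?A (\<lambda>s. H * cU * wt s)" by (rule set_integrable_mult_right[OF sub[OF wt_integral(1)]]) auto
  have "\<bar>K h y - K h x\<bar> = \<bar>LINT s:?A|lborel. U h s\<bar>"
    using K_eq_integral_U[OF h, of x] K_eq_integral_U[OF h, of y] xy split[OF integrable_U(1)[OF h]] by simp
  also have "\<dots> \<le> (LINT s:?A|lborel. \<bar>U h s\<bar>)" using set_integral_norm_bound[OF iU] by simp
  also have "\<dots> \<le> (LINT s:?A|lborel. H * cU * wt s)"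
    by (rule set_integral_mono[OF set_integrable_abs[OF iU] iw]) (use U_bound(2)[OF h H] in auto)
  also have "\<dots> = H * cU * (LINT s:?A|lborel. wt s)" by simp
  finally show ?thesis using split[OF wt_integral(1)] by simp
qed

lemma wt_primitive_continuous: "continuous_on {0..T} (\<lambda>x. LINT s:{0<..<x}|lborel. wt s)"
proof -
  have "continuous_on {0..T} (\<lambda>x. integral {0..x} wt)"
    using set_borel_integral_eq_integral(1)[OF wt_integral(1)] 
    by (intro indefinite_integral_continuous_1) (simp add: integrable_on_Icc_iff_Ioo)
  moreover have "integral {0..x} wt = (LINT s:{0<..<x}|lborel. wt s)" if "x \<in> {0..T}" for x
  proof -
    have "set_integrable lborel {0<..<x} wt" by (rule set_integrable_subset[OF wt_integral(1)]) (use that in auto)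
    from set_integral_has_integral[OF this] show ?thesis 
      by (simp add: has_integral_Icc_iff_Ioo[symmetric] integral_unique)
  qed
  ultimately show ?thesis by (rule continuous_on_eq)
qed

lemma K_equicontinuous:
  assumes e: "e > 0" and H: "H \<ge> 0"
  obtains d where "d > 0"
    "\<And>h x y. bdd_borel h \<Longrightarrow> (\<And>x. \<bar>h x\<bar> \<le> H) \<Longrightarrow> \<bar>x - y\<bar> < d \<Longrightarrow> \<bar>K h x - K h y\<bar> < e"
proof -
  let ?W = "\<lambda>x. LINT s:{0<..<x}|lborel. wt s"
  have Hc: "H * cU \<ge> 0" using H cU_nonneg by simp
  have "uniformly_continuous_on {0..T} ?W" by (rule compact_uniformly_continuous[OF wt_primitive_continuous]) simp
  moreover have "e / (H * cU + 1) > 0" using e Hc by simp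
  ultimately obtain d where d: "d > 0" "\<And>x y. x \<in> {0..T} \<Longrightarrow> y \<in> {0..T} \<Longrightarrow> dist y x < d \<Longrightarrow> dist (?W y) (?W x) < e / (H * cU + 1)"
    unfolding uniformly_continuous_on_def by metis
  have main: "\<bar>K h y - K h x\<bar> < e" if h: "bdd_borel h" "\<And>x. \<bar>h x\<bar> \<le> H" and xy: "0 \<le> x" "x \<le> y" "y \<le> T" "y - x < d" for h x y
  proof -
    have "\<bar>K h y - K h x\<bar> \<le> H * cU * (?W y - ?W x)" by (rule K_modulus[OF h(1) H h(2) xy(1-3)])
    also have "\<dots> \<le> H * cU * (e / (H * cU + 1))"
      using d(2)[of x y] xy by (intro mult_left_mono Hc) (auto simp: dist_real_def)
    also have "\<dots> < e" using e Hc by (simp add: field_simps)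
    finally show ?thesis .
  qed
  \<comment> \<open>\<open>K h\<close> vanishes outside (0,T), so clamping the arguments to [0,T]
    changes nothing and brings them no further apart.\<close>
  let ?c = "\<lambda>x. max 0 (min T x)"
  have clamp: "K h x = K h (?c x)" for h x
    using K_outside[of x h] K_outside[of "?c x" h] T by (cases "x \<in> {0<..<T}") (auto simp: min_def max_def)
  show thesis
  proof (rule that[OF d(1)])
    fix h x y assume h: "bdd_borel h" "\<And>x. \<bar>h x\<bar> \<le> H" and xy: "\<bar>x - y\<bar> < d"
    show "\<bar>K h x - K h y\<bar> < e"
    proof (cases "x \<le> y")
      case True
      have "\<bar>K h (?c y) - K h (?c x)\<bar> < e" by (rule main[OF h]) (use True xy T d in \<open>auto simp: min_def max_def\<close>)
      then show ?thesis using clamp[of h x] clamp[of h y] by (simp add: abs_minus_commute)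
    next
      case False
      have "\<bar>K h (?c x) - K h (?c y)\<bar> < e" by (rule main[OF h]) (use False xy T d in \<open>auto simp: min_def max_def\<close>)
      then show ?thesis using clamp[of h x] clamp[of h y] by simp
    qed
  qed
qed

lemma continuous_K:
  assumes h: "bdd_borel h" shows "continuous_on UNIV (K h)"
  unfolding continuous_on_iff
proof (intro ballI allI impI)
  fix x e :: real assume e: "e > 0"
  obtain H where H: "H \<ge> 0" "\<And>x. \<bar>h x\<bar> \<le> H" using bdd_borelE[OF h] by blast
  obtain d where "d > 0" "\<And>x y. \<bar>x - y\<bar> < d \<Longrightarrow> \<bar>K h x - K h y\<bar> < e"
    using K_equicontinuous[OF e H(1)] h H(2) by metis
  then show "\<exists>d>0. \<forall>x'\<in>UNIV. dist x' x < d \<longrightarrow> dist (K h x') (K h x) < e" by (auto simp: dist_real_def)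
qed

text \<open>The kernel at the fixed offset r > 0 from the diagonal. The truncation by
  \<open>max 0\<close> reproduces the value 0 once s + r leaves the interval and keeps the formula
  continuous in s.\<close>

definition dGc :: "real \<Rightarrow> real \<Rightarrow> real" where
  "dGc r s = (1-\<alpha>) * r powr (2*\<alpha>-2) * Theta (s * max 0 (T - s - r) / (T * r))
      + T powr (1-2*\<alpha>) * (max 0 (T - s - r)) powr \<alpha> * (s + r) powr (\<alpha>-1) * (s * (T - s)) powr (\<alpha>-1)"

lemma dGc_eq: "r > 0 \<Longrightarrow> s \<in> {0<..<T} \<Longrightarrow> dG s (s + r) = dGc r s"
  using alpha by (auto simp: dG_def dGc_def rho_def Theta_nonpos max_def diff_diff_eq)

lemma continuous_on_dGc:
  assumes "r > 0" shows "continuous_on {0<..<T} (dGc r)"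
  unfolding dGc_def[abs_def] using alpha T assms
  by (intro continuous_on_add continuous_on_mult continuous_on_const continuous_on_compose2[OF continuous_on_Theta]
      continuous_on_powr' continuous_on_divide continuous_on_max continuous_on_diff continuous_on_id) auto

lemma continuous_on_dG_shift:
  assumes "r \<noteq> 0" shows "continuous_on {0<..<T} (\<lambda>s. dG s (s + r))"
proof (cases "r > 0")
  case True
  show ?thesis by (rule continuous_on_eq[OF continuous_on_dGc[OF True]]) (use True in \<open>auto simp: dGc_eq\<close>)
next
  case False
  then have r: "-r > 0" using assms by simp
  have "continuous_on {0<..<T} (\<lambda>s. - dGc (-r) (T - s))"
    by (intro continuous_on_minus continuous_on_compose2[OF continuous_on_dGc[OF r]] continuous_intros) auto
  moreover have "- dGc (-r) (T - s) = dG s (s + r)" if "s \<in> {0<..<T}" for s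
  proof -
    have "dG (T - s) (T - (s + r)) = dGc (-r) (T - s)" using dGc_eq[OF r, of "T - s"] that by (simp add: algebra_simps)
    then show ?thesis by (simp add: dG_reflect[of s "s+r"])
  qed
  ultimately show ?thesis by (rule continuous_on_eq)
qed

text \<open>The shift y = s + r moves the diagonal singularity to the fixed point r = 0, after which
  dominated convergence applies on compact subintervals.\<close>

lemma U_continuous:
  assumes h: "bdd_borel h" and hc: "continuous_on UNIV h"
  shows "continuous_on {0<..<T} (U h)"
proof (rule continuous_on_Ioo_if_Icc)
  fix l b assume lb: "0 < l" "l < b" "b < T"
  note [measurable] = bdd_borelD[OF h]
  obtain H where H: "H \<ge> 0" "\<And>x. \<bar>h x\<bar> \<le> H" using bdd_borelE[OF h] by blast
  \<comment> \<open>Bounds the boundary part of \<open>dG\<close> for all s in [l,b], from either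
    side of the diagonal: one summand for the left end, one for the right.\<close>
  define M where "M = T powr (1-\<alpha>) * (l powr (\<alpha>-1) + (T - b) powr (\<alpha>-1)) * (l * (T - b)) powr (\<alpha>-1)"
  define w where "w r = H * (indicator {-T<..<T} r * (2 * \<bar>r\<bar> powr (2*\<alpha>-2) + M))" for r
  have U_shift: "U h s = (\<integral>r. dG s (s + r) * h (s + r) \<partial>lborel)" for s
    unfolding U_def using lborel_integral_real_affine[of 1 "\<lambda>y. dG s y * h y" s] by simp
  have wtb: "wt s \<le> (l * (T - b)) powr (\<alpha>-1)" if "s \<in> {l..b}" for s
    unfolding wt_def using that lb alpha by (intro powr_mono2' mult_mono) auto
  have bd: "\<bar>dG s (s + r)\<bar> \<le> indicator {-T<..<T} r * (2 * \<bar>r\<bar> powr (2*\<alpha>-2) + M)" if s: "s \<in> {l..b}" for s r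
  proof -
    have M0: "0 \<le> 2 * \<bar>r\<bar> powr (2*\<alpha>-2) + M" by (simp add: M_def)
    consider "0 < r \<and> s + r < T" | "r < 0 \<and> 0 < s + r" | "dG s (s + r) = 0" by (rule dG_cases[of s "s+r"]) auto
    then show ?thesis
    proof cases
      case 1
      have "\<bar>dG s (s+r)\<bar> \<le> 2 * \<bar>s - (s+r)\<bar> powr (2*\<alpha>-2) + T powr (1-\<alpha>) * s powr (\<alpha>-1) * wt s"
        by (rule dG_bound_less(2)) (use 1 s lb in auto)
      also have "T powr (1-\<alpha>) * s powr (\<alpha>-1) * wt s \<le> M" unfolding M_def
        using s lb alpha wtb[OF s] powr_mono2'[of "\<alpha>-1" l s] by (intro mult_mono) (auto simp: wt_nonneg intro: add_increasing2)
      finally show ?thesis using 1 s lb by auto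
    next
      case 2
      have "\<bar>dG (T-s) (T-(s+r))\<bar> \<le> 2 * \<bar>(T-s) - (T-(s+r))\<bar> powr (2*\<alpha>-2) + T powr (1-\<alpha>) * (T-s) powr (\<alpha>-1) * wt (T-s)"
        by (rule dG_bound_less(2)) (use 2 s lb in auto)
      also have "T powr (1-\<alpha>) * (T-s) powr (\<alpha>-1) * wt (T-s) \<le> M" unfolding M_def wt_reflect
        using s lb alpha wtb[OF s] powr_mono2'[of "\<alpha>-1" "T-b" "T-s"] by (intro mult_mono) (auto simp: wt_nonneg intro: add_increasing)
      finally show ?thesis using 2 s lb by (auto simp: dG_reflect)
    qed (use M0 in auto)
  qed
  have iw: "integrable lborel w"
  proof -
    have "set_integrable lborel {-T<..<0} (\<lambda>r. (0 - r) powr (2*\<alpha>-1-1))" "set_integrable lborel {0<..<T} (\<lambda>r. (r - 0) powr (2*\<alpha>-1-1))"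
      using power_integral(1)[of "2*\<alpha>-1" "-T" 0] power_integral(3)[of "2*\<alpha>-1" 0 T] T alpha by auto
    then have "integrable lborel (\<lambda>r. indicator {-T<..<0} r *\<^sub>R (0 - r) powr (2*\<alpha>-1-1) + indicator {0<..<T} r *\<^sub>R (r - 0) powr (2*\<alpha>-1-1))"
      unfolding set_integrable_def by (rule Bochner_Integration.integrable_add)
    also have "(\<lambda>r. indicator {-T<..<0} r *\<^sub>R (0 - r) powr (2*\<alpha>-1-1) + indicator {0<..<T} r *\<^sub>R (r - 0) powr (2*\<alpha>-1-1))
       = (\<lambda>r. indicator {-T<..<T} r * \<bar>r\<bar> powr (2*\<alpha>-2))"
      by (auto simp: indicator_def fun_eq_iff)
    finally have 1: "integrable lborel (\<lambda>r. indicator {-T<..<T} r * \<bar>r\<bar> powr (2*\<alpha>-2))" .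
    have 2: "integrable lborel (\<lambda>r. indicator {-T<..<T} r * M)"
      by (intro integrable_mult_left integrable_real_indicator) (use T in auto)
    have "w = (\<lambda>r. H * (2 * (indicator {-T<..<T} r * \<bar>r\<bar> powr (2*\<alpha>-2)) + indicator {-T<..<T} r * M))"
      by (auto simp: w_def algebra_simps)
    then show ?thesis using 1 2 by simp
  qed
  have "continuous_on {l..b} (\<lambda>s. \<integral>r. dG s (s + r) * h (s + r) \<partial>lborel)"
  proof (rule continuous_on_integral_dominated[OF _ _ iw])
    fix s assume s: "s \<in> {l..b}"
    show "(\<lambda>r. dG s (s + r) * h (s + r)) \<in> borel_measurable lborel" by measurable
    have "\<bar>dG s (s + r) * h (s + r)\<bar> \<le> w r" for r
      unfolding w_def abs_mult mult.commute[of H] by (intro mult_mono bd s H) (auto intro: order.trans[OF _ bd[OF s]])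
    then show "AE r in lborel. \<bar>dG s (s + r) * h (s + r)\<bar> \<le> w r" by simp
  next
    have "AE r in lborel. r \<noteq> (0::real)" by (rule AE_lborel_singleton)
    then show "AE r in lborel. continuous_on {l..b} (\<lambda>s. dG s (s + r) * h (s + r))"
    proof eventually_elim
      fix r :: real assume r: "r \<noteq> 0"
      show "continuous_on {l..b} (\<lambda>s. dG s (s + r) * h (s + r))"
        by (intro continuous_on_mult continuous_on_subset[OF continuous_on_dG_shift[OF r]]
            continuous_on_compose2[OF hc] continuous_intros) (use lb in auto)
    qed
  qed
  then show "continuous_on {l..b} (U h)" unfolding U_shift[abs_def] .
qed

lemma DERIV_K:
  assumes h: "bdd_borel h" and hc: "continuous_on UNIV h" and x: "x \<in> {0<..<T}"
  shows "(K h has_real_derivative U h x) (at x)"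
proof -
  have "((\<lambda>z. LINT s:{0<..<z}|lborel. U h s) has_real_derivative U h x) (at x)"
    by (rule DERIV_indefinite_integral[OF U_continuous[OF h hc]])
      (use x in \<open>auto intro!: set_integrable_subset[OF integrable_U(1)[OF h]]\<close>)
  then show ?thesis
    by (rule has_field_derivative_transform_within_open[of _ _ _ "{0<..<T}"]) (use x K_eq_integral_U[OF h] in auto)
qed

end

section \<open>Near-minimisers of the action functional\<close>

text \<open>\<open>r\<close> bounds half the energy. \<open>embed\<close> sends the energy ball into
  |u| \<le> \<gamma>, so \<open>f\<close> and \<open>F\<close> matter on [-\<gamma>,\<gamma>] only;
  \<open>gap\<close> says that on the energy sphere the quadratic part exceeds the largest possible
  gain from \<open>F\<close>, so the action there stays above its value 0 at the origin.\<close>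

locale hammerstein = fractional_dirichlet +
  fixes f F :: "real \<Rightarrow> real" and c \<mu> \<gamma> r M :: real
  assumes f_cont: "continuous_on UNIV f"
    and DERIV_F: "\<And>\<xi>. (F has_real_derivative f \<xi>) (at \<xi>)" and F0: "F 0 = 0"
    and c: "c > 0" and mu: "\<mu> > 0" and gam: "\<gamma> > 0" 
    and M: "\<And>\<xi>. \<bar>\<xi>\<bar> \<le> \<gamma> \<Longrightarrow> F \<xi> \<le> M"
    and embed: "2 * r * (c * (T powr (2*\<alpha>-1) / (2*\<alpha>-1))) \<le> \<gamma>\<^sup>2"
    and gap: "\<mu> * T * M < r"
begin

definition V :: "(real \<Rightarrow> real) \<Rightarrow> real \<Rightarrow> real" where "V h x = c * K h x"

definition E :: "(real \<Rightarrow> real) \<Rightarrow> (real \<Rightarrow> real) \<Rightarrow> real" where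
  "E h k = c * (\<integral>z. adj h z * adj k z \<partial>lborel)"

text \<open>The embedding constant in |u|^2 \<le> P E(h,h).\<close>

definition P :: real where "P = c * (T powr (2*\<alpha>-1) / (2*\<alpha>-1))"

definition L :: real where "L = T powr \<alpha> / \<alpha>"

text \<open>The energy \<open>E h h / 2\<close> of \<open>u = V h\<close> is the quadratic part of the action functional: working with
  \<open>h\<close> instead of \<open>u\<close> avoids the energy space.\<close>

definition J :: "(real \<Rightarrow> real) \<Rightarrow> real" where
  "J h = E h h / 2 - \<mu> * (LINT x:{0<..<T}|lborel. F (V h x))"

definition B :: "(real \<Rightarrow> real) set" where "B = {h. bdd_borel h \<and> E h h \<le> 2 * r}"

lemma P_pos: "P > 0" using c T alpha by (simp add: P_def)
lemma L_pos: "L > 0" using T alpha by (simp add: L_def)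

lemma F_cont: "continuous_on UNIV F"
  using DERIV_F DERIV_isCont by (intro continuous_at_imp_continuous_on) blast

lemma F_measurable [measurable]: "F \<in> borel_measurable borel"
  by (rule borel_measurable_continuous_onI[OF F_cont])

lemma f_measurable [measurable]: "f \<in> borel_measurable borel"
  by (rule borel_measurable_continuous_onI[OF f_cont])

lemma M_nonneg: "M \<ge> 0" using M[of 0] gam F0 by simp

lemma r_pos: "r > 0"
proof -
  have "0 \<le> \<mu> * T * M" using mu T M_nonneg by simp
  then show ?thesis using gap by linarith
qed

lemma V_outside: "x \<notin> {0<..<T} \<Longrightarrow> V h x = 0" by (simp add: V_def K_outside)

lemma V_linear: "bdd_borel h \<Longrightarrow> bdd_borel k \<Longrightarrow> V (\<lambda>x. h x + t * k x) x = V h x + t * V k x"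
  by (simp add: V_def K_linear algebra_simps)

lemma V_bound: "bdd_borel h \<Longrightarrow> H \<ge> 0 \<Longrightarrow> (\<And>x. \<bar>h x\<bar> \<le> H) \<Longrightarrow> \<bar>V h x\<bar> \<le> c * (H * L\<^sup>2)"
  unfolding V_def abs_mult L_def using c K_bound by (simp add: mult_left_mono)

lemma V_measurable [measurable]: 
  assumes [measurable]: "h \<in> borel_measurable borel" shows "V h \<in> borel_measurable borel"
  unfolding V_def by measurable

lemma E_form:
  assumes "bdd_borel h" "bdd_borel k" shows "E h k = (\<integral>x. V h x * k x \<partial>lborel)"
proof -
  have "(\<integral>x. V h x * k x \<partial>lborel) = (\<integral>x. c * (K h x * k x) \<partial>lborel)" by (simp add: V_def mult.assoc)
  then show ?thesis using K_form[OF assms] by (simp add: E_def)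
qed

lemma E_commute: "E h k = E k h" by (simp add: E_def mult.commute)

lemma E_nonneg: "E h h \<ge> 0" using c by (simp add: E_def)

lemma E_linear:
  assumes h: "bdd_borel h" and k: "bdd_borel k" and l: "bdd_borel l"
  shows "E (\<lambda>x. h x + t * k x) l = E h l + t * E k l"
proof -
  have "(\<integral>z. adj (\<lambda>x. h x + t * k x) z * adj l z \<partial>lborel) = (\<integral>z. adj h z * adj l z + t * (adj k z * adj l z) \<partial>lborel)"
    by (simp add: adj_linear[OF h k] algebra_simps)
  also have "\<dots> = (\<integral>z. adj h z * adj l z \<partial>lborel) + t * (\<integral>z. adj k z * adj l z \<partial>lborel)"
    by (subst Bochner_Integration.integral_add) (auto intro!: integrable_adj_mult h k l)
  finally show ?thesis by (simp add: E_def algebra_simps)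
qed

lemma E_quadratic:
  assumes h: "bdd_borel h" and k: "bdd_borel k"
  shows "E (\<lambda>x. h x + t * k x) (\<lambda>x. h x + t * k x) = E h h + 2 * t * E h k + t\<^sup>2 * E k k"
proof -
  have hk: "bdd_borel (\<lambda>x. h x + t * k x)" by (intro bdd_borel_add bdd_borel_cmult h k)
  show ?thesis
    unfolding E_linear[OF h k hk] E_commute[of _ "\<lambda>x. h x + t * k x"] E_linear[OF h k h] E_linear[OF h k k]
    by (simp add: E_commute[of k h] algebra_simps power2_eq_square)
qed

lemma E_polarization:
  assumes h: "bdd_borel h" and k: "bdd_borel k"
  shows "2 * E h k \<le> E h h + E k k" "- 2 * E h k \<le> E h h + E k k"
  using E_quadratic[OF h k, of 1] E_quadratic[OF h k, of "-1"] E_nonneg[of "\<lambda>x. h x + 1 * k x"] E_nonneg[of "\<lambda>x. h x + (-1) * k x"] by simp_all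

lemma V_sq: "bdd_borel h \<Longrightarrow> (V h x)\<^sup>2 \<le> P * E h h"
proof -
  assume "bdd_borel h"
  then have "c\<^sup>2 * (K h x)\<^sup>2 \<le> c\<^sup>2 * (T powr (2*\<alpha>-1) / (2*\<alpha>-1) * (\<integral>z. (adj h z)\<^sup>2 \<partial>lborel))"
    by (intro mult_left_mono K_cauchy_schwarz) auto
  then show ?thesis by (simp add: V_def P_def E_def power2_eq_square mult_ac)
qed

lemma E_bound:
  assumes h: "bdd_borel h" and H: "H \<ge> 0" "\<And>x. \<bar>h x\<bar> \<le> H"
  shows "E h h \<le> c * ((H * L)\<^sup>2 * T)"
proof -
  note [measurable] = bdd_borelD[OF h]
  have "\<bar>adj h z * adj h z\<bar> \<le> (H * L)\<^sup>2" for z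
    using adj_bound[OF h H, of z] unfolding abs_mult power2_eq_square L_def by (intro mult_mono) auto
  then have "\<bar>\<integral>z. adj h z * adj h z \<partial>lborel\<bar> \<le> (H * L)\<^sup>2 * (T - 0)"
    by (intro integrable_bounded_support(2)) (use T in \<open>auto simp: adj_outside\<close>)
  then show ?thesis using c by (simp add: E_def)
qed

lemma V_le_gamma:
  assumes "h \<in> B" shows "\<bar>V h x\<bar> \<le> \<gamma>"
proof -
  have "(V h x)\<^sup>2 \<le> P * E h h" using assms by (intro V_sq) (simp add: B_def)
  also have "\<dots> \<le> P * (2 * r)" using assms P_pos by (simp add: B_def)
  also have "\<dots> \<le> \<gamma>\<^sup>2" using embed by (simp add: P_def mult_ac)
  finally have "\<bar>V h x\<bar>\<^sup>2 \<le> \<gamma>\<^sup>2" by simp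
  then show ?thesis using gam by (simp add: power2_le_iff_abs_le)
qed

lemma f_bounded: obtains Hf where "Hf \<ge> 0" "\<And>\<xi>. \<bar>\<xi>\<bar> \<le> \<gamma> \<Longrightarrow> \<bar>f \<xi>\<bar> \<le> Hf"
proof -
  have "compact (f ` {-\<gamma>..\<gamma>})" by (intro compact_continuous_image continuous_on_subset[OF f_cont]) auto
  then obtain H where H: "\<forall>y\<in>f ` {-\<gamma>..\<gamma>}. norm y \<le> H" using compact_imp_bounded bounded_iff by metis
  have "\<bar>f \<xi>\<bar> \<le> H" if "\<bar>\<xi>\<bar> \<le> \<gamma>" for \<xi> using H that by (force simp: abs_le_iff)
  moreover from this[of 0] gam have "H \<ge> 0" by (metis abs_ge_zero abs_zero order_trans less_imp_le)
  ultimately show thesis using that by blast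
qed

lemma bdd_borel_f:
  assumes "u \<in> borel_measurable borel" "\<And>x. \<bar>u x\<bar> \<le> \<gamma>"
  shows "bdd_borel (\<lambda>x. \<mu> * f (u x))"
proof -
  note [measurable] = assms(1)
  obtain Hf where "Hf \<ge> 0" "\<And>\<xi>. \<bar>\<xi>\<bar> \<le> \<gamma> \<Longrightarrow> \<bar>f \<xi>\<bar> \<le> Hf" using f_bounded by blast
  then show ?thesis using assms(2) by (intro bdd_borel_cmult bdd_borelI[of _ Hf]) auto
qed

text \<open>The mean value theorem turns uniform continuity of \<open>f\<close> on
  [-\<gamma>,\<gamma>] into a first-order lower bound for \<open>F\<close> with a uniform error.
  One-sidedness is enough, since \<open>F\<close> enters the action with a minus sign.\<close>

lemma F_uniform:
  assumes "\<omega> > 0"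
  obtains \<delta> where "\<delta> > 0" "\<And>a b. \<bar>a\<bar> \<le> \<gamma> \<Longrightarrow> \<bar>b\<bar> \<le> \<gamma> \<Longrightarrow> \<bar>a - b\<bar> < \<delta> \<Longrightarrow> \<bar>f a - f b\<bar> < \<omega>"
    "\<And>a b. \<bar>a\<bar> \<le> \<gamma> \<Longrightarrow> \<bar>b\<bar> \<le> \<gamma> \<Longrightarrow> \<bar>a - b\<bar> < \<delta> \<Longrightarrow> F a + f a * (b - a) - \<omega> * \<bar>b - a\<bar> \<le> F b"
proof -
  have "uniformly_continuous_on {-\<gamma>..\<gamma>} f"
    by (intro compact_uniformly_continuous continuous_on_subset[OF f_cont]) auto
  then obtain \<delta> where d: "\<delta> > 0" "\<And>a b. a \<in> {-\<gamma>..\<gamma>} \<Longrightarrow> b \<in> {-\<gamma>..\<gamma>} \<Longrightarrow> dist b a < \<delta> \<Longrightarrow> dist (f b) (f a) < \<omega>"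
    using assms unfolding uniformly_continuous_on_def by metis
  have 1: "\<bar>f a - f b\<bar> < \<omega>" if "\<bar>a\<bar> \<le> \<gamma>" "\<bar>b\<bar> \<le> \<gamma>" "\<bar>a - b\<bar> < \<delta>" for a b
    using d(2)[of b a] that by (auto simp: dist_real_def abs_le_iff)
  have "F a + f a * (b - a) - \<omega> * \<bar>b - a\<bar> \<le> F b" if ab: "\<bar>a\<bar> \<le> \<gamma>" "\<bar>b\<bar> \<le> \<gamma>" "\<bar>a - b\<bar> < \<delta>" for a b
  proof -
    have "\<exists>\<xi>. F b - F a = f \<xi> * (b - a) \<and> \<bar>\<xi>\<bar> \<le> \<gamma> \<and> \<bar>a - \<xi>\<bar> < \<delta>"
    proof (cases a b rule: linorder_cases)
      case less
      obtain z where "a < z" "z < b" "F b - F a = (b - a) * f z" using MVT2[OF less, of F f] DERIV_F by blast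
      then show ?thesis using ab by (intro exI[of _ z]) auto
    next
      case equal then show ?thesis using ab d by (intro exI[of _ a]) auto
    next
      case greater
      obtain z where "b < z" "z < a" "F a - F b = (a - b) * f z" using MVT2[OF greater, of F f] DERIV_F by blast
      then show ?thesis using ab by (intro exI[of _ z]) (auto simp: algebra_simps)
    qed
    then obtain \<xi> where xi: "F b - F a = f \<xi> * (b - a)" "\<bar>\<xi>\<bar> \<le> \<gamma>" "\<bar>a - \<xi>\<bar> < \<delta>" by blast
    have "\<bar>(f a - f \<xi>) * (b - a)\<bar> \<le> \<omega> * \<bar>b - a\<bar>" unfolding abs_mult using 1[OF ab(1) xi(2,3)] by (intro mult_right_mono) auto
    then show ?thesis using xi(1) by (simp add: algebra_simps abs_le_iff)
  qed
  then show thesis using that d(1) 1 by blast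
qed

lemma integrable_F_V:
  assumes "h \<in> B" shows "set_integrable lborel {0<..<T} (\<lambda>x. F (V h x))"
proof -
  have [measurable]: "h \<in> borel_measurable borel" using assms by (simp add: B_def bdd_borel_def)
  have "compact (F ` {-\<gamma>..\<gamma>})" by (intro compact_continuous_image continuous_on_subset[OF F_cont]) auto
  then obtain H where H: "\<forall>y\<in>F ` {-\<gamma>..\<gamma>}. norm y \<le> H" using compact_imp_bounded bounded_iff by metis
  have "\<bar>F (V h x)\<bar> \<le> H" for x using H V_le_gamma[OF assms, of x] by (force simp: abs_le_iff)
  moreover from this[of 0] have "H \<ge> 0" using abs_ge_zero order_trans by blast
  ultimately show ?thesis unfolding set_integrable_def
    by (intro integrable_bounded_support(1)[where a=0 and b=T and C=H]) (auto simp: indicator_def)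
qed

lemma set_integral_const_Ioo: "(LINT x:{0<..<T}|lborel. (C::real)) = C * T" "set_integrable lborel {0<..<T} (\<lambda>x. C::real)"
  using T by (auto simp: set_lebesgue_integral_def set_integrable_def)

lemma J_ge:
  assumes "h \<in> B" and "\<And>x. F (V h x) \<le> m"
  shows "E h h / 2 - \<mu> * (m * T) \<le> J h"
proof -
  have "(LINT x:{0<..<T}|lborel. F (V h x)) \<le> (LINT x:{0<..<T}|lborel. m)"
    by (rule set_integral_mono[OF integrable_F_V[OF assms(1)]]) (use assms set_integral_const_Ioo in auto)
  then show ?thesis using mu unfolding J_def set_integral_const_Ioo by simp
qed

lemma zero_in_B: "(\<lambda>_. 0) \<in> B" "J (\<lambda>_. 0) = 0"
proof -
  have "adj (\<lambda>_. 0) z = 0" for z by (simp add: adj_def)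
  moreover from this have "V (\<lambda>_. 0) x = 0" for x by (simp add: V_def K_def)
  ultimately show "(\<lambda>_. 0) \<in> B" "J (\<lambda>_. 0) = 0"
    using r_pos by (simp_all add: B_def J_def E_def F0 bdd_borel_const set_lebesgue_integral_def)
qed

lemma J_bdd_below: "bdd_below (J ` B)"
proof (rule bdd_belowI2)
  fix h assume "h \<in> B"
  from J_ge[OF this M[OF V_le_gamma[OF this]]] E_nonneg[of h] show "- (\<mu> * (M * T)) \<le> J h" by linarith
qed

definition I :: real where "I = (INF h\<in>B. J h)"

lemma I_le: "h \<in> B \<Longrightarrow> I \<le> J h" unfolding I_def by (rule cINF_lower[OF J_bdd_below])

lemma I_approx: "e > 0 \<Longrightarrow> \<exists>h\<in>B. J h < I + e"
proof -
  assume "e > 0"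
  then have "(INF h\<in>B. J h) < I + e" by (simp add: I_def)
  then show ?thesis using cINF_less_iff[OF _ J_bdd_below] zero_in_B by blast
qed

text \<open>The constraint is inactive by \<open>gap\<close>, so moving a near-minimiser \<open>h\<close> along the negative gradient
  \<open>k = \<mu> f(V h) - h\<close> shows that \<open>E k k\<close> is small.\<close>

lemma almost_critical:
  assumes eps: "\<epsilon> > 0"
  shows "\<exists>h\<in>B. J h < I + \<epsilon> \<and> (\<forall>x. \<bar>V h x - V (\<lambda>y. \<mu> * f (V h y)) x\<bar> \<le> \<epsilon>)"
proof -
  obtain Hf where Hf: "Hf \<ge> 0" "\<And>\<xi>. \<bar>\<xi>\<bar> \<le> \<gamma> \<Longrightarrow> \<bar>f \<xi>\<bar> \<le> Hf" using f_bounded by blast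
  \<comment> \<open>An upper bound for \<open>E k k\<close> not depending on \<open>h\<close>: twice
    the energy of the bounded part plus twice \<open>E h h\<close>. Consequently \<open>eB\<close>
    bounds \<open>V k\<close> uniformly.\<close>
  define EB where "EB = 2 * (c * ((\<mu> * Hf * L)\<^sup>2 * T)) + 4 * r"
  have EB: "EB > 0" unfolding EB_def using r_pos c T by (intro add_nonneg_pos) auto
  define eB where "eB = sqrt (P * EB)"
  have eB: "eB > 0" unfolding eB_def using EB P_pos by simp
  \<comment> \<open>The argument ends with \<open>E k k \<le> 3 * q\<close>, which the embedding
    converts into a bound of V k by \<epsilon>.\<close>
  define q where "q = \<epsilon>\<^sup>2 / (3 * P)"
  have q: "q > 0" using eps P_pos by (simp add: q_def)
  define \<omega> where "\<omega> = q / (\<mu> * T * eB)"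
  have om: "\<omega> > 0" using q mu T eB by (simp add: \<omega>_def)
  obtain \<delta> where d: "\<delta> > 0" "\<And>a b. \<bar>a\<bar> \<le> \<gamma> \<Longrightarrow> \<bar>b\<bar> \<le> \<gamma> \<Longrightarrow> \<bar>a - b\<bar> < \<delta> \<Longrightarrow> F a + f a * (b - a) - \<omega> * \<bar>b - a\<bar> \<le> F b"
    using F_uniform[OF om] by metis
  define g0 where "g0 = r - \<mu> * T * M"
  have g0: "g0 > 0" using gap by (simp add: g0_def)
  \<comment> \<open>The step length keeps the new point in the ball with half of the room left by
    \<open>gap\<close>, makes the second-order term at most \<open>t * q\<close>, and keeps the
    values of V within \<delta>. It depends on \<epsilon> only, so it can be fixed before
    \<open>h\<close>.\<close>
  define t where "t = min 1 (min (g0 / (2 * r + 2 * EB)) (min (2 * q / EB) (\<delta> / (2 * eB))))"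
  have t: "t > 0" "t \<le> 1" using g0 r_pos EB q d(1) eB by (auto simp: t_def)
  have "t \<le> g0 / (2 * r + 2 * EB)" "t \<le> 2 * q / EB" "t \<le> \<delta> / (2 * eB)" by (auto simp: t_def)
  then have tt: "t * (2 * r + 2 * EB) \<le> g0" "t * EB \<le> 2 * q" "t * eB < \<delta>"
    using EB r_pos eB d(1) by (simp_all add: pos_le_divide_eq add_pos_pos mult_ac)
  \<comment> \<open>The defect of the near-minimiser must be small compared with the decrease
    obtainable in a step of length \<open>t\<close>.\<close>
  define \<eta> where "\<eta> = min \<epsilon> (min (t * q) (g0 / 2))"
  have eta: "\<eta> > 0" "\<eta> \<le> \<epsilon>" "\<eta> \<le> t * q" "\<eta> \<le> g0 / 2" using eps t q g0 by (auto simp: \<eta>_def)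
  obtain h where h: "h \<in> B" "J h < I + \<eta>" using I_approx[OF eta(1)] by blast
  have hb: "bdd_borel h" and Eh: "E h h \<le> 2 * r" using h(1) by (auto simp: B_def)
  note [measurable] = bdd_borelD[OF hb]
  define g where "g = (\<lambda>y. \<mu> * f (V h y))"
  have gb: "bdd_borel g" unfolding g_def by (rule bdd_borel_f) (use V_le_gamma[OF h(1)] in auto)
  have gle: "\<bar>g x\<bar> \<le> \<mu> * Hf" for x
    unfolding g_def abs_mult using Hf(2)[OF V_le_gamma[OF h(1)]] mu by (simp add: mult_left_mono)
  define k where "k = (\<lambda>y. g y + (-1) * h y)"
  have kb: "bdd_borel k" unfolding k_def by (intro bdd_borel_add bdd_borel_cmult gb hb)
  have Eg: "E g g \<le> c * ((\<mu> * Hf * L)\<^sup>2 * T)" using mu Hf gle by (intro E_bound gb) auto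
  have Ek: "E k k \<le> EB"
  proof -
    have "E k k = E g g - 2 * E g h + E h h" unfolding k_def using E_quadratic[OF gb hb, of "-1"] by simp
    also have "\<dots> \<le> 2 * E g g + 2 * E h h" using E_polarization(2)[OF gb hb] by simp
    finally show ?thesis using Eg Eh by (simp add: EB_def)
  qed
  have Vk: "\<bar>V k x\<bar> \<le> eB" for x
  proof -
    have "(V k x)\<^sup>2 \<le> P * EB" using order.trans[OF V_sq[OF kb, of x] mult_left_mono[OF Ek, of P]] P_pos by simp
    then have "sqrt ((V k x)\<^sup>2) \<le> eB" unfolding eB_def by (rule real_sqrt_le_mono)
    then show ?thesis by simp
  qed
  let ?h' = "\<lambda>x. h x + t * k x"
  have h'B: "?h' \<in> B"
  proof -
    have "E h h / 2 - \<mu> * (M * T) \<le> J h" by (rule J_ge[OF h(1) M[OF V_le_gamma[OF h(1)]]])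
    \<comment> \<open>As the origin has action 0, \<open>J h\<close> is below \<eta>; hence
      \<open>h\<close> has small energy compared with \<open>2 * r\<close> and the constraint stays
      inactive along the step.\<close>
    then have "E h h \<le> 2 * \<eta> + 2 * (\<mu> * T * M)" using h(2) I_le[OF zero_in_B(1)] zero_in_B(2) by (simp add: mult_ac)
    moreover have "t * (2 * E h k) \<le> t * (2 * r + EB)"
      using E_polarization(1)[OF hb kb] Eh Ek t by (intro mult_left_mono) auto
    moreover have "t\<^sup>2 * E k k \<le> t * EB"
      using t Ek E_nonneg[of k] unfolding power2_eq_square mult.assoc by (intro mult_left_mono) (auto intro: order.trans[OF mult_left_le_one_le])
    ultimately have "E ?h' ?h' \<le> 2 * \<eta> + 2 * (\<mu> * T * M) + t * (2 * r + 2 * EB)"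
      unfolding E_quadratic[OF hb kb] by (simp add: algebra_simps)
    also have "\<dots> \<le> 2 * r" using eta(4) tt(1) g0_def by argo
    finally show ?thesis by (simp add: B_def bdd_borel_add bdd_borel_cmult hb kb)
  qed
  have "(LINT x:{0<..<T}|lborel. F (V h x)) + t * (LINT x:{0<..<T}|lborel. f (V h x) * V k x) - \<omega> * t * eB * T \<le> (LINT x:{0<..<T}|lborel. F (V ?h' x))"
  proof -
    have ifv: "set_integrable lborel {0<..<T} (\<lambda>x. f (V h x) * V k x)"
    proof -
      have "bdd_borel (\<lambda>x. (1/\<mu>) * g x * V k x)"
        by (intro bdd_borel_mult bdd_borel_cmult gb bdd_borelI[of "V k", OF _ Vk] V_measurable bdd_borelD kb)
      then have b: "bdd_borel (\<lambda>x. f (V h x) * V k x)" using mu by (simp add: g_def)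
      then obtain C where "C \<ge> 0" "\<And>x. \<bar>f (V h x) * V k x\<bar> \<le> C" using bdd_borelE by blast
      then show ?thesis unfolding set_integrable_def using bdd_borelD[OF b]
        by (intro integrable_bounded_support(1)[where a=0 and b=T and C=C]) (auto simp: indicator_def)
    qed
    have "(LINT x:{0<..<T}|lborel. (F (V h x) + t * (f (V h x) * V k x)) - \<omega> * t * eB) \<le> (LINT x:{0<..<T}|lborel. F (V ?h' x))"
    proof (rule set_integral_mono)
      show "set_integrable lborel {0<..<T} (\<lambda>x. F (V h x) + t * (f (V h x) * V k x) - \<omega> * t * eB)"
        by (intro set_integral_diff(1) set_integral_add(1) integrable_F_V h set_integrable_mult_right ifv set_integral_const_Ioo)
      show "set_integrable lborel {0<..<T} (\<lambda>x. F (V ?h' x))" by (rule integrable_F_V[OF h'B])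
      fix x assume "x \<in> {0<..<T}"
      have V': "V ?h' x = V h x + t * V k x" by (rule V_linear[OF hb kb])
      have tv: "\<bar>t * V k x\<bar> \<le> t * eB" using Vk t by (simp add: abs_mult)
      have "F (V h x) + f (V h x) * (V ?h' x - V h x) - \<omega> * \<bar>V ?h' x - V h x\<bar> \<le> F (V ?h' x)"
        by (rule d(2)) (use V_le_gamma[OF h(1), of x] V_le_gamma[OF h'B, of x] V' tv tt(3) in auto)
      moreover have "\<omega> * \<bar>V ?h' x - V h x\<bar> \<le> \<omega> * (t * eB)" using tv om V' by (intro mult_left_mono) auto
      ultimately show "F (V h x) + t * (f (V h x) * V k x) - \<omega> * t * eB \<le> F (V ?h' x)"
        using V' by (simp add: algebra_simps)
    qed
    also have "(LINT x:{0<..<T}|lborel. (F (V h x) + t * (f (V h x) * V k x)) - \<omega> * t * eB)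
      = (LINT x:{0<..<T}|lborel. F (V h x)) + t * (LINT x:{0<..<T}|lborel. f (V h x) * V k x) - \<omega> * t * eB * T"
      by (subst set_integral_diff(2) set_integral_add(2);
          (intro set_integral_add(1) integrable_F_V h set_integrable_mult_right ifv set_integral_const_Ioo)?)+
        (simp add: set_integral_const_Ioo)
    finally show ?thesis .
  qed
  then have "\<mu> * ((LINT x:{0<..<T}|lborel. F (V h x)) + t * (LINT x:{0<..<T}|lborel. f (V h x) * V k x) - \<omega> * t * eB * T) \<le> \<mu> * (LINT x:{0<..<T}|lborel. F (V ?h' x))"
    using mu by (intro mult_left_mono) auto
  then have m1: "\<mu> * (LINT x:{0<..<T}|lborel. F (V h x)) + t * (\<mu> * (LINT x:{0<..<T}|lborel. f (V h x) * V k x)) - t * (\<mu> * T * eB * \<omega>) \<le> \<mu> * (LINT x:{0<..<T}|lborel. F (V ?h' x))"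
    by (simp only: right_diff_distrib distrib_left mult_ac)
  \<comment> \<open>The nonlinear part of the first variation becomes an energy pairing with
    \<open>g\<close>, so the total slope in the direction \<open>k\<close> is - E(k,k).\<close>
  have m2: "\<mu> * (LINT x:{0<..<T}|lborel. f (V h x) * V k x) = E k g"
  proof -
    have "\<mu> * (LINT x:{0<..<T}|lborel. f (V h x) * V k x) = (\<integral>x. \<mu> * (indicator {0<..<T} x * (f (V h x) * V k x)) \<partial>lborel)"
      by (simp add: set_lebesgue_integral_def)
    also have "\<dots> = (\<integral>x. V k x * g x \<partial>lborel)"
    proof (rule Bochner_Integration.integral_cong)
      show "\<mu> * (indicator {0<..<T} x * (f (V h x) * V k x)) = V k x * g x" for x
        using V_outside[of x k] by (cases "x \<in> {0<..<T}") (auto simp: g_def)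
    qed simp
    finally show ?thesis using E_form[OF kb gb] by simp
  qed
  \<comment> \<open>Besides the gain \<open>t * E k k\<close> there are three errors: linearisation
    of \<open>F\<close>, second-order term, and defect of \<open>h\<close>. Each is at most
    \<open>t * q\<close>.\<close>
  have "J ?h' \<le> J h + t * (E h k - E k g) + t\<^sup>2 * E k k / 2 + t * (\<mu> * T * eB * \<omega>)"
    using m1 unfolding m2 J_def E_quadratic[OF hb kb] right_diff_distrib[of t] add_divide_distrib by simp
  moreover have "E h k - E k g = - E k k"
    using E_linear[OF gb hb kb, of "-1", folded k_def] by (simp add: E_commute[of g k])
  moreover have "\<mu> * T * eB * \<omega> = q" using mu T eB by (simp add: \<omega>_def)
  moreover have "t\<^sup>2 * E k k / 2 \<le> t * q"
  proof -
    have "t\<^sup>2 * E k k / 2 = t * (t * E k k / 2)" by (simp add: power2_eq_square)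
    also have "\<dots> \<le> t * q"
    proof (rule mult_left_mono)
      have "t * E k k \<le> t * EB" by (rule mult_left_mono[OF Ek]) (use t in simp)
      then show "t * E k k / 2 \<le> q" using tt(2) by linarith
    qed (use t in simp)
    finally show ?thesis .
  qed
  moreover have "I \<le> J ?h'" by (rule I_le[OF h'B])
  ultimately have "t * E k k \<le> t * (3 * q)" using h(2) eta(3) by simp
  then have "E k k \<le> 3 * q" using t by simp
  then have "P * E k k \<le> P * (3 * q)" using P_pos by simp
  also have "\<dots> = \<epsilon>\<^sup>2" using P_pos by (simp add: q_def)
  finally have "(V k x)\<^sup>2 \<le> \<epsilon>\<^sup>2" for x using V_sq[OF kb, of x] by linarith
  then have "\<bar>V k x\<bar> \<le> \<epsilon>" for x using eps by (simp add: power2_le_iff_abs_le)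
  moreover have "V k x = V g x - V h x" for x unfolding k_def using V_linear[OF gb hb, of "-1" x] by simp
  ultimately have "\<forall>x. \<bar>V h x - V (\<lambda>y. \<mu> * f (V h y)) x\<bar> \<le> \<epsilon>" by (simp add: g_def abs_minus_commute)
  then show ?thesis using h eta(2) by (intro bexI[of _ h]) auto
qed


lemma V_diff_le:
  assumes h: "bdd_borel h" and k: "bdd_borel k" and d: "d \<ge> 0" "\<And>x. \<bar>h x - k x\<bar> \<le> d"
  shows "\<bar>V h x - V k x\<bar> \<le> c * (d * L\<^sup>2)"
proof -
  have "V (\<lambda>x. h x + (-1) * k x) x = V h x - V k x" using V_linear[OF h k, of "-1"] by simp
  moreover have "\<bar>V (\<lambda>x. h x + (-1) * k x) x\<bar> \<le> c * (d * L\<^sup>2)"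
    by (rule V_bound[OF bdd_borel_add[OF h bdd_borel_cmult[OF k]]]) (use d in auto)
  ultimately show ?thesis by simp
qed

lemma minimising_limit:
  obtains u h where "u \<in> borel_measurable borel" "\<And>x. \<bar>u x\<bar> \<le> \<gamma>" "\<And>x. u x = V (\<lambda>y. \<mu> * f (u y)) x"
    "\<And>n. h n \<in> B" "(\<lambda>n. J (h n)) \<longlonglongrightarrow> I" "\<And>e. e > 0 \<Longrightarrow> \<exists>N. \<forall>n\<ge>N. \<forall>x. \<bar>V (h n) x - u x\<bar> < e"
proof -
  obtain Hf where Hf: "Hf \<ge> 0" "\<And>\<xi>. \<bar>\<xi>\<bar> \<le> \<gamma> \<Longrightarrow> \<bar>f \<xi>\<bar> \<le> Hf" using f_bounded by blast
  have "\<exists>h. h \<in> B \<and> J h < I + 1 / real (Suc n) \<and> (\<forall>x. \<bar>V h x - V (\<lambda>y. \<mu> * f (V h y)) x\<bar> \<le> 1 / real (Suc n))" for n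
    using almost_critical[of "1 / real (Suc n)"] by auto
  then obtain h0 where h0: "\<And>n. h0 n \<in> B" "\<And>n. J (h0 n) < I + 1 / real (Suc n)"
    "\<And>n x. \<bar>V (h0 n) x - V (\<lambda>y. \<mu> * f (V (h0 n) y)) x\<bar> \<le> 1 / real (Suc n)"
    by metis
  have hb: "bdd_borel (h0 n)" for n using h0(1)[of n] by (simp add: B_def)
  define g where "g n y = \<mu> * f (V (h0 n) y)" for n y
  have gb: "bdd_borel (g n)" for n
    unfolding g_def by (rule bdd_borel_f) (use V_le_gamma[OF h0(1)] V_measurable[OF bdd_borelD[OF hb]] in auto)
  have gle: "\<bar>g n x\<bar> \<le> \<mu> * Hf" for n x
    unfolding g_def abs_mult using Hf(2)[OF V_le_gamma[OF h0(1)]] mu by (simp add: mult_left_mono)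
  have close: "\<bar>V (h0 n) x - V (g n) x\<bar> \<le> 1 / real (Suc n)" for n x
    using h0(3)[of n x] unfolding g_def[abs_def] by simp
  have mH: "\<mu> * Hf \<ge> 0" using mu Hf by simp
  obtain gl k where gl: "continuous_on {0..T} gl" "strict_mono (k :: nat \<Rightarrow> nat)"
     "\<And>e. 0 < e \<Longrightarrow> \<exists>N. \<forall>n x. n \<ge> N \<and> x \<in> {0..T} \<longrightarrow> norm (V (g (k n)) x - gl x) < e"
  proof (rule Arzela_Ascoli[of "{0..T}" "\<lambda>n. V (g n)" "c * ((\<mu> * Hf) * L\<^sup>2)"])
    show "norm (V (g n) x) \<le> c * ((\<mu> * Hf) * L\<^sup>2)" for n x
      using V_bound[OF gb mH gle] by simp
    show "\<exists>d>0. \<forall>n y. y \<in> {0..T} \<and> norm (x - y) < d \<longrightarrow> norm (V (g n) x - V (g n) y) < e" if "0 < e" for x e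
    proof -
      have "e / c > 0" using that c by simp
      then obtain d where "d > 0" "\<And>h x y. bdd_borel h \<Longrightarrow> (\<And>x. \<bar>h x\<bar> \<le> \<mu> * Hf) \<Longrightarrow> \<bar>x - y\<bar> < d \<Longrightarrow> \<bar>K h x - K h y\<bar> < e / c"
        using K_equicontinuous[OF _ mH] by metis
      then have d: "d > 0" "\<bar>x - y\<bar> < d \<Longrightarrow> \<bar>K (g n) x - K (g n) y\<bar> < e / c" for n y
        using gb gle by auto
      have "\<bar>V (g n) x - V (g n) y\<bar> < e" if "\<bar>x - y\<bar> < d" for n y
      proof -
        have "\<bar>V (g n) x - V (g n) y\<bar> = c * \<bar>K (g n) x - K (g n) y\<bar>"
          unfolding V_def right_diff_distrib[symmetric] abs_mult using c by simp
        then show ?thesis using d(2)[OF that, of n] c by (simp add: pos_less_divide_eq mult.commute)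
      qed
      then show ?thesis using d(1) by auto
    qed
  qed auto
  define u where "u x = (if x \<in> {0..T} then gl x else 0)" for x
  have Vg: "\<exists>N. \<forall>n\<ge>N. \<forall>x. \<bar>V (g (k n)) x - u x\<bar> < e" if "e > 0" for e
  proof -
    obtain N where "\<forall>n x. n \<ge> N \<and> x \<in> {0..T} \<longrightarrow> norm (V (g (k n)) x - gl x) < e" using gl(3)[OF \<open>e > 0\<close>] by blast
    then have "\<bar>V (g (k n)) x - u x\<bar> < e" if "n \<ge> N" for n x
      using that \<open>e > 0\<close> V_outside[of x] by (cases "x \<in> {0..T}") (auto simp: u_def)
    then show ?thesis by blast
  qed
  have Vh: "\<exists>N. \<forall>n\<ge>N. \<forall>x. \<bar>V (h0 (k n)) x - u x\<bar> < e" if e: "e > 0" for e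
  proof -
    obtain N1 where N1: "\<forall>n\<ge>N1. \<forall>x. \<bar>V (g (k n)) x - u x\<bar> < e/2" using Vg[OF half_gt_zero[OF e]] by blast
    obtain N2 where N2: "1 / real (Suc N2) < e/2" using nat_approx_posE[OF half_gt_zero[OF e]] by blast
    have "\<bar>V (h0 (k n)) x - u x\<bar> < e" if "n \<ge> max N1 N2" for n x
    proof -
      have "N2 \<le> k n" using seq_suble[OF gl(2), of n] that by linarith
      then have "1 / real (Suc (k n)) \<le> 1 / real (Suc N2)" by (intro divide_left_mono) auto
      then show ?thesis using close[of "k n" x] N1[rule_format, of n x] N2 that by linarith
    qed
    then show ?thesis by blast
  qed
  have Vh_lim: "(\<lambda>n. V (h0 (k n)) x) \<longlonglongrightarrow> u x" for x
    unfolding LIMSEQ_iff using Vh by (metis real_norm_def)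
  have Vg_lim: "(\<lambda>n. V (g (k n)) x) \<longlonglongrightarrow> u x" for x
    unfolding LIMSEQ_iff using Vg by (metis real_norm_def)
  have um: "u \<in> borel_measurable borel"
    by (rule borel_measurable_LIMSEQ_real[OF Vh_lim]) (use V_measurable[OF bdd_borelD[OF hb]] in auto)
  have ug: "\<bar>u x\<bar> \<le> \<gamma>" for x
    by (rule LIMSEQ_le_const2[OF tendsto_rabs[OF Vh_lim]]) (use V_le_gamma[OF h0(1)] in auto)
  have ub: "bdd_borel (\<lambda>y. \<mu> * f (u y))" by (rule bdd_borel_f[OF um ug])
  have ueq: "u x = V (\<lambda>y. \<mu> * f (u y)) x" for x
  proof (rule LIMSEQ_unique[OF Vg_lim])
    show "(\<lambda>n. V (g (k n)) x) \<longlonglongrightarrow> V (\<lambda>y. \<mu> * f (u y)) x"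
      unfolding LIMSEQ_iff
    proof (intro allI impI)
      fix e :: real assume e: "e > 0"
      \<comment> \<open>Calibrated so that the operator bound for V applied to the error \<mu>
        \<omega> gives e/2.\<close>
      define \<omega> where "\<omega> = e / (2 * \<mu> * c * L\<^sup>2)"
      have om: "\<omega> > 0" using e mu c L_pos by (simp add: \<omega>_def)
      obtain \<delta> where d: "\<delta> > 0" "\<And>a b. \<bar>a\<bar> \<le> \<gamma> \<Longrightarrow> \<bar>b\<bar> \<le> \<gamma> \<Longrightarrow> \<bar>a - b\<bar> < \<delta> \<Longrightarrow> \<bar>f a - f b\<bar> < \<omega>"
        using F_uniform[OF om] by metis
      obtain N where N: "\<forall>n\<ge>N. \<forall>x. \<bar>V (h0 (k n)) x - u x\<bar> < \<delta>" using Vh[OF d(1)] by blast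
      have "norm (V (g (k n)) x - V (\<lambda>y. \<mu> * f (u y)) x) < e" if "n \<ge> N" for n
      proof -
        have "\<bar>g (k n) y - \<mu> * f (u y)\<bar> \<le> \<mu> * \<omega>" for y
        proof -
          have "\<bar>f (V (h0 (k n)) y) - f (u y)\<bar> < \<omega>" using N that by (intro d(2) V_le_gamma h0 ug) auto
          then show ?thesis using mu unfolding g_def right_diff_distrib[symmetric] abs_mult by simp
        qed
        then have "\<bar>V (g (k n)) x - V (\<lambda>y. \<mu> * f (u y)) x\<bar> \<le> c * ((\<mu> * \<omega>) * L\<^sup>2)"
          using mu om by (intro V_diff_le gb ub) auto
        also have "\<dots> = e / 2" using mu c L_pos by (simp add: \<omega>_def)
        finally show ?thesis using e by simp
      qed
      then show "\<exists>N. \<forall>n\<ge>N. norm (V (g (k n)) x - V (\<lambda>y. \<mu> * f (u y)) x) < e" by blast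
    qed
  qed
  have Jl: "(\<lambda>n. J (h0 (k n))) \<longlonglongrightarrow> I"
  proof (rule tendsto_sandwich[OF _ _ tendsto_const])
    show "\<forall>\<^sub>F n in sequentially. I \<le> J (h0 (k n))" using I_le h0(1) by simp
    show "\<forall>\<^sub>F n in sequentially. J (h0 (k n)) \<le> I + 1 / real (Suc (k n))" by (rule always_eventually) (use h0(2) in \<open>blast intro: less_imp_le\<close>)
    have "(\<lambda>n. 1 / real (Suc (k n))) \<longlonglongrightarrow> 0"
      using LIMSEQ_subseq_LIMSEQ[OF LIMSEQ_Suc[OF lim_1_over_n] gl(2)] by (simp add: o_def)
    then show "(\<lambda>n. I + 1 / real (Suc (k n))) \<longlonglongrightarrow> I" by (auto intro: tendsto_eq_intros)
  qed
  show thesis by (rule that[OF um ug ueq _ Jl Vh]) (use h0(1) in auto)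
qed

section \<open>Exclusion of the zero solution\<close>

lemma V_one_pos: "x \<in> {0<..<T} \<Longrightarrow> V (\<lambda>_. 1) x > 0"
  using K_one_pos c by (simp add: V_def)

lemma V_const: "V (\<lambda>_. a) x = a * V (\<lambda>_. 1) x"
proof -
  have "V (\<lambda>x. 0 + a * 1) x = V (\<lambda>_. 0) x + a * V (\<lambda>_. 1) x" by (rule V_linear) (auto intro: bdd_borel_const)
  moreover have "V (\<lambda>_. 0) x = 0" by (simp add: V_def K_def adj_def)
  ultimately show ?thesis by simp
qed

text \<open>Constant right-hand sides give positive functions of size s; their energy is quadratic
  in s, while the integral of \<open>F\<close> eventually exceeds every multiple of s^2.\<close>

lemma I_neg:
  assumes lim: "filterlim (\<lambda>t. F t / t\<^sup>2) at_top (at_right 0)"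
  shows "I < 0"
proof -
  let ?v = "V (\<lambda>_. 1)"
  have v0: "?v x \<ge> 0" for x using V_one_pos[of x] V_outside[of x] by (cases "x \<in> {0<..<T}") auto
  define vm where "vm = c * (1 * L\<^sup>2)"
  have vm: "?v x \<le> vm" for x using V_bound[OF bdd_borel_const, of 1 1 x] by (simp add: vm_def)
  have vm0: "vm > 0" using c L_pos by (simp add: vm_def)
  define a where "a = (LINT x:{0<..<T}|lborel. (?v x)\<^sup>2)"
  have vmeas [measurable]: "?v \<in> borel_measurable borel" by measurable
  have iv: "set_integrable lborel {0<..<T} (\<lambda>x. (?v x)\<^sup>2)"
  proof -
    have "\<bar>indicator {0<..<T} x *\<^sub>R (?v x)\<^sup>2\<bar> \<le> vm\<^sup>2" for x using v0 vm by (auto simp: indicator_def power_mono)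
    then show ?thesis unfolding set_integrable_def
      by (intro integrable_bounded_support(1)[where a=0 and b=T and C="vm\<^sup>2"]) (auto simp: indicator_def)
  qed
  have a: "a > 0" unfolding a_def set_lebesgue_integral_def
    by (rule lebesgue_integral_pos[of _ 0 T])
      (use iv T less_imp_neq[OF V_one_pos] in \<open>auto simp: set_integrable_def indicator_def\<close>)
  define e1 where "e1 = E (\<lambda>_. 1) (\<lambda>_. 1)"
  have e1: "e1 \<ge> 0" by (simp add: e1_def E_nonneg)
  \<comment> \<open>With this slope the gain from \<open>F\<close> is at least s^2 (e1 + 1), more
    than the energy part s^2 e1 / 2.\<close>
  define Z where "Z = (e1 + 1) / (\<mu> * a)"
  have "\<forall>\<^sub>F t in at_right 0. Z \<le> F t / t\<^sup>2" using lim by (simp add: filterlim_at_top)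
  then obtain d where d: "d > 0" "\<And>t. 0 < t \<Longrightarrow> t < d \<Longrightarrow> Z \<le> F t / t\<^sup>2" by (auto simp: eventually_at_right_field)
  \<comment> \<open>The first bound keeps the values of V below d, the second keeps the constant in
    the energy ball.\<close>
  define s where "s = min (d / (2 * vm)) (sqrt (2 * r / (e1 + 1)))"
  have s: "s > 0" using d vm0 r_pos e1 by (simp add: s_def)
  have "s \<le> d / (2 * vm)" by (simp add: s_def)
  then have sd: "s * vm < d" using vm0 d by (simp add: pos_le_divide_eq mult_ac)
  have Es: "E (\<lambda>_. s) (\<lambda>_. s) = s\<^sup>2 * e1"
  proof -
    have "E (\<lambda>x. 0 + s * 1) (\<lambda>x. 0 + s * 1) = E (\<lambda>_. 0) (\<lambda>_. 0) + 2 * s * E (\<lambda>_. 0) (\<lambda>_. 1) + s\<^sup>2 * e1"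
      unfolding e1_def by (rule E_quadratic) (auto intro: bdd_borel_const)
    moreover have "adj (\<lambda>_. 0) z = 0" for z by (simp add: adj_def)
    ultimately show ?thesis by (simp add: E_def)
  qed
  have "s\<^sup>2 \<le> (sqrt (2 * r / (e1 + 1)))\<^sup>2" using s by (intro power_mono) (auto simp: s_def)
  also have "\<dots> = 2 * r / (e1 + 1)" using r_pos e1 by simp
  finally have "s\<^sup>2 * (e1 + 1) \<le> 2 * r" using e1 by (simp add: pos_le_divide_eq)
  then have "s\<^sup>2 * e1 \<le> 2 * r" using zero_le_power2[of s] unfolding distrib_left by linarith
  then have sB: "(\<lambda>_. s) \<in> B" using Es by (simp add: B_def bdd_borel_const)
  have "(LINT x:{0<..<T}|lborel. (Z * s\<^sup>2) * (?v x)\<^sup>2) \<le> (LINT x:{0<..<T}|lborel. F (V (\<lambda>_. s) x))"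
  proof (rule set_integral_mono[OF set_integrable_mult_right[OF iv] integrable_F_V[OF sB]])
    fix x assume x: "x \<in> {0<..<T}"
    have sv: "0 < s * ?v x" using s V_one_pos[OF x] by simp
    have "s * ?v x \<le> s * vm" using s vm by (intro mult_left_mono) auto
    then have "Z \<le> F (s * ?v x) / (s * ?v x)\<^sup>2" using sd sv by (intro d(2)) auto
    then have "Z * (s * ?v x)\<^sup>2 \<le> F (s * ?v x)" using iffD1[OF pos_le_divide_eq[OF zero_less_power[OF sv]]] by blast
    then show "(Z * s\<^sup>2) * (?v x)\<^sup>2 \<le> F (V (\<lambda>_. s) x)" by (simp add: V_const[of s] power_mult_distrib mult_ac)
  qed
  then have "Z * s\<^sup>2 * a \<le> (LINT x:{0<..<T}|lborel. F (V (\<lambda>_. s) x))" by (simp add: a_def)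
  then have "\<mu> * (Z * s\<^sup>2 * a) \<le> \<mu> * (LINT x:{0<..<T}|lborel. F (V (\<lambda>_. s) x))" using mu by (intro mult_left_mono) auto
  moreover have "\<mu> * (Z * s\<^sup>2 * a) = s\<^sup>2 * (e1 + 1)" using mu a by (simp add: Z_def)
  ultimately have "J (\<lambda>_. s) \<le> s\<^sup>2 * e1 / 2 - s\<^sup>2 * (e1 + 1)" by (simp add: J_def Es)
  also have "\<dots> = - s\<^sup>2 * (e1 / 2 + 1)" by (simp add: algebra_simps)
  also have "\<dots> < 0" using s e1 by (simp add: mult_pos_pos)
  finally show ?thesis using I_le[OF sB] by simp
qed

theorem nontrivial_fixed_point:
  assumes "f 0 \<noteq> 0 \<or> filterlim (\<lambda>t. F t / t\<^sup>2) at_top (at_right 0)"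
  obtains u where "u \<in> borel_measurable borel" "\<And>x. \<bar>u x\<bar> \<le> \<gamma>" "\<And>x. u x = V (\<lambda>y. \<mu> * f (u y)) x"
    "\<exists>t\<in>{0..T}. u t \<noteq> 0"
proof -
  obtain u h where u: "u \<in> borel_measurable borel" "\<And>x. \<bar>u x\<bar> \<le> \<gamma>" "\<And>x. u x = V (\<lambda>y. \<mu> * f (u y)) x"
    and h: "\<And>n. h n \<in> B" "(\<lambda>n. J (h n)) \<longlonglongrightarrow> I" "\<And>e. e > 0 \<Longrightarrow> \<exists>N. \<forall>n\<ge>N. \<forall>x. \<bar>V (h n) x - u x\<bar> < e"
    using minimising_limit by metis
  have "\<exists>t\<in>{0..T}. u t \<noteq> 0"
  proof (rule ccontr)
    assume "\<not> ?thesis"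
    then have "u x = 0" for x using u(3)[of x] V_outside[of x] by (cases "x \<in> {0..T}") auto
    then have u0: "u = (\<lambda>_. 0)" by auto
    show False using assms
    proof
      assume "f 0 \<noteq> 0"
      have "T / 2 \<in> {0<..<T}" using T by simp
      from V_one_pos[OF this] have "\<mu> * f 0 * V (\<lambda>_. 1) (T / 2) \<noteq> 0" using mu \<open>f 0 \<noteq> 0\<close> by simp
      moreover have "0 = V (\<lambda>y. \<mu> * f 0) (T/2)" using u(3)[of "T/2"] by (simp add: u0)
      ultimately show False using V_const[of "\<mu> * f 0" "T/2"] by simp
    next
      assume "filterlim (\<lambda>t. F t / t\<^sup>2) at_top (at_right 0)"
      then have I: "I < 0" by (rule I_neg)
      \<comment> \<open>If the limit is 0 then V(h n) tends to 0 uniformly, so \<open>F\<close> of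
        it drops below m and the action is at least - \<mu> m T = I/2 > I. The nonnegative energy is
        just discarded; no convergence of the h n is needed.\<close>
      define m where "m = - I / (2 * \<mu> * T)"
      have m: "m > 0" using I mu T by (simp add: m_def field_simps)
      have "isCont F 0" using DERIV_F DERIV_isCont by blast
      then obtain d where d: "d > 0" "\<And>\<xi>. \<bar>\<xi>\<bar> < d \<Longrightarrow> \<bar>F \<xi>\<bar> < m"
        unfolding continuous_at_eps_delta using m by (auto simp: dist_real_def F0)
      obtain N where N: "\<And>n x. n \<ge> N \<Longrightarrow> \<bar>V (h n) x\<bar> < d" using h(3)[OF d(1)] unfolding u0 by auto
      have "I / 2 \<le> J (h n)" if "n \<ge> N" for n
      proof -
        have "E (h n) (h n) / 2 - \<mu> * (m * T) \<le> J (h n)"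
          by (rule J_ge[OF h(1)]) (use d(2)[OF N[OF that]] in \<open>auto simp: abs_less_iff less_imp_le\<close>)
        moreover have "\<mu> * (m * T) = - I / 2" using mu T by (simp add: m_def)
        ultimately show ?thesis using E_nonneg[of "h n"] by linarith
      qed
      then have "I / 2 \<le> I" by (intro LIMSEQ_le_const[OF h(2)]) blast
      then show False using I by simp
    qed
  qed
  with u that show thesis by blast
qed

end

section \<open>The Riesz potential of the derivative\<close>

lemma absolutely_integrable_of_set_integrable:
  fixes f :: "real \<Rightarrow> real"
  assumes "set_integrable lborel S f" shows "f absolutely_integrable_on S"
  using assms integrable_completion[of "\<lambda>x. indicator S x *\<^sub>R f x" lborel]
    borel_measurable_integrable[of lborel "\<lambda>x. indicator S x *\<^sub>R f x"]
  unfolding set_integrable_def by blast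

text \<open>The substitution \<open>w = (z - t)(b - s) / ((z - s)(b - t))\<close> turns the integral into a Beta integral.\<close>

lemma riesz_kernel_factorisation_less:
  assumes a: "1/2 < \<alpha>" "\<alpha> < 1" and st: "s < t" "t < (b::real)"
  shows "set_integrable lborel {t<..<b} (\<lambda>z. (z - s) powr (-\<alpha>) * (z - t) powr (-\<alpha>) * (b - z) powr (2*\<alpha>-2))"
    "(LINT z:{t<..<b}|lborel. (z - s) powr (-\<alpha>) * (z - t) powr (-\<alpha>) * (b - z) powr (2*\<alpha>-2))
      = Beta (2*\<alpha>-1) (1-\<alpha>) * ((b - s) powr (\<alpha>-1) * (b - t) powr (\<alpha>-1) * (t - s) powr (1-2*\<alpha>))"
proof -
  let ?w = "\<lambda>z. (z - t) * (b - s) / ((z - s) * (b - t))"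
  let ?w' = "\<lambda>z. (b - s) * (t - s) / ((b - t) * (z - s)\<^sup>2)"
  let ?f = "\<lambda>w. (1 - w) powr ((2*\<alpha>-1)-1) * w powr ((1-\<alpha>)-1)"
  let ?i = "\<lambda>z. (z - s) powr (-\<alpha>) * (z - t) powr (-\<alpha>) * (b - z) powr (2*\<alpha>-2)"
  let ?k = "(b - s) powr (1-\<alpha>) * (b - t) powr (1-\<alpha>) * (t - s) powr (2*\<alpha>-1)"
  let ?B = "Beta (2*\<alpha>-1) (1-\<alpha>)"
  have bf: "set_integrable lborel {0<..<1} ?f" "(LINT w:{0<..<1}|lborel. ?f w) = ?B"
    using beta_integral_unit[of "2*\<alpha>-1" "1-\<alpha>"] a by auto
  have img: "?w ` {t<..<b} = {0<..<1}"
  proof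
    show "?w ` {t<..<b} \<subseteq> {0<..<1}"
    proof
      fix w assume "w \<in> ?w ` {t<..<b}"
      then obtain z where z: "t < z" "z < b" "w = ?w z" by auto
      have "(z - s) * (b - t) - (z - t) * (b - s) = (b - z) * (t - s)" by (simp add: algebra_simps)
      moreover have "(b - z) * (t - s) > 0" using z st by simp
      ultimately have "(z - t) * (b - s) < (z - s) * (b - t)" by linarith
      then show "w \<in> {0<..<1}" using z st by simp
    qed
    show "{0<..<1} \<subseteq> ?w ` {t<..<b}"
    proof
      fix w :: real assume w: "w \<in> {0<..<1}"
      define D where "D = (b - s) - w * (b - t)"
      have "w * (b - t) < 1 * (b - t)" using w st by (intro mult_strict_right_mono) auto
      also have "1 * (b - t) < b - s" using st by simp
      finally have D: "D > 0" by (simp add: D_def)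
      \<comment> \<open>The inverse of the Moebius map; \<open>D\<close> is positive because w < 1
        and b-t < b-s.\<close>
      define z where "z = (t * (b - s) - w * s * (b - t)) / D"
      have e1: "z - t = w * (b - t) * (t - s) / D" and e2: "b - z = (1 - w) * (b - t) * (b - s) / D"
        and e3: "z - s = (t - s) * (b - s) / D"
        using D unfolding z_def by (simp_all add: divide_simps) (simp_all add: D_def algebra_simps)
      have "z - t > 0" "b - z > 0" unfolding e1 e2 using w st D by simp_all
      moreover have "?w z = w" unfolding e1 e3 using D st by simp
      ultimately show "w \<in> ?w ` {t<..<b}" by (intro image_eqI[of _ _ z]) auto
    qed
  qed
  have inj: "inj_on ?w {t<..<b}"
  proof (rule inj_onI)
    fix x y assume x: "x \<in> {t<..<b}" and y: "y \<in> {t<..<b}" and "?w x = ?w y"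
    then have "((x - t) * (y - s)) * ((b - s) * (b - t)) = ((y - t) * (x - s)) * ((b - s) * (b - t))"
      using st by (simp add: divide_simps mult_ac split: if_splits)
    moreover have "(b - s) * (b - t) \<noteq> 0" using st by simp
    ultimately have "(x - t) * (y - s) = (y - t) * (x - s)" by (metis mult_right_cancel)
    then have "(x - y) * (t - s) = 0" by (simp add: algebra_simps)
    then show "x = y" using st by simp
  qed
  have der: "(?w has_field_derivative ?w' z) (at z within {t<..<b})" if z: "z \<in> {t<..<b}" for z
  proof -
    have "(?w has_field_derivative (1 * (b - s) * ((z - s) * (b - t)) - (z - t) * (b - s) * (1 * (b - t))) / ((z - s) * (b - t) * ((z - s) * (b - t)))) (at z within {t<..<b})"
      using z st by (intro DERIV_divide DERIV_cmult_right) (auto intro!: derivative_eq_intros)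
    moreover have "(1 * (b - s) * ((z - s) * (b - t)) - (z - t) * (b - s) * (1 * (b - t))) / ((z - s) * (b - t) * ((z - s) * (b - t))) = ?w' z"
      using z st by (simp add: divide_simps power2_eq_square) (simp add: algebra_simps)
    ultimately show ?thesis by simp
  qed
  have id: "\<bar>?w' z\<bar> * ?f (?w z) = ?k * ?i z" if z: "z \<in> {t<..<b}" for z
  proof -
    have "(z - s) * (b - t) - (z - t) * (b - s) = (b - z) * (t - s)" by (simp add: algebra_simps)
    moreover have "(z - s) * (b - t) \<noteq> 0" using z st by simp
    ultimately have w1: "1 - ?w z = (b - z) * (t - s) / ((z - s) * (b - t))"
      by (metis diff_divide_distrib divide_self)
    have e: "z - s = exp (ln (z - s))" "z - t = exp (ln (z - t))" "b - z = exp (ln (b - z))"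
      "b - s = exp (ln (b - s))" "b - t = exp (ln (b - t))" "t - s = exp (ln (t - s))"
      using z st by simp_all
    define x1 x2 x3 x4 x5 x6 where x: "x1 = ln (z - s)" "x2 = ln (z - t)" "x3 = ln (b - z)"
      "x4 = ln (b - s)" "x5 = ln (b - t)" "x6 = ln (t - s)"
    note e = e[folded x]
    show ?thesis unfolding w1 unfolding e
      by (simp add: powr_def exp_add[symmetric] exp_diff[symmetric] power2_eq_square) (simp add: algebra_simps)
  qed
  have "(\<lambda>z. \<bar>?w' z\<bar> * ?f (?w z)) absolutely_integrable_on {t<..<b} \<and> integral {t<..<b} (\<lambda>z. \<bar>?w' z\<bar> * ?f (?w z)) = ?B
    \<longleftrightarrow> ?f absolutely_integrable_on (?w ` {t<..<b}) \<and> integral (?w ` {t<..<b}) ?f = ?B"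
    by (rule has_absolute_integral_change_of_variables_1'[OF _ der inj]) auto
  then have A: "(\<lambda>z. \<bar>?w' z\<bar> * ?f (?w z)) absolutely_integrable_on {t<..<b}" "integral {t<..<b} (\<lambda>z. \<bar>?w' z\<bar> * ?f (?w z)) = ?B"
    unfolding img using absolutely_integrable_of_set_integrable[OF bf(1)] set_borel_integral_eq_integral(2)[OF bf(1)] bf(2) by auto
  have "((\<lambda>z. \<bar>?w' z\<bar> * ?f (?w z)) has_integral ?B) {t<..<b}"
    using integrable_integral[OF set_lebesgue_integral_eq_integral(1)[OF A(1)]] unfolding A(2) .
  then have "((\<lambda>z. ?k * ?i z) has_integral ?B) {t<..<b}"
    by (rule has_integral_eq[rotated]) (use id in auto)
  then have "((\<lambda>z. (1 / ?k) * (?k * ?i z)) has_integral (1 / ?k) * ?B) {t<..<b}" by (rule has_integral_mult_right)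
  then have H: "(?i has_integral (1 / ?k) * ?B) {t<..<b}" using st by simp
  show "set_integrable lborel {t<..<b} ?i" by (rule set_integral_of_has_integral_nonneg(1)[OF H]) auto
  have "(LINT z:{t<..<b}|lborel. ?i z) = (1 / ?k) * ?B" by (rule set_integral_of_has_integral_nonneg(2)[OF H]) auto
  also have "1 / ?k = (b - s) powr (\<alpha>-1) * (b - t) powr (\<alpha>-1) * (t - s) powr (1-2*\<alpha>)"
    using powr_minus_divide[of "b-s" "1-\<alpha>"] powr_minus_divide[of "b-t" "1-\<alpha>"] powr_minus_divide[of "t-s" "2*\<alpha>-1"] by simp
  finally show "(LINT z:{t<..<b}|lborel. ?i z)
      = ?B * ((b - s) powr (\<alpha>-1) * (b - t) powr (\<alpha>-1) * (t - s) powr (1-2*\<alpha>))" by simp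
qed

text \<open>Splits the two-sided kernel |t-s| into one-sided kernels based at a common point z > max
  s t. A Riesz potential thereby becomes two successive Abel operators with a weight between them,
  and each can be inverted separately.\<close>

lemma riesz_kernel_factorisation:
  assumes a: "1/2 < \<alpha>" "\<alpha> < 1" and st: "s \<noteq> t" "s < b" "t < (b::real)"
  shows "set_integrable lborel {max s t<..<b} (\<lambda>z. (z - s) powr (-\<alpha>) * (z - t) powr (-\<alpha>) * (b - z) powr (2*\<alpha>-2))"
    "(LINT z:{max s t<..<b}|lborel. (z - s) powr (-\<alpha>) * (z - t) powr (-\<alpha>) * (b - z) powr (2*\<alpha>-2))
      = Beta (2*\<alpha>-1) (1-\<alpha>) * ((b - s) powr (\<alpha>-1) * (b - t) powr (\<alpha>-1) * \<bar>t - s\<bar> powr (1-2*\<alpha>))"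
proof -
  consider "s < t" | "t < s" using st by linarith
  then have "set_integrable lborel {max s t<..<b} (\<lambda>z. (z - s) powr (-\<alpha>) * (z - t) powr (-\<alpha>) * (b - z) powr (2*\<alpha>-2)) \<and>
    (LINT z:{max s t<..<b}|lborel. (z - s) powr (-\<alpha>) * (z - t) powr (-\<alpha>) * (b - z) powr (2*\<alpha>-2))
      = Beta (2*\<alpha>-1) (1-\<alpha>) * ((b - s) powr (\<alpha>-1) * (b - t) powr (\<alpha>-1) * \<bar>t - s\<bar> powr (1-2*\<alpha>))"
  proof cases
    case 1 then show ?thesis using riesz_kernel_factorisation_less[OF a 1 st(3)] by (simp add: max_def)
  next
    case 2 then show ?thesis using riesz_kernel_factorisation_less[OF a 2 st(2)] by (simp add: max_def mult_ac)
  qed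
  then show "set_integrable lborel {max s t<..<b} (\<lambda>z. (z - s) powr (-\<alpha>) * (z - t) powr (-\<alpha>) * (b - z) powr (2*\<alpha>-2))"
    "(LINT z:{max s t<..<b}|lborel. (z - s) powr (-\<alpha>) * (z - t) powr (-\<alpha>) * (b - z) powr (2*\<alpha>-2))
      = Beta (2*\<alpha>-1) (1-\<alpha>) * ((b - s) powr (\<alpha>-1) * (b - t) powr (\<alpha>-1) * \<bar>t - s\<bar> powr (1-2*\<alpha>))" by auto
qed

text \<open>Excludes \<alpha> = 1, where the Abel order 1-\<alpha> degenerates. The goal is that the
  Riesz potential of \<open>U h\<close> has a negative multiple of \<open>h\<close> as its
  derivative.\<close>

locale riesz_flux = fractional_dirichlet +
  fixes h :: "real \<Rightarrow> real"
  assumes alpha1: "\<alpha> < 1" and h: "bdd_borel h" and hc: "continuous_on UNIV h"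
begin

text \<open>\<open>mr\<close> is the density \<open>(T - z)\<^sup>-\<^sup>\<alpha> A\<^sup>* h(z)\<close> as a function of the distance \<open>T - z\<close>; \<open>M\<close> is its primitive in \<open>z\<close>.\<close>

definition mr :: "real \<Rightarrow> real" where
  "mr t = (LINT \<sigma>:{0<..<1}|lborel. (1 - \<sigma>) powr (\<alpha>-1) * (\<sigma> powr \<alpha> * h (T - t * \<sigma>)))"

definition M :: "real \<Rightarrow> real" where "M z = (LINT s:{0<..<z}|lborel. mr (T - s))"

text \<open>The factor produced when Abel operators of the complementary orders 1-\<alpha> and
  \<alpha> compose to plain integration.\<close>

definition B1 :: real where "B1 = Beta (1-\<alpha>) \<alpha>"

lemma hm [measurable]: "h \<in> borel_measurable borel" by (rule bdd_borelD[OF h])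

lemma mr_integrable: "set_integrable lborel {0<..<1} (\<lambda>\<sigma>. (1 - \<sigma>) powr (\<alpha>-1) * (\<sigma> powr \<alpha> * h (T - t * \<sigma>)))"
  and mr_bound: "\<And>H. (\<And>x. \<bar>h x\<bar> \<le> H) \<Longrightarrow> \<bar>mr t\<bar> \<le> H * Beta \<alpha> (\<alpha>+1)"
  and mr_cont: "continuous_on UNIV mr"
proof -
  obtain H where H: "H \<ge> 0" "\<And>x. \<bar>h x\<bar> \<le> H" using bdd_borelE[OF h] by blast
  have b: "\<bar>(1 - \<sigma>) powr (\<alpha>-1) * (\<sigma> powr \<alpha> * h (T - t * \<sigma>))\<bar> \<le> H' * ((1 - \<sigma>) powr (\<alpha>-1) * \<sigma> powr ((\<alpha>+1)-1))"
    if "\<And>x. \<bar>h x\<bar> \<le> H'" for \<sigma> t H'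
    using mult_left_mono[OF that[of "T - t*\<sigma>"], of "(1 - \<sigma>) powr (\<alpha>-1) * \<sigma> powr \<alpha>"] by (simp add: abs_mult mult_ac)
  note i = set_integrable_mult_right[OF beta_integral_unit(1)[of \<alpha> "\<alpha>+1"]]
  show 1: "set_integrable lborel {0<..<1} (\<lambda>\<sigma>. (1 - \<sigma>) powr (\<alpha>-1) * (\<sigma> powr \<alpha> * h (T - t * \<sigma>)))" for t
    by (rule set_integrable_bound[OF i[of H]])
      (use alpha b[OF H(2)] in \<open>auto simp: set_borel_measurable_def intro!: AE_I2 order.trans[OF b[OF H(2)]]\<close>)
  show "\<bar>mr t\<bar> \<le> H' * Beta \<alpha> (\<alpha>+1)" if "\<And>x. \<bar>h x\<bar> \<le> H'" for H'
  proof -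
    have "\<bar>mr t\<bar> \<le> (LINT \<sigma>:{0<..<1}|lborel. \<bar>(1 - \<sigma>) powr (\<alpha>-1) * (\<sigma> powr \<alpha> * h (T - t * \<sigma>))\<bar>)"
      unfolding mr_def using set_integral_norm_bound[OF 1] by simp
    also have "\<dots> \<le> (LINT \<sigma>:{0<..<1}|lborel. H' * ((1 - \<sigma>) powr (\<alpha>-1) * \<sigma> powr ((\<alpha>+1)-1)))"
      by (rule set_integral_mono[OF set_integrable_abs[OF 1] i b[OF that]]) (use alpha in auto)
    also have "\<dots> = H' * Beta \<alpha> (\<alpha>+1)" using beta_integral_unit(2)[of \<alpha> "\<alpha>+1"] alpha by simp
    finally show ?thesis .
  qed
  show "continuous_on UNIV mr"
    unfolding mr_def[abs_def] set_lebesgue_integral_def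
  proof (rule continuous_on_integral_dominated[where w="\<lambda>\<sigma>. indicator {0<..<1} \<sigma> *\<^sub>R (H * ((1 - \<sigma>) powr (\<alpha>-1) * \<sigma> powr ((\<alpha>+1)-1)))"])
    show "integrable lborel (\<lambda>\<sigma>. indicator {0<..<1} \<sigma> *\<^sub>R (H * ((1 - \<sigma>) powr (\<alpha>-1) * \<sigma> powr ((\<alpha>+1)-1))))"
      using i[of H] alpha unfolding set_integrable_def by simp
    show "AE \<sigma> in lborel. \<bar>indicator {0<..<1} \<sigma> *\<^sub>R ((1 - \<sigma>) powr (\<alpha>-1) * (\<sigma> powr \<alpha> * h (T - t * \<sigma>)))\<bar>
        \<le> indicator {0<..<1} \<sigma> *\<^sub>R (H * ((1 - \<sigma>) powr (\<alpha>-1) * \<sigma> powr ((\<alpha>+1)-1)))" for t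
      by (rule AE_I2) (use b[OF H(2)] in \<open>auto simp: indicator_def\<close>)
    show "AE \<sigma> in lborel. continuous_on UNIV (\<lambda>t. indicator {0<..<1} \<sigma> *\<^sub>R ((1 - \<sigma>) powr (\<alpha>-1) * (\<sigma> powr \<alpha> * h (T - t * \<sigma>))))"
      by (rule AE_I2) (intro continuous_intros continuous_on_compose2[OF hc], auto)
  qed measurable
qed

lemma mr_measurable [measurable]: "mr \<in> borel_measurable borel"
  by (rule borel_measurable_continuous_onI[OF mr_cont])

text \<open>Rescaling (z,T) to the unit interval extracts the vanishing order \<alpha> at T; the
  remaining average is continuous on the whole line.\<close>

lemma adj_eq_mr:
  assumes z: "z \<in> {0<..<T}" shows "adj h z = (T - z) powr \<alpha> * mr (T - z)"
proof -
  have "adj h z = (LINT y:{z<..<T}|lborel. (T - z) powr (-\<alpha>) * ((y - z) powr (\<alpha>-1) * ((T - y) powr \<alpha> * h y)))"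
    unfolding adj_def set_lebesgue_integral_def
    by (rule Bochner_Integration.integral_cong) (use z in \<open>auto simp: ker_def indicator_def\<close>)
  also have "\<dots> = (T - z) powr (-\<alpha>) * (LINT y:{z<..<T}|lborel. (y - z) powr (\<alpha>-1) * ((T - y) powr \<alpha> * h y))" by simp
  also have "(LINT y:{z<..<T}|lborel. (y - z) powr (\<alpha>-1) * ((T - y) powr \<alpha> * h y)) = abel \<alpha> (\<lambda>s. s powr \<alpha> * h (T - s)) (T - z)"
    by (subst set_integral_reflect(2)[where t=T]) (simp add: abel_def algebra_simps)
  also have "\<dots> = (T - z) powr \<alpha> * (LINT \<sigma>:{0<..<1}|lborel. (1 - \<sigma>) powr (\<alpha>-1) * (((T - z) * \<sigma>) powr \<alpha> * h (T - (T - z) * \<sigma>)))"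
    using z by (subst abel_scale) auto
  also have "(LINT \<sigma>:{0<..<1}|lborel. (1 - \<sigma>) powr (\<alpha>-1) * (((T - z) * \<sigma>) powr \<alpha> * h (T - (T - z) * \<sigma>)))
     = (LINT \<sigma>:{0<..<1}|lborel. (T - z) powr \<alpha> * ((1 - \<sigma>) powr (\<alpha>-1) * (\<sigma> powr \<alpha> * h (T - (T - z) * \<sigma>))))"
    by (rule set_lebesgue_integral_cong) (use z in \<open>auto simp: powr_mult\<close>)
  also have "\<dots> = (T - z) powr \<alpha> * mr (T - z)" by (simp add: mr_def)
  finally show ?thesis using z by (simp add: powr_minus_divide)
qed

abbreviation m :: "real \<Rightarrow> real" where "m \<equiv> \<lambda>z. mr (T - z)"

text \<open>The singular weight at T in \<open>ker\<close> cancels the vanishing factor of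
  \<open>adj h\<close>, leaving an ordinary Abel integral of a continuous function.\<close>

lemma K_eq_abel:
  assumes x: "x \<in> {0<..<T}" shows "K h x = (T - x) powr \<alpha> * abel \<alpha> m x"
proof -
  have "K h x = (LINT z:{0<..<x}|lborel. (T - x) powr \<alpha> * ((x - z) powr (\<alpha>-1) * m z))"
    unfolding K_def set_lebesgue_integral_def
  proof (rule Bochner_Integration.integral_cong)
    show "ker x z * adj h z = indicator {0<..<x} z *\<^sub>R ((T - x) powr \<alpha> * ((x - z) powr (\<alpha>-1) * m z))" for z
    proof (cases "z \<in> {0<..<x}")
      case True
      then have "(T - z) powr (-\<alpha>) * (T - z) powr \<alpha> = 1" using x by (simp add: powr_minus_divide)
      then show ?thesis using True x adj_eq_mr[of z] by (simp add: ker_def)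
    qed (auto simp: ker_def)
  qed simp
  then show ?thesis by (simp add: abel_def)
qed

lemma m_bounded: obtains C where "C \<ge> 0" "\<And>z. \<bar>m z\<bar> \<le> C"
proof -
  obtain H where H: "H \<ge> 0" "\<And>x. \<bar>h x\<bar> \<le> H" using bdd_borelE[OF h] by blast
  show thesis by (rule that[OF _ mr_bound[OF H(2)]]) (use H alpha Beta_pos[of \<alpha> "\<alpha>+1"] in auto)
qed

lemma m_measurable [measurable]: "m \<in> borel_measurable borel" by measurable

lemma DERIV_M: "z > 0 \<Longrightarrow> (M has_real_derivative m z) (at z)"
proof -
  assume z: "z > 0"
  obtain C where C: "C \<ge> 0" "\<And>z. \<bar>m z\<bar> \<le> C" using m_bounded by blast
  show ?thesis unfolding M_def[abs_def]
    by (rule DERIV_indefinite_integral[where T="z+1"])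
      (use z C in \<open>auto intro!: integrable_Ioo_bounded[of m _ _ C] continuous_on_compose2[OF mr_cont] continuous_intros\<close>)
qed

lemma M_nonpos: "z \<le> 0 \<Longrightarrow> M z = 0" by (simp add: M_def set_lebesgue_integral_def)

lemma M_lipschitz: obtains C where "C \<ge> 0" "\<And>x. 0 \<le> x \<Longrightarrow> \<bar>M x\<bar> \<le> C * x"
proof -
  obtain C where C: "C \<ge> 0" "\<And>z. \<bar>m z\<bar> \<le> C" using m_bounded by blast
  have "\<bar>M x\<bar> \<le> C * (x - 0)" if "0 \<le> x" for x unfolding M_def set_lebesgue_integral_def
    by (rule integrable_bounded_support(2)) (use C that in \<open>auto simp: indicator_def\<close>)
  then show thesis using that[OF C(1)] by simp
qed

lemma M_cont: "continuous_on {0..} M"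
  unfolding continuous_on_eq_continuous_within
proof
  fix x :: real assume x: "x \<in> {0..}"
  show "continuous (at x within {0..}) M"
  proof (cases "x = 0")
    case False
    then show ?thesis using x DERIV_isCont[OF DERIV_M[of x]] continuous_at_imp_continuous_at_within by auto
  next
    case True
    obtain C where C: "C \<ge> 0" "\<And>x. 0 \<le> x \<Longrightarrow> \<bar>M x\<bar> \<le> C * x" using M_lipschitz by blast
    have l: "((\<lambda>x. C * x) \<longlongrightarrow> 0) (at 0 within {0..})" by (auto intro!: tendsto_eq_intros)
    have "(M \<longlongrightarrow> 0) (at 0 within {0..})"
      by (rule Lim_null_comparison[OF _ l]) (use C in \<open>auto simp: eventually_at_filter\<close>)
    then show ?thesis using True by (simp add: continuous_within M_nonpos)
  qed
qed

lemma M_measurable [measurable]: "M \<in> borel_measurable borel"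
proof -
  have "M = abel 1 m" by (auto simp: M_def abel_one fun_eq_iff)
  then show ?thesis by simp
qed


section \<open>Two successive Abel inversions\<close>

definition bU :: "real \<Rightarrow> real" where "bU s = (T - s) powr (1-\<alpha>) * U h s"

lemma bU_measurable [measurable]: "bU \<in> borel_measurable borel" unfolding bU_def by measurable

lemma U_wt_bound: obtains C where "C \<ge> 0" "\<And>s. s \<in> {0<..<T} \<Longrightarrow> \<bar>U h s\<bar> \<le> C * wt s"
proof -
  obtain H where H: "H \<ge> 0" "\<And>x. \<bar>h x\<bar> \<le> H" using bdd_borelE[OF h] by blast
  show thesis by (rule that[OF _ U_bound(2)[OF h H]]) (use H cU_nonneg in auto)
qed

lemma U_integrable_sub: "0 < Z \<Longrightarrow> Z \<le> T \<Longrightarrow> set_integrable lborel {0<..<Z} (U h)"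
  by (rule set_integrable_subset[OF integrable_U(1)[OF h]]) auto

lemma bU_integrable: "0 < Z \<Longrightarrow> Z \<le> T \<Longrightarrow> set_integrable lborel {0<..<Z} bU"
  unfolding bU_def[abs_def]
  by (rule set_integrable_bounded_mult[OF U_integrable_sub, where C="T powr (1-\<alpha>)"])
    (use alpha in \<open>auto intro!: powr_mono2\<close>)

lemma m_integrable: "set_integrable lborel {a<..<b} m"
proof -
  obtain C where "\<And>z. \<bar>m z\<bar> \<le> C" using m_bounded by blast
  then show ?thesis by (intro integrable_Ioo_bounded[of m a b C]) auto
qed

text \<open>Integration by parts moves the derivative from \<open>K h\<close> to the powers, and
  both boundary terms of \<open>?L\<close> vanish. At order 1-\<alpha> this would leave the
  nonintegrable exponent -1-\<alpha>, so the identity is established one order higher and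
  differentiated afterwards.\<close>

lemma abel_bU:
  assumes Z: "Z \<in> {0<..<T}"
  shows "abel (2-\<alpha>) bU Z = (1-\<alpha>) * ((T - Z) * (B1 * M Z) + 2 * ((1-\<alpha>) * B1 * abel 1 M Z))"
proof -
  let ?a = "abel \<alpha> m"
  have q: "set_integrable lborel {0<..<Z} (\<lambda>s. (Z - s) powr (1 - \<alpha> + \<alpha> - 1) * m s)"
    by (subst set_integrable_cong[OF refl refl, of _ _ m]) (auto intro: m_integrable)
  have q2: "set_integrable lborel {0<..<Z} (\<lambda>s. (Z - s) powr (2 - \<alpha> + \<alpha> - 1) * m s)"
    by (rule set_integrable_bounded_mult[OF m_integrable, where C=Z]) auto
  note A1 = abel_abel[of "1-\<alpha>" \<alpha> m Z, OF _ _ m_measurable q]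
  note A2 = abel_abel[of "2-\<alpha>" \<alpha> m Z, OF _ _ m_measurable q2]
  have a1: "abel (1-\<alpha>) ?a Z = B1 * M Z" using A1(2) alpha alpha1 by (simp add: B1_def M_def abel_one)
  have "(1 - \<alpha> + \<alpha>) * Beta (1 - \<alpha> + 1) \<alpha> = (1 - \<alpha>) * Beta (1 - \<alpha>) \<alpha>"
    by (rule Beta_plus1_left) (use alpha1 in \<open>auto elim!: nonpos_Ints_cases\<close>)
  then have b2: "Beta (2-\<alpha>) \<alpha> = (1-\<alpha>) * B1" by (simp add: B1_def)
  have q3: "set_integrable lborel {0<..<Z} (\<lambda>s. (Z - s) powr (1 + 1 - 1) * m s)"
    by (rule set_integrable_bounded_mult[OF m_integrable, where C=Z]) auto
  have M1: "abel 1 M Z = abel 2 m Z"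
  proof -
    have "M = abel 1 m" by (auto simp: M_def abel_one fun_eq_iff)
    then show ?thesis using abel_abel(2)[OF _ _ m_measurable q3] Beta_1_right[of 1] by simp
  qed
  have a2: "abel (2-\<alpha>) ?a Z = (1-\<alpha>) * B1 * abel 1 M Z" using A2(2) alpha alpha1 b2 M1 by simp
  have i1: "set_integrable lborel {0<..<Z} (\<lambda>s. (Z - s) powr (1-\<alpha>-1) * ?a s)"
    and i2: "set_integrable lborel {0<..<Z} (\<lambda>s. (Z - s) powr (2-\<alpha>-1) * ?a s)"
    using A1(1) A2(1) alpha alpha1 by auto
  let ?L = "\<lambda>s. (Z - s) powr (1-\<alpha>) * (T - s) powr (1-\<alpha>) * K h s"
  \<comment> \<open>The two differentiated powers contribute (T-s) + (Z-s), regrouped as (T-Z) +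
    2(Z-s) so that only Abel kernels at Z occur; hence the factor 2.\<close>
  let ?L' = "\<lambda>s. (Z - s) powr (2-\<alpha>-1) * bU s - (1-\<alpha>) * ((T - Z) * ((Z - s) powr (1-\<alpha>-1) * ?a s) + 2 * ((Z - s) powr (2-\<alpha>-1) * ?a s))"
  have "(?L' has_integral (?L Z - ?L 0)) {0..Z}"
  proof (rule fundamental_theorem_of_calculus_interior)
    show "continuous_on {0..Z} ?L"
      using Z alpha1 by (intro continuous_intros continuous_on_powr' continuous_on_subset[OF continuous_K[OF h]]) auto
    fix s assume s: "s \<in> {0<..<Z}"
    have sT: "s \<in> {0<..<T}" using s Z by auto
    have d1: "((\<lambda>s. (c - s) powr (1-\<alpha>)) has_real_derivative ((1-\<alpha>) * (c - s) powr (1-\<alpha>-1)) * (0 - 1)) (at s)" if "c > s" for c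
      using that by (intro DERIV_chain2[OF has_real_derivative_powr] DERIV_diff DERIV_const DERIV_ident) auto
    let ?D = "(((1-\<alpha>) * (Z - s) powr (1-\<alpha>-1)) * (0 - 1) * (T - s) powr (1-\<alpha>) + ((1-\<alpha>) * (T - s) powr (1-\<alpha>-1)) * (0 - 1) * (Z - s) powr (1-\<alpha>)) * K h s
        + U h s * ((Z - s) powr (1-\<alpha>) * (T - s) powr (1-\<alpha>))"
    have "(?L has_real_derivative ?D) (at s)"
      by (intro DERIV_mult d1 DERIV_K[OF h hc sT]) (use s sT in auto)
    moreover have "?D = ?L' s"
    proof -
      define p q where "p = (Z - s) powr (1-\<alpha>-1)" and "q = (T - s) powr (1-\<alpha>-1)"
      have e1: "(Z - s) powr (1-\<alpha>) = (Z - s) * p" using powr_mult_base[of "Z-s" "1-\<alpha>-1"] s by (simp add: p_def)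
      have e2: "(T - s) powr (1-\<alpha>) = (T - s) * q" using powr_mult_base[of "T-s" "1-\<alpha>-1"] sT by (simp add: q_def)
      have e3: "q * (T - s) powr \<alpha> = 1" unfolding q_def using sT by (simp add: powr_add[symmetric])
      have e4: "(Z - s) powr (2-\<alpha>-1) = (Z - s) * p" using e1 by simp
      have "?D = (- (1-\<alpha>) * (p * (T - s) + (Z - s) * p) * (q * (T - s) powr \<alpha>)) * ?a s + (Z - s) * p * bU s"
        unfolding K_eq_abel[OF sT] bU_def e1 e2 unfolding p_def[symmetric] q_def[symmetric] by (simp add: algebra_simps)
      also have "\<dots> = ?L' s" unfolding e3 e4 p_def[symmetric] by (simp add: algebra_simps)
      finally show ?thesis .
    qed
    ultimately show "(?L has_vector_derivative ?L' s) (at s)"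
      by (simp add: has_real_derivative_iff_has_vector_derivative)
  qed (use Z in simp)
  moreover have "K h 0 = 0" by (rule K_outside) simp
  ultimately have z: "(?L' has_integral 0) {0<..<Z}" by (simp add: has_integral_Icc_iff_Ioo)
  have i0: "set_integrable lborel {0<..<Z} (\<lambda>s. (Z - s) powr (2-\<alpha>-1) * bU s)"
    by (rule set_integrable_bounded_mult[OF bU_integrable, where C="Z powr (2-\<alpha>-1)"])
      (use Z alpha alpha1 in \<open>auto intro!: powr_mono2\<close>)
  have i3: "set_integrable lborel {0<..<Z} (\<lambda>s. (T - Z) * ((Z - s) powr (1-\<alpha>-1) * ?a s) + 2 * ((Z - s) powr (2-\<alpha>-1) * ?a s))"
    by (intro set_integral_add(1) set_integrable_mult_right i1 i2)
  have "set_integrable lborel {0<..<Z} ?L'" by (intro set_integral_diff(1) set_integrable_mult_right i0 i3)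
  from has_integral_unique[OF set_integral_has_integral[OF this] z]
  have "0 = (LINT s:{0<..<Z}|lborel. ?L' s)" by simp
  also have "\<dots> = abel (2-\<alpha>) bU Z - (1-\<alpha>) * ((T - Z) * abel (1-\<alpha>) ?a Z + 2 * abel (2-\<alpha>) ?a Z)"
    unfolding abel_def[of "2-\<alpha>"] abel_def[of "1-\<alpha>"]
    by (simp only: set_integral_diff(2)[OF i0 set_integrable_mult_right[OF i3]] set_integral_mult_right
        set_integral_add(2)[OF set_integrable_mult_right[OF i1] set_integrable_mult_right[OF i2]])
  finally show ?thesis unfolding a1 a2 by simp
qed

lemma wt_le: "0 < s \<Longrightarrow> s \<le> b \<Longrightarrow> b < T \<Longrightarrow> wt s \<le> (T - b) powr (\<alpha>-1) * s powr (\<alpha>-1)"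
  unfolding wt_def using alpha by (simp add: powr_mult mult.commute mult_left_mono powr_mono2')

lemma M_cont_Ioo: "continuous_on {0<..<T} M"
  by (rule continuous_on_subset[OF M_cont]) auto

lemma M_integrable:
  assumes "0 < z" shows "set_integrable lborel {0<..<z} M"
proof -
  obtain C where C: "C \<ge> 0" "\<And>x. 0 \<le> x \<Longrightarrow> \<bar>M x\<bar> \<le> C * x" using M_lipschitz by blast
  have "\<bar>M s\<bar> \<le> C * z" if "0 < s" "s < z" for s
    using C(2)[of s] mult_left_mono[of s z C] C(1) that by linarith
  then show ?thesis by (intro integrable_Ioo_bounded[of M 0 z "C * z"]) auto
qed

text \<open>The primitive of \<open>abel (1-\<alpha>) bU\<close> is, up to a factor, the operator of
  order 2-\<alpha> already computed. Differentiation is legitimate because the power bound on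
  \<open>bU\<close> at 0, inherited from \<open>wt\<close>, makes
  \<open>abel (1-\<alpha>) bU\<close> continuous.\<close>

lemma abel_bU_eq:
  assumes z: "z \<in> {0<..<T}"
  shows "abel (1-\<alpha>) bU z = B1 * ((T - z) * m z + (1 - 2*\<alpha>) * M z)"
proof -
  obtain C where C: "C \<ge> 0" "\<And>s. s \<in> {0<..<T} \<Longrightarrow> \<bar>U h s\<bar> \<le> C * wt s" using U_wt_bound by blast
  have Qc: "continuous_on {0<..<T} (abel (1-\<alpha>) bU)"
  proof (rule abel_continuous[where q=\<alpha>])
    show "continuous_on {0<..<T} bU" unfolding bU_def[abs_def]
      using alpha1 by (intro continuous_intros U_continuous h hc continuous_on_powr') auto
    fix b assume b: "b < T"
    have "\<bar>bU s\<bar> \<le> (T powr (1-\<alpha>) * (C * (T - b) powr (\<alpha>-1))) * s powr (\<alpha>-1)" if "0 < s" "s \<le> b" for s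
    proof -
      have "\<bar>U h s\<bar> \<le> C * ((T - b) powr (\<alpha>-1) * s powr (\<alpha>-1))"
        using C(2)[of s] mult_left_mono[OF wt_le[OF that b] C(1)] that b by auto
      then have "(T - s) powr (1-\<alpha>) * \<bar>U h s\<bar> \<le> T powr (1-\<alpha>) * (C * ((T - b) powr (\<alpha>-1) * s powr (\<alpha>-1)))"
        using that b alpha by (intro mult_mono powr_mono2) auto
      then show ?thesis by (simp add: bU_def abs_mult mult_ac)
    qed
    then show "\<exists>C. \<forall>s. 0 < s \<and> s \<le> b \<longrightarrow> \<bar>bU s\<bar> \<le> C * s powr (\<alpha> - 1)" by blast
  qed (use alpha alpha1 in auto)
  have pre: "set_integrable lborel {0<..<Z} (\<lambda>s. (Z - s) powr (1 + (1-\<alpha>) - 1) * bU s)" if "Z \<in> {0<..<T}" for Z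
    by (rule set_integrable_bounded_mult[OF bU_integrable, where C="Z powr (1 + (1-\<alpha>) - 1)"])
      (use that alpha alpha1 in \<open>auto intro!: powr_mono2\<close>)
  have Qi: "set_integrable lborel {0<..<Z} (abel (1-\<alpha>) bU)" if "Z \<in> {0<..<T}" for Z
  proof -
    have "set_integrable lborel {0<..<Z} (\<lambda>s. (Z - s) powr (1 - 1) * abel (1-\<alpha>) bU s)"
      by (rule abel_abel(1)[OF _ _ bU_measurable pre[OF that]]) (use alpha1 in auto)
    moreover have "set_integrable lborel {0<..<Z} (\<lambda>s. (Z - s) powr (1 - 1) * abel (1-\<alpha>) bU s) \<longleftrightarrow> set_integrable lborel {0<..<Z} (abel (1-\<alpha>) bU)"
      by (rule set_integrable_cong) auto
    ultimately show ?thesis by simp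
  qed
  have eq: "(LINT s:{0<..<Z}|lborel. abel (1-\<alpha>) bU s) = B1 * ((T - Z) * M Z + (2 - 2*\<alpha>) * (LINT s:{0<..<Z}|lborel. M s))"
    if "Z \<in> {0<..<T}" for Z
  proof -
    have "(LINT s:{0<..<Z}|lborel. abel (1-\<alpha>) bU s) = Beta 1 (1-\<alpha>) * abel (1 + (1-\<alpha>)) bU Z"
      unfolding abel_one[symmetric] by (rule abel_abel(2)[OF _ _ bU_measurable pre[OF that]]) (use alpha1 in auto)
    also have "\<dots> = 1 / (1-\<alpha>) * abel (2-\<alpha>) bU Z"
      using Beta_1_right[of "1-\<alpha>"] Beta_commute[of 1 "1-\<alpha>"] alpha1 by simp
    also have "\<dots> = (T - Z) * (B1 * M Z) + 2 * ((1-\<alpha>) * B1 * abel 1 M Z)"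
      unfolding abel_bU[OF that] using alpha1 by simp
    finally show ?thesis by (simp add: abel_one algebra_simps)
  qed
  have "((\<lambda>z. LINT s:{0<..<z}|lborel. abel (1-\<alpha>) bU s) has_real_derivative abel (1-\<alpha>) bU z) (at z)"
    by (rule DERIV_indefinite_integral[OF Qc]) (use Qi z in auto)
  then have "((\<lambda>Z. B1 * ((T - Z) * M Z + (2 - 2*\<alpha>) * (LINT s:{0<..<Z}|lborel. M s))) has_real_derivative abel (1-\<alpha>) bU z) (at z)"
    by (rule has_field_derivative_transform_within_open[of _ _ _ "{0<..<T}"]) (use z eq in auto)
  moreover have "((\<lambda>Z. B1 * ((T - Z) * M Z + (2 - 2*\<alpha>) * (LINT s:{0<..<Z}|lborel. M s))) has_real_derivative
     B1 * (((0 - 1) * M z + m z * (T - z)) + (2 - 2*\<alpha>) * M z)) (at z)"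
    by (intro DERIV_cmult DERIV_add DERIV_mult DERIV_diff DERIV_const DERIV_ident DERIV_M
        DERIV_indefinite_integral[OF M_cont_Ioo] M_integrable) (use z in auto)
  ultimately have "abel (1-\<alpha>) bU z = B1 * (((0 - 1) * M z + m z * (T - z)) + (2 - 2*\<alpha>) * M z)" by (rule DERIV_unique)
  then show ?thesis by (simp add: algebra_simps)
qed

text \<open>The density left for the second Abel operator: the result of the first one, divided by
  \<open>B1\<close>, times the weight of exponent 2\<alpha>-2 from the factorised Riesz kernel, as a
  function of the distance s to T.\<close>

definition n :: "real \<Rightarrow> real" where
  "n s = s powr (2*\<alpha>-1) * mr s + (1 - 2*\<alpha>) * (s powr (2*\<alpha>-2) * M (T - s))"

lemma n_measurable [measurable]: "n \<in> borel_measurable borel" unfolding n_def by measurable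

lemma n_bound: obtains C where "C \<ge> 0" "\<And>s. 0 < s \<Longrightarrow> s < T \<Longrightarrow> \<bar>n s\<bar> \<le> C * s powr (2*\<alpha>-2)"
proof -
  obtain C1 where C1: "C1 \<ge> 0" "\<And>z. \<bar>m z\<bar> \<le> C1" using m_bounded by blast
  obtain C2 where C2: "C2 \<ge> 0" "\<And>x. 0 \<le> x \<Longrightarrow> \<bar>M x\<bar> \<le> C2 * x" using M_lipschitz by blast
  have "\<bar>n s\<bar> \<le> (T * C1 + (2*\<alpha>-1) * (C2 * T)) * s powr (2*\<alpha>-2)" if s: "0 < s" "s < T" for s
  proof -
    have "s powr (2*\<alpha>-1) = s * s powr (2*\<alpha>-2)" using powr_mult_base[of s "2*\<alpha>-2"] s by simp
    then have e: "n s = s powr (2*\<alpha>-2) * (s * mr s + (1 - 2*\<alpha>) * M (T - s))" by (simp add: n_def algebra_simps)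
    have "\<bar>mr s\<bar> \<le> C1" using C1(2)[of "T - s"] by simp
    then have 1: "\<bar>s * mr s\<bar> \<le> T * C1" unfolding abs_mult using s C1 by (intro mult_mono) auto
    have "\<bar>M (T - s)\<bar> \<le> C2 * T" using C2(2)[of "T - s"] mult_left_mono[of "T-s" T C2] s C2(1) by linarith
    then have 2: "\<bar>(1 - 2*\<alpha>) * M (T - s)\<bar> \<le> (2*\<alpha>-1) * (C2 * T)" unfolding abs_mult using alpha by (intro mult_mono) auto
    have "\<bar>s * mr s + (1 - 2*\<alpha>) * M (T - s)\<bar> \<le> T * C1 + (2*\<alpha>-1) * (C2 * T)" using 1 2 by linarith
    from mult_left_mono[OF this, of "s powr (2*\<alpha>-2)"] show ?thesis unfolding e abs_mult by (simp only: mult.commute powr_ge_zero abs_of_nonneg)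
  qed
  then show thesis by (rule that[rotated]) (use C1 C2 T alpha in auto)
qed

lemma n_cont: "continuous_on {0<..<T} n"
  unfolding n_def[abs_def] using alpha
  by (intro continuous_intros continuous_on_powr' continuous_on_subset[OF mr_cont] continuous_on_compose2[OF M_cont]) auto

text \<open>The two summands of \<open>n\<close> are exactly those of a product rule. This exactness
  is what makes the second inversion explicit.\<close>

lemma n_primitive:
  assumes t: "t \<in> {0<..<T}"
  shows "set_integrable lborel {0<..<t} n" "(LINT s:{0<..<t}|lborel. n s) = - (t powr (2*\<alpha>-1) * M (T - t))"
proof -
  obtain C where C: "C \<ge> 0" "\<And>s. 0 < s \<Longrightarrow> s < T \<Longrightarrow> \<bar>n s\<bar> \<le> C * s powr (2*\<alpha>-2)" using n_bound by blast
  have "set_integrable lborel {0<..<t} (\<lambda>s. (t - s) powr (1 - 1) * n s)"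
    by (rule abel_power_bound(1)[where q="2*\<alpha>-1" and C=C]) (use t C alpha in auto)
  moreover have "set_integrable lborel {0<..<t} (\<lambda>s. (t - s) powr (1 - 1) * n s) \<longleftrightarrow> set_integrable lborel {0<..<t} n"
    by (rule set_integrable_cong) auto
  ultimately show i: "set_integrable lborel {0<..<t} n" by simp
  let ?N = "\<lambda>s. - (s powr (2*\<alpha>-1) * M (T - s))"
  have "(n has_integral (?N t - ?N 0)) {0..t}"
  proof (rule fundamental_theorem_of_calculus_interior)
    show "continuous_on {0..t} ?N"
      using t alpha by (intro continuous_intros continuous_on_powr' continuous_on_compose2[OF M_cont]) auto
    fix s assume s: "s \<in> {0<..<t}"
    have "((\<lambda>s. M (T - s)) has_real_derivative m (T - s) * (0 - 1)) (at s)"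
      by (rule DERIV_chain2[OF DERIV_M]) (use s t in \<open>auto intro!: derivative_eq_intros\<close>)
    then have "(?N has_real_derivative - (((2*\<alpha>-1) * s powr (2*\<alpha>-1-1)) * M (T - s) + (m (T - s) * (0 - 1)) * s powr (2*\<alpha>-1))) (at s)"
      using s by (intro DERIV_minus DERIV_mult has_real_derivative_powr) auto
    moreover have "- (((2*\<alpha>-1) * s powr (2*\<alpha>-1-1)) * M (T - s) + (m (T - s) * (0 - 1)) * s powr (2*\<alpha>-1)) = n s"
      by (simp add: n_def algebra_simps)
    ultimately show "(?N has_vector_derivative n s) (at s)"
      by (simp add: has_real_derivative_iff_has_vector_derivative)
  qed (use t in simp)
  then have "(n has_integral ?N t) {0<..<t}" using alpha by (simp add: has_integral_Icc_iff_Ioo)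
  then show "(LINT s:{0<..<t}|lborel. n s) = ?N t" using set_integral_has_integral[OF i] has_integral_unique by blast
qed

definition Xi :: "real \<Rightarrow> real" where "Xi t = (LINT s:{0<..<t}|lborel. h (T - s))"

lemma h_integrable: "set_integrable lborel {a<..<b} (\<lambda>s. h (c + d * s))"
proof -
  obtain H where "\<And>x. \<bar>h x\<bar> \<le> H" using bdd_borelE[OF h] by blast
  then show ?thesis by (intro integrable_Ioo_bounded[where C=H]) auto
qed

lemma DERIV_Xi: "t > 0 \<Longrightarrow> (Xi has_real_derivative h (T - t)) (at t)"
  unfolding Xi_def[abs_def]
  by (rule DERIV_indefinite_integral[where T="t+1"])
    (use h_integrable[of _ _ T "-1"] in \<open>auto intro!: continuous_on_compose2[OF hc] continuous_intros\<close>)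

lemma Xi_bound: obtains C where "C \<ge> 0" "\<And>x. 0 \<le> x \<Longrightarrow> \<bar>Xi x\<bar> \<le> C * x"
proof -
  obtain H where H: "H \<ge> 0" "\<And>x. \<bar>h x\<bar> \<le> H" using bdd_borelE[OF h] by blast
  have "\<bar>Xi x\<bar> \<le> H * (x - 0)" if "0 \<le> x" for x unfolding Xi_def set_lebesgue_integral_def
    by (rule integrable_bounded_support(2)) (use H that in \<open>auto simp: indicator_def\<close>)
  then show thesis using that[OF H(1)] by simp
qed

lemma Xi_measurable [measurable]: "Xi \<in> borel_measurable borel"
proof -
  have "Xi = abel 1 (\<lambda>s. h (T - s))" by (auto simp: Xi_def abel_one fun_eq_iff)
  then show ?thesis by simp
qed

text \<open>Averaging \<open>h (T - r * \<sigma>)\<close> over r in (0,t) gives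
  \<open>Xi (t * \<sigma>) / \<sigma>\<close>, and the lost factor \<sigma> is the difference
  between the exponents \<alpha> and \<alpha>-1.\<close>

lemma Xi_average:
  assumes t: "t > 0"
  shows "(LINT \<sigma>:{0<..<1}|lborel. (1 - \<sigma>) powr (\<alpha>-1) * (\<sigma> powr (\<alpha>-1) * Xi (t * \<sigma>))) = (LINT r:{0<..<t}|lborel. mr r)"
proof -
  obtain H where H: "H \<ge> 0" "\<And>x. \<bar>h x\<bar> \<le> H" using bdd_borelE[OF h] by blast
  define g where "g \<sigma> r = indicator {0<..<1} \<sigma> * (indicator {0<..<t} r * ((1 - \<sigma>) powr (\<alpha>-1) * (\<sigma> powr \<alpha> * h (T - r * \<sigma>))))" for \<sigma> r :: real
  have meas: "(\<lambda>(\<sigma>,r). g \<sigma> r) \<in> borel_measurable (borel \<Otimes>\<^sub>M borel)" unfolding g_def by measurable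
  have inner0: "integrable lborel (\<lambda>r. indicator {0<..<t} r * h (T - r * \<sigma>))" for \<sigma>
    using h_integrable[of 0 t T "-\<sigma>"] by (simp add: set_integrable_def mult.commute)
  have g_eq: "g \<sigma> = (\<lambda>r. (indicator {0<..<1} \<sigma> * ((1 - \<sigma>) powr (\<alpha>-1) * \<sigma> powr \<alpha>)) * (indicator {0<..<t} r * h (T - r * \<sigma>)))" for \<sigma>
    by (auto simp: g_def mult_ac)
  have inner: "integrable lborel (g \<sigma>)" for \<sigma>
    unfolding g_eq by (intro integrable_mult_right inner0)
  have bnd: "(\<integral>r. \<bar>g \<sigma> r\<bar> \<partial>lborel) \<le> indicator {0<..<1} \<sigma> * ((H * t) * ((1 - \<sigma>) powr (\<alpha>-1) * \<sigma> powr ((\<alpha>+1)-1)))" for \<sigma>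
  proof -
    have "(\<integral>r. \<bar>g \<sigma> r\<bar> \<partial>lborel) = (indicator {0<..<1} \<sigma> * ((1 - \<sigma>) powr (\<alpha>-1) * \<sigma> powr \<alpha>)) * (\<integral>r. \<bar>indicator {0<..<t} r * h (T - r * \<sigma>)\<bar> \<partial>lborel)"
      unfolding g_eq by (simp add: abs_mult)
    moreover have "\<bar>\<integral>r. \<bar>indicator {0<..<t} r * h (T - r * \<sigma>)\<bar> \<partial>lborel\<bar> \<le> H * (t - 0)"
      by (rule integrable_bounded_support(2)) (use H t in \<open>auto simp: indicator_def\<close>)
    then have "(\<integral>r. \<bar>indicator {0<..<t} r * h (T - r * \<sigma>)\<bar> \<partial>lborel) \<le> H * t" by simp
    ultimately show ?thesis
      using mult_left_mono[of "\<integral>r. \<bar>indicator {0<..<t} r * h (T - r * \<sigma>)\<bar> \<partial>lborel" "H * t" "indicator {0<..<1} \<sigma> * ((1 - \<sigma>) powr (\<alpha>-1) * \<sigma> powr \<alpha>)"]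
      by (simp add: mult_ac)
  qed
  have outer: "integrable lborel (\<lambda>\<sigma>. \<integral>r. \<bar>g \<sigma> r\<bar> \<partial>lborel)"
  proof (rule Bochner_Integration.integrable_bound)
    show "integrable lborel (\<lambda>\<sigma>. indicator {0<..<1} \<sigma> * ((H * t) * ((1 - \<sigma>) powr (\<alpha>-1) * \<sigma> powr ((\<alpha>+1)-1))))"
      using set_integrable_mult_right[OF beta_integral_unit(1)[of \<alpha> "\<alpha>+1"], of "H * t"] alpha unfolding set_integrable_def by simp
    show "AE \<sigma> in lborel. norm (\<integral>r. \<bar>g \<sigma> r\<bar> \<partial>lborel) \<le> norm (indicator {0<..<1} \<sigma> * ((H * t) * ((1 - \<sigma>) powr (\<alpha>-1) * \<sigma> powr ((\<alpha>+1)-1))))"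
      by (rule AE_I2) (use bnd in \<open>auto intro: order.trans[OF _ abs_ge_self]\<close>)
    show "(\<lambda>\<sigma>. \<integral>r. \<bar>g \<sigma> r\<bar> \<partial>lborel) \<in> borel_measurable lborel" unfolding g_def by measurable
  qed
  have "(\<integral>r. (\<integral>\<sigma>. g \<sigma> r \<partial>lborel) \<partial>lborel) = (\<integral>\<sigma>. (\<integral>r. g \<sigma> r \<partial>lborel) \<partial>lborel)"
    by (rule fubini_lborel(1)[OF meas _ outer]) (use inner in auto)
  moreover have "(\<integral>\<sigma>. g \<sigma> r \<partial>lborel) = indicator {0<..<t} r *\<^sub>R mr r" for r
  proof -
    have "(\<lambda>\<sigma>. g \<sigma> r) = (\<lambda>\<sigma>. indicator {0<..<t} r * (indicator {0<..<1} \<sigma> *\<^sub>R ((1 - \<sigma>) powr (\<alpha>-1) * (\<sigma> powr \<alpha> * h (T - r * \<sigma>)))))"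
      by (auto simp: g_def)
    then show ?thesis by (simp add: mr_def set_lebesgue_integral_def)
  qed
  moreover have "(\<integral>r. g \<sigma> r \<partial>lborel) = indicator {0<..<1} \<sigma> *\<^sub>R ((1 - \<sigma>) powr (\<alpha>-1) * (\<sigma> powr (\<alpha>-1) * Xi (t * \<sigma>)))" for \<sigma>
  proof (cases "\<sigma> \<in> {0<..<1}")
    case True
    have "Xi (t * \<sigma>) = \<sigma> * (LINT r:{0<..<t}|lborel. h (T - r * \<sigma>))"
      unfolding Xi_def using set_integral_affine(2)[of \<sigma> 0 "t * \<sigma>" "\<lambda>s. h (T - s)" 0] True by (simp add: mult.commute)
    moreover have "\<sigma> powr \<alpha> = \<sigma> powr (\<alpha>-1) * \<sigma>" using powr_mult_base[of \<sigma> "\<alpha>-1"] True by (simp add: mult.commute)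
    ultimately show ?thesis unfolding g_eq using True by (simp add: set_lebesgue_integral_def)
  qed (simp add: g_def)
  ultimately show ?thesis by (simp add: set_lebesgue_integral_def)
qed

text \<open>A guess for the second inversion, confirmed later by uniqueness. The constant is forced:
  the integral of \<open>mr\<close> over (0,t) is M(T) - M(T-t), and M(T) has to disappear.\<close>

definition S :: "real \<Rightarrow> real" where
  "S t = Xi t - M T / Beta \<alpha> \<alpha>"

lemma abel_S:
  assumes t: "t \<in> {0<..<T}"
  shows "abel \<alpha> (\<lambda>s. s powr (\<alpha>-1) * S s) t = - (t powr (2*\<alpha>-1) * M (T - t))"
proof -
  obtain C where C: "C \<ge> 0" "\<And>x. 0 \<le> x \<Longrightarrow> \<bar>Xi x\<bar> \<le> C * x" using Xi_bound by blast
  let ?b = "\<lambda>\<sigma>. (1 - \<sigma>) powr (\<alpha>-1) * \<sigma> powr (\<alpha>-1)"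
  have be: "set_integrable lborel {0<..<1} ?b" "(LINT \<sigma>:{0<..<1}|lborel. ?b \<sigma>) = Beta \<alpha> \<alpha>"
    using beta_integral_unit[of \<alpha> \<alpha>] alpha by auto
  have Bp: "Beta \<alpha> \<alpha> \<noteq> 0" using Beta_pos[of \<alpha> \<alpha>] alpha by simp
  have ix: "set_integrable lborel {0<..<1} (\<lambda>\<sigma>. (1 - \<sigma>) powr (\<alpha>-1) * (\<sigma> powr (\<alpha>-1) * Xi (t * \<sigma>)))"
  proof -
    have "set_integrable lborel {0<..<1} (\<lambda>\<sigma>. Xi (t * \<sigma>) * ?b \<sigma>)"
    proof (rule set_integrable_bounded_mult[OF be(1), where C="C * t"])
      fix \<sigma> :: real assume s: "\<sigma> \<in> {0<..<1}"
      have "\<bar>Xi (t * \<sigma>)\<bar> \<le> C * (t * \<sigma>)" using C(2) t s by simp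
      also have "\<dots> \<le> C * (t * 1)" using C(1) t s by (intro mult_left_mono) auto
      finally show "\<bar>Xi (t * \<sigma>)\<bar> \<le> C * t" by simp
    qed auto
    then show ?thesis by (simp add: mult_ac)
  qed
  have "abel \<alpha> (\<lambda>s. s powr (\<alpha>-1) * S s) t = t powr \<alpha> * (LINT \<sigma>:{0<..<1}|lborel. (1 - \<sigma>) powr (\<alpha> - 1) * ((t * \<sigma>) powr (\<alpha>-1) * S (t * \<sigma>)))"
    using t by (subst abel_scale) auto
  also have "(LINT \<sigma>:{0<..<1}|lborel. (1 - \<sigma>) powr (\<alpha> - 1) * ((t * \<sigma>) powr (\<alpha>-1) * S (t * \<sigma>)))
    = (LINT \<sigma>:{0<..<1}|lborel. t powr (\<alpha>-1) * ((1 - \<sigma>) powr (\<alpha>-1) * (\<sigma> powr (\<alpha>-1) * Xi (t * \<sigma>)) - (M T / Beta \<alpha> \<alpha>) * ?b \<sigma>))"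
    by (rule set_lebesgue_integral_cong) (use t in \<open>auto simp: powr_mult S_def algebra_simps\<close>)
  also have "\<dots> = t powr (\<alpha>-1) * ((LINT r:{0<..<t}|lborel. mr r) - (M T / Beta \<alpha> \<alpha>) * Beta \<alpha> \<alpha>)"
  proof -
    have "t > 0" using t by simp
    then show ?thesis
      by (simp only: set_integral_mult_right set_integral_diff(2)[OF ix set_integrable_mult_right[OF be(1)]] Xi_average be(2))
  qed
  also have "(M T / Beta \<alpha> \<alpha>) * Beta \<alpha> \<alpha> = M T" using Bp by simp
  also have "(LINT r:{0<..<t}|lborel. mr r) - M T = - M (T - t)"
  proof -
    have "(LINT r:{0<..<t}|lborel. mr r) = (LINT r:{T-t<..<T}|lborel. m r)"
      using set_integral_reflect(2)[of 0 t mr T] by simp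
    moreover have "M T = M (T - t) + (LINT r:{T-t<..<T}|lborel. m r)"
    proof -
      have "AE x in lborel. x \<noteq> T - t" by (rule AE_lborel_singleton)
      then have "M T = (LINT r:{0<..<T-t} \<union> {T-t<..<T}|lborel. m r)" unfolding M_def
        by (intro set_integral_cong_set) (use t in \<open>auto simp: set_borel_measurable_def elim!: eventually_mono\<close>)
      also have "\<dots> = M (T - t) + (LINT r:{T-t<..<T}|lborel. m r)" unfolding M_def
        by (rule set_integral_Un) (auto intro: m_integrable)
      finally show ?thesis .
    qed
    ultimately show ?thesis by simp
  qed
  also have "t powr \<alpha> * (t powr (\<alpha>-1) * - M (T - t)) = - (t powr (2*\<alpha>-1) * M (T - t))"
  proof -
    have "t powr \<alpha> * t powr (\<alpha>-1) = t powr (2*\<alpha>-1)" by (simp add: powr_add[symmetric])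
    then show ?thesis by (simp flip: mult.assoc)
  qed
  finally show ?thesis .
qed

text \<open>The operator of order \<alpha> takes both sides to the same function: on the left it
  completes 1-\<alpha> to plain integration of \<open>n\<close>, on the right it is
  \<open>abel_S\<close>. Injectivity of the Abel operator concludes; the rest checks its continuity
  and integrability conditions.\<close>

lemma abel_n_eq:
  assumes t: "t \<in> {0<..<T}"
  shows "abel (1-\<alpha>) n t = B1 * (t powr (\<alpha>-1) * S t)"
proof -
  obtain C where C: "C \<ge> 0" "\<And>s. 0 < s \<Longrightarrow> s < T \<Longrightarrow> \<bar>n s\<bar> \<le> C * s powr (2*\<alpha>-2)" using n_bound by blast
  obtain C2 where C2: "C2 \<ge> 0" "\<And>x. 0 \<le> x \<Longrightarrow> \<bar>Xi x\<bar> \<le> C2 * x" using Xi_bound by blast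
  have Sc: "continuous_on {0<..<T} S"
    unfolding S_def[abs_def] using DERIV_isCont[OF DERIV_Xi]
    by (intro continuous_intros continuous_at_imp_continuous_on) auto
  have Sm [measurable]: "S \<in> borel_measurable borel" unfolding S_def[abs_def] by measurable
  have pint: "set_integrable lborel {0<..<z} \<phi>"
    if "\<phi> \<in> borel_measurable borel" "0 < z" "\<And>s. 0 < s \<Longrightarrow> s < z \<Longrightarrow> \<bar>\<phi> s\<bar> \<le> D * s powr (\<alpha>-1)" for \<phi> z D
  proof -
    have "set_integrable lborel {0<..<z} (\<lambda>s. (z - s) powr (1 - 1) * \<phi> s)"
      by (rule abel_power_bound(1)[where q=\<alpha> and C=D]) (use that alpha in auto)
    moreover have "set_integrable lborel {0<..<z} (\<lambda>s. (z - s) powr (1 - 1) * \<phi> s) \<longleftrightarrow> set_integrable lborel {0<..<z} \<phi>"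
      by (rule set_integrable_cong) auto
    ultimately show ?thesis by simp
  qed
  show ?thesis
  proof (rule abel_inject[where p=\<alpha> and T=T and \<psi>="\<lambda>t. B1 * (t powr (\<alpha>-1) * S t)"])
    show "continuous_on {0<..<T} (abel (1-\<alpha>) n)"
    proof (rule abel_continuous[where q="2*\<alpha>-1"])
      fix b assume "b < T"
      then show "\<exists>C. \<forall>s. 0 < s \<and> s \<le> b \<longrightarrow> \<bar>n s\<bar> \<le> C * s powr (2*\<alpha>-1 - 1)" using C(2) by (intro exI[of _ C]) auto
    qed (use alpha alpha1 n_cont in auto)
    show "continuous_on {0<..<T} (\<lambda>t. B1 * (t powr (\<alpha>-1) * S t))"
      by (intro continuous_intros Sc) auto
    fix z assume z: "0 < z" "z < T"
    have "\<bar>abel (1-\<alpha>) n s\<bar> \<le> (C * Beta (1-\<alpha>) (2*\<alpha>-1)) * s powr (\<alpha>-1)" if "0 < s" "s < z" for s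
      using abel_power_bound(2)[of "1-\<alpha>" "2*\<alpha>-1" n s C] that z alpha alpha1 C by simp
    then show "set_integrable lborel {0<..<z} (abel (1-\<alpha>) n)" using z by (intro pint) auto
    have "\<bar>B1 * (s powr (\<alpha>-1) * S s)\<bar> \<le> (\<bar>B1\<bar> * (C2 * T + \<bar>M T / Beta \<alpha> \<alpha>\<bar>)) * s powr (\<alpha>-1)" if "0 < s" "s < z" for s
    proof -
      have "\<bar>S s\<bar> \<le> \<bar>Xi s\<bar> + \<bar>M T / Beta \<alpha> \<alpha>\<bar>" unfolding S_def by (rule abs_triangle_ineq4)
      moreover have "\<bar>Xi s\<bar> \<le> C2 * T" using C2(2)[of s] mult_left_mono[of s T C2] C2(1) that z by linarith
      ultimately have "\<bar>S s\<bar> \<le> C2 * T + \<bar>M T / Beta \<alpha> \<alpha>\<bar>" by linarith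
      from mult_left_mono[OF this, of "\<bar>B1\<bar> * s powr (\<alpha>-1)"] show ?thesis by (simp add: abs_mult mult_ac)
    qed
    then show "set_integrable lborel {0<..<z} (\<lambda>t. B1 * (t powr (\<alpha>-1) * S t))" using z by (intro pint) auto
    have zT: "z \<in> {0<..<T}" using z by simp
    have "set_integrable lborel {0<..<z} (\<lambda>s. (z - s) powr (\<alpha> + (1-\<alpha>) - 1) * n s) \<longleftrightarrow> set_integrable lborel {0<..<z} n"
      by (rule set_integrable_cong) auto
    then have "abel \<alpha> (abel (1-\<alpha>) n) z = Beta \<alpha> (1-\<alpha>) * abel (\<alpha> + (1-\<alpha>)) n z"
      using n_primitive(1)[OF zT] alpha alpha1 by (intro abel_abel(2)) auto
    also have "\<dots> = B1 * - (z powr (2*\<alpha>-1) * M (T - z))"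
      using n_primitive(2)[OF zT] by (simp add: abel_one B1_def Beta_commute)
    also have "\<dots> = abel \<alpha> (\<lambda>t. B1 * (t powr (\<alpha>-1) * S t)) z"
      unfolding abel_cmult abel_S[OF zT] ..
    finally show "abel \<alpha> (abel (1-\<alpha>) n) z = abel \<alpha> (\<lambda>t. B1 * (t powr (\<alpha>-1) * S t)) z" .
  qed (use t alpha alpha1 in auto)
qed

section \<open>Inversion of the Riesz potential\<close>

definition R :: "real \<Rightarrow> real" where "R t = (LINT s:{0<..<T}|lborel. \<bar>t - s\<bar> powr (1-2*\<alpha>) * U h s)"

lemma R_integrable:
  assumes t: "t \<in> {0<..<T}"
  shows "set_integrable lborel {0<..<T} (\<lambda>s. \<bar>t - s\<bar> powr (1-2*\<alpha>) * U h s)"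
proof -
  obtain C where C: "C \<ge> 0" "\<And>s. s \<in> {0<..<T} \<Longrightarrow> \<bar>U h s\<bar> \<le> C * wt s" using U_wt_bound by blast
  \<comment> \<open>Half the distance from t to the boundary. Within d of t the weight is bounded,
    farther away the kernel is bounded, so the singularities of the two factors never meet.\<close>
  define d where "d = min (t/2) ((T-t)/2)"
  have d: "d > 0" using t by (simp add: d_def)
  have dt: "d \<le> t/2" "d \<le> (T-t)/2" unfolding d_def by (rule min.cobounded1, rule min.cobounded2)
  let ?b = "\<lambda>s. C * ((d * d) powr (\<alpha>-1) * \<bar>s - t\<bar> powr ((2-2*\<alpha>)-1) + d powr (1-2*\<alpha>) * wt s)"
  have b: "\<bar>\<bar>t - s\<bar> powr (1-2*\<alpha>) * U h s\<bar> \<le> ?b s" if s: "s \<in> {0<..<T}" for s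
  proof -
    have "\<bar>t - s\<bar> powr (1-2*\<alpha>) * wt s \<le> (d * d) powr (\<alpha>-1) * \<bar>s - t\<bar> powr ((2-2*\<alpha>)-1) + d powr (1-2*\<alpha>) * wt s"
    proof (cases "\<bar>t - s\<bar> < d")
      case True
      then have "d * d \<le> s * (T - s)" using s d dt by (intro mult_mono) (auto simp: abs_less_iff)
      then have "wt s \<le> (d * d) powr (\<alpha>-1)" unfolding wt_def using d alpha by (intro powr_mono2') auto
      then have "\<bar>t - s\<bar> powr (1-2*\<alpha>) * wt s \<le> \<bar>t - s\<bar> powr (1-2*\<alpha>) * (d * d) powr (\<alpha>-1)" by (rule mult_left_mono) simp
      then show ?thesis using wt_nonneg[of s] by (simp add: abs_minus_commute mult.commute add_increasing2)
    next
      case False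
      then have "\<bar>t - s\<bar> powr (1-2*\<alpha>) \<le> d powr (1-2*\<alpha>)" using d alpha by (intro powr_mono2') auto
      then show ?thesis using mult_right_mono[OF _ wt_nonneg[of s]] by (simp add: add_increasing)
    qed
    from mult_left_mono[OF this C(1)] mult_left_mono[OF C(2)[OF s], of "\<bar>t - s\<bar> powr (1-2*\<alpha>)"]
    show ?thesis by (simp add: abs_mult mult_ac)
  qed
  have "set_integrable lborel {0<..<T} ?b"
    using set_integrable_abs_powr[of "2-2*\<alpha>" t T] t alpha1
    by (intro set_integrable_mult_right set_integral_add(1) wt_integral(1)) auto
  then show ?thesis
    by (rule set_integrable_bound) (auto simp: set_borel_measurable_def intro!: AE_I2 order.trans[OF b])
qed

text \<open>The factorisation with b = T is inserted and the order of integration exchanged.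
  Integrating in s gives the first Abel operator applied to \<open>bU\<close>, whose weight cancels
  the power of T-s from the factorisation; integrating in z gives the second one applied to
  \<open>n\<close>.\<close>

lemma R_eq:
  assumes t: "t \<in> {0<..<T}"
  shows "R t = B1\<^sup>2 / Beta (1-\<alpha>) (2*\<alpha>-1) * S (T - t)"
proof -
  let ?B2 = "Beta (2*\<alpha>-1) (1-\<alpha>)"
  define f where "f s z = (if 0 < s \<and> s < z \<and> t < z \<and> z < T then (T - s) powr (1-\<alpha>) * U h s * ((z - s) powr (-\<alpha>) * (z - t) powr (-\<alpha>) * (T - z) powr (2*\<alpha>-2)) else 0)" for s z
  have meas: "(\<lambda>(s,z). f s z) \<in> borel_measurable (borel \<Otimes>\<^sub>M borel)" unfolding f_def by measurable
  have f1: "f s = (\<lambda>z. ((T - s) powr (1-\<alpha>) * U h s) * (indicator {max s t<..<T} z *\<^sub>R ((z - s) powr (-\<alpha>) * (z - t) powr (-\<alpha>) * (T - z) powr (2*\<alpha>-2))))"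
    if "s \<in> {0<..<T}" for s using that by (auto simp: f_def indicator_def)
  have f0: "f s = (\<lambda>z. 0)" if "s \<notin> {0<..<T}" for s using that by (auto simp: f_def)
  have AEt: "AE s in lborel. s \<noteq> t" by (rule AE_lborel_singleton)
  have inner: "integrable lborel (f s)" if "s \<noteq> t" for s
  proof (cases "s \<in> {0<..<T}")
    case True
    then show ?thesis unfolding f1[OF True] using riesz_kernel_factorisation(1)[OF alpha(1) alpha1 that, of T] t
      by (intro integrable_mult_right) (auto simp: set_integrable_def)
  qed (simp add: f0)
  have val: "(\<integral>z. indicator {max s t<..<T} z *\<^sub>R ((z - s) powr (-\<alpha>) * (z - t) powr (-\<alpha>) * (T - z) powr (2*\<alpha>-2)) \<partial>lborel)
      = ?B2 * ((T - s) powr (\<alpha>-1) * (T - t) powr (\<alpha>-1) * \<bar>t - s\<bar> powr (1-2*\<alpha>))" if "s \<noteq> t" "s \<in> {0<..<T}" for s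
    using riesz_kernel_factorisation(2)[OF alpha(1) alpha1 that(1), of T] t that unfolding set_lebesgue_integral_def by auto
  have canc: "(T - s) powr (1-\<alpha>) * (T - s) powr (\<alpha>-1) = 1" if "s \<in> {0<..<T}" for s
    using that by (simp add: powr_add[symmetric])
  have eq1: "(\<integral>z. f s z \<partial>lborel) = ?B2 * (T - t) powr (\<alpha>-1) * (indicator {0<..<T} s *\<^sub>R (\<bar>t - s\<bar> powr (1-2*\<alpha>) * U h s))" if "s \<noteq> t" for s
  proof (cases "s \<in> {0<..<T}")
    case True
    have "(\<integral>z. f s z \<partial>lborel) = ((T - s) powr (1-\<alpha>) * U h s) * (?B2 * ((T - s) powr (\<alpha>-1) * (T - t) powr (\<alpha>-1) * \<bar>t - s\<bar> powr (1-2*\<alpha>)))"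
      unfolding f1[OF True] integral_mult_right_zero val[OF that True] ..
    also have "\<dots> = ((T - s) powr (1-\<alpha>) * (T - s) powr (\<alpha>-1)) * (?B2 * (T - t) powr (\<alpha>-1) * (\<bar>t - s\<bar> powr (1-2*\<alpha>) * U h s))" by (simp add: mult_ac)
    finally show ?thesis using True canc[OF True] by simp
  qed (simp add: f0)
  have eq2: "(\<integral>z. \<bar>f s z\<bar> \<partial>lborel) = ?B2 * (T - t) powr (\<alpha>-1) * \<bar>indicator {0<..<T} s *\<^sub>R (\<bar>t - s\<bar> powr (1-2*\<alpha>) * U h s)\<bar>" if "s \<noteq> t" for s
  proof (cases "s \<in> {0<..<T}")
    case True
    have "(\<lambda>z. \<bar>f s z\<bar>) = (\<lambda>z. ((T - s) powr (1-\<alpha>) * \<bar>U h s\<bar>) * (indicator {max s t<..<T} z *\<^sub>R ((z - s) powr (-\<alpha>) * (z - t) powr (-\<alpha>) * (T - z) powr (2*\<alpha>-2))))"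
      unfolding f1[OF True] by (auto simp: abs_mult)
    then have "(\<integral>z. \<bar>f s z\<bar> \<partial>lborel) = ((T - s) powr (1-\<alpha>) * \<bar>U h s\<bar>) * (?B2 * ((T - s) powr (\<alpha>-1) * (T - t) powr (\<alpha>-1) * \<bar>t - s\<bar> powr (1-2*\<alpha>)))"
      by (simp only: integral_mult_right_zero val[OF that True])
    also have "\<dots> = ((T - s) powr (1-\<alpha>) * (T - s) powr (\<alpha>-1)) * (?B2 * (T - t) powr (\<alpha>-1) * (\<bar>t - s\<bar> powr (1-2*\<alpha>) * \<bar>U h s\<bar>))" by (simp add: mult_ac)
    finally show ?thesis using True canc[OF True] by (simp add: abs_mult)
  qed (simp add: f0)
  have ri: "integrable lborel (\<lambda>s. indicator {0<..<T} s *\<^sub>R (\<bar>t - s\<bar> powr (1-2*\<alpha>) * U h s))"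
    using R_integrable[OF t] by (simp add: set_integrable_def)
  have outer: "integrable lborel (\<lambda>s. \<integral>z. \<bar>f s z\<bar> \<partial>lborel)"
  proof (subst integrable_cong_AE)
    show "integrable lborel (\<lambda>s. ?B2 * (T - t) powr (\<alpha>-1) * \<bar>indicator {0<..<T} s *\<^sub>R (\<bar>t - s\<bar> powr (1-2*\<alpha>) * U h s)\<bar>)"
      by (intro integrable_mult_right integrable_abs ri)
    show "AE s in lborel. (\<integral>z. \<bar>f s z\<bar> \<partial>lborel) = ?B2 * (T - t) powr (\<alpha>-1) * \<bar>indicator {0<..<T} s *\<^sub>R (\<bar>t - s\<bar> powr (1-2*\<alpha>) * U h s)\<bar>"
      using AEt by eventually_elim (rule eq2)
    show "(\<lambda>s. \<integral>z. \<bar>f s z\<bar> \<partial>lborel) \<in> borel_measurable lborel" unfolding f_def by measurable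
  qed measurable
  have "(\<integral>z. (\<integral>s. f s z \<partial>lborel) \<partial>lborel) = (\<integral>s. (\<integral>z. f s z \<partial>lborel) \<partial>lborel)"
    by (rule fubini_lborel(1)[OF meas eventually_mono[OF AEt inner] outer])
  also have "\<dots> = (\<integral>s. ?B2 * (T - t) powr (\<alpha>-1) * (indicator {0<..<T} s *\<^sub>R (\<bar>t - s\<bar> powr (1-2*\<alpha>) * U h s)) \<partial>lborel)"
  proof (rule integral_cong_AE)
    show "AE s in lborel. (\<integral>z. f s z \<partial>lborel) = ?B2 * (T - t) powr (\<alpha>-1) * (indicator {0<..<T} s *\<^sub>R (\<bar>t - s\<bar> powr (1-2*\<alpha>) * U h s))"
      using AEt by eventually_elim (rule eq1)
    show "(\<lambda>s. \<integral>z. f s z \<partial>lborel) \<in> borel_measurable lborel" unfolding f_def by measurable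
  qed measurable
  also have "\<dots> = ?B2 * (T - t) powr (\<alpha>-1) * R t" by (simp add: R_def set_lebesgue_integral_def)
  also have "(\<integral>z. (\<integral>s. f s z \<partial>lborel) \<partial>lborel) = (LINT z:{t<..<T}|lborel. B1 * ((z - t) powr (-\<alpha>) * n (T - z)))"
    unfolding set_lebesgue_integral_def
  proof (rule Bochner_Integration.integral_cong)
    show "(\<integral>s. f s z \<partial>lborel) = indicator {t<..<T} z *\<^sub>R (B1 * ((z - t) powr (-\<alpha>) * n (T - z)))" for z
    proof (cases "z \<in> {t<..<T}")
      case True
      have zT: "z \<in> {0<..<T}" using True t by auto
      have "(\<lambda>s. f s z) = (\<lambda>s. ((z - t) powr (-\<alpha>) * (T - z) powr (2*\<alpha>-2)) * (indicator {0<..<z} s *\<^sub>R ((z - s) powr ((1-\<alpha>)-1) * bU s)))"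
        using True by (auto simp: f_def bU_def indicator_def)
      then have "(\<integral>s. f s z \<partial>lborel) = ((z - t) powr (-\<alpha>) * (T - z) powr (2*\<alpha>-2)) * abel (1-\<alpha>) bU z"
        by (simp only: integral_mult_right_zero abel_def set_lebesgue_integral_def)
      also have "\<dots> = B1 * ((z - t) powr (-\<alpha>) * ((T - z) powr (2*\<alpha>-2) * (T - z) * m z + (1 - 2*\<alpha>) * ((T - z) powr (2*\<alpha>-2) * M z)))"
        unfolding abel_bU_eq[OF zT] by (simp add: algebra_simps)
      also have "(T - z) powr (2*\<alpha>-2) * (T - z) = (T - z) powr (2*\<alpha>-1)"
        using powr_mult_base[of "T - z" "2*\<alpha>-2"] zT by (simp add: mult.commute)
      finally show ?thesis using True by (simp add: n_def)
    next
      case False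
      then have "(\<lambda>s. f s z) = (\<lambda>s. 0)" by (auto simp: f_def)
      then show ?thesis using False by simp
    qed
  qed simp
  also have "\<dots> = B1 * abel (1-\<alpha>) n (T - t)"
    using set_integral_reflect(2)[of t T "\<lambda>z. (z - t) powr (-\<alpha>) * n (T - z)" T] by (simp add: abel_def algebra_simps)
  also have "\<dots> = B1 * (B1 * ((T - t) powr (\<alpha>-1) * S (T - t)))"
    using abel_n_eq[of "T - t"] t by simp
  finally have "B1 * (B1 * ((T - t) powr (\<alpha>-1) * S (T - t))) = ?B2 * (T - t) powr (\<alpha>-1) * R t" .
  then have "(T - t) powr (\<alpha>-1) * (B1\<^sup>2 * S (T - t)) = (T - t) powr (\<alpha>-1) * (?B2 * R t)" by (simp add: power2_eq_square mult_ac)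
  then have "B1\<^sup>2 * S (T - t) = ?B2 * R t" using t by simp
  then show ?thesis using Beta_pos[of "2*\<alpha>-1" "1-\<alpha>"] alpha alpha1 by (simp add: Beta_commute field_simps)
qed

lemma DERIV_R:
  assumes t: "t \<in> {0<..<T}"
  shows "(R has_real_derivative - (B1\<^sup>2 / Beta (1-\<alpha>) (2*\<alpha>-1)) * h t) (at t)"
proof -
  have d1: "(S has_real_derivative h (T - (T - t)) - 0) (at (T - t))"
    unfolding S_def[abs_def] by (rule DERIV_diff[OF DERIV_Xi DERIV_const]) (use t in simp)
  have d2: "((\<lambda>t. T - t) has_real_derivative 0 - 1) (at t)" by (intro DERIV_diff DERIV_const DERIV_ident)
  have "((\<lambda>t. S (T - t)) has_real_derivative - h t) (at t)"
    using DERIV_chain2[OF d1 d2] by simp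
  from DERIV_cmult[OF this, of "B1\<^sup>2 / Beta (1-\<alpha>) (2*\<alpha>-1)"]
  have "((\<lambda>t. B1\<^sup>2 / Beta (1-\<alpha>) (2*\<alpha>-1) * S (T - t)) has_real_derivative - (B1\<^sup>2 / Beta (1-\<alpha>) (2*\<alpha>-1)) * h t) (at t)"
    by (simp only: mult_minus_left mult_minus_right)
  then show ?thesis
  proof (rule has_field_derivative_transform_within_open)
    show "B1\<^sup>2 / Beta (1-\<alpha>) (2*\<alpha>-1) * S (T - s) = R s" if "s \<in> {0<..<T}" for s
      using R_eq[OF that] by (rule sym)
  qed (use t in simp_all)
qed

end

section \<open>Absolute continuity and the flux\<close>

text \<open>The Caputo derivatives integrate \<open>deriv u\<close> over closed intervals, where its
  endpoint values are arbitrary. Only agreement with a Borel function on the open interval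
  matters.\<close>

lemma lebesgue_Icc_eq_lborel_Ioo:
  fixes f g :: "real \<Rightarrow> real"
  assumes g: "g \<in> borel_measurable borel" and eq: "\<And>s. a < s \<Longrightarrow> s < b \<Longrightarrow> f s = g s"
  shows "(LINT s:{a..b}|lebesgue. f s) = (LINT s:{a<..<b}|lborel. g s)"
    "set_integrable lebesgue {a..b} f \<longleftrightarrow> set_integrable lborel {a<..<b} g"
proof -
  have [measurable]: "g \<in> borel_measurable borel" by fact
  have m: "(\<lambda>s. indicator {a<..<b} s *\<^sub>R g s) \<in> borel_measurable lborel" by measurable
  have "(\<integral>s. indicator {a..b} s *\<^sub>R f s \<partial>lebesgue) = (\<integral>s. indicator {a<..<b} s *\<^sub>R g s \<partial>lebesgue)"
    by (rule integral_discrete_difference[where X="{a,b}"]) (use eq in \<open>auto simp: indicator_def\<close>)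
  then show "(LINT s:{a..b}|lebesgue. f s) = (LINT s:{a<..<b}|lborel. g s)"
    using integral_completion[OF m] by (simp add: set_lebesgue_integral_def)
  have "integrable lebesgue (\<lambda>s. indicator {a..b} s *\<^sub>R f s) \<longleftrightarrow> integrable lebesgue (\<lambda>s. indicator {a<..<b} s *\<^sub>R g s)"
    by (rule integrable_discrete_difference[where X="{a,b}"]) (use eq in \<open>auto simp: indicator_def\<close>)
  then show "set_integrable lebesgue {a..b} f \<longleftrightarrow> set_integrable lborel {a<..<b} g"
    using integrable_completion[OF m] by (simp add: set_integrable_def)
qed

lemma Gamma_reflection_real: "Gamma x * Gamma (1 - x) = pi / sin (pi * (x::real))"
proof -
  have "complex_of_real (Gamma x * Gamma (1 - x)) = Gamma (of_real x) * Gamma (1 - of_real x)"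
    by (simp add: Gamma_complex_of_real[symmetric])
  also have "\<dots> = of_real (pi / sin (pi * x))"
    unfolding Gamma_reflection_complex by (simp add: sin_of_real[symmetric])
  finally show ?thesis by (simp only: of_real_eq_iff)
qed

lemma abel_reflect:
  "(LINT s:{t<..<T}|lborel. (s - t) powr (p - 1) * \<phi> s) = abel p (\<lambda>s. \<phi> (T - s)) (T - t)"
  using set_integral_reflect(2)[of t T "\<lambda>s. (s - t) powr (p - 1) * \<phi> s" T] by (simp add: abel_def algebra_simps)

context fractional_dirichlet
begin

text \<open>Normalisation: with this factor \<open>c0 K\<close> is the inverse of \<open>u \<mapsto> - d/dt flux(u)\<close>.\<close>

definition c0 :: real where "c0 = 1 / (2 * \<bar>cos (pi * \<alpha>)\<bar> * (Gamma \<alpha>)\<^sup>2)"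

lemma cos_neg: "cos (pi * \<alpha>) < 0"
proof -
  have "cos (pi * \<alpha>) = - sin (pi * (\<alpha> - 1/2))" by (simp add: sin_diff cos_diff right_diff_distrib)
  moreover have "sin (pi * (\<alpha> - 1/2)) > 0"
  proof (rule sin_gt_zero)
    show "0 < pi * (\<alpha> - 1/2)" using alpha by simp
    have "pi * (\<alpha> - 1/2) < pi * 1" using alpha by (intro mult_strict_left_mono) auto
    then show "pi * (\<alpha> - 1/2) < pi" by simp
  qed
  ultimately show ?thesis by simp
qed

lemma c0_pos: "c0 > 0"
  unfolding c0_def using cos_neg Gamma_real_pos[of \<alpha>] alpha
  by (intro divide_pos_pos mult_pos_pos zero_less_power) auto

text \<open>Absolute continuity is checked through the integrable majorant \<open>wt\<close> of \<open>u'\<close>, cut at height \<open>N\<close>.\<close>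

lemma K_absolutely_continuous:
  assumes h: "bdd_borel h"
  shows "absolutely_continuous_fun_on 0 T (\<lambda>x. c * K h x)"
  unfolding absolutely_continuous_fun_on_def
proof (intro allI impI)
  fix \<epsilon> :: real assume eps: "\<epsilon> > 0"
  obtain H where H: "H \<ge> 0" "\<And>x. \<bar>h x\<bar> \<le> H" using bdd_borelE[OF h] by blast
  define C where "C = \<bar>c\<bar> * (H * cU) + 1"
  have C: "C > 0" unfolding C_def using H(1) cU_nonneg by (intro add_nonneg_pos mult_nonneg_nonneg) auto
  let ?rest = "\<lambda>N x. indicator {0<..<T} x *\<^sub>R (wt x - min (wt x) (real N))"
  have iw: "integrable lborel (\<lambda>x. indicator {0<..<T} x *\<^sub>R wt x)" using wt_integral(1) by (simp add: set_integrable_def)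
  have ir: "integrable lborel (?rest N)" for N
    by (rule Bochner_Integration.integrable_bound[OF iw]) (auto intro!: AE_I2 simp: indicator_def wt_nonneg)
  have "(\<lambda>N. \<integral>x. ?rest N x \<partial>lborel) \<longlonglongrightarrow> integral\<^sup>L lborel (\<lambda>x::real. 0)"
  proof (rule integral_dominated_convergence[where w="\<lambda>x. indicator {0<..<T} x *\<^sub>R wt x"])
    show "integrable lborel (\<lambda>x. indicator {0<..<T} x *\<^sub>R wt x)" by (rule iw)
    show "AE x in lborel. (\<lambda>N. ?rest N x) \<longlonglongrightarrow> 0"
    proof (rule AE_I2)
      fix x
      have "\<forall>\<^sub>F N in sequentially. ?rest N x = 0"
        using eventually_ge_at_top[of "nat \<lceil>wt x\<rceil>"] by eventually_elim (auto simp: min_def indicator_def; linarith)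
      then show "(\<lambda>N. ?rest N x) \<longlonglongrightarrow> 0" by (rule tendsto_eventually)
    qed
    show "AE x in lborel. norm (?rest N x) \<le> indicator {0<..<T} x *\<^sub>R wt x" for N
      by (rule AE_I2) (auto simp: indicator_def wt_nonneg)
  qed auto
  then have "\<forall>\<^sub>F N in sequentially. (\<integral>x. ?rest N x \<partial>lborel) < \<epsilon> / (2 * C)"
    using eps C by (intro order_tendstoD(2)) auto
  then obtain N where N: "(\<integral>x. ?rest N x \<partial>lborel) < \<epsilon> / (2 * C)" by (auto simp: eventually_sequentially)
  \<comment> \<open>The part of \<open>wt\<close> below height N costs at most N times the total
    length; \<open>real N + 1\<close> guards against N = 0.\<close>
  define \<delta> where "\<delta> = \<epsilon> / (2 * C * (real N + 1))"
  have del: "\<delta> > 0" using eps C by (simp add: \<delta>_def add_nonneg_pos)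
  show "\<exists>\<delta>>0. \<forall>(n::nat) l r. (\<forall>i<n. 0 \<le> l i \<and> l i \<le> r i \<and> r i \<le> T) \<and>
          (\<forall>i<n. \<forall>j<n. i \<noteq> j \<longrightarrow> {l i<..<r i} \<inter> {l j<..<r j} = {}) \<and> (\<Sum>i<n. r i - l i) < \<delta> \<longrightarrow>
          (\<Sum>i<n. \<bar>c * K h (r i) - c * K h (l i)\<bar>) < \<epsilon>"
  proof (rule exI[of _ \<delta>], intro conjI allI impI)
    show "\<delta> > 0" by (rule del)
    fix n :: nat and l r :: "nat \<Rightarrow> real"
    assume "(\<forall>i<n. 0 \<le> l i \<and> l i \<le> r i \<and> r i \<le> T) \<and>
          (\<forall>i<n. \<forall>j<n. i \<noteq> j \<longrightarrow> {l i<..<r i} \<inter> {l j<..<r j} = {}) \<and> (\<Sum>i<n. r i - l i) < \<delta>"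
    then have lr: "\<forall>i<n. 0 \<le> l i \<and> l i \<le> r i \<and> r i \<le> T"
      and disj: "\<forall>i<n. \<forall>j<n. i \<noteq> j \<longrightarrow> {l i<..<r i} \<inter> {l j<..<r j} = {}"
      and sum: "(\<Sum>i<n. r i - l i) < \<delta>" by blast+
    let ?A = "\<lambda>i. {l i<..<r i}"
    have sub: "set_integrable lborel (?A i) wt" if "i < n" for i
      by (rule set_integrable_subset[OF wt_integral(1)]) (use lr that in auto)
    have irest: "integrable lborel (\<lambda>x. indicator (?A i) x *\<^sub>R (wt x - min (wt x) (real N)))" if "i < n" for i
      by (rule Bochner_Integration.integrable_bound[OF sub[OF that, unfolded set_integrable_def]])
        (auto intro!: AE_I2 simp: indicator_def wt_nonneg)
    have imin: "integrable lborel (\<lambda>x. indicator (?A i) x *\<^sub>R min (wt x) (real N))" if "i < n" for i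
      by (rule Bochner_Integration.integrable_bound[OF sub[OF that, unfolded set_integrable_def]])
        (auto intro!: AE_I2 simp: indicator_def wt_nonneg)
    have each: "\<bar>c * K h (r i) - c * K h (l i)\<bar> \<le> C * (real N * (r i - l i) + (\<integral>x. indicator (?A i) x *\<^sub>R (wt x - min (wt x) (real N)) \<partial>lborel))"
      if i: "i < n" for i
    proof -
      have lri: "0 \<le> l i" "l i \<le> r i" "r i \<le> T" using lr i by auto
      have W: "(LINT s:{0<..<r i}|lborel. wt s) - (LINT s:{0<..<l i}|lborel. wt s) = (LINT s:?A i|lborel. wt s)"
      proof -
        have "AE x in lborel. x \<noteq> l i" by (rule AE_lborel_singleton)
        then have "(LINT s:{0<..<r i}|lborel. wt s) = (LINT s:{0<..<l i} \<union> ?A i|lborel. wt s)"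
          by (intro set_integral_cong_set) (use lri in \<open>auto simp: set_borel_measurable_def elim!: eventually_mono\<close>)
        also have "\<dots> = (LINT s:{0<..<l i}|lborel. wt s) + (LINT s:?A i|lborel. wt s)"
          by (rule set_integral_Un) (use lri sub[OF i] in \<open>auto intro!: set_integrable_subset[OF wt_integral(1)]\<close>)
        finally show ?thesis by simp
      qed
      have W0: "0 \<le> (LINT s:?A i|lborel. wt s)" unfolding set_lebesgue_integral_def
        by (intro Bochner_Integration.integral_nonneg) (auto simp: wt_nonneg)
      have "\<bar>c * K h (r i) - c * K h (l i)\<bar> = \<bar>c\<bar> * \<bar>K h (r i) - K h (l i)\<bar>"
        unfolding right_diff_distrib[symmetric] abs_mult ..
      also have "\<dots> \<le> \<bar>c\<bar> * (H * cU * (LINT s:?A i|lborel. wt s))"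
        using K_modulus[OF h H lri] unfolding W by (rule mult_left_mono) simp
      also have "\<dots> \<le> C * (LINT s:?A i|lborel. wt s)" using W0 by (simp add: C_def distrib_right)
      also have "(LINT s:?A i|lborel. wt s) = (\<integral>x. indicator (?A i) x *\<^sub>R min (wt x) (real N) \<partial>lborel) + (\<integral>x. indicator (?A i) x *\<^sub>R (wt x - min (wt x) (real N)) \<partial>lborel)"
        unfolding set_lebesgue_integral_def
        by (subst Bochner_Integration.integral_add[OF imin[OF i] irest[OF i], symmetric]) (simp add: algebra_simps)
      also have "(\<integral>x. indicator (?A i) x *\<^sub>R min (wt x) (real N) \<partial>lborel) \<le> real N * (r i - l i)"
        by (rule order.trans[OF abs_ge_self], rule integrable_bounded_support(2)) (use lri in \<open>auto simp: indicator_def wt_nonneg\<close>)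
      finally show ?thesis using C by (simp add: mult_left_mono)
    qed
    \<comment> \<open>Disjointness enters here: the masses of \<open>wt\<close> above height N over
      the intervals add up to at most the whole such mass, already made small.\<close>
    have ones: "(\<Sum>i<n. indicator (?A i) x) \<le> (indicator {0<..<T} x :: real)" for x
    proof (cases "\<exists>i<n. x \<in> ?A i")
      case True
      then obtain i where i: "i < n" "x \<in> ?A i" by blast
      have "x \<notin> ?A j" if "j < n" "j \<noteq> i" for j using i disj that by blast
      then have "(\<Sum>j<n. indicator (?A j) x) = (\<Sum>j\<in>{i}. indicator (?A j) x :: real)"
        using i(1) by (intro sum.mono_neutral_right) (auto simp del: greaterThanLessThan_iff)
      then show ?thesis using i lr by (auto simp: indicator_def)
    next
      case False
      then have "(\<Sum>i<n. indicator (?A i) x) = (0 :: real)" by (intro sum.neutral) (auto simp: indicator_def)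
      then show ?thesis by (simp only: indicator_pos_le)
    qed
    have "(\<Sum>i<n. \<integral>x. indicator (?A i) x *\<^sub>R (wt x - min (wt x) (real N)) \<partial>lborel)
        = (\<integral>x. (\<Sum>i<n. indicator (?A i) x *\<^sub>R (wt x - min (wt x) (real N))) \<partial>lborel)"
      by (rule Bochner_Integration.integral_sum[symmetric]) (use irest in auto)
    also have "\<dots> \<le> (\<integral>x. ?rest N x \<partial>lborel)"
    proof (rule integral_mono[OF _ ir])
      show "integrable lborel (\<lambda>x. \<Sum>i<n. indicator (?A i) x *\<^sub>R (wt x - min (wt x) (real N)))"
        by (rule Bochner_Integration.integrable_sum) (use irest in auto)
      show "(\<Sum>i<n. indicator (?A i) x *\<^sub>R (wt x - min (wt x) (real N))) \<le> ?rest N x" for x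
        unfolding real_scaleR_def sum_distrib_right[symmetric] by (rule mult_right_mono[OF ones]) simp
    qed
    finally have rest: "(\<Sum>i<n. \<integral>x. indicator (?A i) x *\<^sub>R (wt x - min (wt x) (real N)) \<partial>lborel) < \<epsilon> / (2 * C)" using N by simp
    have "(\<Sum>i<n. \<bar>c * K h (r i) - c * K h (l i)\<bar>)
       \<le> (\<Sum>i<n. C * (real N * (r i - l i) + (\<integral>x. indicator (?A i) x *\<^sub>R (wt x - min (wt x) (real N)) \<partial>lborel)))"
      by (rule sum_mono) (use each in auto)
    also have "\<dots> = C * (real N * (\<Sum>i<n. r i - l i) + (\<Sum>i<n. \<integral>x. indicator (?A i) x *\<^sub>R (wt x - min (wt x) (real N)) \<partial>lborel))"
      by (simp only: sum_distrib_left sum.distrib distrib_left)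
    also have "\<dots> < C * (\<epsilon> / (2 * C) + \<epsilon> / (2 * C))"
    proof (intro mult_strict_left_mono add_le_less_mono rest C)
      have "real N * (\<Sum>i<n. r i - l i) \<le> (real N + 1) * \<delta>"
        using sum lr by (intro mult_mono) (auto intro!: sum_nonneg)
      also have "\<dots> = \<epsilon> / (2 * C)" using C by (simp add: \<delta>_def)
      finally show "real N * (\<Sum>i<n. r i - l i) \<le> \<epsilon> / (2 * C)" .
    qed
    also have "\<dots> = \<epsilon>" using C by simp
    finally show "(\<Sum>i<n. \<bar>c * K h (r i) - c * K h (l i)\<bar>) < \<epsilon>" .
  qed
qed

lemma deriv_K:
  assumes "bdd_borel h" "continuous_on UNIV h" "0 < s" "s < T"
  shows "deriv (\<lambda>x. c * K h x) s = c * U h s"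
  using DERIV_cmult[OF DERIV_K[OF assms(1,2)], of s c] assms by (intro DERIV_imp_deriv) auto

lemma caputo_left_K:
  assumes h: "bdd_borel h" "continuous_on UNIV h" and t: "t < T" and a: "\<alpha> < 1"
  shows "caputo_left \<alpha> (\<lambda>x. c * K h x) t = c / Gamma (1-\<alpha>) * abel (1-\<alpha>) (U h) t"
proof -
  note [measurable] = bdd_borelD[OF h(1)]
  have "(LINT s:{0..t}|lebesgue. (t - s) powr (- \<alpha>) * deriv (\<lambda>x. c * K h x) s) = (LINT s:{0<..<t}|lborel. c * ((t - s) powr (1 - \<alpha> - 1) * U h s))"
    by (rule lebesgue_Icc_eq_lborel_Ioo(1)) (use t deriv_K[OF h] in \<open>auto simp: mult_ac\<close>)
  then show ?thesis using a by (simp add: caputo_left_def abel_def)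
qed

lemma caputo_right_K:
  assumes h: "bdd_borel h" "continuous_on UNIV h" and t: "0 < t" and a: "\<alpha> < 1"
  shows "caputo_right T \<alpha> (\<lambda>x. c * K h x) t = - (c / Gamma (1-\<alpha>) * abel (1-\<alpha>) (\<lambda>s. U h (T - s)) (T - t))"
proof -
  note [measurable] = bdd_borelD[OF h(1)]
  have "(LINT s:{t..T}|lebesgue. (s - t) powr (- \<alpha>) * deriv (\<lambda>x. c * K h x) s) = (LINT s:{t<..<T}|lborel. c * ((s - t) powr (1 - \<alpha> - 1) * U h s))"
    by (rule lebesgue_Icc_eq_lborel_Ioo(1)) (use t deriv_K[OF h] in \<open>auto simp: mult_ac\<close>)
  also have "\<dots> = c * abel (1-\<alpha>) (\<lambda>s. U h (T - s)) (T - t)" by (simp only: set_integral_mult_right abel_reflect)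
  finally show ?thesis using a by (simp add: caputo_right_def)
qed

end

section \<open>The flux as a Riesz potential and its normalisation\<close>

context riesz_flux
begin

lemma beta_over_gamma: "Beta (1-\<alpha>) (1-\<alpha>) / (Gamma (1-\<alpha>))\<^sup>2 = 1 / Gamma (2-2*\<alpha>)"
proof -
  have "1 - \<alpha> + (1 - \<alpha>) = 2 - 2*\<alpha>" by simp
  then show ?thesis using less_imp_neq[OF Gamma_real_pos[of "1-\<alpha>"]] alpha1 by (simp add: Beta_def power2_eq_square)
qed

text \<open>On each side the fractional integral and the Caputo derivative, both of order
  1-\<alpha>, compose to order 2-2\<alpha>. The sign in the right Caputo derivative turns the
  difference in the flux into a sum, so the two half-range integrals join to one over (0,T).\<close>

lemma flux_eq_R:
  assumes t: "t \<in> {0<..<T}"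
  shows "flux \<alpha> T (\<lambda>x. c * K h x) t = c / Gamma (2-2*\<alpha>) * R t"
proof -
  let ?u = "\<lambda>x. c * K h x" and ?U' = "\<lambda>s. U h (T - s)" and ?g = "Gamma (1-\<alpha>)"
  have ri: "set_integrable lborel {a<..<b} (\<lambda>s. \<bar>t - s\<bar> powr (1-2*\<alpha>) * U h s)" if "0 \<le> a" "b \<le> T" for a b
    by (rule set_integrable_subset[OF R_integrable[OF t]]) (use that in auto)
  have il: "set_integrable lborel {0<..<t} (\<lambda>s. (t - s) powr (1 - \<alpha> + (1-\<alpha>) - 1) * U h s)"
    by (subst set_integrable_cong[OF refl refl, of _ _ "\<lambda>s. \<bar>t - s\<bar> powr (1-2*\<alpha>) * U h s"]) (use t ri[of 0 t] in auto)
  have ir: "set_integrable lborel {0<..<T-t} (\<lambda>s. (T - t - s) powr (1 - \<alpha> + (1-\<alpha>) - 1) * ?U' s)"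
  proof -
    have "set_integrable lborel {0<..<T-t} (\<lambda>s. \<bar>t - (T - s)\<bar> powr (1-2*\<alpha>) * ?U' s)"
      using ri[of t T] t set_integral_reflect(1)[of t T "\<lambda>s. \<bar>t - s\<bar> powr (1-2*\<alpha>) * U h s" T] by simp
    moreover have "set_integrable lborel {0<..<T-t} (\<lambda>s. \<bar>t - (T - s)\<bar> powr (1-2*\<alpha>) * ?U' s)
      \<longleftrightarrow> set_integrable lborel {0<..<T-t} (\<lambda>s. (T - t - s) powr (1 - \<alpha> + (1-\<alpha>) - 1) * ?U' s)"
      by (rule set_integrable_cong) (auto simp: diff_diff_eq add.commute)
    ultimately show ?thesis by simp
  qed
  have coeff: "1 / ?g * (k / ?g * (Beta (1-\<alpha>) (1-\<alpha>) * x)) = k / Gamma (2-2*\<alpha>) * x" for k x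
  proof -
    have "1 / ?g * (k / ?g * (Beta (1-\<alpha>) (1-\<alpha>) * x)) = k * (Beta (1-\<alpha>) (1-\<alpha>) / ?g\<^sup>2) * x"
      by (simp add: power2_eq_square)
    then show ?thesis unfolding beta_over_gamma by simp
  qed
  have "frac_int_left (1-\<alpha>) (caputo_left \<alpha> ?u) t = 1 / ?g * (LINT s:{0..t}|lebesgue. (t - s) powr (1-\<alpha>-1) * caputo_left \<alpha> ?u s)"
    using alpha1 by (simp add: frac_int_left_def)
  also have "(LINT s:{0..t}|lebesgue. (t - s) powr (1-\<alpha>-1) * caputo_left \<alpha> ?u s) = (LINT s:{0<..<t}|lborel. c / ?g * ((t - s) powr (1-\<alpha>-1) * abel (1-\<alpha>) (U h) s))"
    by (rule lebesgue_Icc_eq_lborel_Ioo(1)) (use t caputo_left_K[OF h hc _ alpha1] in auto)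
  also have "\<dots> = c / ?g * abel (1-\<alpha>) (abel (1-\<alpha>) (U h)) t" by (simp only: set_integral_mult_right abel_def)
  also have "abel (1-\<alpha>) (abel (1-\<alpha>) (U h)) t = Beta (1-\<alpha>) (1-\<alpha>) * abel (1-\<alpha>+(1-\<alpha>)) (U h) t"
    by (rule abel_abel(2)[OF _ _ _ il]) (use alpha1 in auto)
  finally have L: "frac_int_left (1-\<alpha>) (caputo_left \<alpha> ?u) t = c / Gamma (2-2*\<alpha>) * abel (1-\<alpha>+(1-\<alpha>)) (U h) t"
    unfolding coeff .
  have "frac_int_right T (1-\<alpha>) (caputo_right T \<alpha> ?u) t = 1 / ?g * (LINT s:{t..T}|lebesgue. (s - t) powr (1-\<alpha>-1) * caputo_right T \<alpha> ?u s)"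
    using alpha1 by (simp add: frac_int_right_def)
  also have "(LINT s:{t..T}|lebesgue. (s - t) powr (1-\<alpha>-1) * caputo_right T \<alpha> ?u s) = (LINT s:{t<..<T}|lborel. (- c / ?g) * ((s - t) powr (1-\<alpha>-1) * abel (1-\<alpha>) ?U' (T - s)))"
    by (rule lebesgue_Icc_eq_lborel_Ioo(1)) (use t caputo_right_K[OF h hc _ alpha1] in auto)
  also have "\<dots> = (- c / ?g) * abel (1-\<alpha>) (abel (1-\<alpha>) ?U') (T - t)"
    by (simp only: set_integral_mult_right abel_reflect) (simp add: abel_def)
  also have "abel (1-\<alpha>) (abel (1-\<alpha>) ?U') (T - t) = Beta (1-\<alpha>) (1-\<alpha>) * abel (1-\<alpha>+(1-\<alpha>)) ?U' (T - t)"
    by (rule abel_abel(2)[OF _ _ _ ir]) (use alpha1 in auto)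
  finally have Rr: "frac_int_right T (1-\<alpha>) (caputo_right T \<alpha> ?u) t = - (c / Gamma (2-2*\<alpha>) * abel (1-\<alpha>+(1-\<alpha>)) ?U' (T - t))"
    unfolding coeff by simp
  have l: "abel (1-\<alpha>+(1-\<alpha>)) (U h) t = (LINT s:{0<..<t}|lborel. \<bar>t - s\<bar> powr (1-2*\<alpha>) * U h s)"
    unfolding abel_def by (rule set_lebesgue_integral_cong) auto
  have r: "abel (1-\<alpha>+(1-\<alpha>)) ?U' (T - t) = (LINT s:{t<..<T}|lborel. \<bar>t - s\<bar> powr (1-2*\<alpha>) * U h s)"
    unfolding abel_reflect[symmetric] by (rule set_lebesgue_integral_cong) (auto simp: abs_minus_commute)
  have "AE x in lborel. x \<noteq> t" by (rule AE_lborel_singleton)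
  then have "R t = (LINT s:{0<..<t} \<union> {t<..<T}|lborel. \<bar>t - s\<bar> powr (1-2*\<alpha>) * U h s)" unfolding R_def
    by (intro set_integral_cong_set) (use t in \<open>auto simp: set_borel_measurable_def elim!: eventually_mono\<close>)
  also have "\<dots> = abel (1-\<alpha>+(1-\<alpha>)) (U h) t + abel (1-\<alpha>+(1-\<alpha>)) ?U' (T - t)" unfolding l r
    by (rule set_integral_Un) (use t ri in auto)
  finally show ?thesis unfolding flux_def L Rr by (simp add: distrib_left)
qed

text \<open>The reflection formula at \<alpha> and at 2\<alpha>-1 leaves a quotient of sines, and
  the double-angle formula reduces it to 2 |cos(\<pi>\<alpha>)|. This is the origin of the cosine in
  \<open>kappa\<close>.\<close>

lemma normalisation: "c0 / Gamma (2-2*\<alpha>) * (B1\<^sup>2 / Beta (1-\<alpha>) (2*\<alpha>-1)) = 1"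
proof -
  have g: "Gamma \<alpha> > 0" "Gamma (1-\<alpha>) > 0" "Gamma (2*\<alpha>-1) > 0" "Gamma (2-2*\<alpha>) > 0"
    using alpha alpha1 by (auto intro: Gamma_real_pos)
  have e: "1 - \<alpha> + (2*\<alpha>-1) = \<alpha>" by simp
  have B: "B1\<^sup>2 / Beta (1-\<alpha>) (2*\<alpha>-1) = (Gamma \<alpha>)\<^sup>2 * (Gamma \<alpha> * Gamma (1-\<alpha>)) / Gamma (2*\<alpha>-1)"
    unfolding B1_def Beta_def e using g by (simp add: power2_eq_square field_simps)
  have r1: "Gamma \<alpha> * Gamma (1-\<alpha>) = pi / sin (pi * \<alpha>)" by (rule Gamma_reflection_real)
  have r2: "Gamma (2*\<alpha>-1) * Gamma (2-2*\<alpha>) = pi / sin (pi * (2*\<alpha>-1))"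
    using Gamma_reflection_real[of "2*\<alpha>-1"] by simp
  have "pi * \<alpha> < pi * 1" using alpha1 by (intro mult_strict_left_mono) auto
  then have s: "sin (pi * \<alpha>) > 0" using alpha by (intro sin_gt_zero) auto
  have "sin (pi * (2*\<alpha>-1)) = - sin (2 * (pi * \<alpha>))" by (simp add: sin_diff right_diff_distrib mult_ac)
  also have "\<dots> = 2 * sin (pi * \<alpha>) * \<bar>cos (pi * \<alpha>)\<bar>" using cos_neg by (simp add: sin_double)
  finally have s2: "sin (pi * (2*\<alpha>-1)) = 2 * sin (pi * \<alpha>) * \<bar>cos (pi * \<alpha>)\<bar>" .
  have "c0 / Gamma (2-2*\<alpha>) * (B1\<^sup>2 / Beta (1-\<alpha>) (2*\<alpha>-1))
     = c0 * (Gamma \<alpha>)\<^sup>2 * (Gamma \<alpha> * Gamma (1-\<alpha>)) / (Gamma (2*\<alpha>-1) * Gamma (2-2*\<alpha>))"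
    unfolding B by (simp add: mult_ac)
  also have "\<dots> = 1" unfolding r1 r2 s2 c0_def using s g cos_neg by (simp add: field_simps)
  finally show ?thesis .
qed

lemma DERIV_flux:
  assumes t: "t \<in> {0<..<T}"
  shows "(flux \<alpha> T (\<lambda>x. c0 * K h x) has_real_derivative - h t) (at t)"
proof -
  have "((\<lambda>t. c0 / Gamma (2-2*\<alpha>) * R t) has_real_derivative c0 / Gamma (2-2*\<alpha>) * (- (B1\<^sup>2 / Beta (1-\<alpha>) (2*\<alpha>-1)) * h t)) (at t)"
    by (rule DERIV_cmult[OF DERIV_R[OF t]])
  also have "c0 / Gamma (2-2*\<alpha>) * (- (B1\<^sup>2 / Beta (1-\<alpha>) (2*\<alpha>-1)) * h t) = - (c0 / Gamma (2-2*\<alpha>) * (B1\<^sup>2 / Beta (1-\<alpha>) (2*\<alpha>-1))) * h t"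
    by (simp only: mult_minus_left mult_minus_right mult.assoc)
  also have "\<dots> = - h t" unfolding normalisation by simp
  finally show ?thesis
    by (rule has_field_derivative_transform_within_open[of _ _ _ "{0<..<T}"]) (use t flux_eq_R in auto)
qed

end

context fractional_dirichlet
begin

text \<open>Here \<open>dG\<close> is the derivative of the classical Green function of the second
  derivative: (T-y)/T for y > s and -y/T for y < s. Thus \<open>U h\<close> is a constant minus the
  primitive of \<open>h\<close>.\<close>

lemma DERIV_U_one:
  assumes a: "\<alpha> = 1" and h: "bdd_borel h" and hc: "continuous_on UNIV h" and t: "t \<in> {0<..<T}"
  shows "(U h has_real_derivative - h t) (at t)"
proof -
  note [measurable] = bdd_borelD[OF h]
  obtain H where H: "H \<ge> 0" "\<And>x. \<bar>h x\<bar> \<le> H" using bdd_borelE[OF h] by blast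
  have ib: "integrable lborel (\<lambda>y. indicator {0<..<z} y * (g y * h y))" if [measurable]: "g \<in> borel_measurable borel" and "\<And>y. y \<in> {0<..<z} \<Longrightarrow> \<bar>g y\<bar> \<le> 1" for g z
  proof (rule integrable_bounded_support(1)[where a=0 and b=z and C="1 * H"])
    show "\<bar>indicator {0<..<z} y * (g y * h y)\<bar> \<le> 1 * H" for y
    proof (cases "y \<in> {0<..<z}")
      case True
      then show ?thesis using mult_mono[OF that(2)[OF True] H(2)[of y]] by (simp add: abs_mult)
    qed (simp add: H)
  qed (auto simp: indicator_def)
  define Q where "Q = (\<integral>y. indicator {0<..<T} y * ((T - y) / T * h y) \<partial>lborel)"
  have UQ: "U h s = Q - (LINT y:{0<..<s}|lborel. h y)" if s: "s \<in> {0<..<T}" for s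
  proof -
    have "U h s = (\<integral>y. indicator {0<..<T} y * ((T - y) / T * h y) - indicator {0<..<s} y * (1 * h y) \<partial>lborel)"
      unfolding U_def
    proof (rule integral_cong_AE)
      have "AE y in lborel. y \<noteq> s" by (rule AE_lborel_singleton)
      then show "AE y in lborel. dG s y * h y = indicator {0<..<T} y * ((T - y) / T * h y) - indicator {0<..<s} y * (1 * h y)"
      proof eventually_elim
        case (elim y)
        have p: "T powr (-1) = 1 / T" using T by (simp add: powr_minus_divide)
        show ?case unfolding dG_def using elim s T p by (auto simp: a indicator_def field_simps)
      qed
    qed measurable
    also have "\<dots> = Q - (\<integral>y. indicator {0<..<s} y * (1 * h y) \<partial>lborel)" unfolding Q_def
      by (rule Bochner_Integration.integral_diff; rule ib) (use T in auto)
    finally show ?thesis by (simp add: set_lebesgue_integral_def)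
  qed
  have "((\<lambda>s. Q - (LINT y:{0<..<s}|lborel. h y)) has_real_derivative 0 - h t) (at t)"
  proof (rule DERIV_diff[OF DERIV_const DERIV_indefinite_integral])
    show "continuous_on {0<..<T} h" by (rule continuous_on_subset[OF hc]) simp
    show "set_integrable lborel {0<..<z} h" for z using ib[of "\<lambda>_. 1" z] by (simp add: set_integrable_def)
  qed (use t in auto)
  then show ?thesis unfolding diff_0
  proof (rule has_field_derivative_transform_within_open[where S="{0<..<T}"])
    show "Q - (LINT y:{0<..<s}|lborel. h y) = U h s" if "s \<in> {0<..<T}" for s
      using UQ[OF that] by (rule sym)
  qed (use t in simp_all)
qed

lemma DERIV_flux_K:
  assumes h: "bdd_borel h" and hc: "continuous_on UNIV h" and t: "t \<in> {0<..<T}"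
  shows "(flux \<alpha> T (\<lambda>x. c0 * K h x) has_real_derivative - h t) (at t)"
proof (cases "\<alpha> = 1")
  case True
  \<comment> \<open>Both fractional integrals are the identity now and the flux is 2u', which this
    factor compensates.\<close>
  have "c0 = 1 / 2" unfolding c0_def using True by simp
  then have fl: "U h s = flux \<alpha> T (\<lambda>x. c0 * K h x) s" if "s \<in> {0<..<T}" for s
    using deriv_K[OF h hc, of s c0] that True
    by (simp add: flux_def frac_int_left_def frac_int_right_def caputo_left_def caputo_right_def)
  show ?thesis
    by (rule has_field_derivative_transform_within_open[OF DERIV_U_one[OF True h hc t], where S="{0<..<T}"])
      (use t in simp, use t in simp, erule fl)
next
  case False
  then interpret riesz_flux T \<alpha> h using alpha h hc by unfold_locales auto
  show ?thesis by (rule DERIV_flux[OF t])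
qed

end

section \<open>Density of polynomials in the energy space\<close>

lemma integral_square_triangle:
  fixes f g :: "real \<Rightarrow> real"
  assumes [measurable]: "f \<in> borel_measurable borel" "g \<in> borel_measurable borel"
    and f: "set_integrable lborel {0<..<T} (\<lambda>x. (f x)\<^sup>2)" and g: "set_integrable lborel {0<..<T} (\<lambda>x. (g x)\<^sup>2)"
  shows "set_integrable lborel {0<..<T} (\<lambda>x. (f x + g x)\<^sup>2)"
    "(LINT x:{0<..<T}|lborel. (f x + g x)\<^sup>2) \<le> 2 * (LINT x:{0<..<T}|lborel. (f x)\<^sup>2) + 2 * (LINT x:{0<..<T}|lborel. (g x)\<^sup>2)"
proof -
  have b: "(f x + g x)\<^sup>2 \<le> 2 * (f x)\<^sup>2 + 2 * (g x)\<^sup>2" for x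
    using zero_le_power2[of "f x - g x"] by (simp add: power2_sum power2_diff)
  have i: "set_integrable lborel {0<..<T} (\<lambda>x. 2 * (f x)\<^sup>2 + 2 * (g x)\<^sup>2)"
    by (intro set_integral_add(1) set_integrable_mult_right f g)
  show j: "set_integrable lborel {0<..<T} (\<lambda>x. (f x + g x)\<^sup>2)"
    by (rule set_integrable_bound[OF i]) (use b in \<open>auto simp: set_borel_measurable_def intro!: AE_I2\<close>)
  have "(LINT x:{0<..<T}|lborel. (f x + g x)\<^sup>2) \<le> (LINT x:{0<..<T}|lborel. 2 * (f x)\<^sup>2 + 2 * (g x)\<^sup>2)"
    by (rule set_integral_mono[OF j i b])
  then show "(LINT x:{0<..<T}|lborel. (f x + g x)\<^sup>2) \<le> 2 * (LINT x:{0<..<T}|lborel. (f x)\<^sup>2) + 2 * (LINT x:{0<..<T}|lborel. (g x)\<^sup>2)"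
    by (simp add: set_integral_add(2)[OF set_integrable_mult_right[OF f] set_integrable_mult_right[OF g]])
qed

lemma bounded_set_integrable:
  assumes [measurable]: "g \<in> borel_measurable borel" and "\<And>x. 0 < x \<Longrightarrow> x < T \<Longrightarrow> \<bar>g x\<bar> \<le> C" and T: "T > 0"
  shows "set_integrable lborel {0<..<T} (g :: real \<Rightarrow> real)" "(LINT x:{0<..<T}|lborel. g x) \<le> C * T"
proof -
  have C: "C \<ge> 0" using assms(2)[of "T/2"] T abs_ge_zero[of "g (T/2)"] by simp
  have b: "\<bar>indicator {0<..<T} x *\<^sub>R g x\<bar> \<le> C" for x using assms(2)[of x] C by (auto simp: indicator_def)
  show "set_integrable lborel {0<..<T} g" unfolding set_integrable_def
    by (rule integrable_bounded_support(1)[where a=0 and b=T, OF _ b]) (auto simp: indicator_def)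
  have "\<bar>\<integral>x. indicator {0<..<T} x *\<^sub>R g x \<partial>lborel\<bar> \<le> C * (T - 0)"
    by (rule integrable_bounded_support(2)[OF _ b]) (use T in \<open>auto simp: indicator_def\<close>)
  then show "(LINT x:{0<..<T}|lborel. g x) \<le> C * T" by (simp add: set_lebesgue_integral_def)
qed

lemma poly_measurable [measurable]: "poly (q::real poly) \<in> borel_measurable borel"
  by (intro borel_measurable_continuous_onI continuous_intros)

lemma poly_bounded_Ioo:
  fixes q :: "real poly" and T :: real
  obtains C where "C \<ge> 0" "\<And>x. 0 < x \<Longrightarrow> x < T \<Longrightarrow> \<bar>poly q x\<bar> \<le> C"
proof -
  have "compact (poly q ` {0..T})" by (intro compact_continuous_image continuous_intros) auto
  then obtain H where "\<forall>y\<in>poly q ` {0..T}. norm y \<le> H" using compact_imp_bounded bounded_iff by metis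
  then show thesis by (intro that[of "\<bar>H\<bar>"]) (auto intro: order.trans[OF _ abs_ge_self])
qed

text \<open>A measurable function is an almost everywhere limit of continuous ones; clipping these
  to [-B,B] keeps the limit and gives a dominating constant. A uniform polynomial approximation of
  one clipped function finishes.\<close>

lemma polynomial_dense_L2_bounded:
  fixes E :: "real \<Rightarrow> real"
  assumes [measurable]: "E \<in> borel_measurable borel" and B: "\<And>x. \<bar>E x\<bar> \<le> B" and T: "T > 0" and eps: "\<epsilon> > 0"
  obtains q :: "real poly" where "(LINT x:{0<..<T}|lborel. (poly q x - E x)\<^sup>2) < \<epsilon>"
proof -
  have "E \<in> borel_measurable lebesgue" by (rule measurable_completion) simp
  then have "E measurable_on UNIV" by (rule lebesgue_measurable_imp_measurable_on) simp
  then obtain N g where N: "negligible N" and gc: "\<And>n. continuous_on UNIV (g n)"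
    and lim: "\<And>x. x \<notin> N \<Longrightarrow> (\<lambda>n::nat. g n x) \<longlonglongrightarrow> E x" unfolding measurable_on_def by auto
  have "AE x in lebesgue. x \<notin> N" using N by (intro AE_not_in) (simp add: negligible_iff_null_sets)
  then have AEN: "AE x in lborel. x \<notin> N" by (simp only: AE_completion_iff)
  define k where "k n x = max (-B) (min B (g n x))" for n x
  have kc: "continuous_on UNIV (k n)" for n unfolding k_def by (intro continuous_intros gc)
  have [measurable]: "k n \<in> borel_measurable borel" for n by (rule borel_measurable_continuous_onI[OF kc])
  have kB: "\<bar>k n x\<bar> \<le> B" for n x using B[of x] by (auto simp: k_def min_def max_def)
  have kE: "(k n x - E x)\<^sup>2 \<le> (2 * B)\<^sup>2" for n x
  proof -
    have "\<bar>k n x - E x\<bar> \<le> 2 * B" using kB[of n x] B[of x] by linarith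
    then have "\<bar>k n x - E x\<bar>\<^sup>2 \<le> (2 * B)\<^sup>2" by (rule power_mono) simp
    then show ?thesis by simp
  qed
  have bi: "set_integrable lborel {0<..<T} (\<lambda>x. (k n x - E x)\<^sup>2)" for n
    by (rule bounded_set_integrable(1)[where C="(2*B)\<^sup>2"]) (use kE T in auto)
  have "(\<lambda>n. LINT x:{0<..<T}|lborel. (k n x - E x)\<^sup>2) \<longlonglongrightarrow> integral\<^sup>L lborel (\<lambda>x::real. 0)"
    unfolding set_lebesgue_integral_def
  proof (rule integral_dominated_convergence[where w="\<lambda>x. indicator {0<..<T} x *\<^sub>R (2 * B)\<^sup>2"])
    show "integrable lborel (\<lambda>x. indicator {0<..<T} x *\<^sub>R (2 * B)\<^sup>2)"
      using bounded_set_integrable(1)[of "\<lambda>_. (2*B)\<^sup>2" T "(2*B)\<^sup>2"] T by (simp add: set_integrable_def)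
    show "AE x in lborel. (\<lambda>n. indicator {0<..<T} x *\<^sub>R (k n x - E x)\<^sup>2) \<longlonglongrightarrow> 0"
      using AEN
    proof eventually_elim
      fix x assume x: "x \<notin> N"
      have "(\<lambda>n. k n x) \<longlonglongrightarrow> max (-B) (min B (E x))" unfolding k_def by (intro tendsto_intros lim x)
      also have "max (-B) (min B (E x)) = E x" using B[of x] by (auto simp: abs_le_iff)
      finally have "(\<lambda>n. indicator {0<..<T} x *\<^sub>R (k n x - E x)\<^sup>2) \<longlonglongrightarrow> indicator {0<..<T} x *\<^sub>R (E x - E x)\<^sup>2"
        by (intro tendsto_intros)
      then show "(\<lambda>n. indicator {0<..<T} x *\<^sub>R (k n x - E x)\<^sup>2) \<longlonglongrightarrow> 0" by simp
    qed
    show "AE x in lborel. norm (indicator {0<..<T} x *\<^sub>R (k n x - E x)\<^sup>2) \<le> indicator {0<..<T} x *\<^sub>R (2 * B)\<^sup>2" for n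
      by (rule AE_I2) (use kE in \<open>auto simp: indicator_def\<close>)
  qed measurable
  then have "\<forall>\<^sub>F n in sequentially. (LINT x:{0<..<T}|lborel. (k n x - E x)\<^sup>2) < \<epsilon> / 4"
    using eps by (intro order_tendstoD(2)) auto
  then obtain n where n: "(LINT x:{0<..<T}|lborel. (k n x - E x)\<^sup>2) < \<epsilon> / 4" by (auto simp: eventually_sequentially)
  \<comment> \<open>Twice the squared uniform error costs \<epsilon>/4; together with less than
    \<epsilon>/2 from the continuous approximation this stays below \<epsilon>.\<close>
  define \<eta> where "\<eta> = sqrt (\<epsilon> / (8 * T))"
  have eta: "\<eta> > 0" "\<eta>\<^sup>2 = \<epsilon> / (8 * T)" using eps T by (simp_all add: \<eta>_def)
  obtain p where p: "real_polynomial_function p" "\<And>x. x \<in> {0..T} \<Longrightarrow> \<bar>k n x - p x\<bar> < \<eta>"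
    using Stone_Weierstrass_real_polynomial_function[of "{0..T}" "k n" \<eta>] continuous_on_subset[OF kc] eta(1) by auto
  obtain a m where am: "p = (\<lambda>x. \<Sum>i\<le>m. a i * x ^ i)" using p(1) real_polynomial_function_iff_sum by blast
  define q where "q = (\<Sum>i\<le>m. monom (a i) i)"
  have q: "poly q x = p x" for x by (simp add: q_def am poly_sum poly_monom)
  have sq: "(poly q x - k n x)\<^sup>2 \<le> \<eta>\<^sup>2" if "0 < x" "x < T" for x
  proof -
    have "\<bar>poly q x - k n x\<bar> \<le> \<eta>" using p(2)[of x] that by (simp add: q abs_minus_commute)
    then have "\<bar>poly q x - k n x\<bar>\<^sup>2 \<le> \<eta>\<^sup>2" by (rule power_mono) simp
    then show ?thesis by simp
  qed
  have s1: "set_integrable lborel {0<..<T} (\<lambda>x. (poly q x - k n x)\<^sup>2)" "(LINT x:{0<..<T}|lborel. (poly q x - k n x)\<^sup>2) \<le> \<eta>\<^sup>2 * T"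
    by (rule bounded_set_integrable[where C="\<eta>\<^sup>2"]; use sq T in auto)+
  have "(LINT x:{0<..<T}|lborel. ((poly q x - k n x) + (k n x - E x))\<^sup>2) \<le> 2 * (LINT x:{0<..<T}|lborel. (poly q x - k n x)\<^sup>2) + 2 * (LINT x:{0<..<T}|lborel. (k n x - E x)\<^sup>2)"
    by (rule integral_square_triangle(2)[OF _ _ s1(1) bi]) measurable
  also have "\<dots> < \<epsilon>" using s1(2) n eta(2) T eps by simp
  finally show thesis by (intro that[of q]) simp
qed

text \<open>With b = 1-\<alpha> the approximants are Caputo derivatives of polynomials. Dividing
  \<open>D\<close> by the weight may leave L2, so the quotient is truncated first; multiplied back
  by the weight, the truncation error is at most 2|D| pointwise.\<close>

lemma polynomial_dense_L2_weighted:
  fixes D :: "real \<Rightarrow> real"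
  assumes [measurable]: "D \<in> borel_measurable borel" and D: "set_integrable lborel {0<..<T} (\<lambda>x. (D x)\<^sup>2)"
    and T: "T > 0" and eps: "\<epsilon> > 0" and b: "b \<ge> 0"
  obtains q :: "real poly" where "set_integrable lborel {0<..<T} (\<lambda>x. (x powr b * poly q x - D x)\<^sup>2)"
    "(LINT x:{0<..<T}|lborel. (x powr b * poly q x - D x)\<^sup>2) < \<epsilon>"
proof -
  define E where "E k x = max (- real k) (min (real k) (x powr (-b) * D x))" for k x
  have [measurable]: "E k \<in> borel_measurable borel" for k unfolding E_def by measurable
  have can: "x powr b * x powr (-b) = 1" if "x > 0" for x :: real using that by (simp add: powr_add[symmetric])
  have le: "(x powr b * E k x - D x)\<^sup>2 \<le> 4 * (D x)\<^sup>2" if x: "x > 0" for k x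
  proof -
    have "\<bar>E k x\<bar> \<le> \<bar>x powr (-b) * D x\<bar>" by (auto simp: E_def min_def max_def)
    then have "x powr b * \<bar>E k x\<bar> \<le> x powr b * \<bar>x powr (-b) * D x\<bar>" by (rule mult_left_mono) simp
    also have "\<dots> = (x powr b * x powr (-b)) * \<bar>D x\<bar>" by (simp add: abs_mult)
    finally have "\<bar>x powr b * E k x\<bar> \<le> \<bar>D x\<bar>" using can[OF x] by (simp add: abs_mult)
    then have "\<bar>x powr b * E k x - D x\<bar> \<le> 2 * \<bar>D x\<bar>" by linarith
    then have "\<bar>x powr b * E k x - D x\<bar>\<^sup>2 \<le> (2 * \<bar>D x\<bar>)\<^sup>2" by (rule power_mono) simp
    then show ?thesis by simp
  qed
  have D4: "set_integrable lborel {0<..<T} (\<lambda>x. 4 * (D x)\<^sup>2)" by (rule set_integrable_mult_right[OF D])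
  have Ei: "set_integrable lborel {0<..<T} (\<lambda>x. (x powr b * E k x - D x)\<^sup>2)" for k
    by (rule set_integrable_bound[OF D4]) (use le in \<open>auto simp: set_borel_measurable_def intro!: AE_I2\<close>)
  have "(\<lambda>k. LINT x:{0<..<T}|lborel. (x powr b * E k x - D x)\<^sup>2) \<longlonglongrightarrow> integral\<^sup>L lborel (\<lambda>x::real. 0)"
    unfolding set_lebesgue_integral_def
  proof (rule integral_dominated_convergence[where w="\<lambda>x. indicator {0<..<T} x *\<^sub>R (4 * (D x)\<^sup>2)"])
    show "integrable lborel (\<lambda>x. indicator {0<..<T} x *\<^sub>R (4 * (D x)\<^sup>2))" using D4 by (simp add: set_integrable_def)
    show "AE x in lborel. (\<lambda>k. indicator {0<..<T} x *\<^sub>R (x powr b * E k x - D x)\<^sup>2) \<longlonglongrightarrow> 0"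
    proof (rule AE_I2)
      fix x
      have "\<forall>\<^sub>F k in sequentially. indicator {0<..<T} x *\<^sub>R (x powr b * E k x - D x)\<^sup>2 = 0"
        using eventually_ge_at_top[of "nat \<lceil>\<bar>x powr (-b) * D x\<bar>\<rceil>"]
      proof eventually_elim
        fix k assume "nat \<lceil>\<bar>x powr (-b) * D x\<bar>\<rceil> \<le> k"
        then have "\<bar>x powr (-b) * D x\<bar> \<le> real k" by linarith
        then have "E k x = x powr (-b) * D x" by (auto simp: E_def)
        then have "x powr b * E k x = (x powr b * x powr (-b)) * D x" by simp
        then show "indicator {0<..<T} x *\<^sub>R (x powr b * E k x - D x)\<^sup>2 = 0" using can[of x] by (auto simp: indicator_def)
      qed
      then show "(\<lambda>k. indicator {0<..<T} x *\<^sub>R (x powr b * E k x - D x)\<^sup>2) \<longlonglongrightarrow> 0" by (rule tendsto_eventually)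
    qed
    show "AE x in lborel. norm (indicator {0<..<T} x *\<^sub>R (x powr b * E k x - D x)\<^sup>2) \<le> indicator {0<..<T} x *\<^sub>R (4 * (D x)\<^sup>2)" for k
      by (rule AE_I2) (use le in \<open>auto simp: indicator_def\<close>)
  qed measurable
  then have "\<forall>\<^sub>F k in sequentially. (LINT x:{0<..<T}|lborel. (x powr b * E k x - D x)\<^sup>2) < \<epsilon> / 4"
    using eps by (intro order_tendstoD(2)) auto
  then obtain k where k: "(LINT x:{0<..<T}|lborel. (x powr b * E k x - D x)\<^sup>2) < \<epsilon> / 4" by (auto simp: eventually_sequentially)
  have Tb: "T powr b > 0" using T by simp
  obtain q where q: "(LINT x:{0<..<T}|lborel. (poly q x - E k x)\<^sup>2) < \<epsilon> / (4 * (T powr b)\<^sup>2)"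
  proof (rule polynomial_dense_L2_bounded[of "E k" "real k" T "\<epsilon> / (4 * (T powr b)\<^sup>2)"])
    show "\<bar>E k x\<bar> \<le> real k" for x by (auto simp: E_def)
    show "\<epsilon> / (4 * (T powr b)\<^sup>2) > 0" using eps Tb by simp
  qed (use T in auto)
  have ple: "(x powr b * poly q x - x powr b * E k x)\<^sup>2 \<le> (T powr b)\<^sup>2 * (poly q x - E k x)\<^sup>2" if "0 < x" "x < T" for x
  proof -
    have "(x powr b)\<^sup>2 \<le> (T powr b)\<^sup>2" using that b by (intro power_mono powr_mono2) auto
    then show ?thesis unfolding right_diff_distrib[symmetric] power_mult_distrib by (rule mult_right_mono) simp
  qed
  obtain C where C: "\<And>x. 0 < x \<Longrightarrow> x < T \<Longrightarrow> \<bar>poly q x\<bar> \<le> C"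
    using poly_bounded_Ioo[of T q] by metis
  have i0: "set_integrable lborel {0<..<T} (\<lambda>x. (poly q x - E k x)\<^sup>2)"
  proof (rule bounded_set_integrable(1)[where C="(C + real k)\<^sup>2"])
    fix x assume "0 < x" "x < T"
    have "\<bar>E k x\<bar> \<le> real k" by (auto simp: E_def)
    then have "\<bar>poly q x - E k x\<bar> \<le> C + real k" using C[OF \<open>0 < x\<close> \<open>x < T\<close>] by linarith
    then have "\<bar>poly q x - E k x\<bar>\<^sup>2 \<le> (C + real k)\<^sup>2" by (rule power_mono) simp
    then show "\<bar>(poly q x - E k x)\<^sup>2\<bar> \<le> (C + real k)\<^sup>2" by simp
  qed (use T in auto)
  have i1: "set_integrable lborel {0<..<T} (\<lambda>x. (x powr b * poly q x - x powr b * E k x)\<^sup>2)"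
    by (rule set_integrable_bound[OF set_integrable_mult_right[OF i0, of "(T powr b)\<^sup>2"]])
      (use ple in \<open>auto simp: set_borel_measurable_def intro!: AE_I2\<close>)
  have "(LINT x:{0<..<T}|lborel. (x powr b * poly q x - x powr b * E k x)\<^sup>2) \<le> (LINT x:{0<..<T}|lborel. (T powr b)\<^sup>2 * (poly q x - E k x)\<^sup>2)"
    by (rule set_integral_mono[OF i1 set_integrable_mult_right[OF i0]]) (use ple in auto)
  also have "\<dots> = (T powr b)\<^sup>2 * (LINT x:{0<..<T}|lborel. (poly q x - E k x)\<^sup>2)" by simp
  also have "\<dots> < (T powr b)\<^sup>2 * (\<epsilon> / (4 * (T powr b)\<^sup>2))" using q Tb by (intro mult_strict_left_mono) auto
  also have "\<dots> = \<epsilon> / 4" using Tb by simp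
  finally have l1: "(LINT x:{0<..<T}|lborel. (x powr b * poly q x - x powr b * E k x)\<^sup>2) < \<epsilon> / 4" .
  have m1: "(\<lambda>x. x powr b * poly q x - x powr b * E k x) \<in> borel_measurable borel" "(\<lambda>x. x powr b * E k x - D x) \<in> borel_measurable borel" by measurable
  have "(LINT x:{0<..<T}|lborel. ((x powr b * poly q x - x powr b * E k x) + (x powr b * E k x - D x))\<^sup>2) < \<epsilon>"
    using integral_square_triangle(2)[OF m1 i1 Ei] l1 k eps by linarith
  moreover have "set_integrable lborel {0<..<T} (\<lambda>x. ((x powr b * poly q x - x powr b * E k x) + (x powr b * E k x - D x))\<^sup>2)"
    by (rule integral_square_triangle(1)[OF m1 i1 Ei])
  ultimately show thesis by (intro that[of q]) auto
qed


section \<open>Polynomials with prescribed Caputo derivative\<close>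

lemma abel_power:
  assumes "p > 0" "q > 0" "z > 0"
  shows "set_integrable lborel {0<..<z} (\<lambda>s. (z - s) powr (p - 1) * s powr (q - 1))"
    "abel p (\<lambda>s. s powr (q - 1)) z = z powr (p + q - 1) * Beta p q"
  using beta_integral[of p q 0 z] assms by (simp_all add: abel_def)

lemma abel_sum:
  assumes "finite I" "\<And>i. i \<in> I \<Longrightarrow> set_integrable lborel {0<..<z} (\<lambda>s. (z - s) powr (p - 1) * \<phi> i s)"
  shows "abel p (\<lambda>s. \<Sum>i\<in>I. \<phi> i s) z = (\<Sum>i\<in>I. abel p (\<phi> i) z)"
proof -
  have "(\<Sum>i\<in>I. abel p (\<phi> i) z) = (\<integral>s. (\<Sum>i\<in>I. indicator {0<..<z} s *\<^sub>R ((z - s) powr (p - 1) * \<phi> i s)) \<partial>lborel)"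
    unfolding abel_def set_lebesgue_integral_def
    by (rule Bochner_Integration.integral_sum[symmetric]) (use assms in \<open>auto simp: set_integrable_def\<close>)
  also have "\<dots> = abel p (\<lambda>s. \<Sum>i\<in>I. \<phi> i s) z"
    unfolding abel_def set_lebesgue_integral_def by (simp add: sum_distrib_left)
  finally show ?thesis by simp
qed

lemma abel_poly_integrable:
  assumes "p > 0" shows "set_integrable lborel {0<..<z} (\<lambda>s. (z - s) powr (p - 1) * poly (q::real poly) s)"
proof (cases "z > 0")
  case True
  obtain C where C: "C \<ge> 0" "\<And>x. 0 < x \<Longrightarrow> x < z \<Longrightarrow> \<bar>poly q x\<bar> \<le> C" using poly_bounded_Ioo[of z q] by metis
  show ?thesis
    by (rule abel_power_bound(1)[where q=1 and C=C]) (use C assms True in auto)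
qed (simp add: set_integrable_def)

text \<open>Cauchy-Schwarz with the kernel of order \<alpha>, square integrable for \<alpha> > 1/2.
  It controls a function uniformly, including its value at T, by the L2 norm of its Caputo
  derivative.\<close>

lemma abel_L2_bound:
  assumes [measurable]: "\<phi> \<in> borel_measurable borel" and a: "1/2 < \<alpha>" and x: "0 < x" "x \<le> T"
    and \<phi>: "set_integrable lborel {0<..<T} (\<lambda>s. (\<phi> s)\<^sup>2)"
  shows "set_integrable lborel {0<..<x} (\<lambda>s. (x - s) powr (\<alpha> - 1) * \<phi> s)"
    "(abel \<alpha> \<phi> x)\<^sup>2 \<le> T powr (2*\<alpha>-1) / (2*\<alpha>-1) * (LINT s:{0<..<T}|lborel. (\<phi> s)\<^sup>2)"
proof -
  let ?f = "\<lambda>s. indicator {0<..<x} s * (x - s) powr (\<alpha> - 1)" and ?g = "\<lambda>s. indicator {0<..<T} s * \<phi> s"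
  have pw: "((x - s) powr (\<alpha> - 1))\<^sup>2 = (x - s) powr ((2*\<alpha>-1) - 1)" if "s < x" for s
    using that by (simp add: powr_power algebra_simps)
  have f2: "(\<lambda>s. (?f s)\<^sup>2) = (\<lambda>s. indicator {0<..<x} s *\<^sub>R (x - s) powr ((2*\<alpha>-1) - 1))"
    using pw by (auto simp: indicator_def fun_eq_iff)
  have g2: "(\<lambda>s. (?g s)\<^sup>2) = (\<lambda>s. indicator {0<..<T} s *\<^sub>R (\<phi> s)\<^sup>2)"
    by (auto simp: indicator_def fun_eq_iff)
  have fg: "(\<lambda>s. ?f s * ?g s) = (\<lambda>s. indicator {0<..<x} s *\<^sub>R ((x - s) powr (\<alpha> - 1) * \<phi> s))"
    using x by (auto simp: indicator_def fun_eq_iff)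
  have "0 < 2*\<alpha>-1" using a by simp
  note pwi = power_integral(1,2)[OF this x(1)]
  have fi: "integrable lborel (\<lambda>s. (?f s)\<^sup>2)" unfolding f2 using pwi(1) by (simp add: set_integrable_def)
  have gi: "integrable lborel (\<lambda>s. (?g s)\<^sup>2)" unfolding g2 using \<phi> by (simp add: set_integrable_def)
  have mf: "?f \<in> borel_measurable borel" "?g \<in> borel_measurable borel" by measurable
  note cs = cauchy_schwarz_integral[OF mf fi gi]
  show "set_integrable lborel {0<..<x} (\<lambda>s. (x - s) powr (\<alpha> - 1) * \<phi> s)"
    using cs(1) unfolding fg set_integrable_def .
  have "(abel \<alpha> \<phi> x)\<^sup>2 \<le> (x powr (2*\<alpha>-1) / (2*\<alpha>-1)) * (LINT s:{0<..<T}|lborel. (\<phi> s)\<^sup>2)"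
    using cs(2) pwi(2) unfolding fg f2 g2 abel_def set_lebesgue_integral_def by simp
  also have "\<dots> \<le> T powr (2*\<alpha>-1) / (2*\<alpha>-1) * (LINT s:{0<..<T}|lborel. (\<phi> s)\<^sup>2)"
  proof (rule mult_right_mono)
    show "x powr (2*\<alpha>-1) / (2*\<alpha>-1) \<le> T powr (2*\<alpha>-1) / (2*\<alpha>-1)"
      using x a by (intro divide_right_mono powr_mono2) auto
    show "0 \<le> (LINT s:{0<..<T}|lborel. (\<phi> s)\<^sup>2)"
      unfolding set_lebesgue_integral_def by (intro Bochner_Integration.integral_nonneg) auto
  qed
  finally show "(abel \<alpha> \<phi> x)\<^sup>2 \<le> T powr (2*\<alpha>-1) / (2*\<alpha>-1) * (LINT s:{0<..<T}|lborel. (\<phi> s)\<^sup>2)" .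
qed

text \<open>\<open>caputo_lift \<alpha> q\<close> is the polynomial vanishing at \<open>0\<close> with left Caputo derivative \<open>t\<^sup>1\<^sup>-\<^sup>\<alpha> q(t)\<close>.\<close>

definition caputo_lift :: "real \<Rightarrow> real poly \<Rightarrow> real poly" where
  "caputo_lift \<alpha> q = (\<Sum>i\<le>degree q. monom (coeff q i * Gamma (real i + 2 - \<alpha>) / Gamma (real i + 2)) (Suc i))"

lemma poly_caputo_lift:
  "poly (caputo_lift \<alpha> q) x = (\<Sum>i\<le>degree q. coeff q i * Gamma (real i + 2 - \<alpha>) / Gamma (real i + 2) * x ^ Suc i)"
  unfolding caputo_lift_def poly_sum poly_monom ..

text \<open>Each monomial produces a Beta value, and the Gamma quotient in
  \<open>caputo_lift\<close> is chosen to match it: the lift is the order-\<alpha> fractional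
  integral of its intended Caputo derivative.\<close>

lemma caputo_lift_eq_abel:
  assumes a: "0 < \<alpha>" "\<alpha> \<le> 1" and x: "x > 0"
  shows "poly (caputo_lift \<alpha> q) x = abel \<alpha> (\<lambda>s. s powr (1-\<alpha>) * poly q s) x / Gamma \<alpha>"
proof -
  have "abel \<alpha> (\<lambda>s. s powr (1-\<alpha>) * poly q s) x = abel \<alpha> (\<lambda>s. \<Sum>i\<le>degree q. coeff q i * s powr (real i + 2 - \<alpha> - 1)) x"
  proof (rule abel_cong)
    fix s :: real assume s: "0 < s"
    have "s powr (1-\<alpha>) * s ^ i = s powr (real i + 2 - \<alpha> - 1)" for i
      using s by (simp add: powr_realpow[symmetric] powr_add[symmetric] algebra_simps)
    then have "s powr (1-\<alpha>) * (c * s ^ i) = c * s powr (real i + 2 - \<alpha> - 1)" for c i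
      by (metis mult.left_commute)
    then show "s powr (1-\<alpha>) * poly q s = (\<Sum>i\<le>degree q. coeff q i * s powr (real i + 2 - \<alpha> - 1))"
      by (simp only: poly_altdef sum_distrib_left)
  qed
  also have "\<dots> = (\<Sum>i\<le>degree q. abel \<alpha> (\<lambda>s. coeff q i * s powr (real i + 2 - \<alpha> - 1)) x)"
  proof (rule abel_sum)
    fix i
    have "set_integrable lborel {0<..<x} (\<lambda>s. coeff q i * ((x - s) powr (\<alpha> - 1) * s powr (real i + 2 - \<alpha> - 1)))"
      by (intro set_integrable_mult_right abel_power(1)) (use a x in auto)
    then show "set_integrable lborel {0<..<x} (\<lambda>s. (x - s) powr (\<alpha> - 1) * (coeff q i * s powr (real i + 2 - \<alpha> - 1)))"
      by (simp add: mult_ac)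
  qed simp
  also have "\<dots> = (\<Sum>i\<le>degree q. coeff q i * (x ^ Suc i * Beta \<alpha> (real i + 2 - \<alpha>)))"
  proof (rule sum.cong[OF refl])
    fix i
    have "abel \<alpha> (\<lambda>s. s powr (real i + 2 - \<alpha> - 1)) x = x powr (\<alpha> + (real i + 2 - \<alpha>) - 1) * Beta \<alpha> (real i + 2 - \<alpha>)"
      by (rule abel_power(2)) (use a x in auto)
    moreover have "x powr (\<alpha> + (real i + 2 - \<alpha>) - 1) = x ^ Suc i"
    proof -
      have "\<alpha> + (real i + 2 - \<alpha>) - 1 = real (Suc i)" by simp
      then show ?thesis using powr_realpow[OF x, of "Suc i"] by metis
    qed
    ultimately show "abel \<alpha> (\<lambda>s. coeff q i * s powr (real i + 2 - \<alpha> - 1)) x = coeff q i * (x ^ Suc i * Beta \<alpha> (real i + 2 - \<alpha>))"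
      unfolding abel_cmult by simp
  qed
  also have "\<dots> = Gamma \<alpha> * poly (caputo_lift \<alpha> q) x"
    unfolding poly_caputo_lift sum_distrib_left by (rule sum.cong[OF refl]) (simp add: Beta_def)
  finally show ?thesis using less_imp_neq[OF Gamma_real_pos[OF a(1)]] by simp
qed

lemma Gamma_Suc_real: "Gamma (real i + 2) = (real i + 1) * Gamma (real i + 1)"
proof -
  have "real i + 1 \<notin> \<int>\<^sub>\<le>\<^sub>0" by (auto elim!: nonpos_Ints_cases)
  then show ?thesis using Gamma_plus1[of "real i + 1"] by (simp add: add.assoc)
qed

lemma pderiv_sum_eq: "finite I \<Longrightarrow> pderiv (\<Sum>i\<in>I. f i) = (\<Sum>i\<in>I. pderiv (f i))"
  by (induction I rule: finite_induct) (simp_all add: pderiv_add)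

lemma poly_pderiv_caputo_lift:
  "poly (pderiv (caputo_lift \<alpha> q)) x = (\<Sum>i\<le>degree q. coeff q i * Gamma (real i + 2 - \<alpha>) / Gamma (real i + 1) * x ^ i)"
proof -
  have pm: "poly (pderiv (monom c (Suc i))) x = (real i + 1) * c * x ^ i" for c i
    by (simp add: pderiv_monom poly_monom algebra_simps)
  have "poly (pderiv (caputo_lift \<alpha> q)) x = (\<Sum>i\<le>degree q. (real i + 1) * (coeff q i * Gamma (real i + 2 - \<alpha>) / Gamma (real i + 2)) * x ^ i)"
    unfolding caputo_lift_def pderiv_sum_eq[OF finite_atMost] poly_sum pm ..
  also have "\<dots> = (\<Sum>i\<le>degree q. coeff q i * Gamma (real i + 2 - \<alpha>) / Gamma (real i + 1) * x ^ i)"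
    by (rule sum.cong[OF refl]) (simp add: Gamma_Suc_real add_pos_nonneg)
  finally show ?thesis .
qed

lemma caputo_left_poly:
  assumes a: "0 < \<alpha>" "\<alpha> \<le> 1"
  shows "caputo_left \<alpha> (poly q) t = (if \<alpha> = 1 then poly (pderiv q) t else abel (1-\<alpha>) (poly (pderiv q)) t / Gamma (1-\<alpha>))"
proof -
  have d: "deriv (poly q) s = poly (pderiv q) s" for s by (rule DERIV_imp_deriv[OF poly_DERIV])
  have "(LINT s:{0..t}|lebesgue. (t - s) powr (- \<alpha>) * deriv (poly q) s) = (LINT s:{0<..<t}|lborel. (t - s) powr (1 - \<alpha> - 1) * poly (pderiv q) s)"
    by (rule lebesgue_Icc_eq_lborel_Ioo(1)) (use d in auto)
  then show ?thesis by (auto simp: caputo_left_def d abel_def)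
qed

lemma caputo_left_poly_diff:
  assumes a: "0 < \<alpha>" "\<alpha> \<le> 1"
  shows "caputo_left \<alpha> (\<lambda>t. poly p t - poly q t) t = caputo_left \<alpha> (poly p) t - caputo_left \<alpha> (poly q) t"
proof -
  have e: "(\<lambda>t. poly p t - poly q t) = poly (p - q)" by auto
  have "abel (1-\<alpha>) (poly (pderiv (p - q))) t = abel (1-\<alpha>) (poly (pderiv p)) t - abel (1-\<alpha>) (poly (pderiv q)) t" if "\<alpha> < 1"
  proof -
    have pos: "0 < 1 - \<alpha>" using that by simp
    show ?thesis unfolding abel_def
      by (subst set_integral_diff(2)[OF abel_poly_integrable[OF pos] abel_poly_integrable[OF pos], symmetric])
        (simp add: pderiv_diff right_diff_distrib)
  qed
  then show ?thesis unfolding e caputo_left_poly[OF a] using a by (auto simp: pderiv_diff diff_divide_distrib)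
qed

lemma caputo_left_lift:
  assumes a: "0 < \<alpha>" "\<alpha> \<le> 1" and t: "t > 0"
  shows "caputo_left \<alpha> (poly (caputo_lift \<alpha> q)) t = t powr (1-\<alpha>) * poly q t"
proof (cases "\<alpha> = 1")
  case True
  have "poly (pderiv (caputo_lift \<alpha> q)) t = (\<Sum>i\<le>degree q. coeff q i * t ^ i)"
    unfolding poly_pderiv_caputo_lift
  proof (rule sum.cong[OF refl])
    fix i
    have "Gamma (real i + 1) \<noteq> 0" using less_imp_neq[OF Gamma_real_pos[of "real i + 1"]] by simp
    moreover have "real i + 2 - \<alpha> = real i + 1" using True by simp
    ultimately show "coeff q i * Gamma (real i + 2 - \<alpha>) / Gamma (real i + 1) * t ^ i = coeff q i * t ^ i" by (metis nonzero_mult_div_cancel_right)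
  qed
  then show ?thesis unfolding caputo_left_poly[OF a] using True t by (simp add: poly_altdef)
next
  case False
  then have a1: "\<alpha> < 1" using a by simp
  let ?b = "\<lambda>i. coeff q i * Gamma (real i + 2 - \<alpha>) / Gamma (real i + 1)"
  have "abel (1-\<alpha>) (poly (pderiv (caputo_lift \<alpha> q))) t = abel (1-\<alpha>) (\<lambda>s. \<Sum>i\<le>degree q. ?b i * s powr (real i + 1 - 1)) t"
    by (rule abel_cong) (simp add: poly_pderiv_caputo_lift powr_realpow)
  also have "\<dots> = (\<Sum>i\<le>degree q. abel (1-\<alpha>) (\<lambda>s. ?b i * s powr (real i + 1 - 1)) t)"
  proof (rule abel_sum)
    fix i
    have "set_integrable lborel {0<..<t} (\<lambda>s. ?b i * ((t - s) powr (1-\<alpha> - 1) * s powr (real i + 1 - 1)))"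
      by (intro set_integrable_mult_right abel_power(1)) (use a1 t in auto)
    then show "set_integrable lborel {0<..<t} (\<lambda>s. (t - s) powr (1-\<alpha> - 1) * (?b i * s powr (real i + 1 - 1)))"
      by (simp only: mult.left_commute)
  qed simp
  also have "\<dots> = (\<Sum>i\<le>degree q. Gamma (1-\<alpha>) * (coeff q i * (t powr (1-\<alpha>) * t ^ i)))"
  proof (rule sum.cong[OF refl])
    fix i
    have "abel (1-\<alpha>) (\<lambda>s. s powr (real i + 1 - 1)) t = t powr ((1-\<alpha>) + (real i + 1) - 1) * Beta (1-\<alpha>) (real i + 1)"
      by (rule abel_power(2)) (use a1 t in auto)
    moreover have "t powr ((1-\<alpha>) + (real i + 1) - 1) = t powr (1-\<alpha>) * t ^ i"
    proof -
      have "(1-\<alpha>) + (real i + 1) - 1 = (1-\<alpha>) + real i" by simp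
      then show ?thesis using t by (simp only: powr_add powr_realpow)
    qed
    moreover have "Beta (1-\<alpha>) (real i + 1) = Gamma (1-\<alpha>) * Gamma (real i + 1) / Gamma (real i + 2 - \<alpha>)"
      by (simp add: Beta_def algebra_simps)
    moreover have "Gamma (real i + 1) \<noteq> 0" "Gamma (real i + 2 - \<alpha>) \<noteq> 0"
      using less_imp_neq[OF Gamma_real_pos[of "real i + 1"]] less_imp_neq[OF Gamma_real_pos[of "real i + 2 - \<alpha>"]] a1 by simp_all
    ultimately show "abel (1-\<alpha>) (\<lambda>s. ?b i * s powr (real i + 1 - 1)) t = Gamma (1-\<alpha>) * (coeff q i * (t powr (1-\<alpha>) * t ^ i))"
      unfolding abel_cmult by simp
  qed
  also have "\<dots> = Gamma (1-\<alpha>) * (t powr (1-\<alpha>) * poly q t)"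
    unfolding poly_altdef sum_distrib_left by (rule sum.cong[OF refl]) (simp add: mult_ac)
  finally show ?thesis unfolding caputo_left_poly[OF a] using False less_imp_neq[OF Gamma_real_pos[of "1-\<alpha>"]] a1 by simp
qed

text \<open>The correction by a constant restores the boundary value \<open>0\<close> at \<open>T\<close> of the lift.\<close>

lemma caputo_lift_dense:
  assumes [measurable]: "D \<in> borel_measurable borel" and D: "set_integrable lborel {0<..<T} (\<lambda>x. (D x)\<^sup>2)"
    and T: "T > 0" and a: "1/2 < \<alpha>" "\<alpha> \<le> 1" and DT: "abel \<alpha> D T = 0" and eps: "\<epsilon> > 0"
  obtains q where "poly (caputo_lift \<alpha> q) T = 0"
    "set_integrable lborel {0<..<T} (\<lambda>x. (x powr (1-\<alpha>) * poly q x - D x)\<^sup>2)"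
    "(LINT x:{0<..<T}|lborel. (x powr (1-\<alpha>) * poly q x - D x)\<^sup>2) < \<epsilon>"
proof -
  define k where "k = abel \<alpha> (\<lambda>s. s powr (2-\<alpha>-1)) T"
  have kint: "set_integrable lborel {0<..<T} (\<lambda>s. (T - s) powr (\<alpha>-1) * s powr (2-\<alpha>-1))"
    by (rule abel_power(1)) (use a T in auto)
  have "k = T powr (\<alpha> + (2-\<alpha>) - 1) * Beta \<alpha> (2-\<alpha>)" unfolding k_def by (rule abel_power(2)) (use a T in auto)
  then have k: "k > 0" using T Beta_pos[of \<alpha> "2-\<alpha>"] a by simp
  define P where "P = T powr (2*\<alpha>-1) / (2*\<alpha>-1)"
  have P: "P > 0" using T a by (simp add: P_def)
  \<comment> \<open>Amplification of the squared L2 error by the endpoint correction: subtracting c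
    costs 2 c^2 times the square integral of the weight, and c^2 is at most P/k^2 times the
    error.\<close>
  define W where "W = 2 + 2 * (P / k\<^sup>2) * ((T powr (1-\<alpha>))\<^sup>2 * T)"
  have W: "W > 0" unfolding W_def using P k T by (intro add_pos_nonneg) auto
  have "\<epsilon> / W > 0" using eps W by simp
  then obtain q where q: "set_integrable lborel {0<..<T} (\<lambda>x. (x powr (1-\<alpha>) * poly q x - D x)\<^sup>2)"
    "(LINT x:{0<..<T}|lborel. (x powr (1-\<alpha>) * poly q x - D x)\<^sup>2) < \<epsilon> / W"
    using polynomial_dense_L2_weighted[OF assms(1) D T, of "\<epsilon> / W" "1-\<alpha>"] a by auto
  let ?e = "LINT x:{0<..<T}|lborel. (x powr (1-\<alpha>) * poly q x - D x)\<^sup>2"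
  have m1: "(\<lambda>x. x powr (1-\<alpha>) * poly q x - D x) \<in> borel_measurable borel" by measurable
  note b1 = abel_L2_bound[OF m1 a(1) T order.refl q(1)]
  note b2 = abel_L2_bound[OF assms(1) a(1) T order.refl D]
  define A where "A = abel \<alpha> (\<lambda>x. x powr (1-\<alpha>) * poly q x) T"
  have Aint: "set_integrable lborel {0<..<T} (\<lambda>s. (T - s) powr (\<alpha>-1) * (s powr (1-\<alpha>) * poly q s))"
    using set_integral_add(1)[OF b1(1) b2(1)] by (simp add: algebra_simps)
  have "abel \<alpha> (\<lambda>x. x powr (1-\<alpha>) * poly q x - D x) T = A - abel \<alpha> D T"
    unfolding A_def abel_def by (subst set_integral_diff(2)[OF Aint b2(1), symmetric]) (simp add: algebra_simps)
  then have A2: "A\<^sup>2 \<le> P * ?e" using b1(2) DT by (simp add: P_def)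
  \<comment> \<open>\<open>k\<close> is the endpoint value produced by the polynomial 1, so
    subtracting c removes \<open>A\<close>. Smallness of c comes from \<open>DT\<close>:
    \<open>A\<close> is the Abel integral at T of the error alone.\<close>
  define c where "c = A / k"
  define q' where "q' = q - [:c:]"
  have "abel \<alpha> (\<lambda>s. s powr (1-\<alpha>) * poly q' s) T = A - c * k"
  proof -
    have "abel \<alpha> (\<lambda>s. s powr (1-\<alpha>) * poly q' s) T = (LINT s:{0<..<T}|lborel. (T - s) powr (\<alpha>-1) * (s powr (1-\<alpha>) * poly q s) - c * ((T - s) powr (\<alpha>-1) * s powr (2-\<alpha>-1)))"
      unfolding abel_def by (rule set_lebesgue_integral_cong) (auto simp: q'_def algebra_simps)
    also have "\<dots> = A - c * k"
      unfolding A_def k_def abel_def by (simp only: set_integral_diff(2)[OF Aint set_integrable_mult_right[OF kint]] set_integral_mult_right)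
    finally show ?thesis .
  qed
  also have "A - c * k = 0" using k by (simp add: c_def)
  finally have z: "poly (caputo_lift \<alpha> q') T = 0" using caputo_lift_eq_abel[of \<alpha> T q'] a T by simp
  have m2: "(\<lambda>x. - c * x powr (1-\<alpha>)) \<in> borel_measurable borel" by measurable
  have cb: "\<bar>(- c * x powr (1-\<alpha>))\<^sup>2\<bar> \<le> c\<^sup>2 * (T powr (1-\<alpha>))\<^sup>2" if "0 < x" "x < T" for x
    using that a by (auto simp: power_mult_distrib intro!: mult_left_mono power_mono powr_mono2)
  have ci: "set_integrable lborel {0<..<T} (\<lambda>x. (- c * x powr (1-\<alpha>))\<^sup>2)"
    "(LINT x:{0<..<T}|lborel. (- c * x powr (1-\<alpha>))\<^sup>2) \<le> c\<^sup>2 * (T powr (1-\<alpha>))\<^sup>2 * T"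
    by (rule bounded_set_integrable[where C="c\<^sup>2 * (T powr (1-\<alpha>))\<^sup>2"]; use cb T in auto)+
  have eq: "(\<lambda>x. ((x powr (1-\<alpha>) * poly q x - D x) + (- c * x powr (1-\<alpha>)))\<^sup>2) = (\<lambda>x. (x powr (1-\<alpha>) * poly q' x - D x)\<^sup>2)"
    by (auto simp: q'_def algebra_simps)
  note tri = integral_square_triangle[OF m1 m2 q(1) ci(1), unfolded eq]
  have "c\<^sup>2 \<le> P * ?e / k\<^sup>2" using A2 k by (simp add: c_def power_divide divide_right_mono)
  then have "c\<^sup>2 * ((T powr (1-\<alpha>))\<^sup>2 * T) \<le> P * ?e / k\<^sup>2 * ((T powr (1-\<alpha>))\<^sup>2 * T)" using T by (intro mult_right_mono) auto
  moreover have "W * ?e = 2 * ?e + 2 * (P * ?e / k\<^sup>2 * ((T powr (1-\<alpha>))\<^sup>2 * T))" by (simp add: W_def algebra_simps)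
  ultimately have "(LINT x:{0<..<T}|lborel. (x powr (1-\<alpha>) * poly q' x - D x)\<^sup>2) \<le> W * ?e"
    using tri(2) ci(2)[unfolded mult.assoc] by linarith
  also have "\<dots> < W * (\<epsilon> / W)" using q(2) W by (rule mult_strict_left_mono)
  also have "\<dots> = \<epsilon>" using W by simp
  finally show thesis using that[OF z tri(1)] by simp
qed

lemma smooth_vanishing_poly:
  assumes "poly q 0 = 0" "poly q T = 0" shows "poly q \<in> smooth_vanishing T"
proof -
  have "((\<lambda>t. poly ((pderiv ^^ n) q) t) has_real_derivative poly ((pderiv ^^ Suc n) q) t) (at t within {0..T})" for n t
    using poly_DERIV[of "(pderiv ^^ n) q" t] by (auto intro: has_field_derivative_at_within)
  then show ?thesis unfolding smooth_vanishing_def using assms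
    by (intro CollectI conjI exI[of _ "\<lambda>n. poly ((pderiv ^^ n) q)"]) auto
qed

text \<open>\<open>D\<close> plays the role of the Caputo derivative of \<open>u\<close>. Polynomial
  lifts whose Caputo derivatives approach \<open>D\<close> in L2 are Cauchy in both parts of the
  energy norm, because \<open>abel_L2_bound\<close> makes them converge uniformly to
  \<open>u\<close>; \<open>DT\<close> lets the lifts vanish at T.\<close>

theorem E0_I:
  assumes [measurable]: "D \<in> borel_measurable borel" and D: "set_integrable lborel {0<..<T} (\<lambda>x. (D x)\<^sup>2)"
    and T: "T > 0" and a: "1/2 < \<alpha>" "\<alpha> \<le> 1" and DT: "abel \<alpha> D T = 0"
    and uc: "continuous_on UNIV u" and u: "\<And>x. 0 < x \<Longrightarrow> x < T \<Longrightarrow> u x = abel \<alpha> D x / Gamma \<alpha>"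
  shows "u \<in> E0 \<alpha> T"
proof -
  have [measurable]: "u \<in> borel_measurable borel" by (rule borel_measurable_continuous_onI[OF uc])
  have a0: "0 < \<alpha>" using a by simp
  have ex: "\<forall>n. \<exists>q. poly (caputo_lift \<alpha> q) T = 0 \<and> set_integrable lborel {0<..<T} (\<lambda>x. (x powr (1-\<alpha>) * poly q x - D x)\<^sup>2)
    \<and> (LINT x:{0<..<T}|lborel. (x powr (1-\<alpha>) * poly q x - D x)\<^sup>2) < 1 / real (Suc n)"
  proof
    fix n
    have "1 / real (Suc n) > 0" by simp
    from caputo_lift_dense[OF assms(1) D T a DT this]
    show "\<exists>q. poly (caputo_lift \<alpha> q) T = 0 \<and> set_integrable lborel {0<..<T} (\<lambda>x. (x powr (1-\<alpha>) * poly q x - D x)\<^sup>2)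
    \<and> (LINT x:{0<..<T}|lborel. (x powr (1-\<alpha>) * poly q x - D x)\<^sup>2) < 1 / real (Suc n)" by blast
  qed
  obtain q where q0: "\<forall>n. poly (caputo_lift \<alpha> (q n)) T = 0 \<and> set_integrable lborel {0<..<T} (\<lambda>x. (x powr (1-\<alpha>) * poly (q n) x - D x)\<^sup>2)
    \<and> (LINT x:{0<..<T}|lborel. (x powr (1-\<alpha>) * poly (q n) x - D x)\<^sup>2) < 1 / real (Suc n)"
    using choice[OF ex] by blast
  then have q: "\<And>n. poly (caputo_lift \<alpha> (q n)) T = 0"
    "\<And>n. set_integrable lborel {0<..<T} (\<lambda>x. (x powr (1-\<alpha>) * poly (q n) x - D x)\<^sup>2)"
    "\<And>n. (LINT x:{0<..<T}|lborel. (x powr (1-\<alpha>) * poly (q n) x - D x)\<^sup>2) < 1 / real (Suc n)"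
    by blast+
  let ?e = "\<lambda>n. LINT x:{0<..<T}|lborel. (x powr (1-\<alpha>) * poly (q n) x - D x)\<^sup>2"
  define g where "g n = poly (caputo_lift \<alpha> (q n))" for n
  have [measurable]: "g n \<in> borel_measurable borel" for n by (simp add: g_def)
  define C where "C = T powr (2*\<alpha>-1) / (2*\<alpha>-1) / (Gamma \<alpha>)\<^sup>2"
  have C: "C \<ge> 0" using T a by (simp add: C_def)
  have dm: "(\<lambda>x. x powr (1-\<alpha>) * poly (q n) x - D x) \<in> borel_measurable borel" for n by measurable
  have gu: "(g n x - u x)\<^sup>2 \<le> C * ?e n" if x: "0 < x" "x < T" for n x
  proof -
    note b1 = abel_L2_bound[OF dm[of n] a(1) x(1) less_imp_le[OF x(2)] q(2)[of n]]
    note b2 = abel_L2_bound[OF assms(1) a(1) x(1) less_imp_le[OF x(2)] D]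
    have i: "set_integrable lborel {0<..<x} (\<lambda>s. (x - s) powr (\<alpha>-1) * (s powr (1-\<alpha>) * poly (q n) s))"
      using set_integral_add(1)[OF b1(1) b2(1)] by (simp add: algebra_simps)
    have "abel \<alpha> (\<lambda>x. x powr (1-\<alpha>) * poly (q n) x - D x) x = abel \<alpha> (\<lambda>x. x powr (1-\<alpha>) * poly (q n) x) x - abel \<alpha> D x"
      unfolding abel_def by (subst set_integral_diff(2)[OF i b2(1), symmetric]) (simp add: algebra_simps)
    then have "g n x - u x = abel \<alpha> (\<lambda>x. x powr (1-\<alpha>) * poly (q n) x - D x) x / Gamma \<alpha>"
      using caputo_lift_eq_abel[OF a0 a(2) x(1), of "q n"] u[OF x] by (simp add: g_def diff_divide_distrib)
    then have "(g n x - u x)\<^sup>2 = (abel \<alpha> (\<lambda>x. x powr (1-\<alpha>) * poly (q n) x - D x) x)\<^sup>2 / (Gamma \<alpha>)\<^sup>2" by (simp add: power_divide)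
    also have "\<dots> \<le> (T powr (2*\<alpha>-1) / (2*\<alpha>-1) * ?e n) / (Gamma \<alpha>)\<^sup>2" using b1(2) by (rule divide_right_mono) simp
    finally show ?thesis by (simp add: C_def)
  qed
  have e0: "?e n \<ge> 0" for n
    unfolding set_lebesgue_integral_def by (intro Bochner_Integration.integral_nonneg) auto
  have gui: "set_integrable lborel {0<..<T} (\<lambda>x. (g n x - u x)\<^sup>2)" "(LINT x:{0<..<T}|lborel. (g n x - u x)\<^sup>2) \<le> C * ?e n * T" for n
    by (rule bounded_set_integrable[where C="C * ?e n"]; use gu T in auto)+
  have L2: "(LINT t:{0..T}|lebesgue. \<bar>g n t - u t\<bar>\<^sup>2) = (LINT x:{0<..<T}|lborel. (g n x - u x)\<^sup>2)" for n
    by (rule lebesgue_Icc_eq_lborel_Ioo(1)) auto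
  have conv: "(\<lambda>n. LINT t:{0..T}|lebesgue. \<bar>g n t - u t\<bar>\<^sup>2) \<longlonglongrightarrow> 0"
  proof (rule tendsto_sandwich[OF _ _ tendsto_const])
    show "\<forall>\<^sub>F n in sequentially. 0 \<le> (LINT t:{0..T}|lebesgue. \<bar>g n t - u t\<bar>\<^sup>2)"
      unfolding set_lebesgue_integral_def by (intro always_eventually allI Bochner_Integration.integral_nonneg) auto
    show "\<forall>\<^sub>F n in sequentially. (LINT t:{0..T}|lebesgue. \<bar>g n t - u t\<bar>\<^sup>2) \<le> C * T * (1 / real (Suc n))"
    proof (intro always_eventually allI)
      fix n
      have "C * T * ?e n \<le> C * T * (1 / real (Suc n))" using C T less_imp_le[OF q(3)] by (intro mult_left_mono) auto
      then show "(LINT t:{0..T}|lebesgue. \<bar>g n t - u t\<bar>\<^sup>2) \<le> C * T * (1 / real (Suc n))"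
        unfolding L2 using gui(2)[of n] by (simp only: mult.commute mult.left_commute)
    qed
    have "(\<lambda>n. C * T * (1 / real (Suc n))) \<longlonglongrightarrow> C * T * 0" by (intro tendsto_intros LIMSEQ_Suc[OF lim_1_over_n])
    then show "(\<lambda>n. C * T * (1 / real (Suc n))) \<longlonglongrightarrow> 0" by simp
  qed
  have norm_le: "E0_norm \<alpha> T (\<lambda>t. g m t - g n t) \<le> sqrt ((2 + 2 * (C * T)) * (?e m + ?e n))" for m n
  proof -
    let ?c = "\<lambda>n x. x powr (1-\<alpha>) * poly (q n) x - D x"
    have "(LINT t:{0..T}|lebesgue. \<bar>caputo_left \<alpha> (\<lambda>t. g m t - g n t) t\<bar>\<^sup>2) = (LINT x:{0<..<T}|lborel. (?c m x + - ?c n x)\<^sup>2)"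
    proof (rule lebesgue_Icc_eq_lborel_Ioo(1))
      fix s assume "0 < s" "s < T"
      then show "\<bar>caputo_left \<alpha> (\<lambda>t. g m t - g n t) s\<bar>\<^sup>2 = (?c m s + - ?c n s)\<^sup>2"
        unfolding g_def caputo_left_poly_diff[OF a0 a(2)] using caputo_left_lift[OF a0 a(2)] by simp
    qed measurable
    also have "\<dots> \<le> 2 * ?e m + 2 * (LINT x:{0<..<T}|lborel. (- ?c n x)\<^sup>2)"
      by (rule integral_square_triangle(2)[OF dm _ q(2)]) (use q(2)[of n] in \<open>auto simp: power2_commute\<close>)
    also have "(LINT x:{0<..<T}|lborel. (- ?c n x)\<^sup>2) = ?e n" by (simp only: power2_minus)
    finally have 1: "(LINT t:{0..T}|lebesgue. \<bar>caputo_left \<alpha> (\<lambda>t. g m t - g n t) t\<bar>\<^sup>2) \<le> 2 * ?e m + 2 * ?e n" .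
    have "(LINT t:{0..T}|lebesgue. \<bar>g m t - g n t\<bar>\<^sup>2) = (LINT x:{0<..<T}|lborel. ((g m x - u x) + - (g n x - u x))\<^sup>2)"
      by (rule lebesgue_Icc_eq_lborel_Ioo(1)) auto
    also have "\<dots> \<le> 2 * (LINT x:{0<..<T}|lborel. (g m x - u x)\<^sup>2) + 2 * (LINT x:{0<..<T}|lborel. (- (g n x - u x))\<^sup>2)"
      by (rule integral_square_triangle(2)[OF _ _ gui(1)]) (use gui(1)[of n] in \<open>auto simp: power2_commute\<close>)
    also have "(LINT x:{0<..<T}|lborel. (- (g n x - u x))\<^sup>2) = (LINT x:{0<..<T}|lborel. (g n x - u x)\<^sup>2)" by (simp only: power2_minus)
    finally have "(LINT t:{0..T}|lebesgue. \<bar>g m t - g n t\<bar>\<^sup>2) \<le> 2 * (C * ?e m * T) + 2 * (C * ?e n * T)"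
      using gui(2)[of m] gui(2)[of n] by linarith
    with 1 show ?thesis unfolding E0_norm_def by (intro real_sqrt_le_mono) (simp add: algebra_simps)
  qed
  have cauchy: "\<exists>N. \<forall>m\<ge>N. \<forall>n\<ge>N. E0_norm \<alpha> T (\<lambda>t. g m t - g n t) < \<epsilon>" if eps: "\<epsilon> > 0" for \<epsilon>
  proof -
    define w where "w = (2 + 2 * (C * T)) * 2"
    have w: "w > 0" using C T unfolding w_def by (intro mult_pos_pos add_pos_nonneg) auto
    obtain N where N: "1 / real (Suc N) < \<epsilon>\<^sup>2 / w" using nat_approx_posE[of "\<epsilon>\<^sup>2 / w"] eps w by auto
    have e: "?e n \<le> 1 / real (Suc N)" if "n \<ge> N" for n
    proof -
      have "1 / real (Suc n) \<le> 1 / real (Suc N)" using that by (intro divide_left_mono) auto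
      then show ?thesis using q(3)[of n] by linarith
    qed
    have "E0_norm \<alpha> T (\<lambda>t. g m t - g n t) < \<epsilon>" if "m \<ge> N" "n \<ge> N" for m n
    proof -
      have "(2 + 2 * (C * T)) * (?e m + ?e n) \<le> (2 + 2 * (C * T)) * (2 * (1 / real (Suc N)))"
        using e[OF that(1)] e[OF that(2)] C T by (intro mult_left_mono) auto
      also have "\<dots> = w * (1 / real (Suc N))" by (simp add: w_def)
      also have "\<dots> < w * (\<epsilon>\<^sup>2 / w)" using N w by (rule mult_strict_left_mono)
      also have "\<dots> = \<epsilon>\<^sup>2" using w by simp
      finally have "sqrt ((2 + 2 * (C * T)) * (?e m + ?e n)) < sqrt (\<epsilon>\<^sup>2)" by (rule real_sqrt_less_mono)
      then show ?thesis using norm_le[of m n] eps by simp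
    qed
    then show ?thesis by blast
  qed
  have sm: "g n \<in> smooth_vanishing T" for n
    unfolding g_def by (rule smooth_vanishing_poly) (use q(1) in \<open>auto simp: poly_caputo_lift\<close>)
  have mu: "set_borel_measurable lebesgue {0..T} u"
    unfolding set_borel_measurable_def by (rule measurable_completion) measurable
  obtain H where "\<And>x. x \<in> {0..T} \<Longrightarrow> \<bar>u x\<bar> \<le> H"
  proof -
    have "compact (u ` {0..T})" by (intro compact_continuous_image continuous_on_subset[OF uc]) auto
    then obtain H where "\<forall>y\<in>u ` {0..T}. norm y \<le> H" using compact_imp_bounded bounded_iff by metis
    then show thesis by (intro that[of H]) auto
  qed
  then have "\<bar>(u x)\<^sup>2\<bar> \<le> H\<^sup>2" if "0 < x" "x < T" for x
    using that power_mono[of "\<bar>u x\<bar>" H 2] by auto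
  then have "set_integrable lborel {0<..<T} (\<lambda>x. (u x)\<^sup>2)" by (intro bounded_set_integrable(1)[where C="H\<^sup>2"]) (use T in auto)
  then have "set_integrable lebesgue {0..T} (\<lambda>t. \<bar>u t\<bar>\<^sup>2)"
    using lebesgue_Icc_eq_lborel_Ioo(2)[of "\<lambda>x. (u x)\<^sup>2" 0 T "\<lambda>t. \<bar>u t\<bar>\<^sup>2"] by simp
  with mu sm cauchy conv show ?thesis unfolding E0_def by (intro CollectI conjI exI[of _ g]) auto
qed

section \<open>The main theorem\<close>

context fractional_dirichlet
begin

text \<open>\<open>D\<close> is the order 1-\<alpha> integral of u' (or u' itself at \<alpha> = 1);
  applying order \<alpha> returns the primitive of u', that is \<open>K h\<close>, which vanishes at
  T. The work lies in showing that \<open>D\<close> is square integrable from the weighted bound on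
  u'.\<close>

lemma K_in_E0:
  assumes h: "bdd_borel h" and hc: "continuous_on UNIV h"
  shows "(\<lambda>x. c * K h x) \<in> E0 \<alpha> T"
proof -
  note [measurable] = bdd_borelD[OF h]
  have uc: "continuous_on UNIV (\<lambda>x. c * K h x)" by (intro continuous_intros continuous_K h)
  obtain H where H: "H \<ge> 0" "\<And>x. \<bar>h x\<bar> \<le> H" using bdd_borelE[OF h] by blast
  define C where "C = H * cU"
  have C: "C \<ge> 0" "\<And>s. s \<in> {0<..<T} \<Longrightarrow> \<bar>U h s\<bar> \<le> C * wt s"
    unfolding C_def using U_bound(2)[OF h H] H cU_nonneg by auto
  show ?thesis
  proof (cases "\<alpha> = 1")
    case True
    let ?D = "\<lambda>s. c * U h s"
    have e: "abel \<alpha> ?D x = c * K h x" if "x \<in> {0..T}" for x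
    proof -
      have "abel 1 ?D x = c * K h x" unfolding abel_cmult abel_one K_eq_integral_U[OF h that] ..
      then show ?thesis using True by simp
    qed
    have b: "\<bar>(?D s)\<^sup>2\<bar> \<le> (\<bar>c\<bar> * C)\<^sup>2" if "0 < s" "s < T" for s
    proof -
      have "wt s = 1" unfolding wt_def using that True by simp
      then have "\<bar>U h s\<bar> \<le> C" using C(2)[of s] that by simp
      then have "\<bar>?D s\<bar> \<le> \<bar>c\<bar> * C" unfolding abs_mult by (rule mult_left_mono) simp
      then have "\<bar>?D s\<bar>\<^sup>2 \<le> (\<bar>c\<bar> * C)\<^sup>2" by (rule power_mono) simp
      then show ?thesis by simp
    qed
    show ?thesis
    proof (rule E0_I[of ?D])
      show "set_integrable lborel {0<..<T} (\<lambda>x. (?D x)\<^sup>2)"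
        by (rule bounded_set_integrable(1)[where C="(\<bar>c\<bar> * C)\<^sup>2"]) (use b T in auto)
      show "abel \<alpha> ?D T = 0" using e[of T] T K_outside[of T h] by simp
      show "c * K h x = abel \<alpha> ?D x / Gamma \<alpha>" if "0 < x" "x < T" for x
        using e[of x] that True by simp
    qed (use T alpha uc in auto)
  next
    case False
    then have a1: "\<alpha> < 1" using alpha by simp
    let ?A = "abel (1-\<alpha>) (U h)" and ?g = "Gamma (1-\<alpha>)"
    let ?D = "\<lambda>s. c / ?g * ?A s"
    have g: "?g > 0" "Gamma \<alpha> > 0" using a1 alpha by (auto intro: Gamma_real_pos)
    have e: "abel \<alpha> ?D x = Gamma \<alpha> * (c * K h x)" if x: "0 < x" "x \<le> T" for x
    proof -
      have "set_integrable lborel {0<..<x} (\<lambda>s. (x - s) powr (\<alpha> + (1-\<alpha>) - 1) * U h s) \<longleftrightarrow> set_integrable lborel {0<..<x} (U h)"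
        by (rule set_integrable_cong) auto
      moreover have "set_integrable lborel {0<..<x} (U h)"
        by (rule set_integrable_subset[OF integrable_U(1)[OF h]]) (use x in auto)
      ultimately have "abel \<alpha> ?A x = Beta \<alpha> (1-\<alpha>) * abel (\<alpha> + (1-\<alpha>)) (U h) x"
        using alpha a1 by (intro abel_abel(2)) auto
      then have "abel \<alpha> ?A x = Gamma \<alpha> * ?g * K h x"
        using K_eq_integral_U[OF h, of x] x by (simp add: Beta_def abel_one)
      then show ?thesis unfolding abel_cmult using g by simp
    qed
    have Ab: "\<bar>?A x\<bar> \<le> C * Beta ((1-\<alpha>)/2) \<alpha> * (x * (T - x)) powr ((\<alpha>-1)/2)" if x: "0 < x" "x < T" for x
    proof -
      define w where "w = (T - x) powr ((\<alpha>-1)/2)"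
      have "\<bar>?A x\<bar> \<le> (LINT s:{0<..<x}|lborel. C * w * ((x - s) powr ((1-\<alpha>)/2 - 1) * s powr (\<alpha> - 1)))"
      proof -
        have b: "\<bar>(x - s) powr (1-\<alpha>-1) * U h s\<bar> \<le> C * w * ((x - s) powr ((1-\<alpha>)/2 - 1) * s powr (\<alpha> - 1))"
          if s: "s \<in> {0<..<x}" for s
        proof -
          \<comment> \<open>Half of the exponent is frozen at x, the other half is moved into the
            kernel, which stays integrable as a Beta density. The resulting bound has exponent
            (\<alpha>-1)/2 at both ends, so its square is a multiple of \<open>wt\<close>.\<close>
          have "(T - s) powr (\<alpha>-1) = (T - s) powr ((\<alpha>-1)/2) * (T - s) powr ((\<alpha>-1)/2)"
            by (simp add: powr_add[symmetric])
          also have "\<dots> \<le> w * (x - s) powr ((\<alpha>-1)/2)" unfolding w_def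
            using s x alpha by (intro mult_mono powr_mono2') auto
          finally have "wt s \<le> s powr (\<alpha>-1) * (w * (x - s) powr ((\<alpha>-1)/2))"
            unfolding wt_def using s x by (simp add: powr_mult mult_left_mono)
          then have "\<bar>U h s\<bar> \<le> C * (s powr (\<alpha>-1) * (w * (x - s) powr ((\<alpha>-1)/2)))"
            using C(2)[of s] mult_left_mono[OF _ C(1)] s x by (meson greaterThanLessThan_iff less_trans order_trans)
          then have "(x - s) powr (1-\<alpha>-1) * \<bar>U h s\<bar> \<le> (x - s) powr (1-\<alpha>-1) * (C * (s powr (\<alpha>-1) * (w * (x - s) powr ((\<alpha>-1)/2))))"
            by (rule mult_left_mono) simp
          also have "\<dots> = C * w * (((x - s) powr (1-\<alpha>-1) * (x - s) powr ((\<alpha>-1)/2)) * s powr (\<alpha>-1))" by (simp only: mult_ac)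
          also have "(x - s) powr (1-\<alpha>-1) * (x - s) powr ((\<alpha>-1)/2) = (x - s) powr ((1-\<alpha>)/2 - 1)"
            by (simp add: powr_add[symmetric] field_simps)
          finally show ?thesis by (simp add: abs_mult)
        qed
        have iw: "set_integrable lborel {0<..<x} (\<lambda>s. C * w * ((x - s) powr ((1-\<alpha>)/2 - 1) * s powr (\<alpha> - 1)))"
          by (intro set_integrable_mult_right abel_power(1)) (use a1 alpha x in auto)
        have i: "set_integrable lborel {0<..<x} (\<lambda>s. (x - s) powr (1-\<alpha>-1) * U h s)"
        proof (rule set_integrable_bound[OF iw])
          show "AE s in lborel. s \<in> {0<..<x} \<longrightarrow> norm ((x - s) powr (1-\<alpha>-1) * U h s) \<le> norm (C * w * ((x - s) powr ((1-\<alpha>)/2 - 1) * s powr (\<alpha> - 1)))"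
            by (intro AE_I2 impI) (simp only: real_norm_def, rule order.trans[OF b abs_ge_self])
        qed (simp add: set_borel_measurable_def)
        have "\<bar>?A x\<bar> \<le> (LINT s:{0<..<x}|lborel. \<bar>(x - s) powr (1-\<alpha>-1) * U h s\<bar>)"
          unfolding abel_def using set_integral_norm_bound[OF i] by simp
        also have "\<dots> \<le> (LINT s:{0<..<x}|lborel. C * w * ((x - s) powr ((1-\<alpha>)/2 - 1) * s powr (\<alpha> - 1)))"
          by (rule set_integral_mono[OF set_integrable_abs[OF i] iw b])
        finally show ?thesis .
      qed
      also have "\<dots> = C * w * abel ((1-\<alpha>)/2) (\<lambda>s. s powr (\<alpha> - 1)) x" by (simp only: set_integral_mult_right abel_def)
      also have "abel ((1-\<alpha>)/2) (\<lambda>s. s powr (\<alpha> - 1)) x = x powr ((1-\<alpha>)/2 + \<alpha> - 1) * Beta ((1-\<alpha>)/2) \<alpha>"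
        by (rule abel_power(2)) (use a1 alpha x in auto)
      also have "(1-\<alpha>)/2 + \<alpha> - 1 = (\<alpha>-1)/2" by (simp add: field_simps)
      finally show ?thesis using x by (simp add: w_def powr_mult mult_ac)
    qed
    have Db: "(?D x)\<^sup>2 \<le> (c / ?g * (C * Beta ((1-\<alpha>)/2) \<alpha>))\<^sup>2 * wt x" if x: "x \<in> {0<..<T}" for x
    proof -
      have "\<bar>?A x\<bar>\<^sup>2 \<le> (C * Beta ((1-\<alpha>)/2) \<alpha> * (x * (T - x)) powr ((\<alpha>-1)/2))\<^sup>2"
        by (rule power_mono[OF Ab]) (use x in auto)
      moreover have "((x * (T - x)) powr ((\<alpha>-1)/2))\<^sup>2 = wt x"
        by (simp add: wt_def power2_eq_square powr_add[symmetric])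
      ultimately have "(?A x)\<^sup>2 \<le> (C * Beta ((1-\<alpha>)/2) \<alpha>)\<^sup>2 * wt x"
        by (simp only: power_mult_distrib power2_abs)
      then have "(c / ?g)\<^sup>2 * (?A x)\<^sup>2 \<le> (c / ?g)\<^sup>2 * ((C * Beta ((1-\<alpha>)/2) \<alpha>)\<^sup>2 * wt x)" by (rule mult_left_mono) simp
      then show ?thesis by (simp only: power_mult_distrib mult.assoc)
    qed
    show ?thesis
    proof (rule E0_I[of ?D])
      show "set_integrable lborel {0<..<T} (\<lambda>x. (?D x)\<^sup>2)"
      proof (rule set_integrable_bound[OF set_integrable_mult_right[OF wt_integral(1)]])
        show "AE x in lborel. x \<in> {0<..<T} \<longrightarrow> norm ((?D x)\<^sup>2) \<le> norm ((c / ?g * (C * Beta ((1-\<alpha>)/2) \<alpha>))\<^sup>2 * wt x)"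
          by (intro AE_I2 impI) (simp only: real_norm_def abs_power2, rule order.trans[OF Db abs_ge_self])
      qed (simp add: set_borel_measurable_def)
      show "abel \<alpha> ?D T = 0" using e[of T] T K_outside[of T h] by simp
      show "c * K h x = abel \<alpha> ?D x / Gamma \<alpha>" if "0 < x" "x < T" for x
        using e[of x] that g by simp
    qed (use T alpha uc in auto)
  qed
qed

lemma kappa_eq: "2 * (c0 * (T powr (2*\<alpha>-1) / (2*\<alpha>-1))) = kappa \<alpha> T / T"
proof -
  have "T powr (2*\<alpha>) = T * T powr (2*\<alpha>-1)" using powr_mult_base[of T "2*\<alpha>-1"] T by simp
  then show ?thesis using T by (simp add: kappa_def c0_def)
qed

lemma kappa_pos: "kappa \<alpha> T > 0"
proof -
  have "0 < 2 * (c0 * (T powr (2*\<alpha>-1) / (2*\<alpha>-1)))" using c0_pos T alpha by simp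
  then show ?thesis unfolding kappa_eq using T by (simp add: zero_less_divide_iff)
qed

end

section \<open>From the supremum to an admissible radius\<close>

lemma antideriv_DERIV:
  assumes "continuous_on UNIV f" shows "(antideriv f has_real_derivative f x) (at x)"
proof -
  have "((\<lambda>u. LBINT y=ereal 0..ereal u. f y) has_vector_derivative f x) (at x within {-\<bar>x\<bar>-1..\<bar>x\<bar>+1})"
    by (rule interval_integral_FTC2) (use continuous_on_subset[OF assms] in auto)
  then have "(antideriv f has_vector_derivative f x) (at x within {-\<bar>x\<bar>-1..\<bar>x\<bar>+1})"
    by (simp add: antideriv_def[abs_def] zero_ereal_def)
  moreover have "at x within {-\<bar>x\<bar>-1..\<bar>x\<bar>+1} = at x" by (rule at_within_Icc_at) auto
  ultimately show ?thesis by (simp add: has_real_derivative_iff_has_vector_derivative)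
qed

lemma antideriv_0: "antideriv f 0 = 0"
  by (simp add: antideriv_def zero_ereal_def)

text \<open>A strict inequality below a supremum is attained by one \<gamma>. Stating the outcome as
  a product instead of a quotient includes the case M = 0, where the quotient is infinite and the
  inequality reads 0 < \<gamma>^2.\<close>

lemma mu_star_witness:
  assumes f: "continuous_on UNIV f" and kap: "kappa \<alpha> T > 0" and mu: "ereal \<mu> < mu_star \<alpha> T f" and mu0: "\<mu> > 0"
  obtains \<gamma> M where "\<gamma> > 0" "\<And>\<xi>. \<bar>\<xi>\<bar> \<le> \<gamma> \<Longrightarrow> antideriv f \<xi> \<le> M" "\<mu> * kappa \<alpha> T * M < \<gamma>\<^sup>2"
proof -
  have "\<exists>\<gamma>>0. ereal (\<mu> * kappa \<alpha> T) < quotient f \<gamma>"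
  proof (rule ccontr)
    assume "\<not> ?thesis"
    then have "(SUP \<gamma>\<in>{0<..}. quotient f \<gamma>) \<le> ereal (\<mu> * kappa \<alpha> T)"
      by (intro SUP_least) (metis greaterThan_iff not_less)
    then have "mu_star \<alpha> T f \<le> ereal (1 / kappa \<alpha> T) * ereal (\<mu> * kappa \<alpha> T)"
      unfolding mu_star_def by (rule ereal_mult_left_mono) (use kap in simp)
    then show False using mu kap by simp
  qed
  then obtain \<gamma> where g: "\<gamma> > 0" "ereal (\<mu> * kappa \<alpha> T) < quotient f \<gamma>" by blast
  define M where "M = (SUP \<xi>\<in>{-\<gamma>..\<gamma>}. antideriv f \<xi>)"
  have "continuous_on {-\<gamma>..\<gamma>} (antideriv f)"
    using DERIV_isCont[OF antideriv_DERIV[OF f]] by (simp add: continuous_at_imp_continuous_on)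
  then have "compact (antideriv f ` {-\<gamma>..\<gamma>})" by (intro compact_continuous_image) auto
  then have "bdd_above (antideriv f ` {-\<gamma>..\<gamma>})" by (intro bounded_imp_bdd_above compact_imp_bounded)
  then have le: "antideriv f \<xi> \<le> M" if "\<bar>\<xi>\<bar> \<le> \<gamma>" for \<xi>
    unfolding M_def by (rule cSUP_upper[rotated]) (use that in auto)
  have M0: "M \<ge> 0" using le[of 0] g(1) by (simp add: antideriv_0)
  have "\<mu> * kappa \<alpha> T * M < \<gamma>\<^sup>2"
  proof (cases "M = 0")
    case False
    then have "\<mu> * kappa \<alpha> T < \<gamma>\<^sup>2 / M" using g(2) by (simp add: quotient_def M_def[symmetric])
    then show ?thesis using False M0 by (simp add: pos_less_divide_eq)
  qed (use g(1) in simp)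
  then show thesis using that g(1) le by blast
qed

lemma AE_lebesgue_interior:
  fixes T :: real
  assumes "\<And>t. t \<in> {0<..<T} \<Longrightarrow> P t" shows "AE t in lebesgue. t \<in> {0..T} \<longrightarrow> P t"
proof -
  have "AE t in lborel. t \<noteq> 0 \<and> t \<noteq> T" by (rule AE_conjI[OF AE_lborel_singleton AE_lborel_singleton])
  then have "AE t in lebesgue. t \<noteq> 0 \<and> t \<noteq> T" by (simp only: AE_completion_iff)
  then show ?thesis by eventually_elim (rule impI, rule assms, auto)
qed

theorem mainTheorem4:
  fixes T \<alpha> :: real and f :: "real \<Rightarrow> real"
  assumes "T > 0"
    and "continuous_on UNIV f"
    and "1/2 < \<alpha>" and "\<alpha> \<le> 1"
    and "f 0 \<noteq> 0 \<or>
         (f 0 = 0 \<and> filterlim (\<lambda>t. antideriv f t / t\<^sup>2) at_top (at_right 0))"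
  shows "\<forall>\<mu>::real. 0 < \<mu> \<and> ereal \<mu> < mu_star \<alpha> T f \<longrightarrow>
           (\<exists>u. u \<in> E0 \<alpha> T \<and> is_solution \<alpha> T \<mu> f u \<and> (\<exists>t\<in>{0..T}. u t \<noteq> 0))"
proof (intro allI impI, elim conjE)
  fix \<mu> :: real assume mu: "0 < \<mu>" "ereal \<mu> < mu_star \<alpha> T f"
  interpret fractional_dirichlet T \<alpha> using assms by unfold_locales
  obtain \<gamma> M where g: "\<gamma> > 0" "\<And>\<xi>. \<bar>\<xi>\<bar> \<le> \<gamma> \<Longrightarrow> antideriv f \<xi> \<le> M" "\<mu> * kappa \<alpha> T * M < \<gamma>\<^sup>2"
    using mu_star_witness[OF assms(2) kappa_pos mu(2,1)] by metis
  \<comment> \<open>Turns the embedding condition into an equality, and the condition on the gap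
    into the inequality of the witness.\<close>
  define r where "r = \<gamma>\<^sup>2 * T / kappa \<alpha> T"
  interpret hammerstein T \<alpha> f "antideriv f" c0 \<mu> \<gamma> r M
  proof unfold_locales
    have "2 * r * (c0 * (T powr (2*\<alpha>-1) / (2*\<alpha>-1))) = r * (kappa \<alpha> T / T)" unfolding kappa_eq[symmetric] by simp
    also have "\<dots> = \<gamma>\<^sup>2" using kappa_pos assms(1) by (simp add: r_def)
    finally show "2 * r * (c0 * (T powr (2*\<alpha>-1) / (2*\<alpha>-1))) \<le> \<gamma>\<^sup>2" by simp
    have "\<mu> * M < \<gamma>\<^sup>2 / kappa \<alpha> T" using g(3) kappa_pos by (simp add: pos_less_divide_eq mult_ac)
    then have "T * (\<mu> * M) < T * (\<gamma>\<^sup>2 / kappa \<alpha> T)" using assms(1) by (rule mult_strict_left_mono)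
    then show "\<mu> * T * M < r" by (simp add: r_def mult_ac)
    show "continuous_on UNIV f" "\<And>\<xi>. (antideriv f has_real_derivative f \<xi>) (at \<xi>)" "antideriv f 0 = 0"
      "c0 > 0" "\<mu> > 0" "\<gamma> > 0" "\<And>\<xi>. \<bar>\<xi>\<bar> \<le> \<gamma> \<Longrightarrow> antideriv f \<xi> \<le> M"
      by (fact assms(2) antideriv_DERIV[OF assms(2)] antideriv_0 c0_pos mu(1) g(1) g(2))+
  qed
  have "f 0 \<noteq> 0 \<or> filterlim (\<lambda>t. antideriv f t / t\<^sup>2) at_top (at_right 0)" using assms(5) by blast
  then obtain u where u: "u \<in> borel_measurable borel" "\<And>x. \<bar>u x\<bar> \<le> \<gamma>" "\<And>x. u x = V (\<lambda>y. \<mu> * f (u y)) x" "\<exists>t\<in>{0..T}. u t \<noteq> 0"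
  proof (rule nontrivial_fixed_point, goal_cases)
    case (1 u)
    show ?case by (rule 1(1)[OF 1(2-)])
  qed
  define h where "h = (\<lambda>y. \<mu> * f (u y))"
  have h: "bdd_borel h" unfolding h_def by (rule bdd_borel_f[OF u(1,2)])
  have uK: "u = (\<lambda>x. c0 * K h x)" unfolding h_def V_def[symmetric] by (rule ext, rule u(3))
  \<comment> \<open>\<open>u\<close> was only known to be Borel; being in the range of
    \<open>K\<close> it is continuous, hence so is \<open>h\<close>, as the pointwise derivative of
    the flux requires.\<close>
  have "continuous_on UNIV u" unfolding uK by (intro continuous_intros continuous_K h)
  then have hc: "continuous_on UNIV h" unfolding h_def
    by (intro continuous_intros continuous_on_compose2[OF assms(2)]) auto
  have fl: "(flux \<alpha> T u has_real_derivative - h t) (at t)" if "t \<in> {0<..<T}" for t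
    using DERIV_flux_K[OF h hc that] by (simp only: uK)
  have "is_solution \<alpha> T \<mu> f u"
    unfolding is_solution_def
  proof (intro conjI)
    show "absolutely_continuous_fun_on 0 T u" unfolding uK by (rule K_absolutely_continuous[OF h])
    show "AE t\<in>{0..T} in lebesgue. flux \<alpha> T u differentiable (at t)"
      by (rule AE_lebesgue_interior) (use fl real_differentiable_def in blast)
    show "AE t\<in>{0..T} in lebesgue. deriv (flux \<alpha> T u) t + \<mu> * f (u t) = 0"
      by (rule AE_lebesgue_interior) (use DERIV_imp_deriv[OF fl] in \<open>simp add: h_def\<close>)
    show "u 0 = 0" "u T = 0" using K_outside[of 0 h] K_outside[of T h] by (simp_all add: uK)
  qed
  moreover have "u \<in> E0 \<alpha> T" unfolding uK by (rule K_in_E0[OF h hc])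
  ultimately show "\<exists>u. u \<in> E0 \<alpha> T \<and> is_solution \<alpha> T \<mu> f u \<and> (\<exists>t\<in>{0..T}. u t \<noteq> 0)" using u(4) by blast
qed

end
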